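(* Let $\varphi:\mathbb{C}=\mathbb{R}^2\to G/K$ be a primitive harmonic map into a $k$-symmetric space. Then $\varphi$ is equivariant if and only if it is generated by a degree one potential, that is, by a holomorphic potential $\xi\,dz$ with $\xi\in\Lambda_1\mathfrak{g}_\tau$.
   Context: $G$ is a compact semisimple Lie group with Lie algebra $\mathfrak g$, complexifications $G^{\mathbb C}$, $\mathfrak g^{\mathbb C}$; $\tau:G\to G$ is an automorphism of finite order $k\ge 2$, and $K$ is a subgroup with $(G^\tau)_0\subset K\subset G^\tau$, so that $G/K$ is a $k$-symmetric space. With $\omega=e^{2\pi i/k}$, let $\mathfrak g_\ell\subset\mathfrak g^{\mathbb C}$ ($\ell\in\mathbb Z_k$) be the $\omega^\ell$-eigenspace of $\tau$; let $\mathfrak k$ be the Lie algebra of $K$ (so $\mathfrak k^{\mathbb C}=\mathfrak g_0$), and let $\mathfrak m\subset\mathfrak g$ be defined by $\mathfrak m^{\mathbb C}=\sum_{\ell\ne0}\mathfrak g_\ell$, so $\mathfrak g=\mathfrak k\oplus\mathfrak m$. All maps are smooth; $z=x+iy$ is the coordinate on $\mathbb C=\mathbb R^2$. A frame of $\varphi:\mathbb R^2\to G/K$ is a map $F:\mathbb R^2\to G$ with $\varphi=FK$. Put $\alpha=F^{-1}dF=\alpha_{\mathfrak k}+\alpha_{\mathfrak m}$ and let $\alpha_{\mathfrak m}=\alpha_{\mathfrak m}'+\alpha_{\mathfrak m}''$ be the decomposition into $(1,0)$- and $(0,1)$-parts. $\varphi$ is harmonic if $d\alpha_{\mathfrak m}'+[\alpha_{\mathfrak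 k}\wedge\alpha_{\mathfrak m}']=0$ for any (hence every) frame, and primitive if $\alpha_{\mathfrak m}'$ takes values in $\mathfrak g_{-1}$. $\varphi$ is primitive harmonic if $k=2$ and $\varphi$ is harmonic, or $k>2$ and $\varphi$ is primitive. $\varphi$ is ($\mathbb R$-)equivariant if $\varphi(x,y)=\exp(xA_0)\,\psi(y)$ for some $A_0\in\mathfrak g$ and some map $\psi:\mathbb R\to G/K$. Loop groups: $\Lambda G_\tau=\{g:S^1\to G \text{ smooth}: g(\omega\lambda)=\tau g(\lambda)\}$; $\Lambda G^{\mathbb C}_\tau$ is defined in the same way with $G^{\mathbb C}$ in place of $G$; $\Lambda_+G_\tau$ is the set of $g\in\Lambda G_\tau^{\mathbb C}$ that extend holomorphically to $|\lambda|<1$ with $g(0)\in B$, where $K^{\mathbb C}=KB$ is a fixed Iwasawa decomposition. It is known (Iwasawa decomposition) that multiplication $\Lambda G_\tau\times\Lambda_+G_\tau\to\Lambda G_\tau^{\mathbb C}$ is a diffeomorphism. $\Lambda\mathfrak g_\tau=\{\xi:S^1\to\mathfrak g \text{ smooth}:\xi(\omega\lambda)=\tau\xi(\lambda)\}$, and $\Lambda_1\mathfrak g_\tau$ is the set of $\xi\in\Lambda\mathfrak g_\tau$ of the form $\xi=\lambda^{-1}\xi_{-1}+\xi_0+\lambda\xi_1$ (so $\xi_\ell\in\mathfrak g_\ell$ and $\overline{\xi_\ell}=\xi_{-\ell}$). A degree one potential is a $1$-form $\xi\,dz$ on $\mathbb C$ with $\xi\in\Lambda_1\mathfrak g_\tau$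 constant in $z$. Given such $\xi$, write $\exp(z\xi)=F_\lambda(z)\,b(z)$ with $F_\lambda(z)\in\Lambda G_\tau$ and $b(z)\in\Lambda_+G_\tau$; it is known that $F_\lambda K$ is then primitive harmonic for each $\lambda\in S^1$. The maps $\varphi_\lambda=F_\lambda K$ ($\lambda\in S^1$) form the associated family generated by $\xi\,dz$, and a map $\varphi$ is generated by $\xi\,dz$ if $\varphi=\varphi_1$.
   Formalization: Generated maps satisfy φ(0)=eK, so "only if" fails e.g. for a constant map gK with g∉K; the equivalence is proved when φ(0)=eK, and for all φ up to left translation by an element of G; G is taken as a compact matrix group (no loss, by Peter–Weyl). *)

theory Defs
  imports "HOL-Complex_Analysis.Complex_Analysis" "HOL-Algebra.Solvable_Groups"
begin

text \<open>
  Compact Lie groups are represented as compact subgroups of some \<open>GL(n,\<complex>)\<close>; by the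
  Peter--Weyl theorem every compact Lie group is isomorphic to one of these.
\<close>

type_synonym 'n cmat = "complex^'n^'n"


section \<open>Matrices\<close>

definition cscale :: "complex \<Rightarrow> 'n::finite cmat \<Rightarrow> 'n cmat"  (infixr "*\<^sub>C" 75)
  where "c *\<^sub>C A = map_matrix ((*) c) A"

definition mexp :: "'n::finite cmat \<Rightarrow> 'n cmat"
  where "mexp A = (\<Sum>j. (1 / fact j) *\<^sub>R (((**) A) ^^ j) (mat 1))"

definition bracket :: "'n::finite cmat \<Rightarrow> 'n cmat \<Rightarrow> 'n cmat"
  where "bracket A B = A ** B - B ** A"

definition GLn :: "'n::finite cmat monoid"
  where "GLn = \<lparr>carrier = {A. invertible A}, mult = (**), one = mat 1\<rparr>"


section \<open>Smooth maps\<close>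

primrec C_times :: "nat \<Rightarrow> 'a::real_normed_vector set \<Rightarrow> ('a \<Rightarrow> 'b::real_normed_vector) \<Rightarrow> bool" where
  "C_times 0 U f \<longleftrightarrow> continuous_on U f"
| "C_times (Suc r) U f \<longleftrightarrow>
     (\<exists>f'. (\<forall>x\<in>U. (f has_derivative f' x) (at x)) \<and> (\<forall>v. C_times r U (\<lambda>x. f' x v)))"

text \<open>Used for open \<open>U\<close> in finite-dimensional spaces only.\<close>

definition smooth_on :: "'a::real_normed_vector set \<Rightarrow> ('a \<Rightarrow> 'b::real_normed_vector) \<Rightarrow> bool"
  where "smooth_on U f \<longleftrightarrow> (\<forall>r. C_times r U f)"


section \<open>Compact matrix groups, their Lie algebras and complexifications\<close>

definition lie_algebra :: "'n::finite cmat set \<Rightarrow> 'n cmat set"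
  where "lie_algebra G = {X. \<forall>t::real. mexp (t *\<^sub>R X) \<in> G}"

text \<open>Semisimple: the only abelian ideal is zero.\<close>

definition semisimple :: "'n::finite cmat set \<Rightarrow> bool"
  where "semisimple g \<longleftrightarrow>
    (\<forall>I. subspace I \<and> I \<subseteq> g \<and> (\<forall>X\<in>g. \<forall>Y\<in>I. bracket X Y \<in> I) \<and> (\<forall>X\<in>I. \<forall>Y\<in>I. bracket X Y = 0)
      \<longrightarrow> I = {0})"

definition compact_semisimple_group :: "'n::finite cmat set \<Rightarrow> bool"
  where "compact_semisimple_group G \<longleftrightarrow>
    subgroup G GLn \<and> compact G \<and> semisimple (lie_algebra G)"

text \<open>
  For compact \<open>G\<close> one has \<open>\<gg> \<inter> i\<gg> = 0\<close> inside the matrices, so \<open>\<gg> + i\<gg>\<close> is the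
  complexified Lie algebra, and \<open>G exp(i\<gg>)\<close> (polar decomposition) is the complexified group.
  Both sums and products decompose uniquely, so the descriptions below of the
  complex extensions of \<open>\<tau>\<close> are well-defined.
\<close>

definition lie_algebra_C :: "'n::finite cmat set \<Rightarrow> 'n cmat set"
  where "lie_algebra_C G = {X + \<i> *\<^sub>C Y | X Y. X \<in> lie_algebra G \<and> Y \<in> lie_algebra G}"

definition group_C :: "'n::finite cmat set \<Rightarrow> 'n cmat set"
  where "group_C G = {h ** mexp (\<i> *\<^sub>C X) | h X. h \<in> G \<and> X \<in> lie_algebra G}"

definition lie_aut :: "('n::finite cmat \<Rightarrow> 'n cmat) \<Rightarrow> 'n cmat \<Rightarrow> 'n cmat"
  where "lie_aut \<tau> X = vector_derivative (\<lambda>t. \<tau> (mexp (t *\<^sub>R X))) (at 0)"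

definition lie_aut_C :: "'n::finite cmat set \<Rightarrow> ('n cmat \<Rightarrow> 'n cmat) \<Rightarrow> 'n cmat \<Rightarrow> 'n cmat"
  where "lie_aut_C G \<tau> Z = (THE W. \<exists>X\<in>lie_algebra G. \<exists>Y\<in>lie_algebra G.
           Z = X + \<i> *\<^sub>C Y \<and> W = lie_aut \<tau> X + \<i> *\<^sub>C lie_aut \<tau> Y)"

definition aut_C :: "'n::finite cmat set \<Rightarrow> ('n cmat \<Rightarrow> 'n cmat) \<Rightarrow> 'n cmat \<Rightarrow> 'n cmat"
  where "aut_C G \<tau> g = (THE w. \<exists>h\<in>G. \<exists>X\<in>lie_algebra G.
           g = h ** mexp (\<i> *\<^sub>C X) \<and> w = \<tau> h ** mexp (\<i> *\<^sub>C lie_aut \<tau> X))"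


section \<open>\<open>k\<close>-symmetric spaces\<close>

definition fixed_points :: "'n::finite cmat set \<Rightarrow> ('n cmat \<Rightarrow> 'n cmat) \<Rightarrow> 'n cmat set"
  where "fixed_points G \<tau> = {g\<in>G. \<tau> g = g}"

text \<open>Continuous homomorphisms between Lie groups are smooth; \<open>k\<close> is the exact order of \<open>\<tau>\<close>.\<close>

definition k_symmetric_space ::
  "'n::finite cmat set \<Rightarrow> ('n cmat \<Rightarrow> 'n cmat) \<Rightarrow> nat \<Rightarrow> 'n cmat set \<Rightarrow> bool"
  where "k_symmetric_space G \<tau> k K \<longleftrightarrow>
    compact_semisimple_group G \<and>
    \<tau> \<in> iso (GLn\<lparr>carrier := G\<rparr>) (GLn\<lparr>carrier := G\<rparr>) \<and> continuous_on G \<tau> \<and>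
    2 \<le> k \<and> (\<forall>g\<in>G. (\<tau> ^^ k) g = g) \<and> (\<forall>j. 0 < j \<and> j < k \<longrightarrow> (\<exists>g\<in>G. (\<tau> ^^ j) g \<noteq> g)) \<and>
    subgroup K GLn \<and>
    connected_component_set (fixed_points G \<tau>) (mat 1) \<subseteq> K \<and> K \<subseteq> fixed_points G \<tau>"

definition omega :: "nat \<Rightarrow> complex"
  where "omega k = cis (2 * pi / real k)"

definition eigenspace ::
  "'n::finite cmat set \<Rightarrow> ('n cmat \<Rightarrow> 'n cmat) \<Rightarrow> nat \<Rightarrow> int \<Rightarrow> 'n cmat set"
  where "eigenspace G \<tau> k l = {Z \<in> lie_algebra_C G. lie_aut_C G \<tau> Z = (omega k powi l) *\<^sub>C Z}"

definition m_space :: "'n::finite cmat set \<Rightarrow> ('n cmat \<Rightarrow> 'n cmat) \<Rightarrow> nat \<Rightarrow> 'n cmat set"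
  where "m_space G \<tau> k = lie_algebra G \<inter>
    {\<Sum>l = 1..<k. Z l | Z. \<forall>l\<in>{1..<k}. Z l \<in> eigenspace G \<tau> k (int l)}"

text \<open>The projections along \<open>\<gg> = \<kk> \<oplus> \<mm>\<close>.\<close>

definition k_part ::
  "'n::finite cmat set \<Rightarrow> ('n cmat \<Rightarrow> 'n cmat) \<Rightarrow> nat \<Rightarrow> 'n cmat set \<Rightarrow> 'n cmat \<Rightarrow> 'n cmat"
  where "k_part G \<tau> k K X = (THE Y. Y \<in> lie_algebra K \<and> X - Y \<in> m_space G \<tau> k)"

definition m_part ::
  "'n::finite cmat set \<Rightarrow> ('n cmat \<Rightarrow> 'n cmat) \<Rightarrow> nat \<Rightarrow> 'n cmat set \<Rightarrow> 'n cmat \<Rightarrow> 'n cmat"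
  where "m_part G \<tau> k K X = (THE Y. Y \<in> m_space G \<tau> k \<and> X - Y \<in> lie_algebra K)"


section \<open>Maps into \<open>G/K\<close>\<close>

text \<open>
  Points of \<open>G/K\<close> are the left cosets \<open>gK\<close>. Since \<open>G \<rightarrow> G/K\<close> is a submersion, a map into
  \<open>G/K\<close> is smooth iff it lifts locally to smooth maps into \<open>G\<close>.
\<close>

definition smooth_into_quotient ::
  "'n::finite cmat set \<Rightarrow> 'n cmat set \<Rightarrow> ('a::real_normed_vector \<Rightarrow> 'n cmat set) \<Rightarrow> bool"
  where "smooth_into_quotient G K \<phi> \<longleftrightarrow>
    (\<forall>p. \<exists>U F. open U \<and> p \<in> U \<and> smooth_on U F \<and> (\<forall>q\<in>U. F q \<in> G \<and> \<phi> q = F q <#\<^bsub>GLn\<^esub> K))"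

definition frame ::
  "'n::finite cmat set \<Rightarrow> 'n cmat set \<Rightarrow> (complex \<Rightarrow> 'n cmat set) \<Rightarrow> (complex \<Rightarrow> 'n cmat) \<Rightarrow> bool"
  where "frame G K \<phi> F \<longleftrightarrow> smooth_on UNIV F \<and> (\<forall>p. F p \<in> G \<and> \<phi> p = F p <#\<^bsub>GLn\<^esub> K)"

text \<open>
  Matrix-valued 1-forms on \<open>\<complex> = \<real>\<^sup>2\<close> are functions of a point and a tangent vector,
  real linear in the latter.
\<close>

type_synonym 'n form1 = "complex \<Rightarrow> complex \<Rightarrow> 'n cmat"

definition maurer_cartan :: "(complex \<Rightarrow> 'n::finite cmat) \<Rightarrow> 'n form1"
  where "maurer_cartan F p v = matrix_inv (F p) ** frechet_derivative F (at p) v"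

definition form_10 :: "'n::finite form1 \<Rightarrow> 'n form1"
  where "form_10 \<beta> p v = (1/2) *\<^sub>R (\<beta> p v - \<i> *\<^sub>C \<beta> p (\<i> * v))"

definition ext_deriv :: "'n::finite form1 \<Rightarrow> complex \<Rightarrow> complex \<Rightarrow> complex \<Rightarrow> 'n cmat"
  where "ext_deriv \<beta> p u v =
    frechet_derivative (\<lambda>q. \<beta> q v) (at p) u - frechet_derivative (\<lambda>q. \<beta> q u) (at p) v"

definition bracket_wedge :: "'n::finite form1 \<Rightarrow> 'n form1 \<Rightarrow> complex \<Rightarrow> complex \<Rightarrow> complex \<Rightarrow> 'n cmat"
  where "bracket_wedge \<alpha> \<beta> p u v = bracket (\<alpha> p u) (\<beta> p v) - bracket (\<alpha> p v) (\<beta> p u)"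

definition alpha_k :: "'n::finite cmat set \<Rightarrow> ('n cmat \<Rightarrow> 'n cmat) \<Rightarrow> nat \<Rightarrow> 'n cmat set \<Rightarrow>
    (complex \<Rightarrow> 'n cmat) \<Rightarrow> 'n form1"
  where "alpha_k G \<tau> k K F p v = k_part G \<tau> k K (maurer_cartan F p v)"

definition alpha_m :: "'n::finite cmat set \<Rightarrow> ('n cmat \<Rightarrow> 'n cmat) \<Rightarrow> nat \<Rightarrow> 'n cmat set \<Rightarrow>
    (complex \<Rightarrow> 'n cmat) \<Rightarrow> 'n form1"
  where "alpha_m G \<tau> k K F p v = m_part G \<tau> k K (maurer_cartan F p v)"

text \<open>
  Neither of the next two conditions depends on the choice of the frame. Frames exist
  for every smooth \<open>\<phi>\<close>, as the domain is contractible.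
\<close>

definition harmonic_map :: "'n::finite cmat set \<Rightarrow> ('n cmat \<Rightarrow> 'n cmat) \<Rightarrow> nat \<Rightarrow> 'n cmat set \<Rightarrow>
    (complex \<Rightarrow> 'n cmat set) \<Rightarrow> bool"
  where "harmonic_map G \<tau> k K \<phi> \<longleftrightarrow> (\<exists>F. frame G K \<phi> F \<and>
    (\<forall>p u v. ext_deriv (form_10 (alpha_m G \<tau> k K F)) p u v
             + bracket_wedge (alpha_k G \<tau> k K F) (form_10 (alpha_m G \<tau> k K F)) p u v = 0))"

definition primitive_map :: "'n::finite cmat set \<Rightarrow> ('n cmat \<Rightarrow> 'n cmat) \<Rightarrow> nat \<Rightarrow> 'n cmat set \<Rightarrow>
    (complex \<Rightarrow> 'n cmat set) \<Rightarrow> bool"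
  where "primitive_map G \<tau> k K \<phi> \<longleftrightarrow> (\<exists>F. frame G K \<phi> F \<and>
    (\<forall>p v. form_10 (alpha_m G \<tau> k K F) p v \<in> eigenspace G \<tau> k (-1)))"

definition primitive_harmonic :: "'n::finite cmat set \<Rightarrow> ('n cmat \<Rightarrow> 'n cmat) \<Rightarrow> nat \<Rightarrow> 'n cmat set \<Rightarrow>
    (complex \<Rightarrow> 'n cmat set) \<Rightarrow> bool"
  where "primitive_harmonic G \<tau> k K \<phi> \<longleftrightarrow>
    k = 2 \<and> harmonic_map G \<tau> k K \<phi> \<or> k > 2 \<and> primitive_map G \<tau> k K \<phi>"

text \<open>The left action of \<open>G\<close> on \<open>G/K\<close> is \<open>l_coset\<close> again.\<close>

definition equivariant :: "'n::finite cmat set \<Rightarrow> 'n cmat set \<Rightarrow> (complex \<Rightarrow> 'n cmat set) \<Rightarrow> bool"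
  where "equivariant G K \<phi> \<longleftrightarrow> (\<exists>A0\<in>lie_algebra G. \<exists>\<psi> :: real \<Rightarrow> 'n cmat set.
    smooth_into_quotient G K \<psi> \<and> (\<forall>x y. \<phi> (Complex x y) = mexp (x *\<^sub>R A0) <#\<^bsub>GLn\<^esub> \<psi> y))"


section \<open>Loop groups and potentials\<close>

text \<open>
  Iwasawa decomposition \<open>K\<^sup>\<complex> = KB\<close>. As \<open>B\<close> is a closed subgroup, bijectivity of the
  multiplication \<open>K \<times> B \<rightarrow> K\<^sup>\<complex>\<close> makes it a diffeomorphism (it is an orbit map of the
  Lie group \<open>K \<times> B\<close>).
\<close>

definition iwasawa_decomposition :: "'n::finite cmat set \<Rightarrow> 'n cmat set \<Rightarrow> bool"
  where "iwasawa_decomposition K B \<longleftrightarrow>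
    subgroup B GLn \<and> closedin (top_of_set (group_C K)) B \<and> solvable (GLn\<lparr>carrier := B\<rparr>) \<and>
    bij_betw (\<lambda>(a, b). a ** b) (K \<times> B) (group_C K)"

text \<open>Loops are functions on \<open>\<complex>\<close> of which only the values on the unit circle matter.\<close>

definition smooth_loop :: "(complex \<Rightarrow> 'n::finite cmat) \<Rightarrow> bool"
  where "smooth_loop g \<longleftrightarrow> smooth_on UNIV (\<lambda>t::real. g (cis t))"

definition loop_group ::
  "'n::finite cmat set \<Rightarrow> ('n cmat \<Rightarrow> 'n cmat) \<Rightarrow> nat \<Rightarrow> (complex \<Rightarrow> 'n cmat) set"
  where "loop_group G \<tau> k = {g. smooth_loop g \<and>
    (\<forall>\<mu>\<in>sphere 0 1. g \<mu> \<in> G \<and> g (omega k * \<mu>) = \<tau> (g \<mu>))}"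

definition loop_group_C ::
  "'n::finite cmat set \<Rightarrow> ('n cmat \<Rightarrow> 'n cmat) \<Rightarrow> nat \<Rightarrow> (complex \<Rightarrow> 'n cmat) set"
  where "loop_group_C G \<tau> k = {g. smooth_loop g \<and>
    (\<forall>\<mu>\<in>sphere 0 1. g \<mu> \<in> group_C G \<and> g (omega k * \<mu>) = aut_C G \<tau> (g \<mu>))}"

definition loop_group_plus :: "'n::finite cmat set \<Rightarrow> ('n cmat \<Rightarrow> 'n cmat) \<Rightarrow> nat \<Rightarrow>
    'n cmat set \<Rightarrow> (complex \<Rightarrow> 'n cmat) set"
  where "loop_group_plus G \<tau> k B = {g \<in> loop_group_C G \<tau> k.
    \<exists>h. (\<forall>\<mu>\<in>sphere 0 1. h \<mu> = g \<mu>) \<and> continuous_on (cball 0 1) h \<and>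
        (\<forall>i j. (\<lambda>\<mu>. h \<mu> $ i $ j) holomorphic_on ball 0 1) \<and>
        (\<forall>\<mu>\<in>ball 0 1. h \<mu> \<in> group_C G) \<and> h 0 \<in> B}"

definition loop_algebra ::
  "'n::finite cmat set \<Rightarrow> ('n cmat \<Rightarrow> 'n cmat) \<Rightarrow> nat \<Rightarrow> (complex \<Rightarrow> 'n cmat) set"
  where "loop_algebra G \<tau> k = {\<xi>. smooth_loop \<xi> \<and>
    (\<forall>\<mu>\<in>sphere 0 1. \<xi> \<mu> \<in> lie_algebra G \<and> \<xi> (omega k * \<mu>) = lie_aut \<tau> (\<xi> \<mu>))}"

definition loop_algebra_1 ::
  "'n::finite cmat set \<Rightarrow> ('n cmat \<Rightarrow> 'n cmat) \<Rightarrow> nat \<Rightarrow> (complex \<Rightarrow> 'n cmat) set"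
  where "loop_algebra_1 G \<tau> k = {\<xi> \<in> loop_algebra G \<tau> k.
    \<exists>\<xi>m \<xi>0 \<xi>p. \<forall>\<mu>\<in>sphere 0 1. \<xi> \<mu> = inverse \<mu> *\<^sub>C \<xi>m + \<xi>0 + \<mu> *\<^sub>C \<xi>p}"

text \<open>\<open>F z \<mu>\<close> is the extended frame \<open>F\<^sub>\<mu>(z)\<close>: pointwise in \<open>z\<close>, \<open>exp(z\<xi>) = F(z) b(z)\<close>.\<close>

definition iwasawa_factors :: "'n::finite cmat set \<Rightarrow> ('n cmat \<Rightarrow> 'n cmat) \<Rightarrow> nat \<Rightarrow> 'n cmat set \<Rightarrow>
    (complex \<Rightarrow> 'n cmat) \<Rightarrow> (complex \<Rightarrow> complex \<Rightarrow> 'n cmat) \<Rightarrow> (complex \<Rightarrow> complex \<Rightarrow> 'n cmat) \<Rightarrow> bool"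
  where "iwasawa_factors G \<tau> k B \<xi> F b \<longleftrightarrow>
    (\<forall>z. F z \<in> loop_group G \<tau> k \<and> b z \<in> loop_group_plus G \<tau> k B \<and>
         (\<forall>\<mu>\<in>sphere 0 1. mexp (z *\<^sub>C \<xi> \<mu>) = F z \<mu> ** b z \<mu>))"

definition generated_by :: "'n::finite cmat set \<Rightarrow> ('n cmat \<Rightarrow> 'n cmat) \<Rightarrow> nat \<Rightarrow> 'n cmat set \<Rightarrow>
    'n cmat set \<Rightarrow> (complex \<Rightarrow> 'n cmat set) \<Rightarrow> (complex \<Rightarrow> 'n cmat) \<Rightarrow> bool"
  where "generated_by G \<tau> k K B \<phi> \<xi> \<longleftrightarrow>
    (\<exists>F b. iwasawa_factors G \<tau> k B \<xi> F b \<and> (\<forall>z. \<phi> z = F z 1 <#\<^bsub>GLn\<^esub> K))"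

text \<open>
  As \<open>F\<^sub>1(0) = 1\<close>, a generated map sends \<open>0\<close> to the base point \<open>K\<close>. A map that is not so
  normalised has to be compared with the potential after a left translation.
\<close>

definition generated_up_to_translation :: "'n::finite cmat set \<Rightarrow> ('n cmat \<Rightarrow> 'n cmat) \<Rightarrow> nat \<Rightarrow>
    'n cmat set \<Rightarrow> 'n cmat set \<Rightarrow> (complex \<Rightarrow> 'n cmat set) \<Rightarrow> (complex \<Rightarrow> 'n cmat) \<Rightarrow> bool"
  where "generated_up_to_translation G \<tau> k K B \<phi> \<xi> \<longleftrightarrow>
    (\<exists>g\<in>G. \<exists>\<phi>0. generated_by G \<tau> k K B \<phi>0 \<xi> \<and> (\<forall>z. \<phi> z = g <#\<^bsub>GLn\<^esub> \<phi>0 z))"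

end

theory Submission
  imports Defs
begin

text \<open>
  Let \<open>F\<close> frame an equivariant map with generator \<open>A\<^sub>0\<close>, and put \<open>f(y) = F(iy)\<close>. Being primitive
  or harmonic means that \<open>f\<^sup>-\<^sup>1 A\<^sub>0 f\<close> and \<open>f\<^sup>-\<^sup>1 f'\<close> are the values at \<open>\<lambda> = 1\<close> of a Lax pair
  \<open>A\<^sub>\<lambda>' = [A\<^sub>\<lambda>, B\<^sub>\<lambda>]\<close> of degree one in \<open>\<lambda>\<^sup>\<plusminus>\<^sup>1\<close>; the potential is \<open>\<xi> = A\<^sub>\<lambda>(0)\<close>. The factorisation of
  \<open>exp(z\<xi>)\<close> is then explicit: \<open>i A\<^sub>\<lambda> - B\<^sub>\<lambda>\<close> contains no negative power of \<open>\<lambda>\<close>, so the solution of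
  \<open>b' = (i A\<^sub>\<lambda> - B\<^sub>\<lambda>) b\<close>, \<open>b(0) = 1\<close> is entire in \<open>\<lambda>\<close>, while \<open>exp(iy\<xi>) b\<^sup>-\<^sup>1\<close> solves the equation
  \<open>f\<^sub>\<lambda>' = f\<^sub>\<lambda> B\<^sub>\<lambda>\<close> with real coefficients. At \<open>\<lambda> = 0\<close> one needs \<open>b\<close> to lie in \<open>K\<^sup>\<complex> = KB\<close>, where \<open>K\<^sup>\<complex>\<close> consists
  of the products \<open>h exp(iX)\<close>: a solution of a linear equation with coefficients in \<open>\<kk>\<^sup>\<complex>\<close> keeps
  such a polar decomposition.

  Conversely \<open>exp(x\<xi>)\<close> is a loop in \<open>G\<close>, so uniqueness of the factorisation gives
  \<open>F\<^sub>\<lambda>(x + iy) = exp(x\<xi>) F\<^sub>\<lambda>(iy) k\<close> with \<open>k\<close> in \<open>K\<close>. For uniqueness, a loop in the compact group \<open>G\<close>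
  that extends holomorphically to the disc is constant, by the maximum principle for a form
  invariant under translations.

  The Lie theory of closed matrix groups that this requires, including the polar decomposition, is
  drawn from Nagumo's theorem on sets invariant under a flow.
\<close>

text \<open>For \<open>X = f^-1 A0 f\<close> and \<open>Y = f^-1 f'\<close> the equation
  \<open>X' = [X, Y]\<close> holds for any frame; once the m-parts \<open>u\<close>,
  \<open>v\<close> of \<open>X\<close>, \<open>Y\<close> are known to satisfy [u, v] in k, its parts
  in k and m are two of the three Lax equations. The third, for \<open>v\<close>, is where the
  hypothesis enters: for k = 2 it is the harmonic map equation, for k > 2 it follows from
  primitivity, because \<open>v\<close> is then a combination of \<open>u\<close> and its image
  under \<tau>.

  Two obstacles shape the rest. A frame of an equivariant map is equivariant only up to a
  \<open>K\<close>-valued factor \<open>h\<close> of both variables, whose derivatives have to be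
  carried along. And Nagumo's theorem wants closed sets, whereas a complexified group need not be
  closed among all matrices and \<open>K\<close> is not assumed closed. The remedies are to work
  with pairs of a matrix and its inverse, and to pass to the identity component of the fixed point
  group.

  The form invariant under both translations takes the place of Hermitian linear algebra:
  multiplication by an element of i g is self-adjoint for it, so exp is injective and proper on i g,
  which gives uniqueness and closedness of the polar decomposition.\<close>

unbundle no fps_syntax

no_notation matrix_matrix_mult (infixl \<open>**\<close> 70)

text \<open>The type constraint of the abbreviation restricts the notation to square matrices.\<close>

abbreviation square_mult :: "'n::finite cmat \<Rightarrow> 'n cmat \<Rightarrow> 'n cmat"  (infixl "**" 70)
  where "A ** B \<equiv> matrix_matrix_mult A B"

section \<open>Matrix algebra\<close>

lemma bounded_bilinear_matrix_mult: "bounded_bilinear ((**) :: 'n::finite cmat \<Rightarrow> _)"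
  unfolding bilinear_conv_bounded_bilinear[symmetric] bilinear_def linear_iff
  by (simp add: vec_eq_iff matrix_matrix_mult_def sum.distrib algebra_simps scaleR_sum_right)

interpretation mm: bounded_bilinear "(**) :: 'n::finite cmat \<Rightarrow> 'n cmat \<Rightarrow> 'n cmat"
  by (rule bounded_bilinear_matrix_mult)

lemma cscale_nth [simp]: "(c *\<^sub>C A) $ i $ j = c * A $ i $ j"
  by (simp add: cscale_def)

lemma bounded_bilinear_cscale: "bounded_bilinear ((*\<^sub>C) :: complex \<Rightarrow> 'n::finite cmat \<Rightarrow> _)"
  unfolding bilinear_conv_bounded_bilinear[symmetric] bilinear_def linear_iff
  by (simp add: vec_eq_iff algebra_simps)

interpretation cs: bounded_bilinear "(*\<^sub>C) :: complex \<Rightarrow> 'n::finite cmat \<Rightarrow> 'n cmat"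
  by (rule bounded_bilinear_cscale)

lemma cscale_cscale [simp]: "a *\<^sub>C b *\<^sub>C A = (a * b) *\<^sub>C A"
  and cscale_one [simp]: "1 *\<^sub>C A = A"
  and cscale_zero_left [simp]: "0 *\<^sub>C A = 0"
  and cscale_zero_right [simp]: "c *\<^sub>C 0 = 0"
  and scaleR_conv_cscale: "r *\<^sub>R A = complex_of_real r *\<^sub>C A"
  by (simp_all add: vec_eq_iff scaleR_conv_of_real[where 'a=complex])

lemma cscale_mult_left [simp]: "(c *\<^sub>C A) ** B = c *\<^sub>C (A ** B)"
  and cscale_mult_right [simp]: "A ** (c *\<^sub>C B) = c *\<^sub>C (A ** B)"
  by (simp_all add: vec_eq_iff matrix_matrix_mult_def sum_distrib_left mult_ac)

lemma cscale_scaleR [simp]: "c *\<^sub>C (r *\<^sub>R A) = r *\<^sub>R (c *\<^sub>C A)"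
  by (simp add: vec_eq_iff)

lemma scaleR_mult_left [simp]: "(r *\<^sub>R A) ** B = r *\<^sub>R (A ** B)"
  and scaleR_mult_right [simp]: "A ** (r *\<^sub>R B) = r *\<^sub>R (A ** B)"
  for A B :: "'n::finite cmat"
  by (simp_all add: mm.scaleR_left mm.scaleR_right)

lemma mat_minus_mult_left [simp]: "(- A) ** B = - (A ** B)"
  and mat_minus_mult_right [simp]: "A ** (- B) = - (A ** B)"
  for A B :: "'n::finite cmat"
  by (simp_all add: mm.minus_left mm.minus_right)

lemma mat_zero_mult_right [simp]: "A ** 0 = 0"
  for A :: "'n::finite cmat"
  by (rule mm.zero_right)

lemma cscale_minus_left [simp]: "(- c) *\<^sub>C A = - (c *\<^sub>C A)"
  and cscale_minus_right [simp]: "c *\<^sub>C (- A) = - (c *\<^sub>C A)"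
  by (simp_all add: vec_eq_iff)

lemmas mat_distribs = mm.add_left mm.add_right mm.diff_left mm.diff_right
  cs.add_left cs.add_right cs.diff_left cs.diff_right scaleR_add_right scaleR_diff_right

lemma has_vector_derivative_mult [derivative_intros]:
  fixes f g :: "real \<Rightarrow> 'n::finite cmat"
  assumes "(f has_vector_derivative f') (at x within S)" "(g has_vector_derivative g') (at x within S)"
  shows "((\<lambda>x. f x ** g x) has_vector_derivative (f x ** g' + f' ** g x)) (at x within S)"
  using assms by (rule mm.has_vector_derivative)

lemma has_vector_derivative_cscale [derivative_intros]:
  assumes "(g has_vector_derivative g') (at x within S)"
  shows "((\<lambda>x. c *\<^sub>C g x) has_vector_derivative (c *\<^sub>C g')) (at x within S)"
  using bounded_linear.has_vector_derivative[OF cs.bounded_linear_right assms] .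

lemma has_vector_derivative_rhs:
  "(f has_vector_derivative a) F \<Longrightarrow> a = b \<Longrightarrow> (f has_vector_derivative b) F"
  by simp

lemma has_vector_derivative_compose_neg:
  fixes f :: "real \<Rightarrow> 'a::real_normed_vector"
  assumes "(f has_vector_derivative f') (at (- y))"
  shows "((\<lambda>y. f (- y)) has_vector_derivative - f') (at y)"
proof -
  have "((\<lambda>y. - y) has_vector_derivative - 1) (at y)" for y :: real
    by (rule has_vector_derivative_minus) (rule has_vector_derivative_id)
  from vector_diff_chain_at[OF this, of f f'] assms show ?thesis
    by (simp add: o_def)
qed

lemma zero_derivative_imp_const:
  fixes f :: "real \<Rightarrow> 'a::euclidean_space"
  assumes "\<And>t. (f has_vector_derivative 0) (at t)"
  shows "f t = f s"
  using has_vector_derivative_zero_constant[of UNIV f] assms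
  by (metis UNIV_I convex_UNIV)

section \<open>Linear differential equations\<close>

lemma ex_antiderivative:
  fixes f :: "real \<Rightarrow> 'a::euclidean_space"
  assumes "continuous_on UNIV f"
  shows "\<exists>F. F 0 = 0 \<and> (\<forall>x. (F has_vector_derivative f x) (at x))"
proof -
  have "\<exists>F. \<forall>x::real. -\<infinity> < ereal x \<longrightarrow> ereal x < \<infinity> \<longrightarrow> (F has_vector_derivative f x) (at x)"
    by (rule einterval_antiderivative) (use assms in \<open>auto simp: continuous_on_eq_continuous_at\<close>)
  then obtain F where F: "\<And>x. (F has_vector_derivative f x) (at x)"
    by auto
  have "((\<lambda>x. F x - F 0) has_vector_derivative f x) (at x)" for x
    by (rule derivative_eq_intros F | simp)+
  then show ?thesis
    by (intro exI[of _ "\<lambda>x. F x - F 0"]) auto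
qed

text \<open>The terms are the Picard iterates of \<open>b' = L b\<close>, each integrating
  \<open>L\<close> applied to the preceding one. One convergence proof thus serves both the
  exponential series and the equation with time-dependent coefficients and a spectral
  parameter.\<close>

locale ode_series =
  fixes b :: "nat \<Rightarrow> real \<Rightarrow> 'a::euclidean_space" and L :: "real \<Rightarrow> 'a \<Rightarrow> 'a" and b0 :: 'a
  assumes b_0: "b 0 y = b0" and b_Suc_0: "b (Suc n) 0 = 0"
    and b_deriv: "(b (Suc n) has_vector_derivative L y (b n y)) (at y)"
    and L_linear: "linear (L y)"
begin

text \<open>Each majorant has \<open>c\<close> times the preceding one as its derivative, so the
  estimate integrates from one iterate to the next.\<close>

lemma bound_nonneg:
  assumes c: "\<And>y v. 0 \<le> y \<Longrightarrow> y \<le> R \<Longrightarrow> norm (L y v) \<le> c * norm v"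
    and y: "0 \<le> y" "y \<le> R"
  shows "norm (b n y) \<le> norm b0 * (c * y) ^ n / fact n"
  using y
proof (induction n arbitrary: y)
  case (Suc n)
  note c0 = c
  show ?case
  proof (cases "y = 0")
    case True
    then show ?thesis by (simp add: b_Suc_0)
  next
    case False
    with Suc have y: "0 < y" "y \<le> R" by auto
    have "norm (b (Suc n) y - b (Suc n) 0)
        \<le> norm b0 * (c * y) ^ Suc n / fact (Suc n) - norm b0 * (c * 0) ^ Suc n / fact (Suc n)"
    proof (rule differentiable_bound_general[OF y(1),
          where f' = "\<lambda>y. L y (b n y)" and \<phi>' = "\<lambda>y. c * (norm b0 * (c * y) ^ n / fact n)"])
      show "continuous_on {0..y} (b (Suc n))"
        by (meson b_deriv continuous_at_imp_continuous_on has_vector_derivative_continuous)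
      show "continuous_on {0..y} (\<lambda>y. norm b0 * (c * y) ^ Suc n / fact (Suc n))"
        by (intro continuous_intros) auto
      show "(b (Suc n) has_vector_derivative L x (b n x)) (at x)" for x
        by (rule b_deriv)
      show "((\<lambda>y. norm b0 * (c * y) ^ Suc n / fact (Suc n)) has_vector_derivative
            c * (norm b0 * (c * x) ^ n / fact n)) (at x)" for x
        unfolding has_real_derivative_iff_has_vector_derivative[symmetric]
        by (rule derivative_eq_intros refl | simp)+
      show "norm (L x (b n x)) \<le> c * (norm b0 * (c * x) ^ n / fact n)" if "0 < x" "x < y" for x
      proof -
        \<comment> \<open>The sign of \<open>c\<close> is not assumed; the bound evaluated at a unit
          vector forces it.\<close>
        have "0 \<le> c"
        proof (rule ccontr)
          assume "\<not> 0 \<le> c"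
          obtain v :: 'a where v: "norm v = 1"
            using vector_choose_size[of 1] by auto
          have "norm (L x v) \<le> c * 1" using c0[of x v] that y v by auto
          then show False using \<open>\<not> 0 \<le> c\<close> norm_ge_zero[of "L x v"] by linarith
        qed
        moreover have "norm (L x (b n x)) \<le> c * norm (b n x)"
          by (rule c0) (use that y in auto)
        moreover have "norm (b n x) \<le> norm b0 * (c * x) ^ n / fact n"
          by (rule Suc.IH) (use that y in auto)
        ultimately show ?thesis
          by (meson mult_left_mono order_trans)
      qed
    qed
    then show ?thesis by (simp add: b_Suc_0)
  qed
qed (simp add: b_0)

text \<open>Reversing time turns the iterates into those of the reversed equation, so negative times
  reduce to positive ones.\<close>

lemma reflect: "ode_series (\<lambda>n y. b n (- y)) (\<lambda>y v. - L (- y) v) b0"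
  by (rule ode_series.intro) (auto simp: b_0 b_Suc_0 intro: has_vector_derivative_compose_neg b_deriv
      linear_compose_neg L_linear)

lemma bound:
  assumes c: "\<And>y v. \<bar>y\<bar> \<le> R \<Longrightarrow> norm (L y v) \<le> c * norm v" and y: "\<bar>y\<bar> \<le> R"
  shows "norm (b n y) \<le> norm b0 * (c * \<bar>y\<bar>) ^ n / fact n"
proof (cases "0 \<le> y")
  case True
  then show ?thesis
    using bound_nonneg[of R c y n] c y by auto
next
  case False
  have "norm (- L (- y) v) \<le> c * norm v" if "0 \<le> y" "y \<le> R" for y v
    using c[of "-y" v] that by auto
  from ode_series.bound_nonneg[OF reflect, of R c "-y" n, OF this] y False
  show ?thesis by auto
qed

lemma majorant:
  assumes c: "\<And>y v. \<bar>y\<bar> \<le> R \<Longrightarrow> norm (L y v) \<le> c * norm v" and y: "\<bar>y\<bar> \<le> R"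
  shows "norm (b n y) \<le> norm b0 * (\<bar>c * R\<bar> ^ n / fact n)"
proof -
  have "norm (b n y) \<le> norm b0 * (c * \<bar>y\<bar>) ^ n / fact n"
    using assms by (rule bound)
  also have "\<dots> \<le> norm b0 * (\<bar>c * R\<bar> ^ n / fact n)"
  proof -
    have "(c * \<bar>y\<bar>) ^ n \<le> \<bar>(c * \<bar>y\<bar>)\<bar> ^ n"
      by (simp flip: power_abs)
    also have "\<dots> \<le> \<bar>c * R\<bar> ^ n"
      by (rule power_mono) (use y in \<open>auto simp: abs_mult intro!: mult_left_mono\<close>)
    finally show ?thesis
      by (simp add: divide_right_mono mult_left_mono)
  qed
  finally show ?thesis .
qed

lemma summable_majorant: "summable (\<lambda>n. norm b0 * (\<bar>x::real\<bar> ^ n / fact n))"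
  using summable_exp_generic[of "\<bar>x\<bar>"] by (intro summable_mult) (simp add: field_simps)

context
  assumes locally_bounded: "\<And>R. \<exists>c. \<forall>y v. \<bar>y\<bar> \<le> R \<longrightarrow> norm (L y v) \<le> c * norm v"
begin

lemma summable: "summable (\<lambda>n. b n y)"
proof -
  obtain c where c: "\<And>x v. \<bar>x\<bar> \<le> \<bar>y\<bar> \<Longrightarrow> norm (L x v) \<le> c * norm v"
    using locally_bounded by blast
  show ?thesis
    by (rule summable_comparison_test[OF _ summable_majorant[of "c * \<bar>y\<bar>"]])
       (use majorant[of "\<bar>y\<bar>" c y] c in auto)
qed

lemma solution_0: "(\<Sum>n. b n 0) = b0"
proof -
  have "(\<lambda>n. b n 0) = (\<lambda>n. if n = 0 then b0 else 0)"
    by (rule ext) (metis b_0 b_Suc_0 not0_implies_Suc)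
  then show ?thesis
    using sums_single[of 0 "\<lambda>_. b0"] by (simp add: sums_iff)
qed

text \<open>Termwise differentiation is legitimate because the differentiated partial sums are
  \<open>L\<close> applied to earlier partial sums, and \<open>L\<close> is bounded uniformly near
  the point in question.\<close>

lemma solution_deriv: "((\<lambda>y. \<Sum>n. b n y) has_vector_derivative L y (\<Sum>n. b n y)) (at y)"
proof -
  define R where "R = \<bar>y\<bar> + 1"
  define S where "S = ball (0::real) R"
  obtain c where c: "\<And>x v. \<bar>x\<bar> \<le> R \<Longrightarrow> norm (L x v) \<le> c * norm v"
    using locally_bounded by blast
  \<comment> \<open>A positive constant is wanted, so that \<open>e / c'\<close> is a valid
    tolerance.\<close>
  define c' where "c' = max c 1"
  have c': "norm (L x v) \<le> c' * norm v" if "\<bar>x\<bar> \<le> R" for x v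
    by (rule order_trans[OF c[OF that]]) (auto simp: c'_def intro!: mult_right_mono)
  have c'1: "c' \<ge> 1" by (simp add: c'_def)
  have unif: "uniform_limit S (\<lambda>n x. \<Sum>i<n. b i x) (\<lambda>x. \<Sum>i. b i x) sequentially"
    by (rule Weierstrass_m_test[OF _ summable_majorant[of "c * R"]])
       (use majorant[of R c] c in \<open>auto simp: S_def\<close>)
  \<comment> \<open>The constant term contributes nothing, so the derivative of a partial sum with
    \<open>Suc m\<close> terms is \<open>L\<close> of the one with \<open>m\<close> terms; this is
    the shift \<open>n - 1\<close> below.\<close>
  define f' where "f' = (\<lambda>n x h. h *\<^sub>R (case n of 0 \<Rightarrow> 0 | Suc m \<Rightarrow> L x (b m x)))"
  define g' where "g' = (\<lambda>x h. h *\<^sub>R L x (\<Sum>n. b n x))"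
  have "\<exists>g. \<forall>x\<in>S. (\<lambda>n. b n x) sums g x \<and> (g has_derivative g' x) (at x within S)"
  proof (rule has_derivative_series)
    show "convex S" by (simp add: S_def)
    show "(b n has_derivative f' n x) (at x within S)" if "x \<in> S" for n x
    proof (cases n)
      case 0
      then have "b n = (\<lambda>_. b0)" using b_0 by auto
      then show ?thesis by (simp add: f'_def 0)
    next
      case (Suc m)
      then show ?thesis
        using b_deriv[of m x] has_derivative_at_withinI
        by (auto simp: f'_def has_vector_derivative_def)
    qed
    show "\<forall>\<^sub>F n in sequentially. \<forall>x\<in>S. \<forall>h. norm ((\<Sum>i<n. f' i x h) - g' x h) \<le> e * norm h"
      if "e > 0" for e
    proof -
      have "\<forall>\<^sub>F n in sequentially. \<forall>x\<in>S. dist (\<Sum>i<n. b i x) (\<Sum>i. b i x) < e / c'"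
        using unif that c'1 unfolding uniform_limit_iff by auto
      then have "\<forall>\<^sub>F n in sequentially. \<forall>x\<in>S. dist (\<Sum>i<n - 1. b i x) (\<Sum>i. b i x) < e / c'"
        by (subst eventually_sequentially_Suc[symmetric]) simp
      moreover have "\<forall>\<^sub>F n::nat in sequentially. n > 0"
        by (rule eventually_gt_at_top)
      ultimately show ?thesis
      proof eventually_elim
        case (elim n)
        then obtain m where m: "n = Suc m" using not0_implies_Suc by auto
        show ?case
        proof (intro ballI allI)
          fix x h assume x: "x \<in> S"
          then have xR: "\<bar>x\<bar> \<le> R" by (simp add: S_def)
          have "(\<Sum>i<n. f' i x h) = h *\<^sub>R (\<Sum>i<m. L x (b i x))"
            unfolding m by (subst sum.lessThan_Suc_shift) (simp add: f'_def scaleR_sum_right)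
          also have "(\<Sum>i<m. L x (b i x)) = L x (\<Sum>i<m. b i x)"
            using linear_sum[OF L_linear] by metis
          finally have "(\<Sum>i<n. f' i x h) - g' x h = h *\<^sub>R L x ((\<Sum>i<m. b i x) - (\<Sum>i. b i x))"
            by (simp add: g'_def linear_diff[OF L_linear] scaleR_diff_right)
          then have "norm ((\<Sum>i<n. f' i x h) - g' x h)
              = \<bar>h\<bar> * norm (L x ((\<Sum>i<m. b i x) - (\<Sum>i. b i x)))" by simp
          also have "\<dots> \<le> \<bar>h\<bar> * (c' * norm ((\<Sum>i<m. b i x) - (\<Sum>i. b i x)))"
            using c'[OF xR] by (intro mult_left_mono) auto
          also have "\<dots> \<le> \<bar>h\<bar> * (c' * (e / c'))"
            using elim x m c'1 by (intro mult_left_mono) (auto simp: dist_norm less_imp_le)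
          finally show "norm ((\<Sum>i<n. f' i x h) - g' x h) \<le> e * norm h"
            using c'1 by (simp add: mult.commute)
        qed
      qed
    qed
    show "0 \<in> S" by (simp add: S_def R_def)
    show "(\<lambda>n. b n 0) sums (\<Sum>n. b n 0)"
      using summable by (rule summable_sums)
  qed
  then obtain g where g: "\<And>x. x \<in> S \<Longrightarrow> (\<lambda>n. b n x) sums g x"
    "\<And>x. x \<in> S \<Longrightarrow> (g has_derivative g' x) (at x within S)" by auto
  have y: "y \<in> S" "open S" by (auto simp: S_def R_def)
  then have "(g has_derivative g' y) (at y)"
    using g(2)[OF y(1)] at_within_open by metis
  then have "((\<lambda>y. \<Sum>n. b n y) has_derivative g' y) (at y)"
    using y g(1) by (auto intro: has_derivative_transform_within_open simp: sums_iff)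
  then show ?thesis
    by (simp add: has_vector_derivative_def g'_def)
qed

end

end

section \<open>The matrix exponential\<close>

abbreviation mpow :: "'n::finite cmat \<Rightarrow> nat \<Rightarrow> 'n cmat"
  where "mpow A j \<equiv> (((**) A) ^^ j) (mat 1)"

lemma mpow_scaleR: "mpow (r *\<^sub>R A) j = r ^ j *\<^sub>R mpow A j"
  by (induction j) auto

lemma linear_mult_left: "linear (\<lambda>X :: 'n cmat. A ** X)" for A :: "'n::finite cmat"
  by (rule bounded_linear.linear[OF mm.bounded_linear_right])

lemma linear_mult_right: "linear (\<lambda>X :: 'n cmat. X ** A)" for A :: "'n::finite cmat"
  by (rule bounded_linear.linear[OF mm.bounded_linear_left])

lemma ode_series_mexp:
  "ode_series (\<lambda>j t. (t ^ j / fact j) *\<^sub>R mpow A j) (\<lambda>_ X. A ** X) (mat 1)"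
proof (rule ode_series.intro)
  show "((\<lambda>t. (t ^ Suc n / fact (Suc n)) *\<^sub>R mpow A (Suc n)) has_vector_derivative
        A ** (y ^ n / fact n) *\<^sub>R mpow A n) (at y)" for n y
  proof -
    have "((\<lambda>t. t ^ Suc n / fact (Suc n)) has_field_derivative y ^ n / fact n) (at y)"
      by (rule derivative_eq_intros refl | simp)+
    from has_vector_derivative_scaleR[OF this has_vector_derivative_const[of "mpow A (Suc n)"]]
    show ?thesis by simp
  qed
qed (simp_all add: linear_mult_left)

lemma mexp_series_bounded:
  fixes A :: "'n::finite cmat"
  shows "\<exists>c. \<forall>y v. \<bar>y::real\<bar> \<le> R \<longrightarrow> norm (A ** v) \<le> c * norm v"
proof -
  obtain c where "c > 0" and c: "\<And>(A :: 'n cmat) (B :: 'n cmat). norm (A ** B) \<le> norm A * norm B * c"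
    using mm.pos_bounded[where ?'n = 'n] by auto
  have "norm (A ** v) \<le> (norm A * c) * norm v" for v
    using c[of A v] by (simp add: mult_ac)
  then show ?thesis by blast
qed

lemma mexp_scaleR_eq:
  fixes A :: "'n::finite cmat"
  shows "mexp (t *\<^sub>R A) = (\<Sum>j. (t ^ j / fact j) *\<^sub>R mpow A j)"
  by (simp add: mexp_def mpow_scaleR)

lemma mexp_sums:
  fixes A :: "'n::finite cmat"
  shows "(\<lambda>j. (1 / fact j) *\<^sub>R mpow A j) sums mexp A"
  using ode_series.summable[OF ode_series_mexp[of A] mexp_series_bounded, of 1]
  by (simp add: mexp_def summable_sums)

lemma mexp_has_vector_derivative:
  "((\<lambda>t. mexp (t *\<^sub>R A)) has_vector_derivative A ** mexp (t *\<^sub>R A)) (at t within S)"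
  unfolding mexp_scaleR_eq
  by (rule has_vector_derivative_at_within)
     (rule ode_series.solution_deriv[OF ode_series_mexp mexp_series_bounded])

lemma mexp_0 [simp]: "mexp (0 :: 'n::finite cmat) = mat 1"
  using ode_series.solution_0[OF ode_series_mexp mexp_series_bounded, of "0 :: 'n cmat"]
    mexp_scaleR_eq[of 0 "0 :: 'n cmat"] by simp

text \<open>The relation passes to all powers and then to the series. Every commutation and
  conjugation rule for \<open>mexp\<close> below is an instance.\<close>

lemma mexp_intertwine:
  fixes A B X :: "'n::finite cmat"
  assumes "A ** X = X ** B"
  shows "mexp A ** X = X ** mexp B"
proof -
  have *: "mpow A j ** X = X ** mpow B j" for j
  proof (induction j)
    case (Suc j)
    have "mpow A (Suc j) ** X = A ** (mpow A j ** X)"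
      by (simp add: matrix_mul_assoc)
    also have "\<dots> = A ** X ** mpow B j"
      by (simp add: Suc matrix_mul_assoc)
    also have "\<dots> = X ** mpow B (Suc j)"
      by (simp add: assms matrix_mul_assoc)
    finally show ?case .
  qed simp
  have "(\<lambda>j. ((1 / fact j) *\<^sub>R mpow A j) ** X) sums (mexp A ** X)"
    using bounded_linear.sums[OF mm.bounded_linear_left mexp_sums] .
  moreover have "(\<lambda>j. X ** ((1 / fact j) *\<^sub>R mpow B j)) sums (X ** mexp B)"
    using bounded_linear.sums[OF mm.bounded_linear_right mexp_sums] .
  ultimately show ?thesis
    using sums_unique2 by (simp add: *)
qed

lemma mexp_commute: "mexp A ** A = A ** mexp A"
  by (rule mexp_intertwine) simp

lemma mexp_has_vector_derivative':
  "((\<lambda>t. mexp (t *\<^sub>R A)) has_vector_derivative mexp (t *\<^sub>R A) ** A) (at t within S)"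
proof -
  have "mexp (t *\<^sub>R A) ** A = A ** mexp (t *\<^sub>R A)"
    by (rule mexp_intertwine) simp
  then show ?thesis
    using mexp_has_vector_derivative by metis
qed

lemma mexp_has_vector_derivative_neg:
  "((\<lambda>t. mexp (- (t *\<^sub>R A))) has_vector_derivative - (mexp (- (t *\<^sub>R A)) ** A)) (at t within S)"
  using mexp_has_vector_derivative'[of "- A" t S] by simp

lemma mexp_minus_right [simp]: "mexp A ** mexp (- A) = mat 1"
proof -
  have "((\<lambda>t. mexp (t *\<^sub>R A) ** mexp (- (t *\<^sub>R A))) has_vector_derivative 0) (at t)" for t
  proof (rule has_vector_derivative_rhs, rule derivative_intros, rule mexp_has_vector_derivative',
      rule mexp_has_vector_derivative_neg)
    have "mexp (- (t *\<^sub>R A)) ** A = A ** mexp (- (t *\<^sub>R A))"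
      by (rule mexp_intertwine) simp
    then show "mexp (t *\<^sub>R A) ** - (mexp (- (t *\<^sub>R A)) ** A) +
        mexp (t *\<^sub>R A) ** A ** mexp (- (t *\<^sub>R A)) = 0"
      by (simp add: matrix_mul_assoc)
  qed
  from zero_derivative_imp_const[OF this, of 1 0] show ?thesis by simp
qed

lemma mexp_minus_left [simp]: "mexp (- A) ** mexp A = mat 1"
  using mexp_minus_right[of "- A"] by simp

lemma mexp_minus_cancel [simp]:
  "X ** mexp A ** mexp (- A) = X" "X ** mexp (- A) ** mexp A = X"
  by (simp_all flip: matrix_mul_assoc)

text \<open>Multiplying a solution by the inverse exponential gives a curve with zero
  derivative.\<close>

lemma mexp_unique:
  assumes "\<And>t. (c has_vector_derivative c t ** A) (at t)" and "c 0 = mat 1"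
  shows "c t = mexp (t *\<^sub>R A)"
proof -
  have "((\<lambda>t. c t ** mexp (- (t *\<^sub>R A))) has_vector_derivative 0) (at t)" for t
  proof (rule has_vector_derivative_rhs, rule derivative_intros, rule assms,
      rule mexp_has_vector_derivative_neg)
    have "mexp (- (t *\<^sub>R A)) ** A = A ** mexp (- (t *\<^sub>R A))"
      by (rule mexp_intertwine) simp
    then show "c t ** - (mexp (- (t *\<^sub>R A)) ** A) + c t ** A ** mexp (- (t *\<^sub>R A)) = 0"
      by (simp add: matrix_mul_assoc)
  qed
  from zero_derivative_imp_const[OF this, of t 0] have "c t ** mexp (- (t *\<^sub>R A)) = mat 1"
    by (simp add: assms)
  then have "c t ** mexp (- (t *\<^sub>R A)) ** mexp (t *\<^sub>R A) = mexp (t *\<^sub>R A)"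
    by simp
  then show ?thesis by simp
qed

lemma mexp_add:
  assumes "A ** B = B ** A"
  shows "mexp (A + B) = mexp A ** mexp B"
proof -
  have "mexp (1 *\<^sub>R A) ** mexp (1 *\<^sub>R B) = mexp (1 *\<^sub>R (A + B))"
  proof (rule mexp_unique)
    fix t
    have AB: "mexp (t *\<^sub>R B) ** A = A ** mexp (t *\<^sub>R B)"
      by (rule mexp_intertwine) (simp add: assms)
    show "((\<lambda>t. mexp (t *\<^sub>R A) ** mexp (t *\<^sub>R B)) has_vector_derivative
        mexp (t *\<^sub>R A) ** mexp (t *\<^sub>R B) ** (A + B)) (at t)"
      by (rule has_vector_derivative_rhs, rule has_vector_derivative_mult,
          rule mexp_has_vector_derivative', rule mexp_has_vector_derivative')
         (simp add: mat_distribs AB flip: matrix_mul_assoc)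
  qed simp
  then show ?thesis by simp
qed

lemma mexp_add_scaleR: "mexp ((s + t) *\<^sub>R A) = mexp (s *\<^sub>R A) ** mexp (t *\<^sub>R A)"
  by (simp add: scaleR_add_left mexp_add)

lemma mexp_conj:
  fixes A P Q :: "'n::finite cmat"
  assumes "Q ** P = mat 1"
  shows "mexp (P ** A ** Q) = P ** mexp A ** Q"
proof -
  have "P ** A ** Q ** P = P ** A"
    by (simp add: assms flip: matrix_mul_assoc)
  then have "mexp (P ** A ** Q) ** P = P ** mexp A"
    by (intro mexp_intertwine) (simp add: matrix_mul_assoc)
  moreover have "P ** Q = mat 1"
    using assms by (simp add: matrix_left_right_inverse[of P Q])
  ultimately show ?thesis
    by (metis matrix_mul_assoc matrix_mul_rid)
qed

lemma norm_mexp_le: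
  "\<exists>c>0. \<forall>A :: 'n::finite cmat. norm (mexp A) \<le> norm (mat 1 :: 'n cmat) * exp (c * norm A)"
proof -
  obtain c where c: "c > 0" "\<And>(A :: 'n cmat) (B :: 'n cmat). norm (A ** B) \<le> norm A * norm B * c"
    using mm.pos_bounded[where ?'n = 'n] by auto
  have "norm (mexp A) \<le> norm (mat 1 :: 'n cmat) * exp (c * norm A)" for A :: "'n cmat"
  proof -
    let ?b = "\<lambda>j. (1 / fact j) *\<^sub>R mpow A j"
    have b: "norm (?b j) \<le> norm (mat 1 :: 'n cmat) * ((c * norm A) ^ j / fact j)" for j
    proof -
      have "norm (A ** v) \<le> c * norm A * norm v" for v
        using c(2)[of A v] by (simp add: mult_ac)
      from ode_series.bound[OF ode_series_mexp this, of 1 1 j]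
      show ?thesis by simp
    qed
    have s: "(\<lambda>j. norm (mat 1 :: 'n cmat) * ((c * norm A) ^ j / fact j)) sums
        (norm (mat 1 :: 'n cmat) * exp (c * norm A))"
      using exp_converges[of "c * norm A"] by (intro sums_mult) (simp add: field_simps)
    have sn: "summable (\<lambda>j. norm (?b j))"
      by (rule summable_comparison_test[OF _ sums_summable[OF s]]) (use b in auto)
    have "norm (mexp A) \<le> (\<Sum>j. norm (?b j))"
      unfolding mexp_def by (rule summable_norm[OF sn])
    also have "\<dots> \<le> norm (mat 1 :: 'n cmat) * exp (c * norm A)"
      using suminf_le[OF b sn sums_summable[OF s]] sums_unique[OF s] by simp
    finally show ?thesis .
  qed
  with c(1) show ?thesis by auto
qed

section \<open>Flow invariance\<close>

text \<open>
  Nagumo's argument: a solution that starts in a closed set stays there if at each point of the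
  set the vector field is tangent to some curve in the set.
\<close>

lemma flow_invariance_nonneg:
  fixes f :: "real \<Rightarrow> 'a::euclidean_space"
  assumes M: "closed M" "f 0 \<in> M"
    and f: "\<And>y. 0 \<le> y \<Longrightarrow> y \<le> R \<Longrightarrow> (f has_vector_derivative f' y) (at y)"
    and tangent: "\<And>y m. 0 \<le> y \<Longrightarrow> y \<le> R \<Longrightarrow> m \<in> M \<Longrightarrow>
      \<exists>\<gamma> w. \<gamma> 0 = m \<and> (\<forall>\<epsilon>. \<gamma> \<epsilon> \<in> M) \<and> (\<gamma> has_vector_derivative w) (at 0) \<and>
        norm (f' y - w) \<le> c * norm (f y - m)"
    and y: "0 \<le> y" "y \<le> R"
  shows "f y \<in> M"
proof -
  define c' where "c' = max c 0"
  define \<delta> where "\<delta> = (\<lambda>y. infdist (f y) M)"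
  have c': "c' \<ge> 0" "c * norm v \<le> c' * norm v" for v :: 'a
    by (auto simp: c'_def intro: mult_right_mono)
  have "M \<noteq> {}" using M by auto
  have \<delta>0: "\<delta> y \<ge> 0" for y by (simp add: \<delta>_def infdist_nonneg)
  \<comment> \<open>Compare \<open>f\<close> with the admissible curve through a nearest point of
    \<open>M\<close>: the velocities differ by at most \<open>c'\<close> times the distance, and
    \<open>\<eta>\<close> absorbs both first-order remainders.\<close>
  have step: "\<exists>d>0. \<forall>\<epsilon>. 0 < \<epsilon> \<and> \<epsilon> < d \<longrightarrow> \<delta> (s + \<epsilon>) \<le> \<delta> s + \<epsilon> * (c' * \<delta> s) + \<eta> * \<epsilon>"
    if s: "0 \<le> s" "s \<le> R" and \<eta>: "\<eta> > 0" for s \<eta>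
  proof -
    obtain m where m: "m \<in> M" "\<delta> s = dist (f s) m"
      using infdist_attains_inf[OF M(1) \<open>M \<noteq> {}\<close>] \<delta>_def by metis
    obtain \<gamma> w where \<gamma>: "\<gamma> 0 = m" "\<And>\<epsilon>. \<gamma> \<epsilon> \<in> M" "(\<gamma> has_vector_derivative w) (at 0)"
      "norm (f' s - w) \<le> c * norm (f s - m)"
      using tangent[OF s m(1)] by auto
    obtain d1 where d1: "d1 > 0"
      "\<And>x. norm (x - s) < d1 \<Longrightarrow> norm (f x - f s - (x - s) *\<^sub>R f' s) \<le> \<eta> / 2 * norm (x - s)"
      using f[OF s] \<eta> unfolding has_vector_derivative_def has_derivative_at_alt
      by (meson half_gt_zero)
    obtain d2 where d2: "d2 > 0"
      "\<And>x. norm (x - 0) < d2 \<Longrightarrow> norm (\<gamma> x - \<gamma> 0 - (x - 0) *\<^sub>R w) \<le> \<eta> / 2 * norm (x - 0)"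
      using \<gamma>(3) \<eta> unfolding has_vector_derivative_def has_derivative_at_alt
      by (meson half_gt_zero)
    show ?thesis
    proof (intro exI[of _ "min d1 d2"] conjI allI impI)
      fix \<epsilon> assume \<epsilon>: "0 < \<epsilon> \<and> \<epsilon> < min d1 d2"
      define r1 where "r1 = f (s + \<epsilon>) - f s - \<epsilon> *\<^sub>R f' s"
      define r2 where "r2 = \<gamma> \<epsilon> - m - \<epsilon> *\<^sub>R w"
      have r: "norm r1 \<le> \<eta> / 2 * \<epsilon>" "norm r2 \<le> \<eta> / 2 * \<epsilon>"
        using d1(2)[of "s + \<epsilon>"] d2(2)[of \<epsilon>] \<epsilon> by (auto simp: r1_def r2_def \<gamma>(1))
      have "\<delta> (s + \<epsilon>) \<le> dist (f (s + \<epsilon>)) (\<gamma> \<epsilon>)"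
        unfolding \<delta>_def using \<gamma>(2) by (rule infdist_le)
      also have "f (s + \<epsilon>) - \<gamma> \<epsilon> = (f s - m) + \<epsilon> *\<^sub>R (f' s - w) + (r1 - r2)"
        by (simp add: r1_def r2_def scaleR_diff_right)
      then have "dist (f (s + \<epsilon>)) (\<gamma> \<epsilon>) = norm ((f s - m) + \<epsilon> *\<^sub>R (f' s - w) + (r1 - r2))"
        by (simp add: dist_norm)
      also have "\<dots> \<le> norm (f s - m) + \<epsilon> * norm (f' s - w) + (norm r1 + norm r2)"
        using \<epsilon> by (intro norm_add_rule_thm norm_triangle_ineq4 order_trans[OF norm_triangle_ineq]
            add_mono) auto
      also have "\<dots> \<le> \<delta> s + \<epsilon> * (c' * \<delta> s) + \<eta> * \<epsilon>"
      proof -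
        have "norm (f' s - w) \<le> c' * \<delta> s"
          using \<gamma>(4) c'(2)[of "f s - m"] m(2) by (simp add: dist_norm)
        then have "\<epsilon> * norm (f' s - w) \<le> \<epsilon> * (c' * \<delta> s)"
          using \<epsilon> by (intro mult_left_mono) auto
        then show ?thesis
          using r m(2) by (simp add: dist_norm)
      qed
      finally show "\<delta> (s + \<epsilon>) \<le> \<delta> s + \<epsilon> * (c' * \<delta> s) + \<eta> * \<epsilon>" .
    qed (use d1 d2 in auto)
  qed
  \<comment> \<open>A Gronwall barrier. The extra 1 in the exponent pays for the error
    \<open>\<eta> * \<epsilon>\<close>, since the barrier itself is at least
    \<open>\<eta>\<close>.\<close>
  have main: "\<delta> y \<le> \<eta> * exp ((c' + 1) * y)" if \<eta>: "\<eta> > 0" and y: "0 \<le> y" "y \<le> R" for \<eta> y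
  proof (rule ccontr)
    define g where "g = (\<lambda>y. \<eta> * exp ((c' + 1) * y))"
    define A where "A = {y. 0 \<le> y \<and> y \<le> R \<and> g y < \<delta> y}"
    assume "\<not> ?thesis"
    then have "y \<in> A" using y by (auto simp: A_def g_def)
    \<comment> \<open>The first time at which the barrier is about to be crossed; continuity from
      the left shows that it has not been crossed at \<open>s\<close> itself.\<close>
    define s where "s = Inf A"
    have bdd: "bdd_below A" by (auto simp: A_def bdd_below_def)
    have s: "0 \<le> s" "s \<le> y"
      using \<open>y \<in> A\<close> bdd by (auto simp: s_def A_def intro: cInf_lower cInf_greatest)
    have below: "\<delta> x \<le> g x" if "0 \<le> x" "x < s" for x
      using cInf_lower[OF _ bdd, of x] that s y by (force simp: A_def s_def)
    have "\<delta> s \<le> g s"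
    proof (cases "s = 0")
      case True
      then show ?thesis using M(2) \<eta> by (simp add: \<delta>_def g_def)
    next
      case False
      have "continuous (at s) f"
        using f[of s] s y has_vector_derivative_continuous by auto
      then have "((\<lambda>x. g x - \<delta> x) \<longlongrightarrow> g s - \<delta> s) (at_left s)"
        unfolding g_def \<delta>_def continuous_at
        by (intro tendsto_intros tendsto_infdist) (auto intro: tendsto_mono[OF at_le])
      moreover have "\<forall>\<^sub>F x in at_left s. 0 \<le> g x - \<delta> x"
        using eventually_at_left_real[of 0 s] False s below by (auto elim!: eventually_mono)
      ultimately have "0 \<le> g s - \<delta> s"
        by (rule tendsto_lowerbound) auto
      then show ?thesis by simp
    qed
    have gs: "\<eta> \<le> g s" using \<eta> s c' by (simp add: g_def)
    obtain d where d: "d > 0"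
      "\<And>\<epsilon>. 0 < \<epsilon> \<Longrightarrow> \<epsilon> < d \<Longrightarrow> \<delta> (s + \<epsilon>) \<le> \<delta> s + \<epsilon> * (c' * \<delta> s) + \<eta> * \<epsilon>"
      using step[OF s(1) _ \<eta>] s y by auto
    have "Inf A < s + d" using d by (simp add: s_def)
    then obtain x where x: "x \<in> A" "x < s + d"
      using cInf_lessD[of A "s + d"] \<open>y \<in> A\<close> by auto
    have "x \<noteq> s" using x(1) \<open>\<delta> s \<le> g s\<close> by (auto simp: A_def)
    moreover have "s \<le> x" using x(1) bdd by (simp add: s_def cInf_lower)
    ultimately have \<epsilon>: "0 < x - s" "x - s < d" using x(2) by auto
    have "\<delta> x \<le> \<delta> s + (x - s) * (c' * \<delta> s) + \<eta> * (x - s)"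
      using d(2)[OF \<epsilon>] by simp
    also have "\<dots> \<le> g s + (x - s) * (c' * g s) + g s * (x - s)"
      using \<open>\<delta> s \<le> g s\<close> gs \<epsilon> c' by (intro add_mono mult_left_mono mult_right_mono) auto
    also have "\<dots> = g s * (1 + (c' + 1) * (x - s))"
      by (simp add: algebra_simps)
    also have "\<dots> \<le> g s * exp ((c' + 1) * (x - s))"
      using gs \<eta> by (intro mult_left_mono exp_ge_add_one_self) auto
    also have "\<dots> = g x"
      by (simp add: g_def algebra_simps flip: exp_add)
    finally show False using x(1) by (auto simp: A_def)
  qed
  \<comment> \<open>Let \<open>\<eta>\<close> tend to 0.\<close>
  have "\<delta> y \<le> 0"
  proof (rule field_le_epsilon)
    fix e :: real assume "e > 0"
    then show "\<delta> y \<le> 0 + e"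
      using main[of "e / exp ((c' + 1) * y)" y] y by simp
  qed
  then have "infdist (f y) M = 0" using \<delta>0[of y] by (simp add: \<delta>_def)
  then show ?thesis
    using in_closed_iff_infdist_zero[OF M(1) \<open>M \<noteq> {}\<close>] by blast
qed

text \<open>Negative times follow by reversing both the solution and the admissible curves, which is
  why these curves are required on both sides of 0.\<close>

lemma flow_invariance:
  fixes f :: "real \<Rightarrow> 'a::euclidean_space"
  assumes M: "closed M" "f 0 \<in> M"
    and f: "\<And>y. (f has_vector_derivative f' y) (at y)"
    and tangent: "\<And>R. \<exists>c. \<forall>y m. \<bar>y\<bar> \<le> R \<longrightarrow> m \<in> M \<longrightarrow>
      (\<exists>\<gamma> w. \<gamma> 0 = m \<and> (\<forall>\<epsilon>. \<gamma> \<epsilon> \<in> M) \<and> (\<gamma> has_vector_derivative w) (at 0) \<and>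
        norm (f' y - w) \<le> c * norm (f y - m))"
  shows "f y \<in> M"
proof -
  obtain c where c: "\<And>x m. \<bar>x\<bar> \<le> \<bar>y\<bar> \<Longrightarrow> m \<in> M \<Longrightarrow>
      \<exists>\<gamma> w. \<gamma> 0 = m \<and> (\<forall>\<epsilon>. \<gamma> \<epsilon> \<in> M) \<and> (\<gamma> has_vector_derivative w) (at 0) \<and>
        norm (f' x - w) \<le> c * norm (f x - m)"
    using tangent[of "\<bar>y\<bar>"] by blast
  show ?thesis
  proof (cases "0 \<le> y")
    case True
    show ?thesis
      by (rule flow_invariance_nonneg[OF M f c, of y y]) (use True in auto)
  next
    case False
    have "f (- (- y)) \<in> M"
    proof (rule flow_invariance_nonneg[OF M(1), where f = "\<lambda>x. f (- x)" and f' = "\<lambda>x. - f' (- x)"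
            and R = "- y" and c = c])
      show "((\<lambda>x. f (- x)) has_vector_derivative - f' (- x)) (at x)" for x
        by (rule has_vector_derivative_compose_neg) (rule f)
      fix x m assume x: "0 \<le> x" "x \<le> - y" and m: "m \<in> M"
      obtain \<gamma> w where \<gamma>: "\<gamma> 0 = m" "\<And>\<epsilon>. \<gamma> \<epsilon> \<in> M" "(\<gamma> has_vector_derivative w) (at 0)"
        "norm (f' (- x) - w) \<le> c * norm (f (- x) - m)"
        using c[of "- x" m] x m by auto
      have "norm (- f' (- x) - - w) = norm (f' (- x) - w)"
        using norm_minus_cancel[of "f' (- x) - w"] by simp
      moreover have "((\<lambda>\<epsilon>. \<gamma> (- \<epsilon>)) has_vector_derivative - w) (at 0)"
        by (rule has_vector_derivative_compose_neg) (simp add: \<gamma>(3))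
      ultimately show "\<exists>\<gamma> w. \<gamma> 0 = m \<and> (\<forall>\<epsilon>. \<gamma> \<epsilon> \<in> M) \<and> (\<gamma> has_vector_derivative w) (at 0) \<and>
        norm (- f' (- x) - w) \<le> c * norm (f (- x) - m)"
        using \<gamma> by (intro exI[of _ "\<lambda>\<epsilon>. \<gamma> (- \<epsilon>)"] exI[of _ "- w"]) auto
    qed (use M False in auto)
    then show ?thesis by simp
  qed
qed

text \<open>A linear field is Lipschitz on bounded time intervals, so it is enough that its value at
  each point of \<open>M\<close> is the velocity of a curve in \<open>M\<close>.\<close>

lemma flow_invariance_linear:
  fixes f :: "real \<Rightarrow> 'a::euclidean_space"
  assumes "closed M" "f 0 \<in> M"
    and "\<And>y. (f has_vector_derivative L y (f y)) (at y)"
    and linear: "\<And>y. linear (L y)"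
    and bounded: "\<And>R. \<exists>c. \<forall>y v. \<bar>y\<bar> \<le> R \<longrightarrow> norm (L y v) \<le> c * norm v"
    and tangent: "\<And>y m. m \<in> M \<Longrightarrow>
      \<exists>\<gamma>. \<gamma> 0 = m \<and> (\<forall>\<epsilon>. \<gamma> \<epsilon> \<in> M) \<and> (\<gamma> has_vector_derivative L y m) (at 0)"
  shows "f y \<in> M"
proof (rule flow_invariance[OF assms(1-3)])
  fix R
  obtain c where c: "\<And>y v. \<bar>y\<bar> \<le> R \<Longrightarrow> norm (L y v) \<le> c * norm v"
    using bounded by blast
  have "norm (L y (f y) - L y m) \<le> c * norm (f y - m)" if "\<bar>y\<bar> \<le> R" for y m
    using c[OF that, of "f y - m"] by (simp add: linear_diff[OF linear])
  then show "\<exists>c. \<forall>y m. \<bar>y\<bar> \<le> R \<longrightarrow> m \<in> M \<longrightarrow>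
      (\<exists>\<gamma> w. \<gamma> 0 = m \<and> (\<forall>\<epsilon>. \<gamma> \<epsilon> \<in> M) \<and> (\<gamma> has_vector_derivative w) (at 0) \<and>
        norm (L y (f y) - w) \<le> c * norm (f y - m))"
    using tangent by metis
qed

lemma continuous_locally_bounded:
  fixes C :: "real \<Rightarrow> 'a::real_normed_vector"
  assumes "continuous_on UNIV C"
  obtains c where "c \<ge> 0" "\<And>y. \<bar>y\<bar> \<le> R \<Longrightarrow> norm (C y) \<le> c"
proof -
  have "compact (C ` {- R..R})"
    using assms by (intro compact_continuous_image) (auto intro: continuous_on_subset)
  then obtain c where c: "\<forall>x\<in>C ` {- R..R}. norm x \<le> c"
    using compact_imp_bounded bounded_iff by metis
  show thesis
    by (rule that[of "max c 0"]) (use c in \<open>auto simp: abs_le_iff le_max_iff_disj\<close>)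
qed

lemma mult_left_locally_bounded:
  fixes C :: "real \<Rightarrow> 'n::finite cmat"
  assumes "continuous_on UNIV C"
  shows "\<exists>c. \<forall>y v. \<bar>y\<bar> \<le> R \<longrightarrow> norm (C y ** v) \<le> c * norm v"
    and "\<exists>c. \<forall>y v. \<bar>y\<bar> \<le> R \<longrightarrow> norm (v ** C y) \<le> c * norm v"
proof -
  obtain c where c: "c \<ge> 0" "\<And>y. \<bar>y\<bar> \<le> R \<Longrightarrow> norm (C y) \<le> c"
    using continuous_locally_bounded[OF assms] by metis
  obtain K where K: "K > 0" "\<And>(A :: 'n cmat) (B :: 'n cmat). norm (A ** B) \<le> norm A * norm B * K"
    using mm.pos_bounded[where ?'n = 'n] by auto
  have "norm (C y ** v) \<le> (c * K) * norm v \<and> norm (v ** C y) \<le> (c * K) * norm v"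
    if "\<bar>y\<bar> \<le> R" for y v
  proof -
    have "norm (C y) * norm v * K \<le> c * norm v * K"
      using c(2)[OF that] K by (intro mult_right_mono) auto
    then show ?thesis
      using K(2)[of "C y" v] K(2)[of v "C y"] by (simp add: mult_ac)
  qed
  then show "\<exists>c. \<forall>y v. \<bar>y\<bar> \<le> R \<longrightarrow> norm (C y ** v) \<le> c * norm v"
    and "\<exists>c. \<forall>y v. \<bar>y\<bar> \<le> R \<longrightarrow> norm (v ** C y) \<le> c * norm v"
    by blast+
qed

lemma has_vector_derivative_quotient:
  assumes "(\<gamma> has_vector_derivative v) (at x)"
  shows "((\<lambda>h. (\<gamma> (x + h) - \<gamma> x) /\<^sub>R h) \<longlongrightarrow> v) (at 0)"
proof (subst Lim_null, subst tendsto_norm_zero_iff[symmetric], rule Lim_transform_eventually)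
  show "((\<lambda>h. norm (\<gamma> (x + h) - \<gamma> x - h *\<^sub>R v) / \<bar>h\<bar>) \<longlongrightarrow> 0) (at 0)"
    using assms by (simp add: has_vector_derivative_def has_derivative_at)
  show "\<forall>\<^sub>F h in at 0. norm (\<gamma> (x + h) - \<gamma> x - h *\<^sub>R v) / \<bar>h\<bar> =
      norm ((\<gamma> (x + h) - \<gamma> x) /\<^sub>R h - v)"
  proof (rule eventually_at_filter[THEN iffD2], rule always_eventually, intro allI impI)
    fix h :: real assume "h \<noteq> 0"
    then have "(\<gamma> (x + h) - \<gamma> x) /\<^sub>R h - v = (\<gamma> (x + h) - \<gamma> x - h *\<^sub>R v) /\<^sub>R h"
      by (simp add: scaleR_diff_right)
    then show "norm (\<gamma> (x + h) - \<gamma> x - h *\<^sub>R v) / \<bar>h\<bar> = norm ((\<gamma> (x + h) - \<gamma> x) /\<^sub>R h - v)"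
      by (simp add: divide_inverse_commute)
  qed
qed

lemma derivative_in_subspace:
  fixes \<gamma> :: "real \<Rightarrow> 'a::euclidean_space"
  assumes "subspace S" "\<And>t. \<gamma> t \<in> S" "(\<gamma> has_vector_derivative v) (at x)"
  shows "v \<in> S"
proof -
  show ?thesis
    using has_vector_derivative_quotient[OF assms(3)] assms(1,2) closed_subspace[OF assms(1)]
    by (rule_tac Lim_in_closed_set[of S "\<lambda>h. (\<gamma> (x + h) - \<gamma> x) /\<^sub>R h" "at 0"])
       (auto intro!: subspace_scale subspace_diff eventuallyI)
qed

lemma antiderivative_in_subspace:
  fixes F :: "real \<Rightarrow> 'a::euclidean_space"
  assumes S: "subspace S" and "F 0 \<in> S" "\<And>y. (F has_vector_derivative f y) (at y)" "\<And>y. f y \<in> S"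
  shows "F y \<in> S"
proof (rule flow_invariance[OF closed_subspace[OF S] assms(2,3)])
  have *: "((\<lambda>\<epsilon>. m + \<epsilon> *\<^sub>R f y) has_vector_derivative f y) (at 0)" for m y
    by (auto intro!: derivative_eq_intros)
  show "\<exists>c. \<forall>y m. \<bar>y\<bar> \<le> R \<longrightarrow> m \<in> S \<longrightarrow>
      (\<exists>\<gamma> w. \<gamma> 0 = m \<and> (\<forall>\<epsilon>. \<gamma> \<epsilon> \<in> S) \<and> (\<gamma> has_vector_derivative w) (at 0) \<and>
        norm (f y - w) \<le> c * norm (F y - m))" for R
  \<comment> \<open>The field depends on time only, so the straight line through \<open>m\<close>
    has exactly the right velocity and the Lipschitz constant is 0.\<close>
  proof (intro exI[of _ 0] allI impI)
    fix y m assume "m \<in> S"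
    then show "\<exists>\<gamma> w. \<gamma> 0 = m \<and> (\<forall>\<epsilon>. \<gamma> \<epsilon> \<in> S) \<and> (\<gamma> has_vector_derivative w) (at 0) \<and>
        norm (f y - w) \<le> 0 * norm (F y - m)"
      using assms(4)
      by (intro exI[of _ "\<lambda>\<epsilon>. m + \<epsilon> *\<^sub>R f y"] exI[of _ "f y"])
         (auto intro: subspace_add[OF S] subspace_scale[OF S] *)
  qed
qed

section \<open>Compact matrix groups\<close>

lemma matrix_inv_unique:
  assumes "A ** B = mat 1"
  shows "matrix_inv A = B"
proof -
  have "B ** A = mat 1"
    using assms by (simp add: matrix_left_right_inverse[of B A])
  then have "\<exists>A'. A ** A' = mat 1 \<and> A' ** A = mat 1"
    using assms by blast
  from someI_ex[OF this] have "matrix_inv A ** A = mat 1"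
    by (simp add: matrix_inv_def)
  then show ?thesis
    by (metis assms matrix_mul_assoc matrix_mul_lid matrix_mul_rid)
qed

lemma invertible_matrix_inv:
  assumes "invertible A"
  shows "A ** matrix_inv A = mat 1" "matrix_inv A ** A = mat 1"
proof -
  obtain B where "A ** B = mat 1" "B ** A = mat 1"
    using assms by (auto simp: invertible_def)
  then show "A ** matrix_inv A = mat 1" "matrix_inv A ** A = mat 1"
    using matrix_inv_unique by auto
qed

locale compact_matrix_group =
  fixes G :: "'n::finite cmat set"
  assumes compact: "compact G"
    and one_mem [simp]: "mat 1 \<in> G"
    and mult_mem: "g \<in> G \<Longrightarrow> h \<in> G \<Longrightarrow> g ** h \<in> G"
    and invertible: "g \<in> G \<Longrightarrow> invertible g"
    and inv_mem: "g \<in> G \<Longrightarrow> matrix_inv g \<in> G"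
begin

lemma inv_right [simp]: "g \<in> G \<Longrightarrow> g ** matrix_inv g = mat 1"
  and inv_left [simp]: "g \<in> G \<Longrightarrow> matrix_inv g ** g = mat 1"
  using invertible invertible_matrix_inv by auto

lemma inv_cancel [simp]:
  "g \<in> G \<Longrightarrow> X ** g ** matrix_inv g = X" "g \<in> G \<Longrightarrow> X ** matrix_inv g ** g = X"
  by (simp_all flip: matrix_mul_assoc)

lemma lie_algebraD: "X \<in> lie_algebra G \<Longrightarrow> mexp (t *\<^sub>R X) \<in> G"
  and mexp_mem: "X \<in> lie_algebra G \<Longrightarrow> mexp X \<in> G"
  unfolding lie_algebra_def using scaleR_one[of X] by (auto, metis)

text \<open>The left translates \<open>m ** \<gamma> \<epsilon>\<close> have the velocities of the
  field \<open>v ** X\<close> at all points of \<open>G\<close>, so the flow line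
  \<open>mexp (t X)\<close> stays in \<open>G\<close>. A single derivative at 0 suffices; this
  replaces the product formula of Trotter and the closed subgroup theorem.\<close>

lemma tangent_in_lie_algebra:
  assumes "\<gamma> 0 = mat 1" "\<And>\<epsilon>. \<gamma> \<epsilon> \<in> G" "(\<gamma> has_vector_derivative X) (at 0)"
  shows "X \<in> lie_algebra G"
  unfolding lie_algebra_def
proof (intro CollectI allI)
  fix t
  show "mexp (t *\<^sub>R X) \<in> G"
  proof (rule flow_invariance_linear[where L = "\<lambda>_ v. v ** X"])
    show "\<exists>\<gamma>. \<gamma> 0 = m \<and> (\<forall>\<epsilon>. \<gamma> \<epsilon> \<in> G) \<and> (\<gamma> has_vector_derivative m ** X) (at 0)"
      if m: "m \<in> G" for m
      by (rule exI[of _ "\<lambda>\<epsilon>. m ** \<gamma> \<epsilon>"])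
         (use assms m in \<open>auto intro!: mult_mem derivative_eq_intros\<close>)
    show "\<exists>c. \<forall>y v. \<bar>y::real\<bar> \<le> R \<longrightarrow> norm (v ** X) \<le> c * norm v" for R
      using mult_left_locally_bounded(2)[of "\<lambda>_. X" R] by simp
  qed (auto intro: linear_mult_right compact_imp_closed compact mexp_has_vector_derivative')
qed

lemma lie_algebra_0: "0 \<in> lie_algebra G"
  by (simp add: lie_algebra_def)

lemma lie_algebra_scaleR: "X \<in> lie_algebra G \<Longrightarrow> r *\<^sub>R X \<in> lie_algebra G"
  by (simp add: lie_algebra_def)

lemma lie_algebra_add:
  assumes "X \<in> lie_algebra G" "Y \<in> lie_algebra G"
  shows "X + Y \<in> lie_algebra G"
proof (rule tangent_in_lie_algebra[of "\<lambda>\<epsilon>. mexp (\<epsilon> *\<^sub>R X) ** mexp (\<epsilon> *\<^sub>R Y)"])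
  show "((\<lambda>\<epsilon>. mexp (\<epsilon> *\<^sub>R X) ** mexp (\<epsilon> *\<^sub>R Y)) has_vector_derivative X + Y) (at 0)"
    by (rule has_vector_derivative_rhs, rule has_vector_derivative_mult,
        rule mexp_has_vector_derivative, rule mexp_has_vector_derivative) simp
qed (use assms in \<open>auto intro: mult_mem lie_algebraD\<close>)

lemma subspace_lie_algebra: "subspace (lie_algebra G)"
  by (simp add: subspace_def lie_algebra_0 lie_algebra_add lie_algebra_scaleR)

lemma lie_algebra_Ad:
  assumes "g \<in> G" "X \<in> lie_algebra G"
  shows "g ** X ** matrix_inv g \<in> lie_algebra G"
proof -
  have "mexp (t *\<^sub>R (g ** X ** matrix_inv g)) = g ** mexp (t *\<^sub>R X) ** matrix_inv g" for t
    using mexp_conj[of "matrix_inv g" g "t *\<^sub>R X"] assms by simp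
  then show ?thesis
    using assms by (auto simp: lie_algebra_def intro!: mult_mem inv_mem)
qed

lemma lie_algebra_Ad':
  assumes "g \<in> G" "X \<in> lie_algebra G"
  shows "matrix_inv g ** X ** g \<in> lie_algebra G"
proof -
  have "matrix_inv (matrix_inv g) = g"
    by (metis assms(1) inv_left inv_right matrix_inv_unique)
  then show ?thesis
    using lie_algebra_Ad[OF inv_mem assms(2), OF assms(1)] by simp
qed

lemma mexp_neg_inv: "X \<in> lie_algebra G \<Longrightarrow> matrix_inv (mexp X) = mexp (- X)"
  by (metis matrix_inv_unique mexp_minus_left mexp_minus_right)

lemma Ad_deriv:
  "((\<lambda>t. mexp (t *\<^sub>R X) ** Y ** mexp (- (t *\<^sub>R X))) has_vector_derivative bracket X Y) (at 0)"
  by (rule has_vector_derivative_rhs, rule has_vector_derivative_mult,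
      rule has_vector_derivative_mult, rule mexp_has_vector_derivative,
      rule has_vector_derivative_const, rule mexp_has_vector_derivative_neg)
     (simp add: bracket_def)

text \<open>The bracket is the velocity of a curve in the Lie algebra, which as a linear subspace is
  closed.\<close>

lemma lie_algebra_bracket:
  assumes X: "X \<in> lie_algebra G" and Y: "Y \<in> lie_algebra G"
  shows "bracket X Y \<in> lie_algebra G"
proof (rule derivative_in_subspace[OF subspace_lie_algebra])
  show "mexp (t *\<^sub>R X) ** Y ** mexp (- (t *\<^sub>R X)) \<in> lie_algebra G" for t
    using lie_algebra_Ad[OF lie_algebraD[OF X] Y, of t] mexp_neg_inv lie_algebra_scaleR[OF X]
    by simp
qed (rule Ad_deriv)

end

section \<open>An inner product invariant under both translations\<close>

definition adj :: "'n::finite cmat \<Rightarrow> 'n cmat"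
  where "adj A = (\<chi> i j. cnj (A $ j $ i))"

lemma adj_nth [simp]: "adj A $ i $ j = cnj (A $ j $ i)"
  by (simp add: adj_def)

lemma adj_adj [simp]: "adj (adj A) = A"
  by (simp add: vec_eq_iff)

lemma adj_mat_1 [simp]: "adj (mat 1) = mat 1"
  by (simp add: vec_eq_iff mat_def)

lemma adj_mult: "adj (A ** B) = adj B ** adj A"
  by (simp add: vec_eq_iff matrix_matrix_mult_def mult.commute)

lemma linear_adj: "linear adj"
  by (rule linearI) (simp_all add: vec_eq_iff)

text \<open>The Euclidean inner product of complex matrices is the real part of the Hermitian trace
  form, for which multiplication by \<open>A\<close> and by \<open>adj A\<close> are
  adjoint.\<close>

lemma inner_mult_left: "inner (A ** Y) Z = inner Y (adj A ** Z)"
proof -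
  have "inner (A ** Y) Z = (\<Sum>i\<in>UNIV. \<Sum>j\<in>UNIV. \<Sum>l\<in>UNIV. inner (A $ i $ l * Y $ l $ j) (Z $ i $ j))"
    by (simp add: inner_vec_def matrix_matrix_mult_def inner_sum_left)
  also have "\<dots> = (\<Sum>i\<in>UNIV. \<Sum>l\<in>UNIV. \<Sum>j\<in>UNIV. inner (A $ i $ l * Y $ l $ j) (Z $ i $ j))"
    by (intro sum.cong refl sum.swap)
  also have "\<dots> = (\<Sum>l\<in>UNIV. \<Sum>i\<in>UNIV. \<Sum>j\<in>UNIV. inner (A $ i $ l * Y $ l $ j) (Z $ i $ j))"
    by (rule sum.swap)
  also have "\<dots> = (\<Sum>l\<in>UNIV. \<Sum>j\<in>UNIV. \<Sum>i\<in>UNIV. inner (A $ i $ l * Y $ l $ j) (Z $ i $ j))"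
    by (intro sum.cong refl sum.swap)
  also have "\<dots> = inner Y (adj A ** Z)"
    by (simp add: inner_vec_def matrix_matrix_mult_def inner_sum_right)
       (intro sum.cong refl, simp add: inner_complex_def algebra_simps)
  finally show ?thesis .
qed

lemma inner_adj: "inner (adj A) (adj B) = inner A B"
  by (simp add: inner_vec_def inner_complex_def) (rule sum.swap)

lemma inner_mult_right: "inner (Y ** A) Z = inner Y (Z ** adj A)"
proof -
  have "inner (Y ** A) Z = inner (adj A ** adj Y) (adj Z)"
    by (simp add: adj_mult[symmetric] inner_adj)
  also have "\<dots> = inner (adj Y) (A ** adj Z)"
    by (simp add: inner_mult_left)
  also have "\<dots> = inner Y (Z ** adj A)"
    using inner_adj[of Y "Z ** adj A"] by (simp add: adj_mult)
  finally show ?thesis .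
qed

lemma inner_cscale_i: "inner (\<i> *\<^sub>C Y) (\<i> *\<^sub>C Z) = inner Y Z"
  by (simp add: inner_vec_def inner_complex_def add.commute)

lemma invertible_adj: "invertible A \<Longrightarrow> invertible (adj A)"
  unfolding invertible_def by (metis adj_mult adj_mat_1)

lemma matrix_inv_adj:
  assumes "invertible A"
  shows "matrix_inv (adj A) = adj (matrix_inv A)"
proof (rule matrix_inv_unique)
  show "adj A ** adj (matrix_inv A) = mat 1"
    by (simp add: invertible_matrix_inv[OF assms] flip: adj_mult)
qed

context compact_matrix_group
begin

text \<open>With the adjoint group in place of \<open>G\<close>, the next lemma also provides the
  matrix that makes the form invariant under right translations.\<close>

lemma compact_matrix_group_adj: "compact_matrix_group (adj ` G)"
proof
  show "compact (adj ` G)"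
    by (rule compact_continuous_image)
       (auto intro: compact linear_continuous_on linear_conv_bounded_linear[THEN iffD1] linear_adj)
  show "mat 1 \<in> adj ` G"
    using one_mem adj_mat_1 by (metis imageI)
qed (auto simp: mult_mem inv_mem invertible invertible_adj matrix_inv_adj simp flip: adj_mult)

text \<open>
  The invariant form is the unique point of the convex hull that minimises the strictly convex,
  invariant function \<open>P \<mapsto> max\<^bsub>h\<in>G\<^esub> \<parallel>h\<^sup>* P h\<parallel>\<close>.
\<close>

lemma ex_invariant_hermitian:
  "\<exists>P \<in> convex hull ((\<lambda>g. adj g ** g) ` G). \<forall>h\<in>G. adj h ** P ** h = P"
proof -
  define C where "C = convex hull ((\<lambda>g. adj g ** g) ` G)"
  define act where "act = (\<lambda>h P :: 'n cmat. adj h ** P ** h)"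
  have act_act: "act g (act h P) = act (h ** g) P" for g h P
    by (simp add: act_def adj_mult matrix_mul_assoc)
  have lin: "linear (act h)" for h
    by (rule linearI) (simp_all add: act_def mat_distribs)
  have act_cont: "continuous_on G (\<lambda>h. act h P)" for P
    unfolding act_def
    by (intro mm.continuous_on continuous_intros linear_continuous_on
        linear_conv_bounded_linear[THEN iffD1] linear_adj)
  have "compact C"
    unfolding C_def
    by (intro compact_convex_hull compact_continuous_image compact mm.continuous_on
        continuous_intros linear_continuous_on linear_conv_bounded_linear[THEN iffD1] linear_adj)
  have "convex C" by (simp add: C_def)
  have "mat 1 \<in> (\<lambda>g. adj g ** g) ` G" by (rule image_eqI[of _ _ "mat 1"]) auto
  then have "C \<noteq> {}" by (auto simp: C_def)
  have act_C: "act h P \<in> C" if "h \<in> G" "P \<in> C" for h P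
  proof -
    have "act h ` C = convex hull (act h ` (\<lambda>g. adj g ** g) ` G)"
      unfolding C_def by (rule convex_hull_linear_image[OF lin])
    also have "\<dots> \<subseteq> C"
      unfolding C_def
      by (rule hull_mono) (auto simp: act_def adj_mult matrix_mul_assoc that(1) mult_mem
          intro!: image_eqI[of _ _ "_ ** h"])
    finally show ?thesis using that by auto
  qed
  have ex_max: "\<exists>g\<in>G. \<forall>h\<in>G. norm (act h P) \<le> norm (act g P)" for P
  proof (rule continuous_attains_sup[OF compact])
    show "G \<noteq> {}" using one_mem by blast
  qed (intro continuous_on_norm act_cont)
  \<comment> \<open>Taking the largest norm along the orbit makes the function invariant under the
    group.\<close>
  define N where "N = (\<lambda>P. SUP h\<in>G. norm (act h P))"
  have N: "\<exists>g\<in>G. N P = norm (act g P)" "\<And>h. h \<in> G \<Longrightarrow> norm (act h P) \<le> N P" for P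
  proof -
    obtain g where g: "g \<in> G" "\<And>h. h \<in> G \<Longrightarrow> norm (act h P) \<le> norm (act g P)"
      using ex_max by blast
    then have "N P = norm (act g P)"
      unfolding N_def by (intro cSup_eq_maximum) auto
    with g show "\<exists>g\<in>G. N P = norm (act g P)" "\<And>h. h \<in> G \<Longrightarrow> norm (act h P) \<le> N P"
      by auto
  qed
  obtain c where c: "c \<ge> 0" "\<And>h P. h \<in> G \<Longrightarrow> norm (act h P) \<le> c * norm P"
  proof -
    obtain K where K: "K > 0" "\<And>(A :: 'n cmat) (B :: 'n cmat). norm (A ** B) \<le> norm A * norm B * K"
      using mm.pos_bounded[where ?'n = 'n] by auto
    obtain r where r: "r \<ge> 0" "\<And>h. h \<in> G \<Longrightarrow> norm h \<le> r"
      using compact_imp_bounded[OF compact] bounded_pos[of G] less_imp_le by metis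
    obtain r' where r': "r' \<ge> 0" "\<And>h. h \<in> adj ` G \<Longrightarrow> norm h \<le> r'"
      using compact_imp_bounded[OF compact_matrix_group.compact[OF compact_matrix_group_adj]]
        bounded_pos[of "adj ` G"] less_imp_le by metis
    show thesis
    proof (rule that[of "r' * K * r * K"])
      show "norm (act h P) \<le> (r' * K * r * K) * norm P" if h: "h \<in> G" for h P
      proof -
        have "norm (act h P) \<le> norm (adj h ** P) * norm h * K"
          unfolding act_def by (rule K)
        also have "\<dots> \<le> (norm (adj h) * norm P * K) * norm h * K"
          using K by (intro mult_right_mono) auto
        also have "\<dots> \<le> (r' * norm P * K) * r * K"
          using K r r' h by (intro mult_right_mono mult_mono) auto
        finally show ?thesis by (simp add: mult_ac)
      qed
    qed (use K r r' in auto)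
  qed
  \<comment> \<open>Continuity of \<open>N\<close>, so that it attains its minimum on the compact
    hull.\<close>
  have N_lip: "N P \<le> N Q + c * norm (P - Q)" for P Q
  proof -
    obtain g where g: "g \<in> G" "N P = norm (act g P)" using N(1) by blast
    have "act g P = act g Q + act g (P - Q)" by (simp add: linear_diff[OF lin])
    then have "norm (act g P) \<le> norm (act g Q) + norm (act g (P - Q))"
      by (metis norm_triangle_ineq)
    also have "\<dots> \<le> N Q + c * norm (P - Q)" using N(2) c g by (intro add_mono) auto
    finally show ?thesis using g by simp
  qed
  have "dist (N P) (N Q) \<le> c * dist P Q" for P Q
    using N_lip[of P Q] N_lip[of Q P] by (simp add: dist_norm norm_minus_commute abs_le_iff)
  then have "c-lipschitz_on C N"
    using c(1) by (auto simp: lipschitz_on_def)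
  then have "continuous_on C N" by (rule lipschitz_on_continuous_on)
  then obtain P where P: "P \<in> C" "\<And>Q. Q \<in> C \<Longrightarrow> N P \<le> N Q"
    using continuous_attains_inf[OF \<open>compact C\<close> \<open>C \<noteq> {}\<close>] by blast
  have "act h P = P" if h: "h \<in> G" for h
  proof (rule ccontr)
    assume neq: "act h P \<noteq> P"
    define R where "R = (1/2) *\<^sub>R (P + act h P)"
    have "(1/2) *\<^sub>R P + (1/2) *\<^sub>R act h P \<in> C"
      by (rule convexD[OF \<open>convex C\<close>]) (use P act_C h in auto)
    then have "R \<in> C" by (simp add: R_def scaleR_add_right)
    obtain g where g: "g \<in> G" "N R = norm (act g R)" using N(1) by blast
    define a b where "a = act g P" and "b = act g (act h P)"
    have "norm a \<le> N P" "norm b \<le> N P"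
      using N(2) g h by (auto simp: a_def b_def act_act mult_mem)
    moreover have "a \<noteq> b"
    proof
      assume "a = b"
      then have "act (matrix_inv g) a = act (matrix_inv g) b" by simp
      then have "act (g ** matrix_inv g) P = act (g ** matrix_inv g) (act h P)"
        by (simp add: a_def b_def act_act[of "matrix_inv g" g])
      then show False using neq g by (simp add: act_def)
    qed
    \<comment> \<open>Strict convexity in quantitative form: \<open>a\<close> and \<open>b\<close>
      differ and have norm at most \<open>N P\<close>, so half their sum is strictly
      shorter.\<close>
    moreover have "norm (a + b) ^ 2 + norm (a - b) ^ 2 = 2 * norm a ^ 2 + 2 * norm b ^ 2"
      by (simp add: power2_norm_eq_inner inner_add inner_diff inner_commute)
    moreover from \<open>a \<noteq> b\<close> have "norm (a - b) ^ 2 > 0" by simp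
    moreover have "norm a ^ 2 \<le> N P ^ 2" "norm b ^ 2 \<le> N P ^ 2"
      using calculation(1,2) by (simp_all add: power_mono)
    ultimately have "norm (a + b) ^ 2 < 4 * N P ^ 2"
      by linarith
    then have "norm (a + b) ^ 2 < (2 * N P) ^ 2" by (simp add: power_mult_distrib)
    moreover have "0 \<le> 2 * N P" using \<open>norm a \<le> N P\<close> norm_ge_zero[of a] by linarith
    ultimately have "norm (a + b) < 2 * N P" by (rule power_less_imp_less_base)
    moreover have "act g R = (1/2) *\<^sub>R (a + b)"
      by (simp add: R_def a_def b_def linear_add[OF lin] linear_cmul[OF lin])
    ultimately have "N R < N P" using g by simp
    then show False using P(2)[OF \<open>R \<in> C\<close>] by simp
  qed
  then show ?thesis using P(1) by (auto simp: C_def act_def)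
qed

text \<open>The real part of a Hermitian inner product invariant under both translations. It lives
  on all matrices and not just on the Lie algebra, because group elements and values of loops are to
  be measured with it.\<close>

definition is_form :: "('n cmat \<Rightarrow> 'n cmat \<Rightarrow> real) \<Rightarrow> bool"
  where "is_form \<beta> \<longleftrightarrow> bounded_bilinear \<beta> \<and> (\<forall>Y Z. \<beta> Y Z = \<beta> Z Y) \<and> (\<forall>Y. Y \<noteq> 0 \<longrightarrow> \<beta> Y Y > 0) \<and>
    (\<forall>g\<in>G. \<forall>h\<in>G. \<forall>Y Z. \<beta> (g ** Y ** h) (g ** Z ** h) = \<beta> Y Z) \<and>
    (\<forall>Y Z. \<beta> (\<i> *\<^sub>C Y) (\<i> *\<^sub>C Z) = \<beta> Y Z)"

text \<open>The form is \<open>inner Y (P ** Z ** Q)\<close>, where \<open>P\<close> absorbs left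
  translations and \<open>Q\<close> right translations.\<close>

lemma ex_form: "\<exists>\<beta>. is_form \<beta>"
proof -
  obtain P where P: "P \<in> convex hull ((\<lambda>g. adj g ** g) ` G)" "\<And>h. h \<in> G \<Longrightarrow> adj h ** P ** h = P"
    using ex_invariant_hermitian by blast
  obtain Q where Q: "Q \<in> convex hull ((\<lambda>g. g ** adj g) ` G)" "\<And>h. h \<in> G \<Longrightarrow> h ** Q ** adj h = Q"
    using compact_matrix_group.ex_invariant_hermitian[OF compact_matrix_group_adj]
    by (auto simp: image_image)
  have hermitian: "adj S = S" if "S \<in> convex hull (f ` G)" "\<And>g. adj (f g) = f g"
    for S and f :: "'n cmat \<Rightarrow> 'n cmat"
  proof -
    have "convex {S. adj S = S}"
      by (auto simp: convex_def linear_add[OF linear_adj] linear_cmul[OF linear_adj])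
    then have "convex hull (f ` G) \<subseteq> {S. adj S = S}"
      by (rule hull_minimal[rotated]) (use that in auto)
    then show ?thesis using that by auto
  qed
  have adjP: "adj P = P" and adjQ: "adj Q = Q"
    by (rule hermitian[OF P(1)], simp add: adj_mult, rule hermitian[OF Q(1)], simp add: adj_mult)
  define \<beta> where "\<beta> = (\<lambda>Y Z. inner Y (P ** Z ** Q))"
  have pos: "\<beta> Y Y > 0" if "Y \<noteq> 0" for Y
  proof -
    \<comment> \<open>Positivity is a half-space condition on \<open>P\<close> and on
      \<open>Q\<close> separately, so it passes from the generators to one convex hull after the
      other.\<close>
    have 1: "inner Y ((adj g ** g) ** Y ** (h ** adj h)) > 0" if gh: "g \<in> G" "h \<in> G" for g h
    proof -
      have "inner Y ((adj g ** g) ** Y ** (h ** adj h)) = inner (g ** Y ** h) (g ** Y ** h)"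
        by (simp only: inner_mult_right[of "g ** Y" h] inner_mult_left[of g Y] matrix_mul_assoc)
      moreover have "matrix_inv g ** (g ** Y ** h) ** matrix_inv h = Y"
        using gh by (simp add: matrix_mul_assoc)
      then have "g ** Y ** h \<noteq> 0" using \<open>Y \<noteq> 0\<close> by auto
      ultimately show ?thesis by simp
    qed
    have 2: "inner Y (P ** Y ** (h ** adj h)) > 0" if h: "h \<in> G" for h
    proof -
      have "convex {P. inner Y (P ** Y ** (h ** adj h)) > 0}"
      proof -
        have "linear (\<lambda>P. inner Y (P ** Y ** (h ** adj h)))"
          by (rule linearI) (simp_all add: mat_distribs inner_add_right)
        from convex_linear_vimage[OF this, of "{0<..}"] show ?thesis
          by (simp add: vimage_def)
      qed
      then have "convex hull ((\<lambda>g. adj g ** g) ` G) \<subseteq> {P. inner Y (P ** Y ** (h ** adj h)) > 0}"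
        by (rule hull_minimal[rotated]) (use 1 h in auto)
      then show ?thesis using P by auto
    qed
    have "convex {Q. inner Y (P ** Y ** Q) > 0}"
    proof -
      have "linear (\<lambda>Q. inner Y (P ** Y ** Q))"
        by (rule linearI) (simp_all add: mat_distribs inner_add_right)
      from convex_linear_vimage[OF this, of "{0<..}"] show ?thesis
        by (simp add: vimage_def)
    qed
    then have "convex hull ((\<lambda>g. g ** adj g) ` G) \<subseteq> {Q. inner Y (P ** Y ** Q) > 0}"
      by (rule hull_minimal[rotated]) (use 2 in auto)
    then show ?thesis using Q by (auto simp: \<beta>_def)
  qed
  have "bilinear \<beta>"
    by (simp add: bilinear_def linear_iff \<beta>_def mat_distribs inner_add_left inner_add_right)
  moreover have "\<beta> Y Z = \<beta> Z Y" for Y Z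
  proof -
    have "\<beta> Y Z = inner (P ** Z ** Q) Y" by (simp add: \<beta>_def inner_commute)
    also have "\<dots> = \<beta> Z Y"
      by (simp only: \<beta>_def inner_mult_right[of "P ** Z" Q] inner_mult_left[of P Z] adjP adjQ
          matrix_mul_assoc)
    finally show ?thesis .
  qed
  moreover have "\<beta> (g ** Y ** h) (g ** Z ** h) = \<beta> Y Z" if "g \<in> G" "h \<in> G" for g h Y Z
  proof -
    have "\<beta> (g ** Y ** h) (g ** Z ** h) = inner Y ((adj g ** P ** g) ** Z ** (h ** Q ** adj h))"
      by (simp only: \<beta>_def inner_mult_right[of "g ** Y" h] inner_mult_left[of g Y] matrix_mul_assoc)
    then show ?thesis by (simp add: P Q that \<beta>_def)
  qed
  moreover have "\<beta> (\<i> *\<^sub>C Y) (\<i> *\<^sub>C Z) = \<beta> Y Z" for Y Z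
    by (simp add: \<beta>_def inner_cscale_i)
  ultimately have "is_form \<beta>"
    unfolding is_form_def using pos by (simp add: bilinear_conv_bounded_bilinear)
  then show ?thesis using exI[of is_form \<beta>] by simp
qed

definition form :: "'n cmat \<Rightarrow> 'n cmat \<Rightarrow> real"
  where "form = (SOME \<beta>. is_form \<beta>)"

lemma is_form: "is_form form"
  unfolding form_def using ex_form by (rule someI_ex)

sublocale form: bounded_bilinear form
  using is_form by (simp add: is_form_def)

lemma form_sym: "form Y Z = form Z Y"
  and form_pos: "Y \<noteq> 0 \<Longrightarrow> form Y Y > 0"
  and form_mult: "g \<in> G \<Longrightarrow> h \<in> G \<Longrightarrow> form (g ** Y ** h) (g ** Z ** h) = form Y Z"
  and form_i: "form (\<i> *\<^sub>C Y) (\<i> *\<^sub>C Z) = form Y Z"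
  using is_form by (auto simp: is_form_def)

lemma form_nonneg: "form Y Y \<ge> 0"
  using form_pos[of Y] by (cases "Y = 0") (auto simp: form.zero_left)

lemma form_eqI: "(\<And>Z. form Y Z = form Y' Z) \<Longrightarrow> Y = Y'"
  using form_pos[of "Y - Y'"] by (force simp: form.diff_left)

lemma form_i_skew: "form (\<i> *\<^sub>C Y) Z = - form Y (\<i> *\<^sub>C Z)"
  using form_i[of Y "\<i> *\<^sub>C Z"] by (simp add: form.minus_right)

text \<open>Differentiate the invariance under \<open>mexp (t X)\<close> at 0.\<close>

lemma form_skew_left:
  assumes "X \<in> lie_algebra G"
  shows "form (X ** Y) Z = - form Y (X ** Z)"
proof -
  have "((\<lambda>t. form (mexp (t *\<^sub>R X) ** Y) (mexp (t *\<^sub>R X) ** Z)) has_vector_derivative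
      form Y (X ** Z) + form (X ** Y) Z) (at 0)"
    by (rule has_vector_derivative_rhs, rule form.has_vector_derivative,
        rule has_vector_derivative_mult, rule mexp_has_vector_derivative,
        rule has_vector_derivative_const, rule has_vector_derivative_mult,
        rule mexp_has_vector_derivative, rule has_vector_derivative_const) simp
  moreover have "form (mexp (t *\<^sub>R X) ** Y) (mexp (t *\<^sub>R X) ** Z) = form Y Z" for t
    using form_mult[of "mexp (t *\<^sub>R X)" "mat 1" Y Z] lie_algebraD[OF assms] by simp
  ultimately have "((\<lambda>t::real. form Y Z) has_vector_derivative
      form Y (X ** Z) + form (X ** Y) Z) (at 0)" by simp
  then have "form Y (X ** Z) + form (X ** Y) Z = 0"
    by (rule vector_derivative_unique_at) (rule has_vector_derivative_const)
  then show ?thesis by simp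
qed

lemma form_skew_right:
  assumes "X \<in> lie_algebra G"
  shows "form (Y ** X) Z = - form Y (Z ** X)"
proof -
  have "((\<lambda>t. form (Y ** mexp (t *\<^sub>R X)) (Z ** mexp (t *\<^sub>R X))) has_vector_derivative
      form Y (Z ** X) + form (Y ** X) Z) (at 0)"
    by (rule has_vector_derivative_rhs, rule form.has_vector_derivative,
        rule has_vector_derivative_mult, rule has_vector_derivative_const,
        rule mexp_has_vector_derivative, rule has_vector_derivative_mult,
        rule has_vector_derivative_const, rule mexp_has_vector_derivative) simp
  moreover have "form (Y ** mexp (t *\<^sub>R X)) (Z ** mexp (t *\<^sub>R X)) = form Y Z" for t
    using form_mult[of "mat 1" "mexp (t *\<^sub>R X)" Y Z] lie_algebraD[OF assms] by simp
  ultimately have "((\<lambda>t::real. form Y Z) has_vector_derivative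
      form Y (Z ** X) + form (Y ** X) Z) (at 0)" by simp
  then have "form Y (Z ** X) + form (Y ** X) Z = 0"
    by (rule vector_derivative_unique_at) (rule has_vector_derivative_const)
  then show ?thesis by simp
qed

text \<open>These elements play the role of Hermitian matrices: multiplication by them, from either
  side, is self-adjoint for \<open>form\<close>.\<close>

definition isym :: "'n cmat set"
  where "isym = (\<lambda>X. \<i> *\<^sub>C X) ` lie_algebra G"

lemma isym_minus: "A \<in> isym \<Longrightarrow> - A \<in> isym"
  and isym_scaleR: "A \<in> isym \<Longrightarrow> r *\<^sub>R A \<in> isym"
  unfolding isym_def
  using subspace_neg[OF subspace_lie_algebra] lie_algebra_scaleR
  by (force simp: image_iff simp flip: cscale_minus_right cscale_scaleR)+

lemma form_isym_left: "A \<in> isym \<Longrightarrow> form (A ** Y) Z = form Y (A ** Z)"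
  and form_isym_right: "A \<in> isym \<Longrightarrow> form (Y ** A) Z = form Y (Z ** A)"
  by (auto simp: isym_def form_i_skew form_skew_left form_skew_right)

text \<open>The exponential factors are moved gradually from one slot to the other:
  \<open>p s\<close> carries the exponentials with parameter \<open>1 - s\<close>,
  \<open>q s\<close> those with parameter \<open>s\<close>, and self-adjointness makes the pairing
  independent of \<open>s\<close>.\<close>

lemma form_isym_mexp:
  assumes A: "A \<in> isym" and B: "B \<in> isym"
  shows "form (mexp A ** Y ** mexp B) Z = form Y (mexp A ** Z ** mexp B)"
proof -
  define r where "r = (\<lambda>s. mexp (- (s *\<^sub>R A)) ** Y ** mexp (- (s *\<^sub>R B)))"
  define p where "p = (\<lambda>s. mexp A ** r s ** mexp B)"
  define q where "q = (\<lambda>s. mexp (s *\<^sub>R A) ** Z ** mexp (s *\<^sub>R B))"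
  have comm: "mexp A ** A = A ** mexp A" "mexp (- (s *\<^sub>R A)) ** A = A ** mexp (- (s *\<^sub>R A))" for s
    by (rule mexp_intertwine; simp)+
  have commB: "V ** mexp B ** B = V ** B ** mexp B" for V
    using mexp_commute[of B] by (metis matrix_mul_assoc)
  have r: "(r has_vector_derivative - (A ** r s) - r s ** B) (at s)" for s
    unfolding r_def
    by (rule has_vector_derivative_rhs, rule has_vector_derivative_mult,
        rule has_vector_derivative_mult, rule mexp_has_vector_derivative_neg,
        rule has_vector_derivative_const, rule mexp_has_vector_derivative_neg)
       (simp add: matrix_mul_assoc comm)
  have p: "(p has_vector_derivative - (A ** p s) - p s ** B) (at s)" for s
    unfolding p_def
    by (rule has_vector_derivative_rhs, rule has_vector_derivative_mult,
        rule has_vector_derivative_mult, rule has_vector_derivative_const, rule r,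
        rule has_vector_derivative_const)
       (simp add: mat_distribs matrix_mul_assoc comm commB)
  have q: "(q has_vector_derivative A ** q s + q s ** B) (at s)" for s
    unfolding q_def
    by (rule has_vector_derivative_rhs, rule has_vector_derivative_mult,
        rule has_vector_derivative_mult, rule mexp_has_vector_derivative,
        rule has_vector_derivative_const, rule mexp_has_vector_derivative')
       (simp add: matrix_mul_assoc)
  have "((\<lambda>s. form (p s) (q s)) has_vector_derivative 0) (at s)" for s
    by (rule has_vector_derivative_rhs, rule form.has_vector_derivative, rule p, rule q)
       (simp add: form.add_right form.diff_left form.minus_left form_isym_left[OF A]
         form_isym_right[OF B])
  from zero_derivative_imp_const[OF this, of 0 1] show ?thesis
    by (simp add: p_def q_def r_def matrix_mul_assoc)
qed

text \<open>Half of each exponential is moved across, which exhibits the pairing as a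
  square.\<close>

lemma form_isym_square:
  assumes A: "A \<in> isym" and B: "B \<in> isym"
  shows "form Y (mexp A ** Y ** mexp B) =
    form (mexp ((1/2) *\<^sub>R A) ** Y ** mexp ((1/2) *\<^sub>R B)) (mexp ((1/2) *\<^sub>R A) ** Y ** mexp ((1/2) *\<^sub>R B))"
proof -
  have half: "mexp ((1/2) *\<^sub>R A) ** mexp ((1/2) *\<^sub>R A) = mexp A" for A :: "'n cmat"
    using mexp_add_scaleR[of "1/2" "1/2" A] by simp
  have "mexp ((1/2) *\<^sub>R A) ** (mexp ((1/2) *\<^sub>R A) ** Y ** mexp ((1/2) *\<^sub>R B)) ** mexp ((1/2) *\<^sub>R B)
      = mexp A ** Y ** mexp B"
    using half[of A] half[of B] by (metis matrix_mul_assoc)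
  then show ?thesis
    using form_isym_mexp[of "(1/2) *\<^sub>R A" "(1/2) *\<^sub>R B" Y] isym_scaleR A B by metis
qed

lemma form_isym_pos:
  assumes A: "A \<in> isym" and B: "B \<in> isym" and "Y \<noteq> 0"
  shows "form Y (mexp A ** Y ** mexp B) > 0"
proof -
  have "mexp (- ((1/2) *\<^sub>R A)) ** (mexp ((1/2) *\<^sub>R A) ** Y ** mexp ((1/2) *\<^sub>R B))
      ** mexp (- ((1/2) *\<^sub>R B)) = Y"
    by (simp add: matrix_mul_assoc)
  then have "mexp ((1/2) *\<^sub>R A) ** Y ** mexp ((1/2) *\<^sub>R B) \<noteq> 0"
    using \<open>Y \<noteq> 0\<close> by auto
  then show ?thesis
    unfolding form_isym_square[OF A B] by (rule form_pos)
qed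

text \<open>Along the path \<open>q\<close> from \<open>v\<close> to
  \<open>mexp A ** v ** mexp (- B)\<close>, the pairing with \<open>w\<close> has derivative
  \<open>form w (mexp (s A) ** w ** mexp (- s B))\<close>. This is positive unless
  \<open>w = 0\<close>, so the path could not return to its starting point.\<close>

lemma isym_mexp_fixed:
  assumes A: "A \<in> isym" and B: "B \<in> isym" and fixed: "mexp A ** v ** mexp (- B) = v"
  shows "A ** v = v ** B"
proof (rule ccontr)
  define w where "w = A ** v - v ** B"
  define q where "q = (\<lambda>s. mexp (s *\<^sub>R A) ** v ** mexp (- (s *\<^sub>R B)))"
  assume "\<not> ?thesis"
  then have "w \<noteq> 0" by (simp add: w_def)
  have comm: "mexp (- (s *\<^sub>R B)) ** B = B ** mexp (- (s *\<^sub>R B))" for s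
    by (rule mexp_intertwine) simp
  have q: "(q has_vector_derivative mexp (s *\<^sub>R A) ** w ** mexp (- (s *\<^sub>R B))) (at s)" for s
    unfolding q_def
    by (rule has_vector_derivative_rhs, rule has_vector_derivative_mult,
        rule has_vector_derivative_mult, rule mexp_has_vector_derivative',
        rule has_vector_derivative_const, rule mexp_has_vector_derivative_neg)
       (simp add: w_def mat_distribs matrix_mul_assoc comm)
  have deriv: "((\<lambda>s. form w (q s)) has_real_derivative form w (mexp (s *\<^sub>R A) ** w ** mexp (- (s *\<^sub>R B)))) (at s)"
    for s
    unfolding has_real_derivative_iff_has_vector_derivative
    by (rule has_vector_derivative_rhs, rule form.has_vector_derivative,
        rule has_vector_derivative_const, rule q) (simp add: form.zero_left)
  have pos: "form w (mexp (s *\<^sub>R A) ** w ** mexp (- (s *\<^sub>R B))) > 0" for s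
    by (rule form_isym_pos[OF _ _ \<open>w \<noteq> 0\<close>]) (auto intro: isym_minus isym_scaleR A B)
  have "form w (q 0) < form w (q 1)"
  proof (rule DERIV_pos_imp_increasing[of 0 1 "\<lambda>s. form w (q s)"])
    show "\<exists>y. ((\<lambda>s. form w (q s)) has_real_derivative y) (at s) \<and> 0 < y" for s
      using deriv pos by (intro exI conjI)
  qed simp
  then show False using fixed by (simp add: q_def)
qed

lemma isym_mexp_inj:
  assumes "A \<in> isym" "B \<in> isym" "mexp A = mexp B"
  shows "A = B"
  using isym_mexp_fixed[OF assms(1,2), of "mat 1"] assms(3) by simp

lemma cscale_i_inj: "\<i> *\<^sub>C X = \<i> *\<^sub>C Y \<longleftrightarrow> X = Y"
  by (simp add: vec_eq_iff)

text \<open>Left invariance of the form removes the factor \<open>h\<close>, so the product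
  determines the square of \<open>mexp A\<close> through \<open>form\<close>; injectivity of the
  exponential on \<open>isym\<close> does the rest.\<close>

lemma polar_unique:
  assumes h: "h \<in> G" "h' \<in> G" and X: "X \<in> lie_algebra G" "X' \<in> lie_algebra G"
    and eq: "h ** mexp (\<i> *\<^sub>C X) = h' ** mexp (\<i> *\<^sub>C X')"
  shows "h = h' \<and> X = X'"
proof -
  define A A' where "A = \<i> *\<^sub>C X" and "A' = \<i> *\<^sub>C X'"
  have A: "A \<in> isym" "A' \<in> isym" using X by (auto simp: A_def A'_def isym_def)
  have 0: "0 \<in> isym" using isym_scaleR[OF A(1), of 0] by simp
  have sq: "form (mexp B ** mexp B) Z = form (mexp B) (mexp B ** Z)" if "B \<in> isym" for B Z
    using form_isym_mexp[OF that 0, of "mexp B" Z] by simp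
  have "form (mexp A ** mexp A) Z = form (mexp A' ** mexp A') Z" for Z
  proof -
    have "form (mexp A ** mexp A) Z = form (h ** mexp A) (h ** mexp A ** Z)"
      using form_mult[OF h(1) one_mem, of "mexp A" "mexp A ** Z"] sq[OF A(1)]
      by (simp add: matrix_mul_assoc)
    also have "\<dots> = form (h' ** mexp A') (h' ** mexp A' ** Z)"
      using eq by (simp add: A_def A'_def)
    also have "\<dots> = form (mexp A' ** mexp A') Z"
      using form_mult[OF h(2) one_mem, of "mexp A'" "mexp A' ** Z"] sq[OF A(2)]
      by (simp add: matrix_mul_assoc)
    finally show ?thesis .
  qed
  then have "mexp A ** mexp A = mexp A' ** mexp A'" by (rule form_eqI)
  then have "mexp (2 *\<^sub>R A) = mexp (2 *\<^sub>R A')"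
    using mexp_add_scaleR[of 1 1 A] mexp_add_scaleR[of 1 1 A'] by simp
  then have "2 *\<^sub>R A = 2 *\<^sub>R A'"
    by (rule isym_mexp_inj[rotated 2]) (auto intro: isym_scaleR A)
  then have "A = A'" by simp
  moreover from this have "h ** mexp A ** mexp (- A) = h' ** mexp A ** mexp (- A)"
    using eq by (simp add: A_def A'_def)
  ultimately show ?thesis
    by (simp add: A_def A'_def cscale_i_inj)
qed

text \<open>Multiplication by \<open>X\<close> would be skew and self-adjoint at once.\<close>

lemma lie_algebra_cap_i:
  assumes "X \<in> lie_algebra G" "Y \<in> lie_algebra G" "X = \<i> *\<^sub>C Y"
  shows "X = 0"
proof (rule ccontr)
  assume "X \<noteq> 0"
  have "X \<in> isym" using assms by (auto simp: isym_def)
  then have "form X X = form (mat 1) (X ** X)"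
    using form_isym_left[of X "mat 1" X] by simp
  moreover have "form X X = - form (mat 1) (X ** X)"
    using form_skew_left[OF assms(1), of "mat 1" X] by simp
  ultimately show False using form_pos[OF \<open>X \<noteq> 0\<close>] by simp
qed

lemma lie_algebra_C_unique:
  assumes "X \<in> lie_algebra G" "Y \<in> lie_algebra G" "X' \<in> lie_algebra G" "Y' \<in> lie_algebra G"
    and "X + \<i> *\<^sub>C Y = X' + \<i> *\<^sub>C Y'"
  shows "X = X' \<and> Y = Y'"
proof -
  have "X - X' = \<i> *\<^sub>C (Y' - Y)"
    using assms(5) by (simp add: cs.diff_right algebra_simps)
  then have "X - X' = 0"
    by (rule lie_algebra_cap_i[rotated 2]) (auto intro: subspace_diff[OF subspace_lie_algebra] assms)
  then show ?thesis using assms(5) by (simp add: cscale_i_inj)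
qed

lemma form_coercive: "\<exists>c>0. \<forall>Y. c * (norm Y)\<^sup>2 \<le> form Y Y"
proof -
  have "continuous_on (sphere 0 1) (\<lambda>Y. form Y Y)"
    by (intro form.continuous_on continuous_intros)
  moreover have "sphere (0::'n cmat) 1 \<noteq> {}" by simp
  ultimately obtain Z where Z: "Z \<in> sphere 0 1" "\<And>Y. Y \<in> sphere 0 1 \<Longrightarrow> form Z Z \<le> form Y Y"
    using continuous_attains_inf[OF compact_sphere, of 0 1 "\<lambda>Y. form Y Y"] by metis
  then have "form Z Z > 0" by (intro form_pos) auto
  moreover have "form Z Z * (norm Y)\<^sup>2 \<le> form Y Y" for Y
  proof (cases "Y = 0")
    case False
    then have "form Z Z \<le> form ((1 / norm Y) *\<^sub>R Y) ((1 / norm Y) *\<^sub>R Y)"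
      by (intro Z(2)) auto
    then show ?thesis
      using False by (simp add: form.scaleR_left form.scaleR_right power2_eq_square field_simps)
  qed (simp add: form.zero_left)
  ultimately show ?thesis by auto
qed

text \<open>The analogue of a^2 <= (e^a - e^-a)^2 for real a. It bounds \<open>A\<close> by its
  exponential and the inverse exponential, which makes the polar decomposition proper.\<close>

lemma isym_bound:
  assumes A: "A \<in> isym"
  shows "form A A \<le> form (mexp A - mexp (- A)) (mexp A - mexp (- A))"
proof -
  define \<phi> where "\<phi> = (\<lambda>s. form A (mexp (s *\<^sub>R A) - mexp (- (s *\<^sub>R A))))"
  define W where "W = mexp A - mexp (- A)"
  define \<phi>' where "\<phi>' = (\<lambda>s. form A (mexp (s *\<^sub>R A) ** A) + form A (mexp (- (s *\<^sub>R A)) ** A))"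
  have deriv: "(\<phi> has_real_derivative \<phi>' s) (at s)" for s
    unfolding \<phi>_def \<phi>'_def has_real_derivative_iff_has_vector_derivative
    by (rule has_vector_derivative_rhs, rule form.has_vector_derivative,
        rule has_vector_derivative_const, rule has_vector_derivative_diff,
        rule mexp_has_vector_derivative', rule mexp_has_vector_derivative_neg)
       (simp add: form.zero_left form.add_right)
  have 0: "0 \<in> isym" using isym_scaleR[OF A, of 0] by simp
  \<comment> \<open>This is e^(sA) + e^(-sA) >= 2: the square of \<open>p - q\<close> is nonnegative
    and its mixed term is exactly \<open>form A A\<close>.\<close>
  have "2 * form A A \<le> \<phi>' s" for s
  proof -
    define p q where "p = mexp ((1/2) *\<^sub>R (s *\<^sub>R A)) ** A" and "q = mexp (- ((1/2) *\<^sub>R (s *\<^sub>R A))) ** A"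
    have "form A (mexp (s *\<^sub>R A) ** A) = form p p"
      using form_isym_square[OF isym_scaleR[OF A] 0, of A s] by (simp add: p_def)
    moreover have "form A (mexp (- (s *\<^sub>R A)) ** A) = form q q"
      using form_isym_square[OF isym_minus[OF isym_scaleR[OF A]] 0, of A s] by (simp add: q_def)
    moreover have "form p q = form A A"
    proof -
      have "form p q = form A (mexp ((1/2) *\<^sub>R (s *\<^sub>R A)) ** q)"
        using form_isym_mexp[OF isym_scaleR[OF isym_scaleR[OF A]] 0, of "1/2" s A q] by (simp add: p_def)
      then show ?thesis by (simp add: q_def matrix_mul_assoc)
    qed
    moreover have "0 \<le> form (p - q) (p - q)" by (rule form_nonneg)
    ultimately show ?thesis
      by (simp add: \<phi>'_def form.diff_left form.diff_right form_sym[of q p])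
  qed
  moreover obtain s where "0 < s" "s < 1" "\<phi> 1 - \<phi> 0 = (1 - 0) * \<phi>' s"
    using MVT2[of 0 1 \<phi> \<phi>'] deriv by auto
  moreover have "\<phi> 1 - \<phi> 0 = form A (mexp A - mexp (- A))"
    by (simp add: \<phi>_def form.zero_right)
  ultimately have "2 * form A A \<le> form A (mexp A - mexp (- A))"
    by (metis diff_zero mult_1)
  then have 1: "2 * form A A \<le> form A W" by (simp add: W_def)
  \<comment> \<open>Expanding this square bounds \<open>2 * form A W\<close> by
    \<open>form A A + form W W\<close>, which does the work of Cauchy-Schwarz.\<close>
  have "0 \<le> form (A - W) (A - W)" by (rule form_nonneg)
  also have "\<dots> = form A A - 2 * form A W + form W W"
    by (simp add: form.diff_left form.diff_right form_sym[of W A])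
  finally have "form A A \<le> form W W" using 1 form_nonneg[of A] by linarith
  then show ?thesis by (simp add: W_def)
qed

end

section \<open>Antiderivatives\<close>

definition antideriv :: "(real \<Rightarrow> 'a::euclidean_space) \<Rightarrow> real \<Rightarrow> 'a"
  where "antideriv f = (SOME F. F 0 = 0 \<and> (\<forall>x. (F has_vector_derivative f x) (at x)))"

lemma antideriv_0: "continuous_on UNIV f \<Longrightarrow> antideriv f 0 = 0"
  and antideriv_deriv: "continuous_on UNIV f \<Longrightarrow> (antideriv f has_vector_derivative f x) (at x)"
  using someI_ex[OF ex_antiderivative, of f] by (auto simp: antideriv_def)

lemma has_vector_derivative_imp_continuous_on:
  assumes "\<And>x. (f has_vector_derivative f' x) (at x)"
  shows "continuous_on S f"
  using has_vector_derivative_continuous[OF assms] by (simp add: continuous_at_imp_continuous_on)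

lemma continuous_on_antideriv: "continuous_on UNIV f \<Longrightarrow> continuous_on UNIV (antideriv f)"
  by (rule has_vector_derivative_imp_continuous_on) (rule antideriv_deriv)

lemma antideriv_eqI:
  assumes "\<And>x. (F has_vector_derivative f x) (at x)" "F 0 = 0"
  shows "antideriv f x = F x"
proof -
  have *: "F 0 = 0 \<and> (\<forall>x. (F has_vector_derivative f x) (at x))"
    using assms by simp
  define H where "H = antideriv f"
  have "H 0 = 0 \<and> (\<forall>x. (H has_vector_derivative f x) (at x))"
    unfolding H_def antideriv_def by (rule someI[of _ F]) (rule *)
  then have H: "H 0 = 0" "\<And>x. (H has_vector_derivative f x) (at x)" by auto
  have "((\<lambda>x. H x - F x) has_vector_derivative 0) (at x)" for x
    using has_vector_derivative_diff[OF H(2) assms(1), of x] by simp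
  from zero_derivative_imp_const[OF this, of x 0] show ?thesis
    using H assms by (simp add: H_def)
qed

section \<open>The derivative of the matrix exponential\<close>

lemma vector_mean_value:
  fixes f :: "real \<Rightarrow> 'a::real_normed_vector"
  assumes "\<And>x. (f has_vector_derivative f' x) (at x)"
    and "\<And>x. 0 \<le> x \<Longrightarrow> x \<le> 1 \<Longrightarrow> norm (f' x) \<le> B" and s: "0 \<le> s" "s \<le> 1"
  shows "norm (f s - f 0) \<le> B * s"
proof (cases "s = 0")
  case False
  have "norm (f s - f 0) \<le> B * s - B * 0"
  proof (rule differentiable_bound_general[where f' = f' and \<phi>' = "\<lambda>_. B"])
    show "continuous_on {0..s} f"
      using assms(1) by (rule has_vector_derivative_imp_continuous_on)
    show "((*) B has_vector_derivative B) (at x)" for x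
      unfolding has_real_derivative_iff_has_vector_derivative[symmetric]
      by (auto intro!: derivative_eq_intros)
  qed (use assms False in \<open>auto intro!: continuous_intros\<close>)
  then show ?thesis by simp
qed simp

lemma mexp_bounded:
  obtains E where "E > 0" "\<And>A :: 'n::finite cmat. norm A \<le> r \<Longrightarrow> norm (mexp A) \<le> E"
proof -
  obtain c where c: "c > 0"
    "\<forall>A :: 'n cmat. norm (mexp A) \<le> norm (mat 1 :: 'n cmat) * exp (c * norm A)"
    using norm_mexp_le by blast
  show thesis
  proof (rule that[of "(norm (mat 1 :: 'n cmat) + 1) * exp (c * r)"])
    show "(norm (mat 1 :: 'n cmat) + 1) * exp (c * r) > 0"
      by (intro mult_pos_pos) (auto intro: add_nonneg_pos)
    show "norm (mexp A) \<le> (norm (mat 1 :: 'n cmat) + 1) * exp (c * r)" if "norm A \<le> r" for A :: "'n cmat"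
    proof -
      have "norm (mexp A) \<le> norm (mat 1 :: 'n cmat) * exp (c * norm A)" using c by auto
      also have "\<dots> \<le> (norm (mat 1 :: 'n cmat) + 1) * exp (c * r)"
        using c that by (intro mult_mono) auto
      finally show ?thesis .
    qed
  qed
qed

text \<open>The first step of Duhamel's formula: the terms with \<open>Z\<close> cancel and only the
  increment \<open>Y\<close> remains.\<close>

lemma mexp_ratio_deriv:
  "((\<lambda>s. mexp (s *\<^sub>R (Z + Y)) ** mexp (- (s *\<^sub>R Z))) has_vector_derivative
    mexp (s *\<^sub>R (Z + Y)) ** Y ** mexp (- (s *\<^sub>R Z))) (at s)"
proof -
  have "mexp (- (s *\<^sub>R Z)) ** Z = Z ** mexp (- (s *\<^sub>R Z))"
    by (rule mexp_intertwine) simp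
  then have "V ** mexp (- (s *\<^sub>R Z)) ** Z = V ** Z ** mexp (- (s *\<^sub>R Z))" for V
    by (metis matrix_mul_assoc)
  then show ?thesis
    by (intro has_vector_derivative_rhs[OF has_vector_derivative_mult[OF
        mexp_has_vector_derivative' mexp_has_vector_derivative_neg]])
       (simp add: mat_distribs matrix_mul_assoc)
qed

lemma mexp_ratio_bound:
  obtains c where "c > 0" "\<And>(Z :: 'n::finite cmat) Y s. norm Z \<le> r \<Longrightarrow> norm Y \<le> r \<Longrightarrow>
    0 \<le> s \<Longrightarrow> s \<le> 1 \<Longrightarrow>
    norm (mexp (s *\<^sub>R (Z + Y)) ** mexp (- (s *\<^sub>R Z)) - mat 1) \<le> c * norm Y"
proof -
  obtain E where E: "E > 0" "\<And>A :: 'n cmat. norm A \<le> 2 * r \<Longrightarrow> norm (mexp A) \<le> E"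
    by (rule mexp_bounded) blast
  obtain K where K: "K > 0" "\<And>(A :: 'n cmat) (B :: 'n cmat). norm (A ** B) \<le> norm A * norm B * K"
    using mm.pos_bounded[where ?'n = 'n] by auto
  define c where "c = E * K * E * K"
  show thesis
  proof (rule that[of c])
    show "c > 0" using E K by (simp add: c_def)
    fix Z Y :: "'n cmat" and s :: real
    assume ZY: "norm Z \<le> r" "norm Y \<le> r" and s: "0 \<le> s" "s \<le> 1"
    have small: "norm (x *\<^sub>R A) \<le> 2 * r" if "norm A \<le> 2 * r" "0 \<le> x" "x \<le> 1" for x and A :: "'n cmat"
      using mult_left_le_one_le[of "norm A" x] that by auto
    have ZY': "norm (Z + Y) \<le> 2 * r" "norm Z \<le> 2 * r"
      using norm_triangle_ineq[of Z Y] ZY norm_ge_zero[of Z] by linarith+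
    have "norm (mexp (x *\<^sub>R (Z + Y)) ** Y ** mexp (- (x *\<^sub>R Z))) \<le> c * norm Y"
      if x: "0 \<le> x" "x \<le> 1" for x
    proof -
      have "norm (mexp (x *\<^sub>R (Z + Y)) ** Y ** mexp (- (x *\<^sub>R Z)))
          \<le> norm (mexp (x *\<^sub>R (Z + Y))) * norm Y * K * norm (mexp (- (x *\<^sub>R Z))) * K"
        using K by (intro order_trans[OF K(2)] mult_right_mono) auto
      also have "\<dots> \<le> E * norm Y * K * E * K"
        using K E small[OF ZY'(1) x] small[OF ZY'(2) x]
        by (intro mult_right_mono mult_mono) (auto intro!: E(2))
      finally show ?thesis by (simp add: c_def mult_ac)
    qed
    from vector_mean_value[OF mexp_ratio_deriv this s]
    have "norm (mexp (s *\<^sub>R (Z + Y)) ** mexp (- (s *\<^sub>R Z)) - mat 1) \<le> c * norm Y * s"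
      by simp
    also have "\<dots> \<le> c * norm Y" using s \<open>c > 0\<close> by (simp add: mult_left_le)
    finally show "norm (mexp (s *\<^sub>R (Z + Y)) ** mexp (- (s *\<^sub>R Z)) - mat 1) \<le> c * norm Y" .
  qed
qed

lemma continuous_on_mexp: "continuous_on S (mexp :: 'n::finite cmat \<Rightarrow> 'n cmat)"
proof (rule continuous_at_imp_continuous_on, intro ballI)
  fix Z :: "'n cmat"
  obtain c where c: "c > 0" "\<And>(W :: 'n cmat) Y s. norm W \<le> norm Z + 1 \<Longrightarrow> norm Y \<le> norm Z + 1 \<Longrightarrow>
    0 \<le> s \<Longrightarrow> s \<le> 1 \<Longrightarrow> norm (mexp (s *\<^sub>R (W + Y)) ** mexp (- (s *\<^sub>R W)) - mat 1) \<le> c * norm Y"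
    by (rule mexp_ratio_bound) blast
  have "((\<lambda>W. mexp W ** mexp (- Z) - mat 1) \<longlongrightarrow> 0) (at Z)"
  proof (rule Lim_null_comparison)
    show "\<forall>\<^sub>F W in at Z. norm (mexp W ** mexp (- Z) - mat 1) \<le> c * norm (W - Z)"
      unfolding eventually_at
    proof (intro exI[of _ 1] conjI ballI impI)
      fix W assume "W \<noteq> Z \<and> dist W Z < 1"
      then show "norm (mexp W ** mexp (- Z) - mat 1) \<le> c * norm (W - Z)"
        using c(2)[of Z "W - Z" 1] norm_ge_zero[of Z] by (simp add: dist_norm)
    qed simp
    show "((\<lambda>W. c * norm (W - Z)) \<longlongrightarrow> 0) (at Z)"
      by (auto intro!: tendsto_eq_intros)
  qed
  then have "((\<lambda>W. (mexp W ** mexp (- Z) - mat 1) ** mexp Z) \<longlongrightarrow> 0 ** mexp Z) (at Z)"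
    by (intro mm.tendsto tendsto_const)
  then have "((\<lambda>W. mexp W - mexp Z) \<longlongrightarrow> 0) (at Z)"
    by (simp add: mm.diff_left)
  then show "continuous (at Z) mexp"
    by (simp add: continuous_at Lim_null[symmetric])
qed

text \<open>Duhamel's formula. \<open>J 1\<close> is the integral over [0,1] of the conjugates of
  \<open>Y\<close>; it is described through an antiderivative, the form in which it is computed
  later.\<close>

lemma mexp_directional_derivative:
  fixes Z Y :: "'n::finite cmat"
  assumes J: "J 0 = 0" "\<And>s. (J has_vector_derivative mexp (s *\<^sub>R Z) ** Y ** mexp (- (s *\<^sub>R Z))) (at s)"
  shows "((\<lambda>\<epsilon>. mexp (Z + \<epsilon> *\<^sub>R Y)) has_vector_derivative J 1 ** mexp Z) (at 0)"
proof -
  define r where "r = norm Z + norm Y"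
  obtain c where c: "c > 0" "\<And>(W :: 'n cmat) Y s. norm W \<le> r \<Longrightarrow> norm Y \<le> r \<Longrightarrow>
    0 \<le> s \<Longrightarrow> s \<le> 1 \<Longrightarrow> norm (mexp (s *\<^sub>R (W + Y)) ** mexp (- (s *\<^sub>R W)) - mat 1) \<le> c * norm Y"
    by (rule mexp_ratio_bound) blast
  obtain E where E: "E > 0" "\<And>A :: 'n cmat. norm A \<le> r \<Longrightarrow> norm (mexp A) \<le> E"
    by (rule mexp_bounded) blast
  obtain K where K: "K > 0" "\<And>(A :: 'n cmat) (B :: 'n cmat). norm (A ** B) \<le> norm A * norm B * K"
    using mm.pos_bounded[where ?'n = 'n] by auto
  define B where "B = c * norm Y * (E * norm Y * K * E * K) * K"
  have "B \<ge> 0" using c E K by (simp add: B_def)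
  have est: "norm (mexp (Z + \<epsilon> *\<^sub>R Y) - mexp Z - \<epsilon> *\<^sub>R (J 1 ** mexp Z)) \<le> B * E * K * \<epsilon>\<^sup>2"
    if \<epsilon>: "\<bar>\<epsilon>\<bar> \<le> 1" for \<epsilon>
  proof -
    define D where "D = (\<lambda>s. mexp (s *\<^sub>R (Z + \<epsilon> *\<^sub>R Y)) ** mexp (- (s *\<^sub>R Z)))"
    define a where "a = (\<lambda>s. mexp (s *\<^sub>R Z) ** Y ** mexp (- (s *\<^sub>R Z)))"
    \<comment> \<open>The remainder of the first-order expansion. Its derivative in \<open>s\<close>
      has one factor \<open>\<epsilon>\<close> from the increment and another from
      \<open>D s - mat 1\<close>, so it is quadratic in \<open>\<epsilon>\<close>.\<close>
    define R where "R = (\<lambda>s. D s - \<epsilon> *\<^sub>R J s)"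
    have D_eq: "mexp (s *\<^sub>R (Z + \<epsilon> *\<^sub>R Y)) = D s ** mexp (s *\<^sub>R Z)" for s
      by (simp add: D_def)
    have R': "(R has_vector_derivative \<epsilon> *\<^sub>R ((D s - mat 1) ** a s)) (at s)" for s
    proof -
      have "(D has_vector_derivative mexp (s *\<^sub>R (Z + \<epsilon> *\<^sub>R Y)) ** (\<epsilon> *\<^sub>R Y) ** mexp (- (s *\<^sub>R Z))) (at s)"
        unfolding D_def by (rule mexp_ratio_deriv)
      then have "(D has_vector_derivative \<epsilon> *\<^sub>R (D s ** a s)) (at s)"
        by (simp add: D_eq a_def matrix_mul_assoc)
      moreover have "((\<lambda>s. \<epsilon> *\<^sub>R J s) has_vector_derivative \<epsilon> *\<^sub>R a s) (at s)"
        using bounded_linear.has_vector_derivative[OF bounded_linear_scaleR_right J(2)]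
        by (simp add: a_def)
      ultimately have "(R has_vector_derivative \<epsilon> *\<^sub>R (D s ** a s) - \<epsilon> *\<^sub>R a s) (at s)"
        unfolding R_def by (rule has_vector_derivative_diff)
      then show ?thesis by (simp add: mm.diff_left scaleR_diff_right)
    qed
    have "norm (\<epsilon> *\<^sub>R ((D s - mat 1) ** a s)) \<le> B * \<epsilon>\<^sup>2" if s: "0 \<le> s" "s \<le> 1" for s
    proof -
      have "norm (\<epsilon> *\<^sub>R Y) \<le> norm Y" using \<epsilon> by (simp add: mult_left_le_one_le)
      then have 1: "norm (D s - mat 1) \<le> c * (\<bar>\<epsilon>\<bar> * norm Y)"
        using c(2)[of Z "\<epsilon> *\<^sub>R Y" s] s norm_ge_zero[of Z] norm_ge_zero[of Y]
        unfolding D_def r_def by auto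
      have "norm (s *\<^sub>R Z) \<le> r"
      proof -
        have "s * norm Z \<le> norm Z" using s by (simp add: mult_left_le_one_le)
        moreover have "norm (s *\<^sub>R Z) = s * norm Z" using s by simp
        ultimately show ?thesis using norm_ge_zero[of Y] unfolding r_def by linarith
      qed
      then have "norm (mexp (s *\<^sub>R Z)) \<le> E" "norm (mexp (- (s *\<^sub>R Z))) \<le> E"
        by (auto intro!: E(2))
      then have "norm (mexp (s *\<^sub>R Z)) * norm Y * K * norm (mexp (- (s *\<^sub>R Z))) * K
          \<le> E * norm Y * K * E * K"
        using K E by (intro mult_right_mono mult_mono) auto
      moreover have "norm (a s) \<le> norm (mexp (s *\<^sub>R Z)) * norm Y * K * norm (mexp (- (s *\<^sub>R Z))) * K"
        unfolding a_def using K by (intro order_trans[OF K(2)] mult_right_mono) auto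
      ultimately have 2: "norm (a s) \<le> E * norm Y * K * E * K" by linarith
      have "norm (\<epsilon> *\<^sub>R ((D s - mat 1) ** a s)) \<le> \<bar>\<epsilon>\<bar> * (norm (D s - mat 1) * norm (a s) * K)"
        using K by (auto intro!: mult_left_mono)
      also have "\<dots> \<le> \<bar>\<epsilon>\<bar> * (c * (\<bar>\<epsilon>\<bar> * norm Y) * (E * norm Y * K * E * K) * K)"
        using 1 2 c K E by (intro mult_left_mono mult_right_mono mult_mono) auto
      also have "\<dots> = B * (\<bar>\<epsilon>\<bar> * \<bar>\<epsilon>\<bar>)"
        by (simp add: B_def mult_ac)
      also have "\<dots> = B * \<epsilon>\<^sup>2" by (simp add: power2_eq_square)
      finally show ?thesis .
    qed
    from vector_mean_value[OF R' this, of 1] have "norm (R 1 - R 0) \<le> B * \<epsilon>\<^sup>2" by simp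
    moreover have "mexp (Z + \<epsilon> *\<^sub>R Y) - mexp Z - \<epsilon> *\<^sub>R (J 1 ** mexp Z) = (R 1 - R 0) ** mexp Z"
      using D_eq[of 1] by (simp add: R_def mm.diff_left J(1)) (simp add: D_def)
    moreover have "norm (mexp Z) \<le> E" by (intro E(2)) (simp add: r_def)
    ultimately have "norm (mexp (Z + \<epsilon> *\<^sub>R Y) - mexp Z - \<epsilon> *\<^sub>R (J 1 ** mexp Z)) \<le> B * \<epsilon>\<^sup>2 * E * K"
      using K E \<open>B \<ge> 0\<close> by (simp only:) (intro order_trans[OF K(2)] mult_right_mono mult_mono; simp)
    then show ?thesis by (simp add: mult_ac)
  qed
  define C where "C = B * E * K + 1"
  have C: "C > 0" using \<open>B \<ge> 0\<close> E K by (simp add: C_def add_nonneg_pos)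
  show ?thesis
    unfolding has_vector_derivative_def has_derivative_at_alt
  proof (intro conjI allI impI)
    fix e :: real assume "e > 0"
    show "\<exists>d>0. \<forall>y. norm (y - 0) < d \<longrightarrow>
        norm (mexp (Z + y *\<^sub>R Y) - mexp (Z + 0 *\<^sub>R Y) - (y - 0) *\<^sub>R (J 1 ** mexp Z)) \<le> e * norm (y - 0)"
    proof (intro exI[of _ "min 1 (e / C)"] conjI allI impI)
      fix \<epsilon> :: real assume \<epsilon>: "norm (\<epsilon> - 0) < min 1 (e / C)"
      then have "norm (mexp (Z + \<epsilon> *\<^sub>R Y) - mexp Z - \<epsilon> *\<^sub>R (J 1 ** mexp Z)) \<le> B * E * K * \<epsilon>\<^sup>2"
        by (intro est) auto
      also have "\<dots> \<le> C * (\<bar>\<epsilon>\<bar> * \<bar>\<epsilon>\<bar>)"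
        by (simp add: C_def power2_eq_square mult_right_mono)
      also have "\<dots> \<le> e * \<bar>\<epsilon>\<bar>"
      proof -
        have "C * \<bar>\<epsilon>\<bar> \<le> e" using \<epsilon> C by (simp add: field_simps)
        from mult_right_mono[OF this, of "\<bar>\<epsilon>\<bar>"] show ?thesis by (simp add: mult_ac)
      qed
      finally show "norm (mexp (Z + \<epsilon> *\<^sub>R Y) - mexp (Z + 0 *\<^sub>R Y) - (\<epsilon> - 0) *\<^sub>R (J 1 ** mexp Z))
          \<le> e * norm (\<epsilon> - 0)" by simp
    qed (use C \<open>e > 0\<close> in auto)
  qed (rule bounded_linear_scaleR_left)
qed

section \<open>The polar decomposition of the complexification\<close>

context compact_matrix_group
begin

lemma lie_algebra_CE:
  assumes "C \<in> lie_algebra_C G"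
  obtains U V where "U \<in> lie_algebra G" "V \<in> lie_algebra G" "C = U + \<i> *\<^sub>C V"
  using assms by (auto simp: lie_algebra_C_def)

lemma lie_algebra_CI:
  "U \<in> lie_algebra G \<Longrightarrow> V \<in> lie_algebra G \<Longrightarrow> U + \<i> *\<^sub>C V \<in> lie_algebra_C G"
  by (auto simp: lie_algebra_C_def)

lemma lie_algebra_C_Ad':
  assumes "g \<in> G" "C \<in> lie_algebra_C G"
  shows "matrix_inv g ** C ** g \<in> lie_algebra_C G"
  using assms(2)
  by (rule lie_algebra_CE)
     (auto simp: mat_distribs intro!: lie_algebra_CI lie_algebra_Ad'[OF assms(1)])

definition orbit :: "'n cmat \<Rightarrow> 'n cmat \<Rightarrow> real \<Rightarrow> 'n cmat"
  where "orbit Z Y s = mexp (s *\<^sub>R Z) ** Y ** mexp (- (s *\<^sub>R Z))"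

lemma orbit_deriv: "(orbit Z Y has_vector_derivative bracket Z (orbit Z Y s)) (at s)"
proof -
  have "mexp (- (s *\<^sub>R Z)) ** Z = Z ** mexp (- (s *\<^sub>R Z))"
    by (rule mexp_intertwine) simp
  then have "V ** mexp (- (s *\<^sub>R Z)) ** Z = V ** Z ** mexp (- (s *\<^sub>R Z))" for V
    by (metis matrix_mul_assoc)
  show ?thesis
    unfolding orbit_def[abs_def]
    by (rule has_vector_derivative_rhs, rule has_vector_derivative_mult,
        rule has_vector_derivative_mult, rule mexp_has_vector_derivative,
        rule has_vector_derivative_const, rule mexp_has_vector_derivative_neg)
       (simp add: bracket_def matrix_mul_assoc)
qed

text \<open>For \<open>Z = \<i> X\<close> the parts of the orbit even and odd in \<open>s\<close>
  are formally cos(s ad X) Y and i sin(s ad X) Y; \<open>orbit_re\<close> and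
  \<open>orbit_im\<close> are thus the components of the orbit in g + i g.\<close>

definition orbit_re :: "'n cmat \<Rightarrow> 'n cmat \<Rightarrow> real \<Rightarrow> 'n cmat"
  where "orbit_re Z Y s = (1/2) *\<^sub>R (orbit Z Y s + orbit Z Y (- s))"

definition orbit_im :: "'n cmat \<Rightarrow> 'n cmat \<Rightarrow> real \<Rightarrow> 'n cmat"
  where "orbit_im Z Y s = (1/2) *\<^sub>R (- (\<i> *\<^sub>C (orbit Z Y s - orbit Z Y (- s))))"

lemma orbit_decomp: "orbit Z Y s = orbit_re Z Y s + \<i> *\<^sub>C orbit_im Z Y s"
proof -
  have "orbit_re Z Y s + \<i> *\<^sub>C orbit_im Z Y s = (1/2) *\<^sub>R orbit Z Y s + (1/2) *\<^sub>R orbit Z Y s"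
    by (simp add: orbit_re_def orbit_im_def mat_distribs)
  then show ?thesis by (simp flip: scaleR_add_left)
qed

lemma bracket_linear: "linear (bracket X)"
  by (rule linearI) (simp_all add: bracket_def mat_distribs algebra_simps)

lemma bracket_i: "bracket (\<i> *\<^sub>C X) Y = \<i> *\<^sub>C bracket X Y" "bracket X (\<i> *\<^sub>C Y) = \<i> *\<^sub>C bracket X Y"
  by (simp_all add: bracket_def cs.diff_right)

lemma orbit_neg_deriv:
  "((\<lambda>s. orbit Z Y (- s)) has_vector_derivative - bracket Z (orbit Z Y (- s))) (at s)"
  by (rule has_vector_derivative_compose_neg) (rule orbit_deriv)

lemma orbit_re_deriv:
  "(orbit_re (\<i> *\<^sub>C X) Y has_vector_derivative - bracket X (orbit_im (\<i> *\<^sub>C X) Y s)) (at s)"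
  unfolding orbit_re_def[abs_def]
  by (rule has_vector_derivative_rhs,
      rule bounded_linear.has_vector_derivative[OF bounded_linear_scaleR_right],
      rule has_vector_derivative_add, rule orbit_deriv, rule orbit_neg_deriv)
     (simp add: orbit_im_def bracket_i linear_cmul[OF bracket_linear] linear_diff[OF bracket_linear]
       linear_neg[OF bracket_linear] mat_distribs)

lemma orbit_im_deriv:
  "(orbit_im (\<i> *\<^sub>C X) Y has_vector_derivative bracket X (orbit_re (\<i> *\<^sub>C X) Y s)) (at s)"
  unfolding orbit_im_def[abs_def]
  by (rule has_vector_derivative_rhs,
      rule bounded_linear.has_vector_derivative[OF bounded_linear_scaleR_right],
      rule has_vector_derivative_minus, rule has_vector_derivative_cscale,
      rule has_vector_derivative_diff, rule orbit_deriv, rule orbit_neg_deriv)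
     (simp add: orbit_re_def bracket_i linear_cmul[OF bracket_linear] linear_add[OF bracket_linear]
       mat_distribs)

text \<open>The two parts solve a coupled linear system that preserves the product of two copies of
  the Lie algebra.\<close>

lemma orbit_parts_mem:
  assumes X: "X \<in> lie_algebra G" and Y: "Y \<in> lie_algebra G"
  shows "orbit_re (\<i> *\<^sub>C X) Y s \<in> lie_algebra G \<and> orbit_im (\<i> *\<^sub>C X) Y s \<in> lie_algebra G"
proof -
  define L where "L = (\<lambda>v :: 'n cmat \<times> 'n cmat. (- bracket X (snd v), bracket X (fst v)))"
  have L: "linear L"
    by (rule linearI) (simp_all add: L_def linear_add[OF bracket_linear] linear_cmul[OF bracket_linear])
  define M where "M = lie_algebra G \<times> lie_algebra G"
  have M: "subspace M"
    unfolding M_def using subspace_lie_algebra by (rule subspace_Times[OF _ subspace_lie_algebra])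
  have "(orbit_re (\<i> *\<^sub>C X) Y s, orbit_im (\<i> *\<^sub>C X) Y s) \<in> M"
  proof (rule flow_invariance_linear[where L = "\<lambda>_. L"])
    show "closed M" using M by (rule closed_subspace)
    show "(orbit_re (\<i> *\<^sub>C X) Y 0, orbit_im (\<i> *\<^sub>C X) Y 0) \<in> M"
      using Y lie_algebra_0
      by (simp add: M_def orbit_re_def orbit_im_def orbit_def flip: scaleR_add_left)
    show "((\<lambda>s. (orbit_re (\<i> *\<^sub>C X) Y s, orbit_im (\<i> *\<^sub>C X) Y s)) has_vector_derivative
        L (orbit_re (\<i> *\<^sub>C X) Y s, orbit_im (\<i> *\<^sub>C X) Y s)) (at s)" for s
      unfolding L_def
      by (intro has_vector_derivative_Pair has_vector_derivative_rhs[OF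
          has_vector_derivative_Pair[OF orbit_re_deriv orbit_im_deriv]]) simp
    show "\<exists>c. \<forall>y v. \<bar>y::real\<bar> \<le> R \<longrightarrow> norm (L v) \<le> c * norm v" for R
      using linear_bounded[OF L] by (metis mult.commute)
    show "\<exists>\<gamma>. \<gamma> 0 = m \<and> (\<forall>\<epsilon>. \<gamma> \<epsilon> \<in> M) \<and> (\<gamma> has_vector_derivative L m) (at 0)" if "m \<in> M" for m
    proof (intro exI[of _ "\<lambda>\<epsilon>. m + \<epsilon> *\<^sub>R L m"] conjI allI)
      have "L m \<in> M"
        using that lie_algebra_bracket[OF X] subspace_neg[OF subspace_lie_algebra]
        by (auto simp: M_def L_def)
      then show "m + \<epsilon> *\<^sub>R L m \<in> M" for \<epsilon>
        using that M by (intro subspace_add subspace_scale)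
      show "((\<lambda>\<epsilon>. m + \<epsilon> *\<^sub>R L m) has_vector_derivative L m) (at 0)"
        by (auto intro!: derivative_eq_intros)
    qed simp
  qed (use L in auto)
  then show ?thesis by (simp add: M_def)
qed

lemma continuous_on_orbit_parts:
  "continuous_on UNIV (orbit_re (\<i> *\<^sub>C X) Y)" "continuous_on UNIV (orbit_im (\<i> *\<^sub>C X) Y)"
  by (rule has_vector_derivative_imp_continuous_on, rule orbit_re_deriv,
      rule has_vector_derivative_imp_continuous_on, rule orbit_im_deriv)

text \<open>
  The derivative of \<open>mexp\<close> at \<open>\<i>X\<close> in the direction \<open>\<i>Y\<close>, multiplied by \<open>mexp (- \<i>X)\<close>, has the
  component \<open>mean_orbit X Y\<close> in \<open>\<i>\<gg>\<close>; positivity of the invariant form makes this an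
  isomorphism in \<open>Y\<close>.
\<close>

definition mean_orbit :: "'n cmat \<Rightarrow> 'n cmat \<Rightarrow> 'n cmat"
  where "mean_orbit X Y = antideriv (orbit_re (\<i> *\<^sub>C X) Y) 1"

lemma linear_mean_orbit: "linear (mean_orbit X)"
proof (rule linearI)
  fix Y Y' :: "'n cmat" and r :: real
  note d = antideriv_deriv[OF continuous_on_orbit_parts(1)]
    and z = antideriv_0[OF continuous_on_orbit_parts(1)]
  let ?F = "\<lambda>Y. antideriv (orbit_re (\<i> *\<^sub>C X) Y)"
  have add: "orbit_re (\<i> *\<^sub>C X) (Y + Y') = (\<lambda>s. orbit_re (\<i> *\<^sub>C X) Y s + orbit_re (\<i> *\<^sub>C X) Y' s)"
    by (rule ext) (simp add: orbit_re_def orbit_def mat_distribs algebra_simps)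
  have "antideriv (orbit_re (\<i> *\<^sub>C X) (Y + Y')) 1 = ?F Y 1 + ?F Y' 1"
    unfolding add by (rule antideriv_eqI) (auto intro!: has_vector_derivative_add d simp: z)
  then show "mean_orbit X (Y + Y') = mean_orbit X Y + mean_orbit X Y'"
    by (simp add: mean_orbit_def)
  have scale: "orbit_re (\<i> *\<^sub>C X) (r *\<^sub>R Y) = (\<lambda>s. r *\<^sub>R orbit_re (\<i> *\<^sub>C X) Y s)"
    by (rule ext) (simp add: orbit_re_def orbit_def mat_distribs mult.commute)
  have "antideriv (orbit_re (\<i> *\<^sub>C X) (r *\<^sub>R Y)) 1 = r *\<^sub>R ?F Y 1"
    unfolding scale
    by (rule antideriv_eqI)
       (auto intro!: bounded_linear.has_vector_derivative[OF bounded_linear_scaleR_right] d simp: z)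
  then show "mean_orbit X (r *\<^sub>R Y) = r *\<^sub>R mean_orbit X Y"
    by (simp add: mean_orbit_def)
qed

lemma mean_orbit_mem:
  assumes "X \<in> lie_algebra G" "Y \<in> lie_algebra G"
  shows "mean_orbit X Y \<in> lie_algebra G"
  unfolding mean_orbit_def
  by (rule antiderivative_in_subspace[OF subspace_lie_algebra, of _ "orbit_re (\<i> *\<^sub>C X) Y"])
     (auto simp: antideriv_0 continuous_on_orbit_parts lie_algebra_0 orbit_parts_mem[OF assms]
       intro: antideriv_deriv)

text \<open>Every point of the orbit pairs positively with \<open>Y\<close>, hence so does the even
  part, and the pairing with its antiderivative increases strictly.\<close>

lemma mean_orbit_pos:
  assumes X: "X \<in> lie_algebra G" and "Y \<noteq> 0"
  shows "form Y (mean_orbit X Y) > 0"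
proof -
  define A where "A = \<i> *\<^sub>C X"
  have A: "A \<in> isym" using X by (simp add: A_def isym_def)
  have pos: "form Y (orbit A Y s) > 0" for s
    unfolding orbit_def
    by (rule form_isym_pos) (auto intro: isym_scaleR isym_minus A simp: \<open>Y \<noteq> 0\<close>)
  have pos_re: "form Y (orbit_re A Y s) > 0" for s
    using pos[of s] pos[of "- s"] by (simp add: orbit_re_def form.scaleR_right form.add_right)
  have "form Y (antideriv (orbit_re A Y) 0) < form Y (antideriv (orbit_re A Y) 1)"
  proof (rule DERIV_pos_imp_increasing[of 0 1 "\<lambda>s. form Y (antideriv (orbit_re A Y) s)"])
    show "\<exists>y. ((\<lambda>s. form Y (antideriv (orbit_re A Y) s)) has_real_derivative y) (at s) \<and> 0 < y" for s
    proof (intro exI conjI)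
      show "((\<lambda>s. form Y (antideriv (orbit_re A Y) s)) has_real_derivative form Y (orbit_re A Y s)) (at s)"
        unfolding has_real_derivative_iff_has_vector_derivative A_def
        by (rule bounded_linear.has_vector_derivative[OF form.bounded_linear_right])
           (rule antideriv_deriv[OF continuous_on_orbit_parts(1)])
    qed (rule pos_re)
  qed simp
  then show ?thesis
    by (simp add: mean_orbit_def A_def antideriv_0 continuous_on_orbit_parts form.zero_right)
qed

lemma mean_orbit_surj:
  assumes X: "X \<in> lie_algebra G" and V: "V \<in> lie_algebra G"
  shows "\<exists>Y\<in>lie_algebra G. mean_orbit X Y = V"
proof -
  have "inj_on (mean_orbit X) (span (lie_algebra G))"
  proof (rule inj_onI)
    fix Y Y' assume "mean_orbit X Y = mean_orbit X Y'"
    then have "form (Y - Y') (mean_orbit X (Y - Y')) = 0"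
      by (simp add: linear_diff[OF linear_mean_orbit] form.zero_right)
    then show "Y = Y'"
      using mean_orbit_pos[OF X, of "Y - Y'"] by fastforce
  qed
  then have "dim (mean_orbit X ` lie_algebra G) = dim (lie_algebra G)"
    by (rule dim_image_eq[OF linear_mean_orbit])
  moreover have "mean_orbit X ` lie_algebra G \<subseteq> lie_algebra G"
    using mean_orbit_mem[OF X] by auto
  ultimately have "mean_orbit X ` lie_algebra G = lie_algebra G"
    using subspace_lie_algebra linear_mean_orbit
    by (intro subspace_dim_equal) (auto intro: linear_subspace_image)
  then show ?thesis using V by (metis imageE)
qed

text \<open>Tangency in Nagumo's theorem for the set G exp(i g). After conjugation by
  \<open>h\<close> the velocity is \<open>U0 + \<i> V\<close>; surjectivity of
  \<open>mean_orbit\<close> chooses the variation \<open>Y\<close> of the exponent that produces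
  \<open>V\<close>, and the factor in \<open>G\<close> takes up the rest.\<close>

lemma group_C_tangent:
  assumes h: "h \<in> G" and X: "X \<in> lie_algebra G" and C: "C \<in> lie_algebra_C G"
  shows "\<exists>U\<in>lie_algebra G. \<exists>Y\<in>lie_algebra G.
    ((\<lambda>\<epsilon>. h ** mexp (\<epsilon> *\<^sub>R U) ** mexp (\<i> *\<^sub>C X + \<epsilon> *\<^sub>R (\<i> *\<^sub>C Y))) has_vector_derivative
      C ** h ** mexp (\<i> *\<^sub>C X)) (at 0)"
proof -
  obtain U0 V where UV: "U0 \<in> lie_algebra G" "V \<in> lie_algebra G" "matrix_inv h ** C ** h = U0 + \<i> *\<^sub>C V"
    using lie_algebra_C_Ad'[OF h C] by (rule lie_algebra_CE)
  obtain Y where Y: "Y \<in> lie_algebra G" "mean_orbit X Y = V"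
    using mean_orbit_surj[OF X UV(2)] by blast
  define Jr where "Jr = antideriv (orbit_re (\<i> *\<^sub>C X) Y)"
  define Ji where "Ji = antideriv (orbit_im (\<i> *\<^sub>C X) Y)"
  define J where "J = (\<lambda>s. \<i> *\<^sub>C Jr s - Ji s)"
  \<comment> \<open>The derivative of the exponential also has the component \<open>- Ji 1\<close>
    in the Lie algebra, which the factor in \<open>G\<close> must compensate.\<close>
  define U where "U = U0 + Ji 1"
  note cont = continuous_on_orbit_parts
  have "Ji 1 \<in> lie_algebra G"
    unfolding Ji_def
    by (rule antiderivative_in_subspace[OF subspace_lie_algebra, of _ "orbit_im (\<i> *\<^sub>C X) Y"])
       (auto simp: antideriv_0 cont lie_algebra_0 orbit_parts_mem[OF X Y(1)] intro: antideriv_deriv)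
  then have U: "U \<in> lie_algebra G" using UV by (simp add: U_def lie_algebra_add)
  have "((\<lambda>\<epsilon>. mexp (\<i> *\<^sub>C X + \<epsilon> *\<^sub>R (\<i> *\<^sub>C Y))) has_vector_derivative J 1 ** mexp (\<i> *\<^sub>C X)) (at 0)"
  proof (rule mexp_directional_derivative)
    show "J 0 = 0" by (simp add: J_def Jr_def Ji_def antideriv_0 cont)
    show "(J has_vector_derivative mexp (s *\<^sub>R \<i> *\<^sub>C X) ** \<i> *\<^sub>C Y ** mexp (- (s *\<^sub>R \<i> *\<^sub>C X))) (at s)" for s
    proof -
      have "mexp (s *\<^sub>R \<i> *\<^sub>C X) ** \<i> *\<^sub>C Y ** mexp (- (s *\<^sub>R \<i> *\<^sub>C X)) = \<i> *\<^sub>C orbit (\<i> *\<^sub>C X) Y s"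
        by (simp add: orbit_def)
      also have "\<dots> = \<i> *\<^sub>C orbit_re (\<i> *\<^sub>C X) Y s - orbit_im (\<i> *\<^sub>C X) Y s"
        by (subst orbit_decomp) (simp add: cs.add_right)
      finally show ?thesis
        unfolding J_def Jr_def Ji_def
        by (simp only:) (intro has_vector_derivative_diff has_vector_derivative_cscale antideriv_deriv cont)
    qed
  qed
  then have "((\<lambda>\<epsilon>. h ** mexp (\<epsilon> *\<^sub>R U) ** mexp (\<i> *\<^sub>C X + \<epsilon> *\<^sub>R (\<i> *\<^sub>C Y))) has_vector_derivative
      h ** (J 1 + U) ** mexp (\<i> *\<^sub>C X)) (at 0)"
    by (intro has_vector_derivative_rhs[OF has_vector_derivative_mult[OF has_vector_derivative_mult[OF
        has_vector_derivative_const mexp_has_vector_derivative]]])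
       (auto simp: mat_distribs matrix_mul_assoc)
  moreover have "J 1 + U = matrix_inv h ** C ** h"
    using Y(2) by (simp add: J_def U_def Jr_def mean_orbit_def UV(3))
  then have "h ** (J 1 + U) = C ** h"
    using h by (simp add: matrix_mul_assoc)
  ultimately show ?thesis using U Y(1) by auto
qed

text \<open>A limit of elements of the complexified group may cease to be invertible; prescribing
  the inverse as well prevents this. Bounds on \<open>m\<close> and \<open>n\<close> bound both
  exponentials, hence \<open>X\<close>, so that all \<open>m j\<close> lie in one compact piece of
  the polar decomposition.\<close>

lemma group_C_inverse_closed: "closed {(m, n). m \<in> group_C G \<and> m ** n = mat 1}"
  unfolding closed_sequential_limits
proof (intro allI impI, elim conjE)
  fix x :: "nat \<Rightarrow> 'n cmat \<times> 'n cmat" and l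
  assume x: "\<forall>j. x j \<in> {(m, n). m \<in> group_C G \<and> m ** n = mat 1}" and lim: "x \<longlonglongrightarrow> l"
  define m n where "m = (\<lambda>j. fst (x j))" and "n = (\<lambda>j. snd (x j))"
  have lims: "m \<longlonglongrightarrow> fst l" "n \<longlonglongrightarrow> snd l"
    using lim unfolding m_def n_def by (auto intro: tendsto_intros)
  have "\<forall>j. \<exists>h X. h \<in> G \<and> X \<in> lie_algebra G \<and> m j = h ** mexp (\<i> *\<^sub>C X)"
    using x by (simp add: m_def group_C_def split_beta) blast
  then obtain h X where hX: "\<And>j. h j \<in> G" "\<And>j. X j \<in> lie_algebra G" "\<And>j. m j = h j ** mexp (\<i> *\<^sub>C X j)"
    by metis
  have mn: "m j ** n j = mat 1" for j using x by (simp add: m_def n_def split_beta)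
  have e1: "mexp (\<i> *\<^sub>C X j) = matrix_inv (h j) ** m j" for j
    using hX(1) by (simp add: hX(3) matrix_mul_assoc)
  have e2: "mexp (- (\<i> *\<^sub>C X j)) = n j ** h j" for j
  proof -
    have "n j ** m j = mat 1"
      using mn[of j] by (simp add: matrix_left_right_inverse[of "n j"])
    then have "n j ** h j ** mexp (\<i> *\<^sub>C X j) ** mexp (- (\<i> *\<^sub>C X j)) = mexp (- (\<i> *\<^sub>C X j))"
      by (simp add: hX(3) matrix_mul_assoc)
    then show ?thesis by simp
  qed
  have bdd: "bounded (range m)" "bounded (range n)"
    using lims convergent_imp_bounded by (auto simp: convergent_def)

  obtain r1 where r1: "\<And>g. g \<in> G \<Longrightarrow> norm g \<le> r1"
    using compact_imp_bounded[OF compact] unfolding bounded_iff by blast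
  obtain r2 where r2: "\<And>j. norm (m j) \<le> r2" using bdd(1) unfolding bounded_iff by auto
  obtain r3 where r3: "\<And>j. norm (n j) \<le> r3" using bdd(2) unfolding bounded_iff by auto
  obtain K where K: "K > 0" "\<And>(A :: 'n cmat) (B :: 'n cmat). norm (A ** B) \<le> norm A * norm B * K"
    using mm.pos_bounded[where ?'n = 'n] by auto
  obtain F where F: "F > 0" "\<And>A B. norm (form A B) \<le> norm A * norm B * F"
    using form.pos_bounded by auto
  obtain c where c: "c > 0" "\<And>Y. c * (norm Y)\<^sup>2 \<le> form Y Y"
    using form_coercive by auto
  define R where "R = r1 * r2 * K + r3 * r1 * K"
  \<comment> \<open>\<open>R\<close> bounds \<open>mexp A - mexp (- A)\<close>, and
    \<open>isym_bound\<close> turns this into a bound on \<open>A\<close>; \<open>F\<close> and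
    \<open>c\<close> compare the form with the norm.\<close>
  have "norm (\<i> *\<^sub>C X j) \<le> sqrt (R * R * F / c)" for j
  proof -
    define A where "A = \<i> *\<^sub>C X j"
    have A: "A \<in> isym" using hX by (simp add: A_def isym_def)
    have "0 \<le> r1" using r1[OF one_mem] norm_ge_zero order_trans by blast
    have "norm (mexp A) \<le> r1 * r2 * K"
      unfolding A_def e1 using K r1[OF inv_mem[OF hX(1)]] r2 \<open>0 \<le> r1\<close>
      by (intro order_trans[OF K(2)] mult_right_mono mult_mono) auto
    moreover have "0 \<le> r3" using r3 norm_ge_zero order_trans by blast
    then have "norm (mexp (- A)) \<le> r3 * r1 * K"
      unfolding A_def e2 using K r1[OF hX(1)] r3
      by (intro order_trans[OF K(2)] mult_right_mono mult_mono) auto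
    ultimately have W: "norm (mexp A - mexp (- A)) \<le> R"
      unfolding R_def by (intro order_trans[OF norm_triangle_ineq4] add_mono)
    have "c * (norm A)\<^sup>2 \<le> form (mexp A - mexp (- A)) (mexp A - mexp (- A))"
      using c(2)[of A] isym_bound[OF A] by linarith
    also have "\<dots> \<le> norm (mexp A - mexp (- A)) * norm (mexp A - mexp (- A)) * F"
      using F(2)[of "mexp A - mexp (- A)" "mexp A - mexp (- A)"] by simp
    also have "\<dots> \<le> R * R * F"
      using F W order_trans[OF norm_ge_zero W] by (intro mult_right_mono mult_mono) auto
    finally have "(norm A)\<^sup>2 \<le> R * R * F / c" using c by (simp add: field_simps)
    then show ?thesis unfolding A_def by (rule real_le_rsqrt)
  qed
  then have Xb: "norm (X j) \<le> sqrt (R * R * F / c)" for j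
    by (metis cscale_nth inner_cscale_i norm_eq_sqrt_inner)
  define S where "S = (\<lambda>(h, X). h ** mexp (\<i> *\<^sub>C X)) ` (G \<times> (cball 0 (sqrt (R * R * F / c)) \<inter> lie_algebra G))"
  have "compact S"
    unfolding S_def
  proof (intro compact_continuous_image compact_Times compact)
    show "compact (cball 0 (sqrt (R * R * F / c)) \<inter> lie_algebra G)"
      by (intro compact_Int_closed compact_cball closed_subspace subspace_lie_algebra)
    show "continuous_on (G \<times> (cball 0 (sqrt (R * R * F / c)) \<inter> lie_algebra G)) (\<lambda>(h, X). h ** mexp (\<i> *\<^sub>C X))"
      unfolding split_def
      by (intro mm.continuous_on continuous_on_compose2[OF continuous_on_mexp[of UNIV]]
          cs.continuous_on continuous_intros) auto
  qed
  moreover have "m j \<in> S" for j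
    unfolding S_def hX(3) using hX Xb by (intro image_eqI[of _ _ "(h j, X j)"]) auto
  ultimately have "fst l \<in> S"
    using lims(1) closed_sequentially compact_imp_closed by blast
  moreover have "S \<subseteq> group_C G" by (auto simp: S_def group_C_def)
  moreover have "(\<lambda>j. m j ** n j) \<longlonglongrightarrow> fst l ** snd l" by (intro mm.tendsto lims)
  then have "fst l ** snd l = mat 1" by (simp add: mn LIMSEQ_const_iff)
  ultimately show "l \<in> {(m, n). m \<in> group_C G \<and> m ** n = mat 1}" by (auto simp: split_beta)
qed

text \<open>The inverse \<open>n\<close> is carried along because the closed set consists of
  pairs.\<close>

theorem group_C_flow:
  assumes C: "\<And>y. C y \<in> lie_algebra_C G" "continuous_on UNIV C"
    and b: "\<And>y. (b has_vector_derivative C y ** b y) (at y)" "b 0 = mat 1"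
    and n: "\<And>y. (n has_vector_derivative - (n y ** C y)) (at y)" "n 0 = mat 1"
  shows "b y \<in> group_C G"
proof -
  define M where "M = {(m, n). m \<in> group_C G \<and> m ** n = (mat 1 :: 'n cmat)}"
  define L where "L = (\<lambda>y (v :: 'n cmat \<times> 'n cmat). (C y ** fst v, - (snd v ** C y)))"
  have "(b y, n y) \<in> M"
  proof (rule flow_invariance_linear[where L = L])
    show "closed M" unfolding M_def by (rule group_C_inverse_closed)
    have "mat 1 \<in> group_C G"
      unfolding group_C_def using one_mem lie_algebra_0 by force
    then show "(b 0, n 0) \<in> M" by (simp add: M_def b n)
    show "((\<lambda>y. (b y, n y)) has_vector_derivative L y (b y, n y)) (at y)" for y
      unfolding L_def using has_vector_derivative_Pair[OF b(1) n(1)] by simp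
    show "linear (L y)" for y
      by (rule linearI) (simp_all add: L_def mat_distribs)
    show "\<exists>c. \<forall>y v. \<bar>y\<bar> \<le> R \<longrightarrow> norm (L y v) \<le> c * norm v" for R
    proof -
      obtain c where c: "\<And>y v. \<bar>y\<bar> \<le> R \<Longrightarrow> norm (C y ** v) \<le> c * norm v"
        using mult_left_locally_bounded(1)[OF C(2), of R] by blast
      obtain c' where c': "\<And>y v. \<bar>y\<bar> \<le> R \<Longrightarrow> norm (v ** C y) \<le> c' * norm v"
        using mult_left_locally_bounded(2)[OF C(2), of R] by blast
      have "norm (L y v) \<le> (\<bar>c\<bar> + \<bar>c'\<bar>) * norm v" if "\<bar>y\<bar> \<le> R" for y v
      proof -
        have "norm (L y v) \<le> norm (C y ** fst v) + norm (snd v ** C y)"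
          using norm_Pair_le[of "C y ** fst v" "- (snd v ** C y)"] by (simp add: L_def)
        also have "\<dots> \<le> c * norm (fst v) + c' * norm (snd v)"
          using c[OF that] c'[OF that] by (intro add_mono)
        also have "\<dots> \<le> \<bar>c\<bar> * norm v + \<bar>c'\<bar> * norm v"
          using norm_fst_le[of "fst v" "snd v"] norm_snd_le[of "snd v" "fst v"]
          by (intro add_mono mult_mono) auto
        finally show ?thesis by (simp add: algebra_simps)
      qed
      then show ?thesis by blast
    qed
    show "\<exists>\<gamma>. \<gamma> 0 = v \<and> (\<forall>\<epsilon>. \<gamma> \<epsilon> \<in> M) \<and> (\<gamma> has_vector_derivative L y v) (at 0)" if v: "v \<in> M" for y v
    proof -
      obtain h X where h: "h \<in> G" and X: "X \<in> lie_algebra G" and m: "fst v = h ** mexp (\<i> *\<^sub>C X)"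
        using v by (auto simp: M_def group_C_def)
      obtain U Y where U: "U \<in> lie_algebra G" and Y: "Y \<in> lie_algebra G" and
        p': "((\<lambda>\<epsilon>. h ** mexp (\<epsilon> *\<^sub>R U) ** mexp (\<i> *\<^sub>C X + \<epsilon> *\<^sub>R (\<i> *\<^sub>C Y))) has_vector_derivative
          C y ** h ** mexp (\<i> *\<^sub>C X)) (at 0)"
        using group_C_tangent[OF h X C(1)] by blast
      define p where "p = (\<lambda>\<epsilon>. h ** mexp (\<epsilon> *\<^sub>R U) ** mexp (\<i> *\<^sub>C X + \<epsilon> *\<^sub>R (\<i> *\<^sub>C Y)))"
      define q where "q = (\<lambda>\<epsilon>. mexp (- (\<i> *\<^sub>C X) + \<epsilon> *\<^sub>R (- (\<i> *\<^sub>C Y))) ** mexp (- (\<epsilon> *\<^sub>R U)) ** matrix_inv h)"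
      have pq: "p \<epsilon> ** q \<epsilon> = mat 1" for \<epsilon>
      proof -
        define W where "W = \<i> *\<^sub>C X + \<epsilon> *\<^sub>R (\<i> *\<^sub>C Y)"
        have "p \<epsilon> = h ** mexp (\<epsilon> *\<^sub>R U) ** mexp W" by (simp add: p_def W_def)
        moreover have "q \<epsilon> = mexp (- W) ** mexp (- (\<epsilon> *\<^sub>R U)) ** matrix_inv h"
          by (simp add: q_def W_def)
        ultimately show ?thesis using h by (simp add: matrix_mul_assoc)
      qed
      \<comment> \<open>Only differentiability of \<open>q\<close> is wanted from this formula; the
        value of the derivative is then forced by differentiating
        \<open>p \<epsilon> ** q \<epsilon> = mat 1\<close>.\<close>
      define J where "J = antideriv (\<lambda>s. mexp (s *\<^sub>R (- (\<i> *\<^sub>C X))) ** (- (\<i> *\<^sub>C Y)) ** mexp (- (s *\<^sub>R (- (\<i> *\<^sub>C X)))))"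
      have cont: "continuous_on UNIV (\<lambda>s. mexp (s *\<^sub>R (- (\<i> *\<^sub>C X))) ** (- (\<i> *\<^sub>C Y)) ** mexp (- (s *\<^sub>R (- (\<i> *\<^sub>C X)))))"
        by (intro mm.continuous_on continuous_on_compose2[OF continuous_on_mexp[of UNIV]] continuous_intros) auto
      have "((\<lambda>\<epsilon>. mexp (- (\<i> *\<^sub>C X) + \<epsilon> *\<^sub>R (- (\<i> *\<^sub>C Y)))) has_vector_derivative J 1 ** mexp (- (\<i> *\<^sub>C X))) (at 0)"
        by (rule mexp_directional_derivative; unfold J_def)
           (rule antideriv_0[OF cont], rule antideriv_deriv[OF cont])
      from has_vector_derivative_mult[OF has_vector_derivative_mult[OF this mexp_has_vector_derivative_neg[of U]]
          has_vector_derivative_const[of "matrix_inv h"]]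
      obtain q' where q': "(q has_vector_derivative q') (at 0)"
        unfolding q_def by blast
      have p0: "p 0 = fst v" by (simp add: p_def m)
      have v1: "fst v ** snd v = mat 1" using v by (auto simp: M_def)
      then have v2: "snd v ** fst v = mat 1" by (simp add: matrix_left_right_inverse[of "snd v"])
      have q0: "q 0 = snd v"
        by (metis p0 pq v2 matrix_mul_assoc matrix_mul_lid matrix_mul_rid)
      have p'': "(p has_vector_derivative C y ** fst v) (at 0)"
        using p' by (simp add: p_def m matrix_mul_assoc)
      have "((\<lambda>\<epsilon>. p \<epsilon> ** q \<epsilon>) has_vector_derivative p 0 ** q' + (C y ** fst v) ** q 0) (at 0)"
        using p'' q' by (rule has_vector_derivative_mult)
      then have "((\<lambda>\<epsilon>::real. mat 1 :: 'n cmat) has_vector_derivative p 0 ** q' + (C y ** fst v) ** q 0) (at 0)"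
        by (simp add: pq)
      then have "p 0 ** q' + (C y ** fst v) ** q 0 = 0"
        by (rule vector_derivative_unique_at) (rule has_vector_derivative_const)
      then have "fst v ** q' = - C y"
        using v1 by (simp add: p0 q0 add_eq_0_iff flip: matrix_mul_assoc)
      then have "snd v ** (fst v ** q') = snd v ** (- C y)" by simp
      then have "q' = - (snd v ** C y)" using v2 by (simp add: matrix_mul_assoc)
      then have "((\<lambda>\<epsilon>. (p \<epsilon>, q \<epsilon>)) has_vector_derivative L y v) (at 0)"
        unfolding L_def using has_vector_derivative_Pair[OF p'' q'] by simp
      moreover have "(p \<epsilon>, q \<epsilon>) \<in> M" for \<epsilon>
      proof -
        have "p \<epsilon> = (h ** mexp (\<epsilon> *\<^sub>R U)) ** mexp (\<i> *\<^sub>C (X + \<epsilon> *\<^sub>R Y))"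
          by (simp add: p_def cs.add_right)
        moreover have "h ** mexp (\<epsilon> *\<^sub>R U) \<in> G" "X + \<epsilon> *\<^sub>R Y \<in> lie_algebra G"
          using h U X Y by (auto intro: mult_mem lie_algebraD lie_algebra_add lie_algebra_scaleR)
        ultimately have "p \<epsilon> \<in> group_C G" unfolding group_C_def by blast
        then show ?thesis by (simp add: M_def pq)
      qed
      ultimately show ?thesis
        by (intro exI[of _ "\<lambda>\<epsilon>. (p \<epsilon>, q \<epsilon>)"]) (simp add: p0 q0)
    qed
  qed
  then show ?thesis by (simp add: M_def)
qed

end

section \<open>Symmetric spaces\<close>

lemma group_GLn: "group (GLn :: 'n::finite cmat monoid)"
proof (rule groupI)
  fix x :: "'n cmat" assume "x \<in> carrier GLn"
  then show "\<exists>y\<in>carrier GLn. y \<otimes>\<^bsub>GLn\<^esub> x = \<one>\<^bsub>GLn\<^esub>"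
    unfolding GLn_def invertible_def by auto
qed (auto simp: GLn_def matrix_mul_assoc invertible_mult, auto simp: invertible_def intro: exI[of _ "mat 1"])

lemma subgroup_GLnD:
  assumes "subgroup H GLn"
  shows "mat 1 \<in> H" "\<And>g h. g \<in> H \<Longrightarrow> h \<in> H \<Longrightarrow> g ** h \<in> H" "\<And>g. g \<in> H \<Longrightarrow> invertible g"
    "\<And>g. g \<in> H \<Longrightarrow> matrix_inv g \<in> H"
proof -
  show 1: "\<And>g. g \<in> H \<Longrightarrow> invertible g"
    using subgroup.mem_carrier[OF assms] by (simp add: GLn_def)
  show "mat 1 \<in> H" using subgroup.one_closed[OF assms] by (simp add: GLn_def)
  show "g ** h \<in> H" if "g \<in> H" "h \<in> H" for g h
    using subgroup.m_closed[OF assms that] by (simp add: GLn_def)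
  fix g assume g: "g \<in> H"
  have "invertible (matrix_inv g)"
    unfolding invertible_def using invertible_matrix_inv[OF 1[OF g]] by auto
  then have "inv\<^bsub>GLn\<^esub> g = matrix_inv g"
    using invertible_matrix_inv[OF 1[OF g]] 1[OF g]
    by (intro group.inv_equality[OF group_GLn]) (auto simp: GLn_def)
  then show "matrix_inv g \<in> H" using subgroup.m_inv_closed[OF assms g] by simp
qed

lemma compact_matrix_groupI:
  assumes "subgroup G GLn" "compact G"
  shows "compact_matrix_group G"
  using subgroup_GLnD[OF assms(1)] assms(2) by unfold_locales auto

section \<open>Continuous one-parameter subgroups\<close>

lemma tendsto_det [tendsto_intros]:
  fixes f :: "'a \<Rightarrow> 'n::finite cmat"
  assumes "(f \<longlongrightarrow> L) F"
  shows "((\<lambda>x. det (f x)) \<longlongrightarrow> det L) F"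
  unfolding det_def by (intro tendsto_intros assms)

lemma has_vector_derivative_shift:
  fixes f :: "real \<Rightarrow> 'a::real_normed_vector"
  assumes "(f has_vector_derivative f') (at (s + a))"
  shows "((\<lambda>s. f (s + a)) has_vector_derivative f') (at s)"
proof -
  have "((\<lambda>s. s + a) has_vector_derivative 1) (at s)"
    by (auto intro!: derivative_eq_intros)
  from vector_diff_chain_at[OF this assms] show ?thesis by (simp add: o_def)
qed

text \<open>Smoothing by integration: for small \<open>\<delta>\<close> the integral of
  \<open>c\<close> over [0, \<delta>] is invertible, since divided by \<open>\<delta>\<close> it is
  close to the identity. Hence \<open>c\<close> is a difference of antiderivatives times a constant
  matrix, so it is differentiable and solves the exponential equation.\<close>

lemma one_parameter_subgroup:
  fixes c :: "real \<Rightarrow> 'n::finite cmat"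
  assumes cont: "continuous_on UNIV c" and c0: "c 0 = mat 1" and add: "\<And>s t. c (s + t) = c s ** c t"
  shows "\<exists>Y. \<forall>t. c t = mexp (t *\<^sub>R Y)"
proof -
  define \<Phi> where "\<Phi> = antideriv c"
  note \<Phi> = antideriv_deriv[OF cont, folded \<Phi>_def] and \<Phi>0 = antideriv_0[OF cont, folded \<Phi>_def]
  have "((\<lambda>h. (\<Phi> (0 + h) - \<Phi> 0) /\<^sub>R h) \<longlongrightarrow> c 0) (at 0)"
    using \<Phi>[of 0] by (rule has_vector_derivative_quotient)
  then have "((\<lambda>h. det (\<Phi> h /\<^sub>R h)) \<longlongrightarrow> det (mat 1 :: 'n cmat)) (at 0)"
    by (intro tendsto_det) (simp add: \<Phi>0 c0)
  then have "\<forall>\<^sub>F h in at 0. det (\<Phi> h /\<^sub>R h) \<noteq> 0"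
    by (rule tendsto_imp_eventually_ne) simp
  then obtain d where "d > 0" and d: "\<And>h. h \<noteq> 0 \<Longrightarrow> dist h 0 < d \<Longrightarrow> det (\<Phi> h /\<^sub>R h) \<noteq> 0"
    unfolding eventually_at by auto
  define \<delta> where "\<delta> = d / 2"
  have "det (\<Phi> \<delta> /\<^sub>R \<delta>) \<noteq> 0"
    using d[of \<delta>] \<open>d > 0\<close> by (simp add: \<delta>_def)
  then have "invertible (\<Phi> \<delta> /\<^sub>R \<delta>)" by (simp add: invertible_det_nz)
  then obtain B' where "(\<Phi> \<delta> /\<^sub>R \<delta>) ** B' = mat 1" by (auto simp: invertible_def)
  then have "\<Phi> \<delta> ** (inverse \<delta> *\<^sub>R B') = mat 1" by simp
  then obtain B where B: "\<Phi> \<delta> ** B = mat 1" by metis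
  have "c t ** \<Phi> s = \<Phi> (t + s) - \<Phi> t" for t s
  proof -
    have "((\<lambda>s. c t ** \<Phi> s - \<Phi> (t + s)) has_vector_derivative 0) (at s)" for s
    proof -
      have "((\<lambda>s. \<Phi> (t + s)) has_vector_derivative c (t + s)) (at s)"
        using has_vector_derivative_shift[of \<Phi> "c (t + s)" s t] \<Phi>[of "t + s"] by (simp add: add.commute)
      then show ?thesis
        by (intro has_vector_derivative_rhs[OF has_vector_derivative_diff[OF
              has_vector_derivative_mult[OF has_vector_derivative_const \<Phi>]]])
           (auto simp: add)
    qed
    from zero_derivative_imp_const[OF this, of s 0] show ?thesis
      by (simp add: \<Phi>0 algebra_simps)
  qed
  then have c_eq: "c t = (\<Phi> (t + \<delta>) - \<Phi> t) ** B" for t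
    using B by (metis matrix_mul_assoc matrix_mul_rid)
  have "(c has_vector_derivative c t ** ((c \<delta> - mat 1) ** B)) (at t)" for t
  proof -
    have "((\<lambda>t. \<Phi> (t + \<delta>)) has_vector_derivative c (t + \<delta>)) (at t)"
      using \<Phi> by (rule has_vector_derivative_shift)
    then have "((\<lambda>t. (\<Phi> (t + \<delta>) - \<Phi> t) ** B) has_vector_derivative (c (t + \<delta>) - c t) ** B) (at t)"
      by (intro has_vector_derivative_rhs[OF has_vector_derivative_mult[OF
            has_vector_derivative_diff[OF _ \<Phi>] has_vector_derivative_const]]) auto
    moreover have "(c (t + \<delta>) - c t) ** B = c t ** ((c \<delta> - mat 1) ** B)"
      by (simp add: add mat_distribs matrix_mul_assoc)
    ultimately show ?thesis by (simp flip: c_eq)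
  qed
  then have "c t = mexp (t *\<^sub>R ((c \<delta> - mat 1) ** B))" for t
    by (rule mexp_unique) (rule c0)
  then show ?thesis by (intro exI allI)
qed

section \<open>The automorphism and its differential\<close>

locale symmetric_space = compact_matrix_group G for G :: "'n::finite cmat set" +
  fixes \<tau> :: "'n cmat \<Rightarrow> 'n cmat" and k :: nat and K :: "'n cmat set"
  assumes \<tau>_mem: "g \<in> G \<Longrightarrow> \<tau> g \<in> G"
    and \<tau>_mult: "g \<in> G \<Longrightarrow> h \<in> G \<Longrightarrow> \<tau> (g ** h) = \<tau> g ** \<tau> h"
    and \<tau>_cont: "continuous_on G \<tau>"
    and k_ge_2: "2 \<le> k"
    and \<tau>_pow: "g \<in> G \<Longrightarrow> (\<tau> ^^ k) g = g"
    and K_subgroup: "subgroup K GLn"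
    and component_subset: "connected_component_set (fixed_points G \<tau>) (mat 1) \<subseteq> K"
    and K_fixed: "K \<subseteq> fixed_points G \<tau>"
begin

lemma K_G: "h \<in> K \<Longrightarrow> h \<in> G" and \<tau>_K: "h \<in> K \<Longrightarrow> \<tau> h = h"
  using K_fixed by (auto simp: fixed_points_def)

lemmas K_one = subgroup_GLnD(1)[OF K_subgroup]
  and K_mult = subgroup_GLnD(2)[OF K_subgroup]
  and K_inv = subgroup_GLnD(4)[OF K_subgroup]

lemma \<tau>_one [simp]: "\<tau> (mat 1) = mat 1"
proof -
  have "\<tau> (mat 1) ** \<tau> (mat 1) = \<tau> (mat 1)"
    using \<tau>_mult[OF one_mem one_mem] by simp
  then have "matrix_inv (\<tau> (mat 1)) ** \<tau> (mat 1) ** \<tau> (mat 1) = matrix_inv (\<tau> (mat 1)) ** \<tau> (mat 1)"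
    by (simp flip: matrix_mul_assoc)
  then show ?thesis using \<tau>_mem[OF one_mem] by simp
qed

lemma \<tau>_inv: "g \<in> G \<Longrightarrow> \<tau> (matrix_inv g) = matrix_inv (\<tau> g)"
  using \<tau>_mult[of g "matrix_inv g"] by (intro matrix_inv_unique[symmetric]) (simp add: inv_mem)

lemma \<tau>_mexp_ex:
  assumes "X \<in> lie_algebra G"
  shows "\<exists>Y. \<forall>t. \<tau> (mexp (t *\<^sub>R X)) = mexp (t *\<^sub>R Y)"
proof (rule one_parameter_subgroup)
  show "continuous_on UNIV (\<lambda>t. \<tau> (mexp (t *\<^sub>R X)))"
    by (rule continuous_on_compose2[OF \<tau>_cont])
       (auto intro!: continuous_on_compose2[OF continuous_on_mexp[of UNIV]] continuous_intros
         lie_algebraD assms)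
  show "\<tau> (mexp ((s + t) *\<^sub>R X)) = \<tau> (mexp (s *\<^sub>R X)) ** \<tau> (mexp (t *\<^sub>R X))" for s t
    unfolding mexp_add_scaleR by (intro \<tau>_mult lie_algebraD assms)
qed simp

lemma lie_aut_eqI:
  assumes "\<And>t. \<tau> (mexp (t *\<^sub>R X)) = mexp (t *\<^sub>R Y)"
  shows "lie_aut \<tau> X = Y"
  unfolding lie_aut_def assms
  using mexp_has_vector_derivative[of Y 0 UNIV] by (intro vector_derivative_at) simp

lemma \<tau>_mexp: "X \<in> lie_algebra G \<Longrightarrow> \<tau> (mexp (t *\<^sub>R X)) = mexp (t *\<^sub>R lie_aut \<tau> X)"
  using \<tau>_mexp_ex lie_aut_eqI by metis

lemma lie_aut_mem: "X \<in> lie_algebra G \<Longrightarrow> lie_aut \<tau> X \<in> lie_algebra G"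
  using \<tau>_mem[OF lie_algebraD] \<tau>_mexp by (simp add: lie_algebra_def)

text \<open>Nagumo's theorem applied to the graph of \<open>\<tau>\<close>, which is compact. It
  keeps a solution in \<open>G\<close> and identifies its image under \<open>\<tau>\<close> at the
  same time; additivity of the differential and the twisting condition of the extended frame both
  rest on it.\<close>

lemma \<tau>_flow:
  assumes f: "\<And>y. (f has_vector_derivative f y ** B y) (at y)" "f 0 = mat 1"
    and f': "\<And>y. (f' has_vector_derivative f' y ** B' y) (at y)" "f' 0 = mat 1"
    and B: "continuous_on UNIV B" "continuous_on UNIV B'"
    and tangent: "\<And>y. \<exists>\<gamma>. \<gamma> 0 = mat 1 \<and> (\<forall>\<epsilon>. \<gamma> \<epsilon> \<in> G) \<and> (\<gamma> has_vector_derivative B y) (at 0) \<and>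
      ((\<lambda>\<epsilon>. \<tau> (\<gamma> \<epsilon>)) has_vector_derivative B' y) (at 0)"
  shows "f y \<in> G \<and> f' y = \<tau> (f y)"
proof -
  define M where "M = (\<lambda>g. (g, \<tau> g)) ` G"
  define L where "L = (\<lambda>y (v :: 'n cmat \<times> 'n cmat). (fst v ** B y, snd v ** B' y))"
  have "(f y, f' y) \<in> M"
  proof (rule flow_invariance_linear[where L = L])
    show "closed M"
      unfolding M_def
      by (intro compact_imp_closed compact_continuous_image compact continuous_intros \<tau>_cont)
    show "(f 0, f' 0) \<in> M"
      unfolding M_def by (rule image_eqI[of _ _ "mat 1"]) (simp_all add: f f')
    show "((\<lambda>y. (f y, f' y)) has_vector_derivative L y (f y, f' y)) (at y)" for y
      unfolding L_def using has_vector_derivative_Pair[OF f(1) f'(1)] by simp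
    show "linear (L y)" for y
      by (rule linearI) (simp_all add: L_def mat_distribs)
    show "\<exists>c. \<forall>y v. \<bar>y\<bar> \<le> R \<longrightarrow> norm (L y v) \<le> c * norm v" for R
    proof -
      obtain c where c: "\<And>y v. \<bar>y\<bar> \<le> R \<Longrightarrow> norm (v ** B y) \<le> c * norm v"
        using mult_left_locally_bounded(2)[OF B(1), of R] by blast
      obtain c' where c': "\<And>y v. \<bar>y\<bar> \<le> R \<Longrightarrow> norm (v ** B' y) \<le> c' * norm v"
        using mult_left_locally_bounded(2)[OF B(2), of R] by blast
      have "norm (L y v) \<le> (\<bar>c\<bar> + \<bar>c'\<bar>) * norm v" if "\<bar>y\<bar> \<le> R" for y v
      proof -
        have "norm (L y v) \<le> norm (fst v ** B y) + norm (snd v ** B' y)"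
          using norm_Pair_le[of "fst v ** B y" "snd v ** B' y"] by (simp add: L_def)
        also have "\<dots> \<le> c * norm (fst v) + c' * norm (snd v)"
          using c[OF that] c'[OF that] by (intro add_mono)
        also have "\<dots> \<le> \<bar>c\<bar> * norm v + \<bar>c'\<bar> * norm v"
          using norm_fst_le[of "fst v" "snd v"] norm_snd_le[of "snd v" "fst v"]
          by (intro add_mono mult_mono) auto
        finally show ?thesis by (simp add: algebra_simps)
      qed
      then show ?thesis by blast
    qed
    show "\<exists>\<gamma>. \<gamma> 0 = v \<and> (\<forall>\<epsilon>. \<gamma> \<epsilon> \<in> M) \<and> (\<gamma> has_vector_derivative L y v) (at 0)" if v: "v \<in> M" for y v
    proof -
      obtain m where m: "m \<in> G" "v = (m, \<tau> m)" using v by (auto simp: M_def)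
      obtain \<gamma> where \<gamma>: "\<gamma> 0 = mat 1" "\<And>\<epsilon>. \<gamma> \<epsilon> \<in> G" "(\<gamma> has_vector_derivative B y) (at 0)"
        "((\<lambda>\<epsilon>. \<tau> (\<gamma> \<epsilon>)) has_vector_derivative B' y) (at 0)"
        using tangent[of y] by blast
      have "((\<lambda>\<epsilon>. (m ** \<gamma> \<epsilon>, \<tau> m ** \<tau> (\<gamma> \<epsilon>))) has_vector_derivative
          (m ** B y + 0 ** \<gamma> 0, \<tau> m ** B' y + 0 ** \<tau> (\<gamma> 0))) (at 0)"
        by (intro has_vector_derivative_Pair has_vector_derivative_mult \<gamma> has_vector_derivative_const)
      then have "((\<lambda>\<epsilon>. (m ** \<gamma> \<epsilon>, \<tau> m ** \<tau> (\<gamma> \<epsilon>))) has_vector_derivative L y v) (at 0)"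
        by (simp add: L_def m)
      moreover have "(m ** \<gamma> \<epsilon>, \<tau> m ** \<tau> (\<gamma> \<epsilon>)) \<in> M" for \<epsilon>
        unfolding M_def using m \<gamma>(2) by (intro image_eqI[of _ _ "m ** \<gamma> \<epsilon>"]) (auto simp: \<tau>_mult mult_mem)
      ultimately show ?thesis
        by (intro exI[of _ "\<lambda>\<epsilon>. (m ** \<gamma> \<epsilon>, \<tau> m ** \<tau> (\<gamma> \<epsilon>))"]) (simp add: m \<gamma>(1))
    qed
  qed
  then show ?thesis by (auto simp: M_def)
qed

lemma lie_aut_scaleR: "X \<in> lie_algebra G \<Longrightarrow> lie_aut \<tau> (r *\<^sub>R X) = r *\<^sub>R lie_aut \<tau> X"
  by (rule lie_aut_eqI) (use \<tau>_mexp[of X "_ * r"] in simp)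

lemma lie_aut_add:
  assumes X: "X \<in> lie_algebra G" and Y: "Y \<in> lie_algebra G"
  shows "lie_aut \<tau> (X + Y) = lie_aut \<tau> X + lie_aut \<tau> Y"
proof (rule lie_aut_eqI)
  fix t
  have "mexp (t *\<^sub>R (X + Y)) \<in> G \<and> mexp (t *\<^sub>R (lie_aut \<tau> X + lie_aut \<tau> Y)) = \<tau> (mexp (t *\<^sub>R (X + Y)))"
  proof (rule \<tau>_flow[where B = "\<lambda>_. X + Y" and B' = "\<lambda>_. lie_aut \<tau> X + lie_aut \<tau> Y"])
    have *: "((\<lambda>\<epsilon>. mexp (\<epsilon> *\<^sub>R X) ** mexp (\<epsilon> *\<^sub>R Y)) has_vector_derivative X + Y) (at 0)" for X Y :: "'n cmat"
      by (rule has_vector_derivative_rhs, rule has_vector_derivative_mult,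
          rule mexp_has_vector_derivative, rule mexp_has_vector_derivative) simp
    show "\<exists>\<gamma>. \<gamma> 0 = mat 1 \<and> (\<forall>\<epsilon>. \<gamma> \<epsilon> \<in> G) \<and> (\<gamma> has_vector_derivative X + Y) (at 0) \<and>
        ((\<lambda>\<epsilon>. \<tau> (\<gamma> \<epsilon>)) has_vector_derivative lie_aut \<tau> X + lie_aut \<tau> Y) (at 0)"
      using *[of X Y] *[of "lie_aut \<tau> X" "lie_aut \<tau> Y"]
      by (intro exI[of _ "\<lambda>\<epsilon>. mexp (\<epsilon> *\<^sub>R X) ** mexp (\<epsilon> *\<^sub>R Y)"])
         (auto simp: \<tau>_mult \<tau>_mexp lie_algebraD X Y mult_mem)
  qed (auto intro: mexp_has_vector_derivative')
  then show "\<tau> (mexp (t *\<^sub>R (X + Y))) = mexp (t *\<^sub>R (lie_aut \<tau> X + lie_aut \<tau> Y))" by simp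
qed

lemma ex_linear_extension: "\<exists>T. linear T \<and> (\<forall>X\<in>lie_algebra G. T X = lie_aut \<tau> X)"
proof -
  obtain S where S: "S \<subseteq> lie_algebra G" "independent S" "lie_algebra G \<subseteq> span S"
    using basis_exists[of "lie_algebra G"] by metis
  obtain T where T: "linear T" "\<And>X. X \<in> S \<Longrightarrow> T X = lie_aut \<tau> X"
    using linear_independent_extend[OF S(2), of "lie_aut \<tau>"] by auto
  have "X \<in> lie_algebra G \<and> T X = lie_aut \<tau> X" if "X \<in> span S" for X
    using that
  proof (induction rule: span_induct_alt)
    case base
    show ?case
      using lie_aut_scaleR[OF lie_algebra_0, of 0] linear_0[OF T(1)] by (simp add: lie_algebra_0)
  next
    case (step c x y)
    then have x: "x \<in> lie_algebra G" using S(1) by auto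
    then have "lie_aut \<tau> (c *\<^sub>R x + y) = c *\<^sub>R lie_aut \<tau> x + lie_aut \<tau> y"
      using step by (simp add: lie_aut_add lie_algebra_scaleR lie_aut_scaleR)
    then show ?case
      using step x T by (simp add: linear_add linear_cmul lie_algebra_add lie_algebra_scaleR)
  qed
  then show ?thesis using T S(3) by blast
qed

text \<open>A linear extension of \<open>lie_aut \<tau>\<close> to all matrices, so that linearity
  applies without membership conditions. Off the Lie algebra the choice is arbitrary.\<close>

definition d\<tau> :: "'n cmat \<Rightarrow> 'n cmat"
  where "d\<tau> = (SOME T. linear T \<and> (\<forall>X\<in>lie_algebra G. T X = lie_aut \<tau> X))"

lemma linear_d\<tau>: "linear d\<tau>" and d\<tau>_eq: "X \<in> lie_algebra G \<Longrightarrow> lie_aut \<tau> X = d\<tau> X"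
  using someI_ex[OF ex_linear_extension] by (auto simp: d\<tau>_def)

lemma d\<tau>_mem: "X \<in> lie_algebra G \<Longrightarrow> d\<tau> X \<in> lie_algebra G"
  using lie_aut_mem d\<tau>_eq by simp

lemma \<tau>_exp: "X \<in> lie_algebra G \<Longrightarrow> \<tau> (mexp (t *\<^sub>R X)) = mexp (t *\<^sub>R d\<tau> X)"
  using \<tau>_mexp d\<tau>_eq by simp

lemma d\<tau>_eqI:
  assumes "X \<in> lie_algebra G" "\<And>t. \<tau> (mexp (t *\<^sub>R X)) = mexp (t *\<^sub>R Y)"
  shows "d\<tau> X = Y"
  using lie_aut_eqI[OF assms(2)] d\<tau>_eq[OF assms(1)] by simp

lemma d\<tau>_Ad:
  assumes g: "g \<in> G" and X: "X \<in> lie_algebra G"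
  shows "d\<tau> (g ** X ** matrix_inv g) = \<tau> g ** d\<tau> X ** matrix_inv (\<tau> g)"
proof (rule d\<tau>_eqI[OF lie_algebra_Ad[OF assms]])
  fix t
  have "mexp (t *\<^sub>R (g ** X ** matrix_inv g)) = g ** mexp (t *\<^sub>R X) ** matrix_inv g"
    using mexp_conj[of "matrix_inv g" g "t *\<^sub>R X"] g by simp
  then have "\<tau> (mexp (t *\<^sub>R (g ** X ** matrix_inv g))) = \<tau> g ** mexp (t *\<^sub>R d\<tau> X) ** matrix_inv (\<tau> g)"
    using g X by (simp add: \<tau>_mult mult_mem inv_mem lie_algebraD \<tau>_exp \<tau>_inv)
  also have "\<dots> = mexp (t *\<^sub>R (\<tau> g ** d\<tau> X ** matrix_inv (\<tau> g)))"
    using mexp_conj[of "matrix_inv (\<tau> g)" "\<tau> g" "t *\<^sub>R d\<tau> X"] g by (simp add: \<tau>_mem)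
  finally show "\<tau> (mexp (t *\<^sub>R (g ** X ** matrix_inv g))) =
      mexp (t *\<^sub>R (\<tau> g ** d\<tau> X ** matrix_inv (\<tau> g)))" .
qed

lemma d\<tau>_bracket:
  assumes X: "X \<in> lie_algebra G" and Y: "Y \<in> lie_algebra G"
  shows "d\<tau> (bracket X Y) = bracket (d\<tau> X) (d\<tau> Y)"
proof -
  have "d\<tau> (mexp (t *\<^sub>R X) ** Y ** mexp (- (t *\<^sub>R X))) = mexp (t *\<^sub>R d\<tau> X) ** d\<tau> Y ** mexp (- (t *\<^sub>R d\<tau> X))" for t
    using d\<tau>_Ad[OF lie_algebraD[OF X] Y, of t] X
    by (simp add: \<tau>_exp mexp_neg_inv lie_algebra_scaleR d\<tau>_mem)
  moreover have "((\<lambda>t. d\<tau> (mexp (t *\<^sub>R X) ** Y ** mexp (- (t *\<^sub>R X)))) has_vector_derivative d\<tau> (bracket X Y)) (at 0)"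
    by (rule bounded_linear.has_vector_derivative[OF
          linear_conv_bounded_linear[THEN iffD1, OF linear_d\<tau>] Ad_deriv])
  ultimately have "((\<lambda>t. mexp (t *\<^sub>R d\<tau> X) ** d\<tau> Y ** mexp (- (t *\<^sub>R d\<tau> X))) has_vector_derivative d\<tau> (bracket X Y)) (at 0)"
    by simp
  then show ?thesis by (rule vector_derivative_unique_at) (rule Ad_deriv)
qed

lemma d\<tau>_pow_mem: "X \<in> lie_algebra G \<Longrightarrow> (d\<tau> ^^ j) X \<in> lie_algebra G"
  by (induction j) (auto intro: d\<tau>_mem)

lemma linear_d\<tau>_pow: "linear (d\<tau> ^^ j)"
proof (induction j)
  case 0
  then show ?case using linear_id by (simp add: id_def)
next
  case (Suc j)
  then show ?case using linear_compose[OF Suc linear_d\<tau>] by (simp add: o_def)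
qed

lemma d\<tau>_pow_k:
  assumes X: "X \<in> lie_algebra G"
  shows "(d\<tau> ^^ k) X = X"
proof -
  have "(\<tau> ^^ j) (mexp (t *\<^sub>R X)) = mexp (t *\<^sub>R (d\<tau> ^^ j) X)" for j t
    by (induction j) (auto simp: \<tau>_exp d\<tau>_pow_mem X)
  then have "mexp (t *\<^sub>R (d\<tau> ^^ k) X) = mexp (t *\<^sub>R X)" for t
    using \<tau>_pow[OF lie_algebraD[OF X]] by metis
  then have "((\<lambda>t. mexp (t *\<^sub>R X)) has_vector_derivative (d\<tau> ^^ k) X) (at 0)"
    using mexp_has_vector_derivative[of "(d\<tau> ^^ k) X" 0 UNIV] by simp
  moreover have "((\<lambda>t. mexp (t *\<^sub>R X)) has_vector_derivative X) (at 0)"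
    using mexp_has_vector_derivative[of X 0 UNIV] by simp
  ultimately show ?thesis by (rule vector_derivative_unique_at)
qed

lemma mexp_line_unique:
  assumes "\<And>t. mexp (t *\<^sub>R X) = mexp (t *\<^sub>R Y)"
  shows "X = Y"
proof -
  have "((\<lambda>t. mexp (t *\<^sub>R X)) has_vector_derivative Z) (at 0)" if "\<And>t. mexp (t *\<^sub>R X) = mexp (t *\<^sub>R Z)" for Z
    using mexp_has_vector_derivative[of Z 0 UNIV] that by simp
  from this[OF refl] this[OF assms] show ?thesis by (rule vector_derivative_unique_at)
qed

lemma fixed_mexp_iff:
  assumes "X \<in> lie_algebra G"
  shows "(\<forall>t. mexp (t *\<^sub>R X) \<in> fixed_points G \<tau>) \<longleftrightarrow> d\<tau> X = X"
  using assms mexp_line_unique[of "d\<tau> X" X] by (auto simp: fixed_points_def lie_algebraD \<tau>_exp)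

lemma one_parameter_in_component:
  assumes "\<And>t. mexp (t *\<^sub>R X) \<in> S"
  shows "mexp (t *\<^sub>R X) \<in> connected_component_set S (mat 1)"
proof -
  have "connected (range (\<lambda>t. mexp (t *\<^sub>R X)))"
    by (intro connected_continuous_image continuous_on_compose2[OF continuous_on_mexp[of UNIV]]
        continuous_intros connected_UNIV) auto
  moreover have "mat 1 \<in> range (\<lambda>t. mexp (t *\<^sub>R X))"
    by (rule range_eqI[of _ _ 0]) simp
  ultimately show ?thesis
    using assms by (auto simp: intro!: connected_componentI)
qed

text \<open>A one-parameter subgroup of fixed points is connected to the identity, so it lies in the
  component contained in \<open>K\<close>.\<close>

lemma lie_algebra_K: "lie_algebra K = {X \<in> lie_algebra G. d\<tau> X = X}"
proof (rule Set.set_eqI, rule iffI)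
  fix X assume "X \<in> lie_algebra K"
  then have *: "\<And>t. mexp (t *\<^sub>R X) \<in> fixed_points G \<tau>"
    using K_fixed by (auto simp: lie_algebra_def)
  then have "X \<in> lie_algebra G" by (auto simp: lie_algebra_def fixed_points_def)
  with * show "X \<in> {X \<in> lie_algebra G. d\<tau> X = X}" using fixed_mexp_iff by auto
next
  fix X assume "X \<in> {X \<in> lie_algebra G. d\<tau> X = X}"
  then have "\<And>t. mexp (t *\<^sub>R X) \<in> fixed_points G \<tau>" using fixed_mexp_iff by auto
  then show "X \<in> lie_algebra K"
    unfolding lie_algebra_def
    by (intro CollectI allI subsetD[OF component_subset] one_parameter_in_component)
qed

section \<open>Eigenspaces and the splitting into k and m\<close>

lemma lie_aut_C_eq:
  assumes X: "X \<in> lie_algebra G" and Y: "Y \<in> lie_algebra G"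
  shows "lie_aut_C G \<tau> (X + \<i> *\<^sub>C Y) = d\<tau> X + \<i> *\<^sub>C d\<tau> Y"
  unfolding lie_aut_C_def
proof (rule the_equality)
  show "\<exists>X'\<in>lie_algebra G. \<exists>Y'\<in>lie_algebra G. X + \<i> *\<^sub>C Y = X' + \<i> *\<^sub>C Y' \<and>
      d\<tau> X + \<i> *\<^sub>C d\<tau> Y = lie_aut \<tau> X' + \<i> *\<^sub>C lie_aut \<tau> Y'"
    using X Y d\<tau>_eq by (intro bexI[of _ X] bexI[of _ Y]) auto
next
  fix W assume "\<exists>X'\<in>lie_algebra G. \<exists>Y'\<in>lie_algebra G. X + \<i> *\<^sub>C Y = X' + \<i> *\<^sub>C Y' \<and>
      W = lie_aut \<tau> X' + \<i> *\<^sub>C lie_aut \<tau> Y'"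
  then show "W = d\<tau> X + \<i> *\<^sub>C d\<tau> Y"
    using lie_algebra_C_unique[OF X Y] d\<tau>_eq X Y by metis
qed

lemma aut_C_eq:
  assumes h: "h \<in> G" and X: "X \<in> lie_algebra G"
  shows "aut_C G \<tau> (h ** mexp (\<i> *\<^sub>C X)) = \<tau> h ** mexp (\<i> *\<^sub>C d\<tau> X)"
  unfolding aut_C_def
proof (rule the_equality)
  show "\<exists>h'\<in>G. \<exists>X'\<in>lie_algebra G. h ** mexp (\<i> *\<^sub>C X) = h' ** mexp (\<i> *\<^sub>C X') \<and>
      \<tau> h ** mexp (\<i> *\<^sub>C d\<tau> X) = \<tau> h' ** mexp (\<i> *\<^sub>C lie_aut \<tau> X')"
    using h X d\<tau>_eq by (intro bexI[of _ h] bexI[of _ X]) auto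
next
  fix w assume "\<exists>h'\<in>G. \<exists>X'\<in>lie_algebra G. h ** mexp (\<i> *\<^sub>C X) = h' ** mexp (\<i> *\<^sub>C X') \<and>
      w = \<tau> h' ** mexp (\<i> *\<^sub>C lie_aut \<tau> X')"
  then show "w = \<tau> h ** mexp (\<i> *\<^sub>C d\<tau> X)"
    using polar_unique[OF h _ X] d\<tau>_eq X by metis
qed

lemma complex_cscale:
  "c *\<^sub>C (X + \<i> *\<^sub>C Y) = (Re c *\<^sub>R X - Im c *\<^sub>R Y) + \<i> *\<^sub>C (Im c *\<^sub>R X + Re c *\<^sub>R Y)"
  by (simp add: vec_eq_iff complex_eq_iff algebra_simps)

lemma eigenspace_iff:
  assumes X: "X \<in> lie_algebra G" and Y: "Y \<in> lie_algebra G"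
  shows "X + \<i> *\<^sub>C Y \<in> eigenspace G \<tau> k l \<longleftrightarrow>
    d\<tau> X = Re (omega k powi l) *\<^sub>R X - Im (omega k powi l) *\<^sub>R Y \<and>
    d\<tau> Y = Im (omega k powi l) *\<^sub>R X + Re (omega k powi l) *\<^sub>R Y"
proof -
  define c where "c = omega k powi l"
  have "X + \<i> *\<^sub>C Y \<in> eigenspace G \<tau> k l \<longleftrightarrow> d\<tau> X + \<i> *\<^sub>C d\<tau> Y =
      (Re c *\<^sub>R X - Im c *\<^sub>R Y) + \<i> *\<^sub>C (Im c *\<^sub>R X + Re c *\<^sub>R Y)"
    using lie_algebra_CI[OF X Y]
    by (simp add: eigenspace_def lie_aut_C_eq[OF X Y] c_def complex_cscale del: cs.add_right)
  also have "\<dots> \<longleftrightarrow> d\<tau> X = Re c *\<^sub>R X - Im c *\<^sub>R Y \<and> d\<tau> Y = Im c *\<^sub>R X + Re c *\<^sub>R Y"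
  proof
    assume eq: "d\<tau> X + \<i> *\<^sub>C d\<tau> Y =
      (Re c *\<^sub>R X - Im c *\<^sub>R Y) + \<i> *\<^sub>C (Im c *\<^sub>R X + Re c *\<^sub>R Y)"
    show "d\<tau> X = Re c *\<^sub>R X - Im c *\<^sub>R Y \<and> d\<tau> Y = Im c *\<^sub>R X + Re c *\<^sub>R Y"
      by (rule lie_algebra_C_unique[OF _ _ _ _ eq])
         (auto intro!: d\<tau>_mem X Y lie_algebra_add lie_algebra_scaleR
           subspace_diff[OF subspace_lie_algebra])
  qed simp
  finally show ?thesis by (simp add: c_def)
qed

text \<open>Averaging over the powers of \<open>d\<tau>\<close>: on the Lie algebra this is the
  projection onto k along m.\<close>

definition avg :: "'n cmat \<Rightarrow> 'n cmat"
  where "avg X = (1 / k) *\<^sub>R (\<Sum>j<k. (d\<tau> ^^ j) X)"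

lemma linear_avg: "linear avg"
  unfolding avg_def[abs_def]
  by (rule linearI)
     (simp_all add: linear_add[OF linear_d\<tau>_pow] linear_cmul[OF linear_d\<tau>_pow] sum.distrib
       scaleR_add_right scaleR_sum_right mult.commute)

lemma avg_mem: "X \<in> lie_algebra G \<Longrightarrow> avg X \<in> lie_algebra G"
  unfolding avg_def
  by (intro lie_algebra_scaleR subspace_sum[OF subspace_lie_algebra] d\<tau>_pow_mem)

lemma sum_shift:
  fixes f :: "nat \<Rightarrow> 'a::ab_group_add"
  assumes "f k = f 0"
  shows "(\<Sum>j<k. f (Suc j)) = (\<Sum>j<k. f j)"
  using sum.lessThan_Suc_shift[of f k] sum.lessThan_Suc[of f k] assms by simp

lemma d\<tau>_avg: "X \<in> lie_algebra G \<Longrightarrow> d\<tau> (avg X) = avg X"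
  unfolding avg_def
  using sum_shift[of "\<lambda>j. (d\<tau> ^^ j) X"] d\<tau>_pow_k
  by (simp add: linear_cmul[OF linear_d\<tau>] linear_sum[OF linear_d\<tau>])

lemma avg_fixed:
  assumes "d\<tau> X = X"
  shows "avg X = X"
proof -
  have "(d\<tau> ^^ j) X = X" for j by (induction j) (auto simp: assms)
  then show ?thesis using k_ge_2 by (simp add: avg_def sum_constant_scaleR del: sum_constant)
qed

lemma omega_pow_k: "omega k ^ k = 1"
  using k_ge_2 by (simp add: omega_def Complex.DeMoivre)

lemma omega_nz [simp]: "omega k \<noteq> 0"
  by (simp add: omega_def)

lemma omega_pow_ne_1:
  assumes "0 < l" "l < k"
  shows "omega k ^ l \<noteq> 1"
proof
  assume "omega k ^ l = 1"
  then have "cis (real l * (2 * pi / real k)) = 1" by (simp add: omega_def Complex.DeMoivre)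
  then have "cos (real l * (2 * pi / real k)) = 1" by (simp add: complex_eq_iff)
  then obtain n :: int where "real l * (2 * pi / real k) = of_int n * 2 * pi"
    unfolding cos_one_2pi_int by blast
  then have "real l = of_int n * real k" using k_ge_2 by (simp add: field_simps)
  then have eq: "int l = n * int k" by (metis of_int_eq_iff of_int_mult of_int_of_nat_eq)
  have "n > 0" using eq assms by (metis of_nat_0_less_iff zero_less_mult_iff of_nat_0_le_iff not_le)
  then have "int k \<le> n * int k" using k_ge_2 by simp
  then show False using eq assms by linarith
qed

lemma geometric_omega:
  assumes "0 < l" "l < k"
  shows "(\<Sum>j<k. (omega k ^ l) ^ j) = 0" "(\<Sum>j<k. (inverse (omega k) ^ l) ^ j) = 0"
proof -
  have 1: "omega k ^ l \<noteq> 1" using omega_pow_ne_1[OF assms] .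
  have 2: "inverse (omega k) ^ l \<noteq> 1"
    using 1 by (metis inverse_1 inverse_inverse_eq power_inverse)
  have 3: "(omega k ^ l) ^ k = 1" "(inverse (omega k) ^ l) ^ k = 1"
    by (simp_all add: power_inverse flip: power_mult) (simp_all add: mult.commute power_mult omega_pow_k)
  show "(\<Sum>j<k. (omega k ^ l) ^ j) = 0" "(\<Sum>j<k. (inverse (omega k) ^ l) ^ j) = 0"
    using geometric_sum[OF 1, of k] geometric_sum[OF 2, of k] 3 by auto
qed

lemma eigen_avg:
  assumes "0 < l" "l < k" and X: "X \<in> lie_algebra G" and Y: "Y \<in> lie_algebra G"
    and eig: "X + \<i> *\<^sub>C Y \<in> eigenspace G \<tau> k (int l)"
  shows "avg X = 0"
proof -
  define c where "c = omega k ^ l"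
  have XY: "d\<tau> X = Re c *\<^sub>R X - Im c *\<^sub>R Y" "d\<tau> Y = Im c *\<^sub>R X + Re c *\<^sub>R Y"
    using eig eigenspace_iff[OF X Y] by (simp_all add: c_def)
  have pow: "(d\<tau> ^^ j) X + \<i> *\<^sub>C (d\<tau> ^^ j) Y = c ^ j *\<^sub>C (X + \<i> *\<^sub>C Y)" for j
  proof (induction j)
    case (Suc j)
    have "(d\<tau> ^^ Suc j) X + \<i> *\<^sub>C (d\<tau> ^^ Suc j) Y = (d\<tau> ^^ j) (d\<tau> X) + \<i> *\<^sub>C (d\<tau> ^^ j) (d\<tau> Y)"
      by (simp only: funpow_Suc_right o_apply)
    also have "\<dots> = c *\<^sub>C ((d\<tau> ^^ j) X + \<i> *\<^sub>C (d\<tau> ^^ j) Y)"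
      unfolding XY complex_cscale
      by (simp add: linear_add[OF linear_d\<tau>_pow] linear_diff[OF linear_d\<tau>_pow] linear_cmul[OF linear_d\<tau>_pow])
    finally show ?case using Suc by simp
  qed simp
  have "avg X + \<i> *\<^sub>C avg Y = (1 / k) *\<^sub>R (\<Sum>j<k. (d\<tau> ^^ j) X + \<i> *\<^sub>C (d\<tau> ^^ j) Y)"
    by (simp add: avg_def sum.distrib scaleR_add_right cs.sum_right)
  also have "\<dots> = (1 / k) *\<^sub>R ((\<Sum>j<k. c ^ j) *\<^sub>C (X + \<i> *\<^sub>C Y))"
    by (simp only: pow cs.sum_left)
  also have "\<dots> = 0 + \<i> *\<^sub>C 0"
    using geometric_omega(1)[OF assms(1,2)] by (simp add: c_def)
  finally have "avg X + \<i> *\<^sub>C avg Y = 0 + \<i> *\<^sub>C 0" .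
  then show ?thesis
    using lie_algebra_C_unique[OF avg_mem[OF X] avg_mem[OF Y] lie_algebra_0 lie_algebra_0] by simp
qed

text \<open>In one direction, averaging kills each eigenvector because a nontrivial sum of roots of
  unity vanishes; in the other, discrete Fourier inversion supplies the eigenvectors.\<close>

lemma m_space_eq: "m_space G \<tau> k = {X \<in> lie_algebra G. avg X = 0}"
proof (rule Set.set_eqI, rule iffI)
  fix X assume "X \<in> m_space G \<tau> k"
  then obtain Z where X: "X \<in> lie_algebra G" "X = (\<Sum>l = 1..<k. Z l)"
    and Z: "\<And>l. l \<in> {1..<k} \<Longrightarrow> Z l \<in> eigenspace G \<tau> k (int l)"
    by (auto simp: m_space_def)
  have "\<forall>l\<in>{1..<k}. \<exists>U V. U \<in> lie_algebra G \<and> V \<in> lie_algebra G \<and> Z l = U + \<i> *\<^sub>C V"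
    using Z unfolding eigenspace_def lie_algebra_C_def by blast
  then obtain U V where UV: "\<And>l. l \<in> {1..<k} \<Longrightarrow> U l \<in> lie_algebra G"
    "\<And>l. l \<in> {1..<k} \<Longrightarrow> V l \<in> lie_algebra G" "\<And>l. l \<in> {1..<k} \<Longrightarrow> Z l = U l + \<i> *\<^sub>C V l"
    by metis
  have eq: "X + \<i> *\<^sub>C 0 = (\<Sum>l = 1..<k. U l) + \<i> *\<^sub>C (\<Sum>l = 1..<k. V l)"
    by (simp add: X(2) UV(3) sum.distrib cs.sum_right)
  have sums: "(\<Sum>l = 1..<k. U l) \<in> lie_algebra G" "(\<Sum>l = 1..<k. V l) \<in> lie_algebra G"
    by (intro subspace_sum[OF subspace_lie_algebra] UV; assumption)+
  have "X = (\<Sum>l = 1..<k. U l)"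
    using lie_algebra_C_unique[OF X(1) lie_algebra_0 sums eq] by simp
  then have "avg X = (\<Sum>l = 1..<k. avg (U l))" by (simp add: linear_sum[OF linear_avg])
  also have "\<dots> = 0"
  proof (intro sum.neutral ballI)
    fix l assume l: "l \<in> {1..<k}"
    show "avg (U l) = 0"
      by (rule eigen_avg[of l _ "V l"]) (use l UV[OF l] Z[OF l] in auto)
  qed
  finally show "X \<in> {X \<in> lie_algebra G. avg X = 0}" using X by simp
next
  fix X assume "X \<in> {X \<in> lie_algebra G. avg X = 0}"
  then have X: "X \<in> lie_algebra G" "avg X = 0" by auto
  \<comment> \<open>The coefficients \<open>omega k\<close> to the power -lj: the mean over
    \<open>j\<close> with these weights projects onto the eigenvalue
    \<open>omega k ^ l\<close>.\<close>
  define c where "c = (\<lambda>l j. (inverse (omega k) ^ l) ^ j :: complex)"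
  define U where "U = (\<lambda>l. (1 / k) *\<^sub>R (\<Sum>j<k. Re (c l j) *\<^sub>R (d\<tau> ^^ j) X))"
  define V where "V = (\<lambda>l. (1 / k) *\<^sub>R (\<Sum>j<k. Im (c l j) *\<^sub>R (d\<tau> ^^ j) X))"
  define Z where "Z = (\<lambda>l. (1 / k) *\<^sub>R (\<Sum>j<k. c l j *\<^sub>C (d\<tau> ^^ j) X))"
  have UV: "U l \<in> lie_algebra G" "V l \<in> lie_algebra G" for l
    unfolding U_def V_def
    by (intro lie_algebra_scaleR subspace_sum[OF subspace_lie_algebra] d\<tau>_pow_mem X)+
  have decomp: "a *\<^sub>C W = Re a *\<^sub>R W + \<i> *\<^sub>C (Im a *\<^sub>R W)" for a and W :: "'n cmat"
    by (simp add: vec_eq_iff complex_eq_iff)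
  have Z: "Z l = U l + \<i> *\<^sub>C V l" for l
    unfolding Z_def U_def V_def by (subst decomp) (simp add: sum.distrib scaleR_add_right cs.sum_right)
  have "Z l \<in> eigenspace G \<tau> k (int l)" for l
  proof -
    have "lie_aut_C G \<tau> (Z l) = d\<tau> (U l) + \<i> *\<^sub>C d\<tau> (V l)"
      unfolding Z by (rule lie_aut_C_eq[OF UV])
    also have "\<dots> = (1 / k) *\<^sub>R (\<Sum>j<k. c l j *\<^sub>C (d\<tau> ^^ Suc j) X)"
      unfolding U_def V_def
      by (subst decomp)
         (simp add: linear_cmul[OF linear_d\<tau>] linear_sum[OF linear_d\<tau>] sum.distrib scaleR_add_right cs.sum_right)
    also have "(\<Sum>j<k. c l j *\<^sub>C (d\<tau> ^^ Suc j) X) = omega k ^ l *\<^sub>C (\<Sum>j<k. c l (Suc j) *\<^sub>C (d\<tau> ^^ Suc j) X)"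
    proof -
      have c_eq: "c l j = omega k ^ l * c l (Suc j)" for j
        by (simp add: c_def power_inverse)
      have "(\<Sum>j<k. c l j *\<^sub>C (d\<tau> ^^ Suc j) X) = (\<Sum>j<k. omega k ^ l *\<^sub>C c l (Suc j) *\<^sub>C (d\<tau> ^^ Suc j) X)"
        by (intro sum.cong refl) (subst c_eq, rule cscale_cscale[symmetric])
      then show ?thesis by (simp only: cs.sum_right)
    qed
    also have "(\<Sum>j<k. c l (Suc j) *\<^sub>C (d\<tau> ^^ Suc j) X) = (\<Sum>j<k. c l j *\<^sub>C (d\<tau> ^^ j) X)"
    proof (rule sum_shift)
      have "c l k = 1"
        by (simp add: c_def power_inverse flip: power_mult)
           (simp add: mult.commute power_mult omega_pow_k)
      then show "c l k *\<^sub>C (d\<tau> ^^ k) X = c l 0 *\<^sub>C (d\<tau> ^^ 0) X"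
        by (simp add: d\<tau>_pow_k[OF X(1)]) (simp add: c_def)
    qed
    finally have "lie_aut_C G \<tau> (Z l) = omega k ^ l *\<^sub>C Z l" by (simp add: Z_def)
    then show ?thesis using lie_algebra_CI[OF UV] by (simp add: eigenspace_def Z)
  qed
  moreover have "X = (\<Sum>l = 1..<k. Z l)"
  proof -
    \<comment> \<open>The component \<open>Z 0\<close> is \<open>avg X\<close>, so the sum may start
      at 0, where Fourier inversion applies.\<close>
    have "Z 0 = 0" using X(2) by (simp add: Z_def c_def avg_def)
    then have "(\<Sum>l = 1..<k. Z l) = (\<Sum>l<k. Z l)"
      using k_ge_2 by (simp add: lessThan_atLeast0 sum.atLeast_Suc_lessThan[of 0 k])
    also have "\<dots> = (1 / k) *\<^sub>R (\<Sum>j<k. \<Sum>l<k. c l j *\<^sub>C (d\<tau> ^^ j) X)"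
      unfolding Z_def by (subst sum.swap) (simp add: scaleR_sum_right)
    also have "(\<Sum>j<k. \<Sum>l<k. c l j *\<^sub>C (d\<tau> ^^ j) X) = (\<Sum>j<k. if j = 0 then real k *\<^sub>R X else 0)"
    proof (intro sum.cong refl)
      fix j assume "j \<in> {..<k}"
      have "(\<Sum>l<k. c l j *\<^sub>C (d\<tau> ^^ j) X) = (\<Sum>l<k. c l j) *\<^sub>C (d\<tau> ^^ j) X"
        by (rule cs.sum_left[symmetric])
      also have "(\<Sum>l<k. c l j) = (\<Sum>l<k. (inverse (omega k) ^ j) ^ l)"
        by (simp add: c_def mult.commute flip: power_mult)
      also have "\<dots> = (if j = 0 then of_nat k else 0)"
        using geometric_omega(2)[of j] \<open>j \<in> {..<k}\<close> by auto
      finally show "(\<Sum>l<k. c l j *\<^sub>C (d\<tau> ^^ j) X) = (if j = 0 then real k *\<^sub>R X else 0)"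
        by (auto simp: scaleR_conv_cscale)
    qed
    finally show ?thesis using k_ge_2 by simp
  qed
  ultimately show "X \<in> m_space G \<tau> k"
    using X(1) by (auto simp: m_space_def)
qed

text \<open>Elements of \<open>K\<close> are fixed by \<open>\<tau>\<close>, so conjugation by them
  commutes with \<open>d\<tau>\<close>.\<close>

lemma avg_Ad:
  assumes h: "h \<in> K" and X: "X \<in> lie_algebra G"
  shows "d\<tau> (h ** X ** matrix_inv h) = h ** d\<tau> X ** matrix_inv h"
    and "avg (h ** X ** matrix_inv h) = h ** avg X ** matrix_inv h"
proof -
  have 1: "d\<tau> (h ** X ** matrix_inv h) = h ** d\<tau> X ** matrix_inv h" if "X \<in> lie_algebra G" for X
    using d\<tau>_Ad[OF K_G[OF h] that] \<tau>_K[OF h] by simp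
  then show "d\<tau> (h ** X ** matrix_inv h) = h ** d\<tau> X ** matrix_inv h" using X .
  have "(d\<tau> ^^ j) (h ** X ** matrix_inv h) = h ** (d\<tau> ^^ j) X ** matrix_inv h" for j
    by (induction j) (auto simp: 1 d\<tau>_pow_mem X)
  then show "avg (h ** X ** matrix_inv h) = h ** avg X ** matrix_inv h"
    by (simp add: avg_def mm.sum_left mm.sum_right)
qed

lemma k_part_eq:
  assumes X: "X \<in> lie_algebra G"
  shows "k_part G \<tau> k K X = avg X"
  unfolding k_part_def
proof (rule the_equality)
  show "avg X \<in> lie_algebra K \<and> X - avg X \<in> m_space G \<tau> k"
    using X by (simp add: lie_algebra_K m_space_eq avg_mem d\<tau>_avg linear_diff[OF linear_avg]
        avg_fixed subspace_diff[OF subspace_lie_algebra])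
  fix Y assume "Y \<in> lie_algebra K \<and> X - Y \<in> m_space G \<tau> k"
  then show "Y = avg X"
    by (auto simp: lie_algebra_K m_space_eq linear_diff[OF linear_avg] avg_fixed)
qed

lemma m_part_eq:
  assumes X: "X \<in> lie_algebra G"
  shows "m_part G \<tau> k K X = X - avg X"
  unfolding m_part_def
proof (rule the_equality)
  show "X - avg X \<in> m_space G \<tau> k \<and> X - (X - avg X) \<in> lie_algebra K"
    using X by (simp add: lie_algebra_K m_space_eq avg_mem d\<tau>_avg linear_diff[OF linear_avg]
        avg_fixed subspace_diff[OF subspace_lie_algebra])
  fix Y assume Y: "Y \<in> m_space G \<tau> k \<and> X - Y \<in> lie_algebra K"
  then have "avg (X - Y) = X - Y" by (auto simp: lie_algebra_K avg_fixed)
  then show "Y = X - avg X"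
    using Y by (simp add: m_space_eq linear_diff[OF linear_avg])
qed

end

lemma k_symmetric_spaceD:
  assumes "k_symmetric_space G \<tau> k K"
  shows "symmetric_space G \<tau> k K"
proof -
  interpret compact_matrix_group G
    using assms by (intro compact_matrix_groupI) (auto simp: k_symmetric_space_def compact_semisimple_group_def)
  have "\<tau> \<in> iso (GLn\<lparr>carrier := G\<rparr>) (GLn\<lparr>carrier := G\<rparr>)"
    using assms by (simp add: k_symmetric_space_def)
  then have \<tau>: "\<And>g. g \<in> G \<Longrightarrow> \<tau> g \<in> G" "\<And>g h. g \<in> G \<Longrightarrow> h \<in> G \<Longrightarrow> \<tau> (g ** h) = \<tau> g ** \<tau> h"
    by (auto simp: iso_def hom_def GLn_def)
  show ?thesis
    using assms \<tau>
    by (intro symmetric_space.intro symmetric_space_axioms.intro compact_matrix_group_axioms)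
       (auto simp: k_symmetric_space_def)
qed

section \<open>Holomorphic matrix functions\<close>

abbreviation mat_holomorphic :: "(complex \<Rightarrow> 'n::finite cmat) \<Rightarrow> complex set \<Rightarrow> bool"  (infix "matholomorphic'_on" 50)
  where "f matholomorphic_on S \<equiv> \<forall>i j. (\<lambda>\<mu>. f \<mu> $ i $ j) holomorphic_on S"

lemma continuous_on_matI:
  fixes f :: "'a::topological_space \<Rightarrow> 'n::finite cmat"
  assumes "\<And>i j. continuous_on S (\<lambda>x. f x $ i $ j)"
  shows "continuous_on S f"
proof -
  have "continuous_on S (\<lambda>x. \<chi> i. \<chi> j. f x $ i $ j)"
    by (intro continuous_on_vec_lambda assms)
  then show ?thesis by (simp add: vec_lambda_eta)
qed

lemma continuous_on_mat_nth:
  fixes f :: "'a::topological_space \<Rightarrow> 'n::finite cmat"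
  assumes "continuous_on S f"
  shows "continuous_on S (\<lambda>x. f x $ i $ j)"
  by (intro continuous_intros assms)

lemma mat_holomorphic_mult:
  assumes "f matholomorphic_on S" "g matholomorphic_on S"
  shows "(\<lambda>\<mu>. f \<mu> ** g \<mu>) matholomorphic_on S"
  using assms by (auto simp: matrix_matrix_mult_def intro!: holomorphic_intros)

lemma mat_holomorphic_cscale:
  assumes "c holomorphic_on S" "g matholomorphic_on S"
  shows "(\<lambda>\<mu>. c \<mu> *\<^sub>C g \<mu>) matholomorphic_on S"
  using assms by (auto intro!: holomorphic_intros)

lemma det_nth: "det (\<chi> i j. (A i j :: complex)) = (\<Sum>p\<in>{p. p permutes (UNIV :: 'n::finite set)}. of_int (sign p) * (\<Prod>i\<in>UNIV. A i (p i)))"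
  by (simp add: det_def)

text \<open>Cramer's rule makes the entries of the inverse rational in those of the matrix, which
  gives holomorphy and continuity of inverses.\<close>

lemma matrix_inv_nth:
  fixes A :: "'n::finite cmat"
  assumes "invertible A"
  shows "matrix_inv A $ i $ j =
    det (\<chi> r c. if c = i then (if r = j then 1 else 0) else A $ r $ c) / det A"
proof -
  define x where "x = (\<chi> l. matrix_inv A $ l $ j)"
  have "A *v x = (\<chi> r. if r = j then 1 else 0)"
  proof -
    have "(A *v x) $ r = (A ** matrix_inv A) $ r $ j" for r
      by (simp add: x_def matrix_vector_mult_def matrix_matrix_mult_def)
    then show ?thesis
      by (simp add: vec_eq_iff invertible_matrix_inv[OF assms] mat_def)
  qed
  then have "x = (\<chi> l. det (\<chi> r c. if c = l then (\<chi> r. if r = j then 1 else 0) $ r else A $ r $ c) / det A)"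
    using assms by (intro cramer[THEN iffD1]) (simp_all add: invertible_det_nz)
  then have "x $ i = (\<chi> l. det (\<chi> r c. if c = l then (\<chi> r. if r = j then 1 else 0) $ r else A $ r $ c) / det A) $ i"
    by simp
  then show ?thesis by (simp only: x_def vec_lambda_beta)
qed

lemma mat_holomorphic_inv:
  assumes "f matholomorphic_on S" "\<And>\<mu>. \<mu> \<in> S \<Longrightarrow> invertible (f \<mu>)"
  shows "(\<lambda>\<mu>. matrix_inv (f \<mu>)) matholomorphic_on S"
proof (intro allI)
  fix i j
  have "(\<lambda>\<mu>. det (\<chi> r c. if c = i then (if r = j then 1 else 0) else f \<mu> $ r $ c) / det (f \<mu>)) holomorphic_on S"
  proof (intro holomorphic_on_divide)
    have "(\<lambda>\<mu>. if c = i then (if r = j then 1 else 0) else f \<mu> $ r $ c) holomorphic_on S" for r c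
      using assms(1) by (cases "c = i"; cases "r = j") simp_all
    then show "(\<lambda>\<mu>. det (\<chi> r c. if c = i then (if r = j then 1 else 0) else f \<mu> $ r $ c)) holomorphic_on S"
      unfolding det_nth by (intro holomorphic_intros) auto
    show "(\<lambda>\<mu>. det (f \<mu>)) holomorphic_on S"
      unfolding det_def by (intro holomorphic_intros) (use assms(1) in auto)
  qed (use assms(2) invertible_det_nz in auto)
  then show "(\<lambda>\<mu>. matrix_inv (f \<mu>) $ i $ j) holomorphic_on S"
    by (rule holomorphic_transform) (simp add: matrix_inv_nth assms(2))
qed

lemma continuous_on_matrix_inv:
  fixes f :: "'a::topological_space \<Rightarrow> 'n::finite cmat"
  assumes f: "continuous_on S f" and inv: "\<And>x. x \<in> S \<Longrightarrow> invertible (f x)"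
  shows "continuous_on S (\<lambda>x. matrix_inv (f x))"
proof (rule continuous_on_matI)
  fix i j
  have entry: "continuous_on S (\<lambda>x. if c = i then (if r = j then 1 else 0) else f x $ r $ c)" for r c
    using continuous_on_mat_nth[OF f] by (cases "c = i"; cases "r = j") simp_all
  have "continuous_on S (\<lambda>x. det (\<chi> r c. if c = i then (if r = j then 1 else 0) else f x $ r $ c) / det (f x))"
  proof (intro continuous_on_divide)
    show "continuous_on S (\<lambda>x. det (\<chi> r c. if c = i then (if r = j then 1 else 0) else f x $ r $ c))"
      unfolding det_nth by (intro continuous_intros entry)
    show "continuous_on S (\<lambda>x. det (f x))"
      unfolding det_def by (intro continuous_intros continuous_on_mat_nth f)
  qed (use inv invertible_det_nz in auto)
  then show "continuous_on S (\<lambda>x. matrix_inv (f x) $ i $ j)"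
    by (rule continuous_on_eq) (simp add: matrix_inv_nth inv)
qed

lemma mat_expand: "Z = (\<Sum>i\<in>UNIV. \<Sum>j\<in>UNIV. Z $ i $ j *\<^sub>C axis i (axis j 1))"
proof -
  have "(\<Sum>i\<in>UNIV. \<Sum>j\<in>UNIV. Z $ i $ j *\<^sub>C axis i (axis j 1)) $ r $ s = Z $ r $ s" for r s
  proof -
    have "(\<Sum>i\<in>UNIV. \<Sum>j\<in>UNIV. Z $ i $ j *\<^sub>C axis i (axis j 1)) $ r $ s =
        (\<Sum>i\<in>UNIV. \<Sum>j\<in>UNIV. if i = r then (if j = s then Z $ i $ j else 0) else 0)"
      by (simp add: axis_def) (intro sum.cong refl, auto)
    also have "\<dots> = (\<Sum>i\<in>UNIV. if i = r then (\<Sum>j\<in>UNIV. if j = s then Z $ i $ j else 0) else 0)"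
      by (intro sum.cong refl) auto
    also have "\<dots> = Z $ r $ s" by simp
    finally show ?thesis .
  qed
  then show ?thesis by (simp add: vec_eq_iff)
qed

lemma complex_linear_holomorphic:
  fixes l :: "'n::finite cmat \<Rightarrow> complex"
  assumes "linear l" "\<And>c Z. l (c *\<^sub>C Z) = c * l Z" "f matholomorphic_on S"
  shows "(\<lambda>\<mu>. l (f \<mu>)) holomorphic_on S"
proof -
  have "l (f \<mu>) = (\<Sum>i\<in>UNIV. \<Sum>j\<in>UNIV. f \<mu> $ i $ j * l (axis i (axis j 1)))" for \<mu>
    by (subst mat_expand) (simp add: linear_sum[OF assms(1)] assms(2))
  then show ?thesis
    using assms(3) by (simp only:) (intro holomorphic_intros, auto)
qed

section \<open>Uniqueness of the Iwasawa decomposition\<close>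

context compact_matrix_group
begin

text \<open>The complex-linear functional of \<open>Z\<close> with real part
  \<open>form W Z\<close>; composed with a holomorphic matrix function it is holomorphic.\<close>

definition cform :: "'n cmat \<Rightarrow> 'n cmat \<Rightarrow> complex"
  where "cform W Z = Complex (form W Z) (- form W (\<i> *\<^sub>C Z))"

lemma cform_linear: "linear (cform W)"
  by (rule linearI)
     (simp_all add: cform_def complex_eq_iff form.add_right form.scaleR_right cs.add_right)

lemma cform_cscale: "cform W (c *\<^sub>C Z) = c * cform W Z"
proof -
  have "form W (c *\<^sub>C Z) = Re c * form W Z + Im c * form W (\<i> *\<^sub>C Z)" for c Z
  proof -
    have "c *\<^sub>C Z = Re c *\<^sub>R Z + Im c *\<^sub>R (\<i> *\<^sub>C Z)"
      by (simp add: vec_eq_iff complex_eq_iff)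
    then show ?thesis by (simp add: form.add_right form.scaleR_right)
  qed
  from this[of c Z] this[of "\<i> * c" Z] show ?thesis
    by (simp add: cform_def complex_eq_iff)
qed

lemma cform_holomorphic:
  assumes "g matholomorphic_on S"
  shows "(\<lambda>\<mu>. cform W (g \<mu> ** Y)) holomorphic_on S"
proof (rule complex_linear_holomorphic[OF cform_linear cform_cscale mat_holomorphic_mult[OF assms]])
qed auto

text \<open>Freeze \<open>W\<close> at the value \<open>g \<mu> ** Y\<close> and apply the maximum
  principle to the real part of \<open>cform W (g z ** Y)\<close>. On the circle it is at most the
  mean of \<open>form W W\<close> and \<open>form Y Y\<close>; at \<open>\<mu>\<close> it equals
  \<open>form W W\<close>.\<close>

lemma form_sup:
  assumes g: "continuous_on (cball 0 1) g" "g matholomorphic_on ball 0 1"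
    and circle: "\<And>\<mu>. \<mu> \<in> sphere 0 1 \<Longrightarrow> g \<mu> \<in> G" and \<mu>: "\<mu> \<in> ball 0 1"
  shows "form (g \<mu> ** Y) (g \<mu> ** Y) \<le> form Y Y"
proof -
  define W where "W = g \<mu> ** Y"
  have am: "form W Z \<le> (form W W + form Z Z) / 2" for Z
    using form_nonneg[of "W - Z"] by (simp add: form.diff_left form.diff_right form_sym[of Z W])
  have "Re (cform W (g \<mu> ** Y)) \<le> (form W W + form Y Y) / 2"
  proof (rule maximum_real_frontier[where f = "\<lambda>\<mu>. cform W (g \<mu> ** Y)" and S = "ball 0 1"])
    show "continuous_on (closure (ball 0 1)) (\<lambda>\<mu>. cform W (g \<mu> ** Y))"
      using g(1) by (intro linear_continuous_on_compose[OF _ cform_linear] mm.continuous_on continuous_on_const) simp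
    show "Re (cform W (g z ** Y)) \<le> (form W W + form Y Y) / 2" if "z \<in> frontier (ball 0 1)" for z
    proof -
      have "g z \<in> G" using that circle by simp
      then have "form (g z ** Y) (g z ** Y) = form Y Y"
        using form_mult[of "g z" "mat 1" Y Y] by simp
      then show ?thesis using am[of "g z ** Y"] by (simp add: cform_def)
    qed
  qed (use \<mu> cform_holomorphic[OF g(2)] in auto)
  then show ?thesis by (simp add: cform_def W_def[symmetric])
qed

text \<open>
  By the maximum principle both \<open>g\<close> and its inverse are contractions for the invariant form on
  the disc, hence isometries, and an isometry-valued holomorphic map is constant.
\<close>

lemma holomorphic_loop_constant:
  assumes g: "continuous_on (cball 0 1) g" "g matholomorphic_on ball 0 1"
    and g': "continuous_on (cball 0 1) g'" "g' matholomorphic_on ball 0 1"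
    and inv: "\<And>\<mu>. \<mu> \<in> cball 0 1 \<Longrightarrow> g' \<mu> ** g \<mu> = mat 1"
    and circle: "\<And>\<mu>. \<mu> \<in> sphere 0 1 \<Longrightarrow> g \<mu> \<in> G"
    and \<mu>: "\<mu> \<in> cball 0 1"
  shows "g \<mu> = g 0"
proof -
  have circle': "g' \<mu> \<in> G" if "\<mu> \<in> sphere 0 1" for \<mu>
  proof -
    have "g' \<mu> = matrix_inv (g \<mu>)"
      using inv[of \<mu>] that matrix_inv_unique[of "g \<mu>" "g' \<mu>"]
      by (simp add: matrix_left_right_inverse[of "g \<mu>"])
    then show ?thesis using circle[OF that] by (simp add: inv_mem)
  qed
  define n0 where "n0 = form (mat 1) (mat 1)"
  \<comment> \<open>One inequality comes from \<open>g\<close> at the identity, the reverse one from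
    the inverse \<open>g'\<close> at \<open>Y = g \<mu>\<close>.\<close>
  have iso: "form (g \<mu>) (g \<mu>) = n0" if "\<mu> \<in> ball 0 1" for \<mu>
    using form_sup[OF g circle that, of "mat 1"] form_sup[OF g' circle' that, of "g \<mu>"] inv[of \<mu>] that
    by (simp add: n0_def)
  define W where "W = g 0"
  \<comment> \<open>The exponential turns the real part into a modulus, whose maximum is attained at
    the interior point 0 because all values of \<open>g\<close> have the same length.\<close>
  define f where "f = (\<lambda>\<mu>. exp (cform W (g \<mu>)))"
  have "f constant_on ball 0 1"
  proof (rule maximum_modulus_principle[where U = "ball 0 1" and \<xi> = 0])
    show "f holomorphic_on ball 0 1"
      unfolding f_def using cform_holomorphic[OF g(2), of W "mat 1"] by (intro holomorphic_intros) simp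
    show "norm (f z) \<le> norm (f 0)" if "z \<in> ball 0 1" for z
    proof -
      have "form W (g z) \<le> n0"
        using form_nonneg[of "W - g z"] iso[OF that] iso[of 0]
        by (simp add: W_def form.diff_left form.diff_right form_sym[of "g z" "g 0"])
      then show ?thesis using iso[of 0] by (simp add: f_def cform_def W_def)
    qed
  qed auto
  then obtain c where c: "\<And>z. z \<in> ball 0 1 \<Longrightarrow> f z = c" by (auto simp: constant_on_def)
  have const: "g z = g 0" if "z \<in> ball 0 1" for z
  proof -
    have "f z = f 0" using c[OF that] c[of 0] by simp
    then have "norm (f z) = norm (f 0)" by simp
    then have "form W (g z) = form W (g 0)" by (simp add: f_def cform_def)
    then have "form (g z - W) (g z - W) = 0"
      using iso[OF that] iso[of 0]
      by (simp add: W_def form.diff_left form.diff_right form_sym[of "g z" "g 0"])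
    then have "g z - W = 0" using form_pos[of "g z - W"] by fastforce
    then show ?thesis by (simp add: W_def)
  qed
  \<comment> \<open>Continuity extends constancy from the open disc to the circle.\<close>
  have sub: "(\<lambda>z. g z - g 0) ` closure (ball 0 1) \<subseteq> {0}"
  proof (rule image_closure_subset)
    show "continuous_on (closure (ball 0 1)) (\<lambda>z. g z - g 0)"
      by (intro continuous_on_diff continuous_on_const) (simp add: g(1))
    show "(\<lambda>z. g z - g 0) ` ball 0 1 \<subseteq> {0}"
    proof (rule image_subsetI)
      fix z :: complex assume "z \<in> ball 0 1"
      from const[OF this] show "g z - g 0 \<in> {0}" by simp
    qed
  qed simp
  have "\<mu> \<in> closure (ball 0 1)" using \<mu> by simp
  then have "g \<mu> - g 0 \<in> (\<lambda>z. g z - g 0) ` closure (ball 0 1)" by (rule imageI)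
  then have "g \<mu> - g 0 \<in> {0}" using sub by (rule subsetD[rotated])
  then show ?thesis by simp
qed

end

section \<open>Cosets and translation of the Iwasawa factors\<close>

lemma mem_l_coset_GLn: "x \<in> a <#\<^bsub>GLn\<^esub> S \<longleftrightarrow> (\<exists>h\<in>S. x = a ** h)"
  by (auto simp: l_coset_def GLn_def)

lemma l_coset_GLn_assoc: "(a ** b) <#\<^bsub>GLn\<^esub> S = a <#\<^bsub>GLn\<^esub> (b <#\<^bsub>GLn\<^esub> S)"
  by (auto simp: l_coset_def GLn_def matrix_mul_assoc)

lemma l_coset_GLn_one [simp]: "mat 1 <#\<^bsub>GLn\<^esub> S = S"
  by (rule Set.set_eqI) (auto simp: mem_l_coset_GLn)

context symmetric_space
begin

lemma l_coset_K [simp]: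
  assumes h: "h \<in> K"
  shows "h <#\<^bsub>GLn\<^esub> K = K"
proof (rule Set.set_eqI, rule iffI)
  fix x assume "x \<in> K"
  then have "x = h ** (matrix_inv h ** x)" "matrix_inv h ** x \<in> K"
    using h K_G by (simp_all add: matrix_mul_assoc K_mult K_inv)
  then show "x \<in> h <#\<^bsub>GLn\<^esub> K" unfolding mem_l_coset_GLn by blast
qed (use h in \<open>auto simp: mem_l_coset_GLn K_mult\<close>)

text \<open>The polar decompositions in \<open>K\<close> and in \<open>G\<close> agree by
  uniqueness, so the exponential factor is trivial.\<close>

lemma group_C_K_cap:
  assumes "g \<in> G" "g \<in> group_C K"
  shows "g \<in> K"
proof -
  obtain h X where hX: "h \<in> K" "X \<in> lie_algebra K" "g = h ** mexp (\<i> *\<^sub>C X)"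
    using assms(2) by (auto simp: group_C_def)
  have eq: "g ** mexp (\<i> *\<^sub>C 0) = h ** mexp (\<i> *\<^sub>C X)" using hX by simp
  have "X \<in> lie_algebra G" using hX(2) by (simp add: lie_algebra_K)
  from polar_unique[OF assms(1) K_G[OF hX(1)] lie_algebra_0 this eq] show ?thesis
    using hX(1) by simp
qed

lemma invertible_mexp: "invertible (mexp A)"
  unfolding invertible_def by (intro exI[of _ "mexp (- A)"]) simp

lemma group_C_invertible: "x \<in> group_C G \<Longrightarrow> invertible x"
  by (auto simp: group_C_def intro!: invertible_mult[OF invertible invertible_mexp])

lemma Complex_cscale: "Complex x y *\<^sub>C A = x *\<^sub>R A + (\<i> * y) *\<^sub>C A"
  by (simp add: vec_eq_iff complex_eq_iff)

text \<open>Since exp(z \<xi>) = exp(x \<xi>) exp(w \<xi>), the quotient of the positive factors at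
  \<open>w\<close> and at \<open>z\<close> is on the circle a loop in \<open>G\<close>. It extends
  with its inverse to the disc, so it is constant; its value at 0 lies in \<open>B\<close>, and B
  \<inter> G \<subseteq> K.\<close>

lemma iwasawa_equivariance:
  assumes B: "iwasawa_decomposition K B" and \<xi>: "\<xi> \<in> loop_algebra G \<tau> k"
    and fact: "iwasawa_factors G \<tau> k B \<xi> F b"
  shows "\<exists>\<kappa>\<in>K. F (Complex x y) 1 = mexp (x *\<^sub>R \<xi> 1) ** F (Complex 0 y) 1 ** \<kappa>"
proof -
  define z w where "z = Complex x y" and "w = Complex 0 y"
  have F: "\<And>z \<mu>. \<mu> \<in> sphere 0 1 \<Longrightarrow> F z \<mu> \<in> G"
    and eq: "\<And>z \<mu>. \<mu> \<in> sphere 0 1 \<Longrightarrow> mexp (z *\<^sub>C \<xi> \<mu>) = F z \<mu> ** b z \<mu>"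
    and b: "\<And>z. b z \<in> loop_group_plus G \<tau> k B"
    using fact by (auto simp: iwasawa_factors_def loop_group_def)
  have \<xi>_mem: "\<xi> \<mu> \<in> lie_algebra G" if "\<mu> \<in> sphere 0 1" for \<mu>
    using \<xi> that by (simp add: loop_algebra_def)
  have "\<exists>h. (\<forall>\<mu>\<in>sphere 0 1. h \<mu> = b z \<mu>) \<and> continuous_on (cball 0 1) h \<and> h matholomorphic_on ball 0 1 \<and>
      (\<forall>\<mu>\<in>cball 0 1. invertible (h \<mu>)) \<and> h 0 \<in> B" for z
  proof -
    obtain h where h: "\<forall>\<mu>\<in>sphere 0 1. h \<mu> = b z \<mu>" "continuous_on (cball 0 1) h" "h matholomorphic_on ball 0 1"
      "\<forall>\<mu>\<in>ball 0 1. h \<mu> \<in> group_C G" "h 0 \<in> B"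
      using b[of z] unfolding loop_group_plus_def by blast
    moreover have "b z \<mu> \<in> group_C G" if "\<mu> \<in> sphere 0 1" for \<mu>
      using b[of z] that by (simp add: loop_group_plus_def loop_group_C_def)
    then have "h \<mu> \<in> group_C G" if "\<mu> \<in> cball 0 1" for \<mu>
    proof (cases "\<mu> \<in> ball 0 1")
      case False
      with that have "\<mu> \<in> sphere 0 1" by simp
      then show ?thesis using h(1) \<open>\<And>\<mu>. \<mu> \<in> sphere 0 1 \<Longrightarrow> b z \<mu> \<in> group_C G\<close> by simp
    qed (use h(4) in auto)
    ultimately show ?thesis using group_C_invertible by blast
  qed
  then obtain h where h: "\<And>z \<mu>. \<mu> \<in> sphere 0 1 \<Longrightarrow> h z \<mu> = b z \<mu>" "\<And>z. continuous_on (cball 0 1) (h z)"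
    "\<And>z. h z matholomorphic_on ball 0 1" "\<And>z \<mu>. \<mu> \<in> cball 0 1 \<Longrightarrow> invertible (h z \<mu>)" "\<And>z. h z 0 \<in> B"
    by metis
  define g where "g = (\<lambda>\<mu>. h w \<mu> ** matrix_inv (h z \<mu>))"
  define g' where "g' = (\<lambda>\<mu>. h z \<mu> ** matrix_inv (h w \<mu>))"
  have circle: "g \<mu> = matrix_inv (mexp (x *\<^sub>R \<xi> \<mu>) ** F w \<mu>) ** F z \<mu>" "g \<mu> \<in> G"
    if \<mu>: "\<mu> \<in> sphere 0 1" for \<mu>
  proof -
    define p where "p = mexp (x *\<^sub>R \<xi> \<mu>) ** F w \<mu>"
    have p: "p \<in> G" unfolding p_def by (intro mult_mem F[OF \<mu>] lie_algebraD \<xi>_mem \<mu>)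
    have "mexp (z *\<^sub>C \<xi> \<mu>) = mexp (x *\<^sub>R \<xi> \<mu>) ** mexp (w *\<^sub>C \<xi> \<mu>)"
      unfolding z_def w_def Complex_cscale by (simp add: mexp_add)
    then have "F z \<mu> ** h z \<mu> = p ** h w \<mu>"
      by (simp add: eq[OF \<mu>] h(1)[OF \<mu>] p_def matrix_mul_assoc)
    then have "matrix_inv p ** F z \<mu> ** h z \<mu> = h w \<mu>"
      using p by (simp add: matrix_mul_assoc flip: matrix_mul_assoc[of _ "F z \<mu>"])
    then have "matrix_inv p ** F z \<mu> ** (h z \<mu> ** matrix_inv (h z \<mu>)) = g \<mu>"
      by (simp add: g_def matrix_mul_assoc)
    then show "g \<mu> = matrix_inv (mexp (x *\<^sub>R \<xi> \<mu>) ** F w \<mu>) ** F z \<mu>"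
      using \<mu> by (simp add: p_def invertible_matrix_inv h(4))
    then show "g \<mu> \<in> G" using p \<mu> by (simp add: p_def[symmetric] mult_mem inv_mem F)
  qed
  have "g 1 = g 0"
  proof (rule holomorphic_loop_constant[of g g'])
    show "continuous_on (cball 0 1) g" "continuous_on (cball 0 1) g'"
      unfolding g_def g'_def by (intro mm.continuous_on continuous_on_matrix_inv h; assumption)+
    show "g matholomorphic_on ball 0 1" "g' matholomorphic_on ball 0 1"
      unfolding g_def g'_def
      by (rule mat_holomorphic_mult[OF h(3) mat_holomorphic_inv[OF h(3)]], rule h(4), simp)+
    show "g' \<mu> ** g \<mu> = mat 1" if "\<mu> \<in> cball 0 1" for \<mu>
    proof -
      have "g' \<mu> ** g \<mu> = h z \<mu> ** (matrix_inv (h w \<mu>) ** h w \<mu>) ** matrix_inv (h z \<mu>)"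
        by (simp add: g_def g'_def matrix_mul_assoc)
      then show ?thesis using h(4)[OF that] by (simp add: invertible_matrix_inv)
    qed
  qed (use circle(2) in auto)
  moreover have "g 0 \<in> B"
    unfolding g_def using B subgroup_GLnD[of B] h(5) by (simp add: iwasawa_decomposition_def)
  moreover have "B \<subseteq> group_C K"
  proof
    fix \<beta> assume "\<beta> \<in> B"
    then have "(\<lambda>(a, b). a ** b) (mat 1, \<beta>) \<in> (\<lambda>(a, b). a ** b) ` (K \<times> B)"
      using K_one by (intro imageI) auto
    then show "\<beta> \<in> group_C K" using B by (simp add: iwasawa_decomposition_def bij_betw_def)
  qed
  ultimately have "g 1 \<in> K" using circle(2)[of 1] by (intro group_C_K_cap) auto
  moreover have "F z 1 = mexp (x *\<^sub>R \<xi> 1) ** F w 1 ** g 1"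
  proof -
    have "mexp (x *\<^sub>R \<xi> 1) ** F w 1 \<in> G" by (intro mult_mem F lie_algebraD \<xi>_mem) auto
    then show ?thesis using circle(1)[of 1] by (simp add: matrix_mul_assoc)
  qed
  ultimately show ?thesis by (auto simp: z_def w_def)
qed

end

section \<open>Restriction to the imaginary axis\<close>

lemma C_times_compose_linear:
  fixes f :: "'a::real_normed_vector \<Rightarrow> 'b::real_normed_vector"
    and L :: "'c::real_normed_vector \<Rightarrow> 'a"
  assumes L: "bounded_linear L" and f: "C_times r U f"
  shows "C_times r (L -` U) (\<lambda>y. f (L y))"
  using f
proof (induction r arbitrary: f)
  case 0
  then show ?case
    by (auto intro!: continuous_on_compose2[of U f] linear_continuous_on[OF L])
next
  case (Suc r)
  then obtain f' where f': "\<And>x. x \<in> U \<Longrightarrow> (f has_derivative f' x) (at x)"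
    "\<And>v. C_times r U (\<lambda>x. f' x v)" by auto
  have "((\<lambda>y. f (L y)) has_derivative (\<lambda>v. f' (L y) (L v))) (at y)" if "y \<in> L -` U" for y
    using has_derivative_compose[OF bounded_linear_imp_has_derivative[OF L] f'(1)] that by auto
  moreover have "C_times r (L -` U) (\<lambda>y. f' (L y) (L v))" for v
    using Suc.IH[OF f'(2)] .
  ultimately show ?case
    unfolding C_times.simps by (intro exI[of _ "\<lambda>y v. f' (L y) (L v)"]) blast
qed

lemma smooth_on_compose_linear:
  "bounded_linear L \<Longrightarrow> smooth_on U f \<Longrightarrow> smooth_on (L -` U) (\<lambda>y. f (L y))"
  by (simp add: smooth_on_def C_times_compose_linear)

lemma bounded_linear_Complex_0: "bounded_linear (\<lambda>y. Complex 0 y)"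
  by (rule bounded_linear_intro[where K = 1]) (auto simp: complex_eq_iff cmod_def)

lemma smooth_into_quotient_restrict:
  assumes "smooth_into_quotient G K \<phi>"
  shows "smooth_into_quotient G K (\<lambda>y. \<phi> (Complex 0 y))"
  unfolding smooth_into_quotient_def
proof
  fix p
  obtain U F where U: "open U" "Complex 0 p \<in> U" "smooth_on U F" "\<forall>q\<in>U. F q \<in> G \<and> \<phi> q = F q <#\<^bsub>GLn\<^esub> K"
    using assms unfolding smooth_into_quotient_def by blast
  have "open ((\<lambda>y. Complex 0 y) -` U)"
    using U(1) bounded_linear_Complex_0
    by (intro continuous_open_vimage) (auto intro: linear_continuous_at)
  then show "\<exists>U F. open U \<and> p \<in> U \<and> smooth_on U F \<and> (\<forall>q\<in>U. F q \<in> G \<and> \<phi> (Complex 0 q) = F q <#\<^bsub>GLn\<^esub> K)"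
    using U smooth_on_compose_linear[OF bounded_linear_Complex_0 U(3)]
    by (intro exI[of _ "(\<lambda>y. Complex 0 y) -` U"] exI[of _ "\<lambda>y. F (Complex 0 y)"]) auto
qed

context symmetric_space
begin

text \<open>The factor in \<open>K\<close> disappears in the coset, and the left translation by
  \<open>g\<close> conjugates the generator \<open>\<xi> 1\<close>. The profile
  \<open>\<psi>\<close> is the restriction of the map to the imaginary axis.\<close>

theorem generated_imp_equivariant:
  assumes B: "iwasawa_decomposition K B" and smooth: "smooth_into_quotient G K \<phi>"
    and \<xi>: "\<xi> \<in> loop_algebra_1 G \<tau> k" and gen: "generated_up_to_translation G \<tau> k K B \<phi> \<xi>"
  shows "equivariant G K \<phi>"
proof -
  obtain g F b where g: "g \<in> G" and fact: "iwasawa_factors G \<tau> k B \<xi> F b"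
    and \<phi>: "\<And>z. \<phi> z = g <#\<^bsub>GLn\<^esub> (F z 1 <#\<^bsub>GLn\<^esub> K)"
    using gen unfolding generated_up_to_translation_def generated_by_def by metis
  have \<xi>': "\<xi> \<in> loop_algebra G \<tau> k" using \<xi> by (simp add: loop_algebra_1_def)
  then have \<xi>1: "\<xi> 1 \<in> lie_algebra G" by (simp add: loop_algebra_def)
  define A0 where "A0 = g ** \<xi> 1 ** matrix_inv g"
  have translate: "\<phi> (Complex x y) = mexp (x *\<^sub>R A0) <#\<^bsub>GLn\<^esub> \<phi> (Complex 0 y)" for x y
  proof -
    obtain \<kappa> where \<kappa>: "\<kappa> \<in> K" "F (Complex x y) 1 = mexp (x *\<^sub>R \<xi> 1) ** F (Complex 0 y) 1 ** \<kappa>"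
      using iwasawa_equivariance[OF B \<xi>' fact] by blast
    have "mexp (x *\<^sub>R A0) ** g = g ** mexp (x *\<^sub>R \<xi> 1)"
      using g by (intro mexp_intertwine) (simp add: A0_def)
    then have "mexp (x *\<^sub>R A0) <#\<^bsub>GLn\<^esub> \<phi> (Complex 0 y)
        = (g ** mexp (x *\<^sub>R \<xi> 1) ** F (Complex 0 y) 1) <#\<^bsub>GLn\<^esub> K"
      by (simp add: \<phi> flip: l_coset_GLn_assoc) (simp add: matrix_mul_assoc)
    also have "\<dots> = (g ** mexp (x *\<^sub>R \<xi> 1) ** F (Complex 0 y) 1 ** \<kappa>) <#\<^bsub>GLn\<^esub> K"
      using \<kappa>(1) by (simp add: l_coset_GLn_assoc)
    also have "\<dots> = \<phi> (Complex x y)"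
      by (simp add: \<phi> \<kappa>(2) matrix_mul_assoc flip: l_coset_GLn_assoc)
    finally show ?thesis by simp
  qed
  have "A0 \<in> lie_algebra G" unfolding A0_def using g \<xi>1 by (rule lie_algebra_Ad)
  then show ?thesis
    unfolding equivariant_def
    by (intro bexI[of _ A0] exI[of _ "\<lambda>y. \<phi> (Complex 0 y)"] conjI allI
        smooth_into_quotient_restrict[OF smooth] translate)
qed

end

section \<open>Holomorphic dependence on the spectral parameter\<close>

lemma mat_norm_nth_le: "cmod (A $ i $ j) \<le> norm A" for A :: "'n::finite cmat"
  by (rule order_trans[OF Finite_Cartesian_Product.norm_nth_le Finite_Cartesian_Product.norm_nth_le])

lemma bounded_linear_mat_nth: "bounded_linear (\<lambda>A :: 'n::finite cmat. A $ i $ j)"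
  by (rule bounded_linear_intro[where K = 1]) (auto simp: mat_norm_nth_le)

lemma mat_holomorphic_series:
  fixes P :: "nat \<Rightarrow> complex \<Rightarrow> 'n::finite cmat"
  assumes S: "open S" and hol: "\<And>n. P n matholomorphic_on S"
    and major: "\<And>x. x \<in> S \<Longrightarrow> \<exists>d>0. \<exists>M. cball x d \<subseteq> S \<and> summable M \<and> (\<forall>n. \<forall>\<mu>\<in>cball x d. norm (P n \<mu>) \<le> M n)"
  shows "(\<lambda>\<mu>. \<Sum>n. P n \<mu>) matholomorphic_on S"
proof (intro allI)
  fix i j
  have "(\<lambda>\<mu>. \<Sum>n. P n \<mu> $ i $ j) holomorphic_on S"
  proof (rule holomorphic_uniform_sequence[OF S])
    show "(\<lambda>\<mu>. \<Sum>l<n. P l \<mu> $ i $ j) holomorphic_on S" for n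
      using hol by (intro holomorphic_intros) auto
    show "\<exists>d. 0 < d \<and> cball x d \<subseteq> S \<and>
        uniform_limit (cball x d) (\<lambda>n \<mu>. \<Sum>l<n. P l \<mu> $ i $ j) (\<lambda>\<mu>. \<Sum>n. P n \<mu> $ i $ j) sequentially"
      if x: "x \<in> S" for x
    proof -
      obtain d M where d: "d > 0" "cball x d \<subseteq> S" "summable M"
        "\<And>n \<mu>. \<mu> \<in> cball x d \<Longrightarrow> norm (P n \<mu>) \<le> M n"
        using major[OF x] by blast
      have "norm (P n \<mu> $ i $ j) \<le> M n" if "\<mu> \<in> cball x d" for n \<mu>
        using mat_norm_nth_le d(4)[OF that] by (rule order_trans)
      then have "uniform_limit (cball x d) (\<lambda>n \<mu>. \<Sum>l<n. P l \<mu> $ i $ j) (\<lambda>\<mu>. \<Sum>n. P n \<mu> $ i $ j) sequentially"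
        using d(3) by (rule Weierstrass_m_test)
      then show ?thesis using d by blast
    qed
  qed
  moreover have "(\<Sum>n. P n \<mu> $ i $ j) = (\<Sum>n. P n \<mu>) $ i $ j" if \<mu>: "\<mu> \<in> S" for \<mu>
  proof -
    obtain d M where d: "d > 0" "summable M" "\<And>n z. z \<in> cball \<mu> d \<Longrightarrow> norm (P n z) \<le> M n"
      using major[OF \<mu>] by blast
    have "summable (\<lambda>n. P n \<mu>)"
      by (rule summable_comparison_test[OF _ d(2)]) (use d(1,3) in auto)
    then show ?thesis
      by (rule bounded_linear.suminf[OF bounded_linear_mat_nth, symmetric])
  qed
  ultimately show "(\<lambda>\<mu>. (\<Sum>n. P n \<mu>) $ i $ j) holomorphic_on S"
    by (rule holomorphic_transform)
qed

lemma mat_holomorphic_imp_continuous_on: "f matholomorphic_on S \<Longrightarrow> continuous_on S f"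
  by (rule continuous_on_matI) (auto intro: holomorphic_on_imp_continuous_on)

lemma mat_holomorphic_mexp:
  fixes M :: "complex \<Rightarrow> 'n::finite cmat"
  assumes S: "open S" and M: "M matholomorphic_on S"
  shows "(\<lambda>\<mu>. mexp (M \<mu>)) matholomorphic_on S"
  unfolding mexp_def
proof (rule mat_holomorphic_series[OF S])
  have pow: "(\<lambda>\<mu>. mpow (M \<mu>) n) matholomorphic_on S" for n
  proof (induction n)
    case (Suc n)
    then show ?case using mat_holomorphic_mult[OF M Suc] by simp
  qed auto
  show "(\<lambda>\<mu>. (1 / fact n) *\<^sub>R mpow (M \<mu>) n) matholomorphic_on S" for n
    unfolding scaleR_conv_cscale by (rule mat_holomorphic_cscale[OF holomorphic_on_const pow])
  fix x assume "x \<in> S"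
  then obtain d where d: "d > 0" "cball x d \<subseteq> S" using S open_contains_cball by blast
  have "compact (M ` cball x d)"
    using mat_holomorphic_imp_continuous_on[OF M] d(2)
    by (intro compact_continuous_image compact_cball) (rule continuous_on_subset)
  then have "bounded (M ` cball x d)" by (rule compact_imp_bounded)
  then have "\<exists>r. \<forall>\<mu>\<in>cball x d. norm (M \<mu>) \<le> r" by (simp only: bounded_iff ball_simps)
  then obtain r where r: "\<And>\<mu>. \<mu> \<in> cball x d \<Longrightarrow> norm (M \<mu>) \<le> r" by blast
  obtain K where K: "K > 0" "\<And>(A :: 'n cmat) (B :: 'n cmat). norm (A ** B) \<le> norm A * norm B * K"
    using mm.pos_bounded[where ?'n = 'n] by auto
  have "norm ((1 / fact n) *\<^sub>R mpow (M \<mu>) n) \<le> norm (mat 1 :: 'n cmat) * (\<bar>r * K * 1\<bar> ^ n / fact n)"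
    if "\<mu> \<in> cball x d" for n \<mu>
  proof -
    have "norm (M \<mu> ** v) \<le> r * K * norm v" for v
    proof -
      have "norm (M \<mu>) * norm v * K \<le> r * norm v * K"
        using r[OF that] K by (intro mult_right_mono) auto
      then show ?thesis using K(2)[of "M \<mu>" v] by (simp add: mult_ac)
    qed
    then show ?thesis
      using ode_series.majorant[OF ode_series_mexp, of 1 "M \<mu>" "r * K" 1 n] by simp
  qed
  then show "\<exists>d>0. \<exists>Ma. cball x d \<subseteq> S \<and> summable Ma \<and>
      (\<forall>n. \<forall>\<mu>\<in>cball x d. norm ((1 / fact n) *\<^sub>R mpow (M \<mu>) n) \<le> Ma n)"
    using d ode_series.summable_majorant[OF ode_series_mexp, of "r * K * 1"] by blast
qed

lemma mat_holomorphic_loop_deriv: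
  assumes "f matholomorphic_on - {0}"
  shows "((\<lambda>t. f (cis t)) has_vector_derivative
    (\<i> * cis t) *\<^sub>C (\<chi> i j. deriv (\<lambda>\<mu>. f \<mu> $ i $ j) (cis t))) (at t)"
proof -
  define g where "g = (\<lambda>i j \<mu>. f \<mu> $ i $ j)"
  have g: "((\<lambda>t. g i j (cis t)) has_vector_derivative \<i> * cis t * deriv (g i j) (cis t)) (at t)" for i j
  proof -
    have "g i j holomorphic_on - {0}" using assms by (simp add: g_def)
    then have "(g i j has_field_derivative deriv (g i j) (cis t)) (at (cis t))"
      by (rule holomorphic_derivI) auto
    moreover have "(cis has_vector_derivative \<i> * cis t) (at t)"
    proof -
      have "((\<lambda>t. exp (t *\<^sub>R \<i>)) has_vector_derivative exp (t *\<^sub>R \<i>) * \<i>) (at t)"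
        by (rule exp_scaleR_has_vector_derivative_right)
      moreover have "exp (t *\<^sub>R \<i>) = cis t" for t
        by (simp add: cis_conv_exp scaleR_conv_of_real mult.commute)
      ultimately show ?thesis by (simp add: mult.commute)
    qed
    ultimately show ?thesis
      using field_vector_diff_chain_at[of cis "\<i> * cis t" t "g i j" "deriv (g i j) (cis t)"]
      by (simp add: o_def)
  qed
  have "((\<lambda>t. \<Sum>i\<in>UNIV. \<Sum>j\<in>UNIV. g i j (cis t) *\<^sub>C axis i (axis j 1)) has_vector_derivative
      (\<Sum>i\<in>UNIV. \<Sum>j\<in>UNIV. (\<i> * cis t * deriv (g i j) (cis t)) *\<^sub>C axis i (axis j 1))) (at t)"
    by (intro has_vector_derivative_sum bounded_linear.has_vector_derivative[OF cs.bounded_linear_left] g)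
  moreover have "(\<Sum>i\<in>UNIV. \<Sum>j\<in>UNIV. g i j (cis t) *\<^sub>C axis i (axis j 1)) = f (cis t)" for t
    unfolding g_def by (rule mat_expand[symmetric])
  moreover have "(\<Sum>i\<in>UNIV. \<Sum>j\<in>UNIV. (\<i> * cis t * deriv (g i j) (cis t)) *\<^sub>C axis i (axis j 1)) =
      (\<i> * cis t) *\<^sub>C (\<chi> i j. deriv (\<lambda>\<mu>. f \<mu> $ i $ j) (cis t))"
    by (subst mat_expand[of "(\<i> * cis t) *\<^sub>C (\<chi> i j. deriv (\<lambda>\<mu>. f \<mu> $ i $ j) (cis t))"])
       (simp add: g_def)
  ultimately show ?thesis by simp
qed

text \<open>The derivative of t \<mapsto> f(cis t) is again a function holomorphic off 0 evaluated
  on the circle, so induction over all such functions gives every order.\<close>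

lemma smooth_loop_mat_holomorphic:
  assumes "f matholomorphic_on - {0}"
  shows "smooth_loop f"
  unfolding smooth_loop_def smooth_on_def
proof
  fix r
  show "C_times r UNIV (\<lambda>t. f (cis t))"
    using assms
  proof (induction r arbitrary: f)
    case 0
    have "continuous_on UNIV (\<lambda>t. f (cis t))"
      by (rule has_vector_derivative_imp_continuous_on) (rule mat_holomorphic_loop_deriv[OF 0])
    then show ?case by simp
  next
    case (Suc r)
    define D where "D = (\<lambda>\<mu>. \<chi> i j. deriv (\<lambda>\<mu>. f \<mu> $ i $ j) \<mu>)"
    have D: "D matholomorphic_on - {0}"
      using Suc.prems by (auto simp: D_def intro!: holomorphic_deriv)
    have "(\<lambda>\<mu>. (of_real v * \<i> * \<mu>) *\<^sub>C D \<mu>) matholomorphic_on - {0}" for v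
      by (intro mat_holomorphic_cscale D holomorphic_intros)
    then have "C_times r UNIV (\<lambda>t. (of_real v * \<i> * cis t) *\<^sub>C D (cis t))" for v
      by (rule Suc.IH)
    then have "C_times r UNIV (\<lambda>t. v *\<^sub>R ((\<i> * cis t) *\<^sub>C D (cis t)))" for v
      by (simp add: scaleR_conv_cscale mult.assoc)
    moreover have "((\<lambda>t. f (cis t)) has_derivative (\<lambda>v. v *\<^sub>R ((\<i> * cis t) *\<^sub>C D (cis t)))) (at t)" for t
      using mat_holomorphic_loop_deriv[OF Suc.prems, of t]
      by (simp add: has_vector_derivative_def D_def)
    ultimately show ?case
      unfolding C_times.simps by (intro exI[of _ "\<lambda>t v. v *\<^sub>R ((\<i> * cis t) *\<^sub>C D (cis t))"]) auto
  qed
qed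

text \<open>The equation \<open>b' = (C0 + \<mu> C1) b\<close> depends on the parameter without
  negative powers, so its solutions are entire in \<open>\<mu>\<close>.\<close>

locale affine_ode =
  fixes C0 C1 :: "real \<Rightarrow> 'n::finite cmat"
  assumes cont: "continuous_on UNIV C0" "continuous_on UNIV C1"
begin

definition C :: "complex \<Rightarrow> real \<Rightarrow> 'n cmat"
  where "C \<mu> y = C0 y + \<mu> *\<^sub>C C1 y"

lemma C_cont: "continuous_on UNIV (C \<mu>)"
  unfolding C_def[abs_def] by (intro continuous_intros cont cs.continuous_on)

primrec picard :: "nat \<Rightarrow> complex \<Rightarrow> real \<Rightarrow> 'n cmat" where
  "picard 0 \<mu> = (\<lambda>y. mat 1)"
| "picard (Suc n) \<mu> = antideriv (\<lambda>y. C \<mu> y ** picard n \<mu> y)"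

lemma picard_cont: "continuous_on UNIV (picard n \<mu>)"
proof (induction n)
  case (Suc n)
  show ?case
    unfolding picard.simps by (intro continuous_on_antideriv mm.continuous_on C_cont Suc)
qed simp

lemma integrand_cont: "continuous_on UNIV (\<lambda>y. C \<mu> y ** picard n \<mu> y)"
  by (intro mm.continuous_on C_cont picard_cont)

lemma ode_series_picard: "ode_series (\<lambda>n. picard n \<mu>) (\<lambda>y v. C \<mu> y ** v) (mat 1)"
proof (rule ode_series.intro)
  show "(picard (Suc n) \<mu> has_vector_derivative C \<mu> y ** picard n \<mu> y) (at y)" for n y
    unfolding picard.simps by (rule antideriv_deriv[OF integrand_cont])
  show "picard (Suc n) \<mu> 0 = 0" for n
    unfolding picard.simps by (rule antideriv_0[OF integrand_cont])
qed (simp_all add: linear_mult_left)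

text \<open>Expanding in powers of \<open>\<mu>\<close> yields holomorphy of the iterates without
  differentiating an integral with respect to a parameter.\<close>

lemma picard_polynomial:
  "\<exists>q. (\<forall>j. continuous_on UNIV (q j)) \<and> (\<forall>\<mu> y. picard n \<mu> y = (\<Sum>j\<le>n. \<mu> ^ j *\<^sub>C q j y))"
proof (induction n)
  case 0
  show ?case by (rule exI[of _ "\<lambda>_ _. mat 1"]) simp
next
  case (Suc n)
  then obtain q where q: "\<And>j. continuous_on UNIV (q j)" "\<And>\<mu> y. picard n \<mu> y = (\<Sum>j\<le>n. \<mu> ^ j *\<^sub>C q j y)"
    by blast
  define a where "a = (\<lambda>j. antideriv (\<lambda>y. C0 y ** q j y))"
  define b where "b = (\<lambda>j. antideriv (\<lambda>y. C1 y ** q j y))"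
  have ca: "continuous_on UNIV (\<lambda>y. C0 y ** q j y)" and cb: "continuous_on UNIV (\<lambda>y. C1 y ** q j y)" for j
    by (intro mm.continuous_on cont q)+
  \<comment> \<open>\<open>C0\<close> keeps the degree and \<open>C1\<close> raises it by one, hence
    the index \<open>j - 1\<close>; the guards remove the contributions absent at the top and bottom
    degrees.\<close>
  define p where "p = (\<lambda>j y. (if j \<le> n then a j y else 0) + (if j = 0 then 0 else b (j - 1) y))"
  have "continuous_on UNIV (p j)" for j
    unfolding p_def a_def b_def
    by (cases "j \<le> n"; cases "j = 0") (auto intro!: continuous_on_add continuous_on_antideriv ca cb)
  moreover have "picard (Suc n) \<mu> y = (\<Sum>j\<le>Suc n. \<mu> ^ j *\<^sub>C p j y)" for \<mu> y
  proof -
    define F where "F = (\<lambda>y. (\<Sum>j\<le>n. \<mu> ^ j *\<^sub>C a j y) + (\<Sum>j\<le>n. \<mu> ^ Suc j *\<^sub>C b j y))"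
    have "(F has_vector_derivative (\<Sum>j\<le>n. \<mu> ^ j *\<^sub>C (C0 y ** q j y)) + (\<Sum>j\<le>n. \<mu> ^ Suc j *\<^sub>C (C1 y ** q j y))) (at y)" for y
      unfolding F_def a_def b_def
      by (intro has_vector_derivative_add has_vector_derivative_sum has_vector_derivative_cscale
          antideriv_deriv ca cb)
    moreover have "(\<Sum>j\<le>n. \<mu> ^ j *\<^sub>C (C0 y ** q j y)) + (\<Sum>j\<le>n. \<mu> ^ Suc j *\<^sub>C (C1 y ** q j y)) =
        C \<mu> y ** picard n \<mu> y" for y
      by (simp add: C_def q(2) mat_distribs mm.sum_right cs.sum_right sum.distrib mult.commute[of \<mu>])
    ultimately have "(F has_vector_derivative C \<mu> y ** picard n \<mu> y) (at y)" for y by simp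
    moreover have "F 0 = 0"
      by (simp add: F_def a_def b_def antideriv_0 ca cb)
    ultimately have "picard (Suc n) \<mu> y = F y"
      unfolding picard.simps by (rule antideriv_eqI)
    also have "F y = (\<Sum>j\<le>Suc n. \<mu> ^ j *\<^sub>C p j y)"
    proof -
      have "(\<Sum>j\<le>Suc n. \<mu> ^ j *\<^sub>C p j y) =
          (\<Sum>j\<le>Suc n. \<mu> ^ j *\<^sub>C (if j \<le> n then a j y else 0)) +
          (\<Sum>j\<le>Suc n. \<mu> ^ j *\<^sub>C (if j = 0 then 0 else b (j - 1) y))"
        by (simp only: p_def cs.add_right sum.distrib)
      also have "(\<Sum>j\<le>Suc n. \<mu> ^ j *\<^sub>C (if j \<le> n then a j y else 0)) = (\<Sum>j\<le>n. \<mu> ^ j *\<^sub>C a j y)"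
        by simp
      also have "(\<Sum>j\<le>Suc n. \<mu> ^ j *\<^sub>C (if j = 0 then 0 else b (j - 1) y)) = (\<Sum>j\<le>n. \<mu> ^ Suc j *\<^sub>C b j y)"
        by (subst sum.atMost_Suc_shift) simp
      finally show ?thesis by (simp add: F_def)
    qed
    finally show ?thesis .
  qed
  ultimately show ?case by blast
qed

lemma picard_holomorphic: "(\<lambda>\<mu>. picard n \<mu> y) matholomorphic_on UNIV"
proof -
  obtain q where "\<And>\<mu> y. picard n \<mu> y = (\<Sum>j\<le>n. \<mu> ^ j *\<^sub>C q j y)"
    using picard_polynomial by blast
  then have "picard n \<mu> y $ i $ j = (\<Sum>l\<le>n. \<mu> ^ l * q l y $ i $ j)" for \<mu> i j
    by simp
  then show ?thesis by (auto intro!: holomorphic_intros)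
qed

definition sol :: "complex \<Rightarrow> real \<Rightarrow> 'n cmat"
  where "sol \<mu> y = (\<Sum>n. picard n \<mu> y)"

lemma sol_deriv: "(sol \<mu> has_vector_derivative C \<mu> y ** sol \<mu> y) (at y)"
  unfolding sol_def[abs_def]
  by (rule ode_series.solution_deriv[OF ode_series_picard mult_left_locally_bounded(1)[OF C_cont]])

lemma sol_0: "sol \<mu> 0 = mat 1"
  unfolding sol_def
  by (rule ode_series.solution_0[OF ode_series_picard]) (rule mult_left_locally_bounded(1)[OF C_cont])

text \<open>On the unit ball around \<open>x\<close> the coefficient matrix has a bound independent
  of \<open>\<mu>\<close>, so the exponential majorants are uniform there.\<close>

lemma sol_holomorphic: "(\<lambda>\<mu>. sol \<mu> y) matholomorphic_on UNIV"
  unfolding sol_def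
proof (rule mat_holomorphic_series[OF open_UNIV picard_holomorphic])
  fix x :: complex
  define R where "R = \<bar>y\<bar>"
  define r where "r = norm x + 1"
  have "r \<ge> 0" by (simp add: r_def)
  obtain c0 where c0: "c0 \<ge> 0" "\<And>y. \<bar>y\<bar> \<le> R \<Longrightarrow> norm (C0 y) \<le> c0"
    using continuous_locally_bounded[OF cont(1)] by metis
  obtain c1 where c1: "c1 \<ge> 0" "\<And>y. \<bar>y\<bar> \<le> R \<Longrightarrow> norm (C1 y) \<le> c1"
    using continuous_locally_bounded[OF cont(2)] by metis
  obtain K where K: "K > 0" "\<And>(A :: 'n cmat) (B :: 'n cmat). norm (A ** B) \<le> norm A * norm B * K"
    using mm.pos_bounded[where ?'n = 'n] by auto
  obtain L where L: "L > 0" "\<And>a (B :: 'n cmat). norm (a *\<^sub>C B) \<le> norm a * norm B * L"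
    using cs.pos_bounded[where ?'n = 'n] by auto
  define c where "c = (c0 + r * c1 * L) * K"
  have "norm (picard n \<mu> y) \<le> norm (mat 1 :: 'n cmat) * (\<bar>c * R\<bar> ^ n / fact n)"
    if \<mu>: "\<mu> \<in> cball x 1" for n \<mu>
  proof (rule ode_series.majorant[OF ode_series_picard])
    have "norm \<mu> \<le> r" using \<mu> norm_triangle_sub[of \<mu> x] by (simp add: r_def dist_norm norm_minus_commute)
    show "norm (C \<mu> s ** v) \<le> c * norm v" if s: "\<bar>s\<bar> \<le> R" for s v
    proof -
      have "norm (C \<mu> s) \<le> norm (C0 s) + norm (\<mu> *\<^sub>C C1 s)"
        unfolding C_def by (rule norm_triangle_ineq)
      also have "\<dots> \<le> c0 + norm \<mu> * norm (C1 s) * L"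
        using c0(2)[OF s] L(2) by (intro add_mono)
      also have "\<dots> \<le> c0 + r * c1 * L"
        using \<open>r \<ge> 0\<close> c1 c1(2)[OF s] L \<open>norm \<mu> \<le> r\<close> by (intro add_left_mono mult_right_mono mult_mono) auto
      finally have "norm (C \<mu> s) * norm v * K \<le> (c0 + r * c1 * L) * norm v * K"
        using K by (intro mult_right_mono) auto
      then show ?thesis using K(2)[of "C \<mu> s" v] by (simp add: c_def mult_ac)
    qed
  qed (simp add: R_def)
  then show "\<exists>d>0. \<exists>M. cball x d \<subseteq> UNIV \<and> summable M \<and> (\<forall>n. \<forall>\<mu>\<in>cball x d. norm (picard n \<mu> y) \<le> M n)"
    using ode_series.summable_majorant[OF ode_series_picard, of "c * R"] zero_less_one by blast
qed

end

text \<open>The inverse solves an equation with the coefficients on the right. Transposition moves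
  them to the left, so the inverse also comes as an entire function of \<open>\<mu>\<close>.\<close>

lemma affine_ode_solution:
  fixes C0 C1 :: "real \<Rightarrow> 'n::finite cmat"
  assumes "continuous_on UNIV C0" "continuous_on UNIV C1"
  shows "\<exists>b n. (\<forall>\<mu> y. (b \<mu> has_vector_derivative (C0 y + \<mu> *\<^sub>C C1 y) ** b \<mu> y) (at y)) \<and>
    (\<forall>\<mu> y. (n \<mu> has_vector_derivative - (n \<mu> y ** (C0 y + \<mu> *\<^sub>C C1 y))) (at y)) \<and>
    (\<forall>\<mu>. b \<mu> 0 = mat 1) \<and> (\<forall>\<mu>. n \<mu> 0 = mat 1) \<and>
    (\<forall>\<mu> y. b \<mu> y ** n \<mu> y = mat 1) \<and> (\<forall>\<mu> y. n \<mu> y ** b \<mu> y = mat 1) \<and>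
    (\<forall>y. (\<lambda>\<mu>. b \<mu> y) matholomorphic_on UNIV) \<and> (\<forall>y. (\<lambda>\<mu>. n \<mu> y) matholomorphic_on UNIV)"
proof -
  interpret b: affine_ode C0 C1 using assms by unfold_locales
  have transpose: "bounded_linear (transpose :: 'n cmat \<Rightarrow> 'n cmat)"
    by (simp add: linear_conv_bounded_linear[symmetric] linear_iff transpose_def vec_eq_iff)
  interpret n: affine_ode "\<lambda>y. - transpose (C0 y)" "\<lambda>y. - transpose (C1 y)"
    by unfold_locales (intro continuous_on_minus continuous_on_compose2[OF
        linear_continuous_on[OF transpose, of UNIV]] assms; simp)+
  define n where "n = (\<lambda>\<mu> y. transpose (n.sol \<mu> y))"
  have n: "(n \<mu> has_vector_derivative - (n \<mu> y ** (C0 y + \<mu> *\<^sub>C C1 y))) (at y)" for \<mu> y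
  proof -
    have "transpose (n.C \<mu> y ** n.sol \<mu> y) = - (n \<mu> y ** (C0 y + \<mu> *\<^sub>C C1 y))"
      by (simp add: n_def n.C_def matrix_transpose_mul)
         (simp add: vec_eq_iff matrix_matrix_mult_def transpose_def sum_negf[symmetric] algebra_simps)
    then show ?thesis
      using bounded_linear.has_vector_derivative[OF transpose n.sol_deriv[of \<mu> y]]
      by (simp add: n_def)
  qed
  have n0: "n \<mu> 0 = mat 1" for \<mu> by (simp add: n_def n.sol_0 transpose_mat)
  have nb: "n \<mu> y ** b.sol \<mu> y = mat 1" for \<mu> y
  proof -
    have "((\<lambda>y. n \<mu> y ** b.sol \<mu> y) has_vector_derivative 0) (at y)" for y
      by (rule has_vector_derivative_rhs, rule has_vector_derivative_mult, rule n, rule b.sol_deriv)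
         (simp add: b.C_def matrix_mul_assoc)
    from zero_derivative_imp_const[OF this, of y 0] show ?thesis by (simp add: n0 b.sol_0)
  qed
  have bn: "b.sol \<mu> y ** n \<mu> y = mat 1" for \<mu> y
    using nb by (simp add: matrix_left_right_inverse[of "b.sol \<mu> y"])
  have hol: "(\<lambda>\<mu>. n \<mu> y) matholomorphic_on UNIV" for y
    using n.sol_holomorphic[of y] by (simp add: n_def transpose_def)
  show ?thesis
    by (rule exI[of _ b.sol], rule exI[of _ n])
       (intro conjI allI b.sol_deriv[unfolded b.C_def] n b.sol_0 n0 bn nb
         b.sol_holomorphic[THEN spec, THEN spec] hol[THEN spec, THEN spec])
qed

section \<open>Potentials from Lax data\<close>

context symmetric_space
begin

text \<open>The identity component of the fixed point group is compact, lies in \<open>K\<close> and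
  has the same Lie algebra, so \<open>group_C_flow\<close> applies to it whether or not
  \<open>K\<close> is known to be closed.\<close>

definition K\<^sub>0 :: "'n cmat set"
  where "K\<^sub>0 = connected_component_set (fixed_points G \<tau>) (mat 1)"

lemma K\<^sub>0_fixed: "K\<^sub>0 \<subseteq> fixed_points G \<tau>"
  unfolding K\<^sub>0_def by (rule connected_component_subset)

lemma one_fixed: "mat 1 \<in> fixed_points G \<tau>"
  by (simp add: fixed_points_def)

lemma compact_fixed_points: "compact (fixed_points G \<tau>)"
proof -
  have "closed {g \<in> G. \<tau> g - g = 0}"
    by (intro continuous_closed_preimage_constant continuous_intros \<tau>_cont compact_imp_closed compact)
  with compact have "compact (G \<inter> {g \<in> G. \<tau> g - g = 0})" by (rule compact_Int_closed)
  moreover have "fixed_points G \<tau> = G \<inter> {g \<in> G. \<tau> g - g = 0}" by (auto simp: fixed_points_def)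
  ultimately show ?thesis by (simp only:)
qed

lemma K\<^sub>0_image:
  assumes cont: "continuous_on G f" and maps: "\<And>g. g \<in> fixed_points G \<tau> \<Longrightarrow> f g \<in> fixed_points G \<tau>"
    and "f (mat 1) \<in> K\<^sub>0" and g: "g \<in> K\<^sub>0"
  shows "f g \<in> K\<^sub>0"
proof -
  have "connected (f ` K\<^sub>0)"
    unfolding K\<^sub>0_def
    by (intro connected_continuous_image connected_connected_component continuous_on_subset[OF cont])
       (use K\<^sub>0_fixed in \<open>auto simp: K\<^sub>0_def fixed_points_def\<close>)
  moreover have "f ` K\<^sub>0 \<subseteq> fixed_points G \<tau>" using maps K\<^sub>0_fixed by auto
  moreover have "mat 1 \<in> K\<^sub>0" using one_fixed by (simp add: K\<^sub>0_def)
  ultimately have "connected_component (fixed_points G \<tau>) (f (mat 1)) (f g)"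
    using g by (intro connected_componentI[of "f ` K\<^sub>0"]) auto
  moreover have "connected_component (fixed_points G \<tau>) (mat 1) (f (mat 1))"
    using assms(3) by (simp add: K\<^sub>0_def)
  ultimately show ?thesis
    unfolding K\<^sub>0_def by (simp add: connected_component_trans[of _ "mat 1" "f (mat 1)"])
qed

lemma compact_matrix_group_K\<^sub>0: "compact_matrix_group K\<^sub>0"
proof
  have K0_G: "g \<in> G" if "g \<in> K\<^sub>0" for g using K\<^sub>0_fixed that by (auto simp: fixed_points_def)
  show "compact K\<^sub>0"
  proof -
    have "closed K\<^sub>0"
      unfolding K\<^sub>0_def by (intro closed_connected_component compact_imp_closed compact_fixed_points)
    with compact_fixed_points have "compact (fixed_points G \<tau> \<inter> K\<^sub>0)" by (rule compact_Int_closed)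
    moreover have "fixed_points G \<tau> \<inter> K\<^sub>0 = K\<^sub>0" using K\<^sub>0_fixed by auto
    ultimately show ?thesis by (simp only:)
  qed
  show one: "mat 1 \<in> K\<^sub>0" using one_fixed by (simp add: K\<^sub>0_def)
  show "g ** h \<in> K\<^sub>0" if "g \<in> K\<^sub>0" "h \<in> K\<^sub>0" for g h
  proof (rule K\<^sub>0_image[OF _ _ _ that(2)])
    show "continuous_on G (\<lambda>h. g ** h)" by (intro mm.continuous_on continuous_intros)
    show "g ** h \<in> fixed_points G \<tau>" if "h \<in> fixed_points G \<tau>" for h
      using that K\<^sub>0_fixed \<open>g \<in> K\<^sub>0\<close> by (auto simp: fixed_points_def mult_mem \<tau>_mult)
  qed (use that in simp)
  show "invertible g" if "g \<in> K\<^sub>0" for g using invertible[OF K0_G[OF that]] .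
  show "matrix_inv g \<in> K\<^sub>0" if "g \<in> K\<^sub>0" for g
  proof (rule K\<^sub>0_image[OF _ _ _ that])
    show "continuous_on G matrix_inv"
      using continuous_on_matrix_inv[of G "\<lambda>g. g"] invertible by simp
    show "matrix_inv g \<in> fixed_points G \<tau>" if "g \<in> fixed_points G \<tau>" for g
      using that by (auto simp: fixed_points_def inv_mem \<tau>_inv)
    have "matrix_inv (mat 1 :: 'n cmat) = mat 1" by (rule matrix_inv_unique) simp
    then show "matrix_inv (mat 1) \<in> K\<^sub>0" using one by simp
  qed
qed

lemma lie_algebra_K\<^sub>0: "lie_algebra K\<^sub>0 = lie_algebra K"
proof (rule subset_antisym)
  show "lie_algebra K\<^sub>0 \<subseteq> lie_algebra K"
    using component_subset by (auto simp: lie_algebra_def K\<^sub>0_def)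
  show "lie_algebra K \<subseteq> lie_algebra K\<^sub>0"
  proof
    fix X assume "X \<in> lie_algebra K"
    then have *: "mexp (t *\<^sub>R X) \<in> fixed_points G \<tau>" for t
      using K_fixed by (auto simp: lie_algebra_def)
    show "X \<in> lie_algebra K\<^sub>0"
      unfolding lie_algebra_def K\<^sub>0_def by (intro CollectI allI one_parameter_in_component *)
  qed
qed

lemma group_C_K\<^sub>0: "group_C K\<^sub>0 \<subseteq> group_C K"
proof -
  have "K\<^sub>0 \<subseteq> K" using component_subset by (simp add: K\<^sub>0_def)
  then show ?thesis unfolding group_C_def lie_algebra_K\<^sub>0 by blast
qed

end

interpretation br: bounded_bilinear "bracket :: 'n::finite cmat \<Rightarrow> _"
  unfolding bilinear_conv_bounded_bilinear[symmetric] bilinear_def linear_iff bracket_def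
  by (auto simp: mat_distribs)

lemma bracket_cscale: "bracket (c *\<^sub>C X) Y = c *\<^sub>C bracket X Y" "bracket X (c *\<^sub>C Y) = c *\<^sub>C bracket X Y"
  by (simp_all add: bracket_def cs.diff_right)

lemma bracket_self: "bracket X X = 0"
  by (simp add: bracket_def)

lemma bracket_swap: "bracket X Y = - bracket Y X"
  by (simp add: bracket_def)

text \<open>
  The components of \<open>\<alpha>\<^sub>\<lambda>\<close> along the imaginary axis, for \<open>\<lambda>\<close> on the unit circle, are
  \<open>\<alpha>\<^sub>\<lambda>(\<partial>\<^sub>x) = \<kappa> + Re \<lambda> u - Im \<lambda> v\<close> and \<open>\<alpha>\<^sub>\<lambda>(\<partial>\<^sub>y) = \<eta> + Im \<lambda> u + Re \<lambda> v\<close>; the three differential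
  equations say that these form a Lax pair for every \<open>\<lambda>\<close>.
\<close>

locale lax_data = symmetric_space G \<tau> k K for G :: "'n::finite cmat set" and \<tau> k K +
  fixes \<kappa> \<eta> u v :: "real \<Rightarrow> 'n cmat"
  assumes \<kappa>_mem: "\<kappa> y \<in> lie_algebra K" and \<eta>_mem: "\<eta> y \<in> lie_algebra K"
    and u_mem: "u y \<in> lie_algebra G" and v_mem: "v y \<in> lie_algebra G"
    and d\<tau>_u: "d\<tau> (u y) = Re (omega k) *\<^sub>R u y - Im (omega k) *\<^sub>R v y"
    and d\<tau>_v: "d\<tau> (v y) = Im (omega k) *\<^sub>R u y + Re (omega k) *\<^sub>R v y"
    and \<eta>_cont: "continuous_on UNIV \<eta>"
    and \<kappa>_deriv: "(\<kappa> has_vector_derivative bracket (\<kappa> y) (\<eta> y) + bracket (u y) (v y)) (at y)"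
    and u_deriv: "(u has_vector_derivative bracket (\<kappa> y) (v y) + bracket (u y) (\<eta> y)) (at y)"
    and v_deriv: "(v has_vector_derivative bracket (v y) (\<eta> y) - bracket (\<kappa> y) (u y)) (at y)"
begin

lemmas conts = has_vector_derivative_imp_continuous_on[OF \<kappa>_deriv]
  has_vector_derivative_imp_continuous_on[OF u_deriv]
  has_vector_derivative_imp_continuous_on[OF v_deriv] \<eta>_cont

text \<open>With \<open>q\<close>, the Laurent polynomials that equal Re \<mu> and - Im \<mu> on the
  unit circle. They extend the Lax pair to all nonzero \<open>\<mu>\<close>.\<close>

definition p :: "complex \<Rightarrow> complex" where "p \<mu> = (inverse \<mu> + \<mu>) / 2"
definition q :: "complex \<Rightarrow> complex" where "q \<mu> = \<i> * (\<mu> - inverse \<mu>) / 2"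

definition A :: "complex \<Rightarrow> real \<Rightarrow> 'n cmat"
  where "A \<mu> y = \<kappa> y + p \<mu> *\<^sub>C u y + q \<mu> *\<^sub>C v y"

definition L :: "complex \<Rightarrow> real \<Rightarrow> 'n cmat"
  where "L \<mu> y = \<eta> y - q \<mu> *\<^sub>C u y + p \<mu> *\<^sub>C v y"

text \<open>\<open>C0 + \<mu> C1\<close> is the combination \<open>\<i> A - L\<close> after the
  negative powers have cancelled; its value at 0 lies in the complexification of k.\<close>

definition C0 :: "real \<Rightarrow> 'n cmat" where "C0 y = \<i> *\<^sub>C \<kappa> y - \<eta> y"
definition C1 :: "real \<Rightarrow> 'n cmat" where "C1 y = \<i> *\<^sub>C u y - v y"

text \<open>The first two identities express the cancellation of the negative power; the third makes
  the coefficient of \<open>[u, v]\<close> independent of the parameter.\<close>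

lemma pq_relations:
  assumes "\<mu> \<noteq> 0"
  shows "\<i> * p \<mu> - \<i> * \<mu> = - q \<mu>" "\<i> * q \<mu> + \<mu> = p \<mu>" "\<i> * \<mu> * q \<mu> + \<mu> * p \<mu> = 1"
  using assms by (simp_all add: p_def q_def field_simps flip: power2_eq_square)

lemma pq_circle:
  assumes "\<mu> \<in> sphere 0 1"
  shows "p \<mu> = Re \<mu>" "q \<mu> = - Im \<mu>"
proof -
  have "inverse \<mu> = cnj \<mu>"
    using assms by (simp add: complex_div_cnj[of 1 \<mu>] inverse_eq_divide)
  then show "p \<mu> = Re \<mu>" "q \<mu> = - Im \<mu>"
    by (simp_all add: p_def q_def complex_eq_iff)
qed

lemma A_minus_C:
  assumes "\<mu> \<noteq> 0"
  shows "\<i> *\<^sub>C A \<mu> y - (C0 y + \<mu> *\<^sub>C C1 y) = L \<mu> y"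
proof -
  have "\<i> *\<^sub>C A \<mu> y - (C0 y + \<mu> *\<^sub>C C1 y) =
      \<eta> y + (\<i> * p \<mu> - \<i> * \<mu>) *\<^sub>C u y + (\<i> * q \<mu> + \<mu>) *\<^sub>C v y"
    by (simp add: A_def C0_def C1_def mat_distribs mult.commute[of \<mu>])
  then show ?thesis by (simp add: pq_relations[OF assms] L_def)
qed

text \<open>The Lax equation \<open>A' = [A, L]\<close>: since \<open>A\<close> commutes with
  itself, \<open>L\<close> may be replaced by \<open>- (C0 + \<mu> C1)\<close>, the form that fits
  conjugation by a solution of \<open>b' = (C0 + \<mu> C1) b\<close>.\<close>

lemma A_deriv:
  assumes "\<mu> \<noteq> 0"
  shows "(A \<mu> has_vector_derivative bracket (C0 y + \<mu> *\<^sub>C C1 y) (A \<mu> y)) (at y)"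
proof -
  have "bracket (C0 y + \<mu> *\<^sub>C C1 y) (A \<mu> y) =
      bracket (\<kappa> y) (\<eta> y) + p \<mu> *\<^sub>C bracket (u y) (\<eta> y) + q \<mu> *\<^sub>C bracket (v y) (\<eta> y) +
      (\<i> * p \<mu> - \<i> * \<mu>) *\<^sub>C bracket (\<kappa> y) (u y) + (\<i> * q \<mu> + \<mu>) *\<^sub>C bracket (\<kappa> y) (v y) +
      (\<i> * \<mu> * q \<mu> + \<mu> * p \<mu>) *\<^sub>C bracket (u y) (v y)"
    unfolding A_def C0_def C1_def
    by (simp add: br.add_left br.add_right br.diff_left br.diff_right bracket_cscale bracket_self
        bracket_swap[of "\<eta> y"] bracket_swap[of "u y" "\<kappa> y"] bracket_swap[of "v y" "\<kappa> y"]
        bracket_swap[of "v y" "u y"] mat_distribs mult_ac)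
  also have "\<dots> = bracket (\<kappa> y) (\<eta> y) + bracket (u y) (v y) +
      p \<mu> *\<^sub>C (bracket (\<kappa> y) (v y) + bracket (u y) (\<eta> y)) +
      q \<mu> *\<^sub>C (bracket (v y) (\<eta> y) - bracket (\<kappa> y) (u y))"
    unfolding pq_relations[OF assms] by (simp add: mat_distribs)
  finally show ?thesis
    unfolding A_def[abs_def]
    by (simp only:) (intro has_vector_derivative_add has_vector_derivative_cscale \<kappa>_deriv u_deriv v_deriv)
qed

lemma A_circle:
  assumes "\<mu> \<in> sphere 0 1"
  shows "A \<mu> y = \<kappa> y + Re \<mu> *\<^sub>R u y - Im \<mu> *\<^sub>R v y" "L \<mu> y = \<eta> y + Im \<mu> *\<^sub>R u y + Re \<mu> *\<^sub>R v y"
  by (simp_all add: A_def L_def pq_circle[OF assms] scaleR_conv_cscale)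

lemma \<kappa>_mem_G: "\<kappa> y \<in> lie_algebra G" "d\<tau> (\<kappa> y) = \<kappa> y"
  and \<eta>_mem_G: "\<eta> y \<in> lie_algebra G" "d\<tau> (\<eta> y) = \<eta> y"
  using \<kappa>_mem \<eta>_mem by (auto simp: lie_algebra_K)

lemma AL_mem:
  assumes "\<mu> \<in> sphere 0 1"
  shows "A \<mu> y \<in> lie_algebra G" "L \<mu> y \<in> lie_algebra G"
  unfolding A_circle[OF assms]
  by (intro lie_algebra_add subspace_diff[OF subspace_lie_algebra] lie_algebra_scaleR
      \<kappa>_mem_G \<eta>_mem_G u_mem v_mem)+

lemma omega_sphere: "\<mu> \<in> sphere 0 1 \<Longrightarrow> omega k * \<mu> \<in> sphere 0 1"
  by (simp add: norm_mult omega_def)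

text \<open>On the pair \<open>(u, v)\<close> the differential of \<tau> is the rotation that
  multiplication of \<open>\<mu>\<close> by \<open>omega k\<close> produces in the
  coefficients.\<close>

lemma AL_twisted:
  assumes "\<mu> \<in> sphere 0 1"
  shows "d\<tau> (A \<mu> y) = A (omega k * \<mu>) y" "d\<tau> (L \<mu> y) = L (omega k * \<mu>) y"
  unfolding A_circle[OF assms] A_circle[OF omega_sphere[OF assms]]
  by (simp_all add: linear_add[OF linear_d\<tau>] linear_diff[OF linear_d\<tau>] linear_cmul[OF linear_d\<tau>]
      d\<tau>_u d\<tau>_v \<kappa>_mem_G \<eta>_mem_G algebra_simps scaleR_add_left scaleR_diff_left)

text \<open>Valid for every complex \<open>\<mu>\<close>, so also inside the disc, where the
  positive factor has to stay in the complexified group.\<close>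

lemma C_mem_lie_algebra_C: "C0 y + \<mu> *\<^sub>C C1 y \<in> lie_algebra_C G"
proof -
  have "C0 y + \<mu> *\<^sub>C C1 y =
      (- \<eta> y - Re \<mu> *\<^sub>R v y - Im \<mu> *\<^sub>R u y) + \<i> *\<^sub>C (\<kappa> y + Re \<mu> *\<^sub>R u y - Im \<mu> *\<^sub>R v y)"
    by (simp add: C0_def C1_def vec_eq_iff complex_eq_iff algebra_simps)
  then show ?thesis
    by (simp only:) (intro lie_algebra_CI lie_algebra_add subspace_diff[OF subspace_lie_algebra]
      subspace_neg[OF subspace_lie_algebra] lie_algebra_scaleR \<kappa>_mem_G \<eta>_mem_G u_mem v_mem)
qed

lemma C_cont: "continuous_on UNIV C0" "continuous_on UNIV C1"
  unfolding C0_def[abs_def] C1_def[abs_def]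
  by (intro continuous_intros cs.continuous_on conts)+

lemma L_cont: "continuous_on UNIV (L \<mu>)"
  unfolding L_def[abs_def] by (intro continuous_intros cs.continuous_on conts)

definition \<xi> :: "complex \<Rightarrow> 'n cmat" where "\<xi> \<mu> = A \<mu> 0"

lemma \<xi>_holomorphic: "\<xi> matholomorphic_on - {0}"
  unfolding \<xi>_def[abs_def] A_def p_def q_def by (auto intro!: holomorphic_intros)

lemma \<xi>_loop_algebra_1: "\<xi> \<in> loop_algebra_1 G \<tau> k"
proof -
  have "smooth_loop \<xi>" using \<xi>_holomorphic by (rule smooth_loop_mat_holomorphic)
  then have "\<xi> \<in> loop_algebra G \<tau> k"
    using AL_mem(1) AL_twisted(1) by (simp add: loop_algebra_def \<xi>_def d\<tau>_eq)
  moreover have "\<xi> \<mu> = inverse \<mu> *\<^sub>C ((1/2) *\<^sub>C (u 0 - \<i> *\<^sub>C v 0)) + \<kappa> 0 + \<mu> *\<^sub>C ((1/2) *\<^sub>C (u 0 + \<i> *\<^sub>C v 0))" for \<mu>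
  proof -
    have "c + (\<nu> + \<mu>) / 2 * a + \<i> * (\<mu> - \<nu>) / 2 * b = \<nu> * ((1/2) * (a - \<i> * b)) + c + \<mu> * ((1/2) * (a + \<i> * b))"
      for \<nu> a b c :: complex
      by (simp add: field_simps)
    then show ?thesis
      unfolding \<xi>_def A_def p_def q_def vec_eq_iff vector_add_component vector_minus_component cscale_nth
      by blast
  qed
  ultimately show ?thesis
    unfolding loop_algebra_1_def by blast
qed

text \<open>The curve \<open>f\<close>, the extended frame along the imaginary axis at parameter 1,
  is kept in the conclusion: its differential equation later identifies the generated map with the
  given one. The element \<open>k1\<close> is the \<open>K\<close>-factor of the positive part at
  parameter 0.\<close>

theorem generates:
  assumes B: "iwasawa_decomposition K B"
  shows "\<exists>F b f. iwasawa_factors G \<tau> k B \<xi> F b \<and>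
    (\<forall>y. (f has_vector_derivative f y ** (\<eta> y + v y)) (at y)) \<and> f 0 = mat 1 \<and>
    (\<forall>x y. \<exists>k1\<in>K. F (Complex x y) 1 = mexp (x *\<^sub>R \<xi> 1) ** f y ** k1)"
proof -
  obtain b n where b: "\<And>\<mu> y. (b \<mu> has_vector_derivative (C0 y + \<mu> *\<^sub>C C1 y) ** b \<mu> y) (at y)"
    and n: "\<And>\<mu> y. (n \<mu> has_vector_derivative - (n \<mu> y ** (C0 y + \<mu> *\<^sub>C C1 y))) (at y)"
    and b0: "\<And>\<mu>. b \<mu> 0 = mat 1" and n0: "\<And>\<mu>. n \<mu> 0 = mat 1"
    and bn: "\<And>\<mu> y. b \<mu> y ** n \<mu> y = mat 1" and nb: "\<And>\<mu> y. n \<mu> y ** b \<mu> y = mat 1"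
    and bh: "\<And>y. (\<lambda>\<mu>. b \<mu> y) matholomorphic_on UNIV" and nh: "\<And>y. (\<lambda>\<mu>. n \<mu> y) matholomorphic_on UNIV"
    using affine_ode_solution[OF C_cont] by metis
  define f where "f = (\<lambda>\<mu> y. mexp (y *\<^sub>R (\<i> *\<^sub>C \<xi> \<mu>)) ** n \<mu> y)"
  \<comment> \<open>\<open>A\<close> evolves by conjugation with \<open>b\<close>, so
    \<open>n A b\<close> keeps its initial value \<open>\<xi>\<close>. This moves
    \<open>\<xi>\<close> past \<open>n\<close> when \<open>f\<close> is differentiated.\<close>
  have n_conj: "\<xi> \<mu> ** n \<mu> y = n \<mu> y ** A \<mu> y" if "\<mu> \<noteq> 0" for \<mu> y
  proof -
    have "((\<lambda>y. n \<mu> y ** A \<mu> y ** b \<mu> y) has_vector_derivative 0) (at y)" for y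
      by (rule has_vector_derivative_rhs, rule has_vector_derivative_mult,
          rule has_vector_derivative_mult, rule n, rule A_deriv[OF that], rule b)
         (simp add: bracket_def mat_distribs matrix_mul_assoc del: cscale_mult_left cscale_mult_right)
    from zero_derivative_imp_const[OF this, of y 0] have "n \<mu> y ** A \<mu> y ** b \<mu> y = \<xi> \<mu>"
      by (simp add: n0 b0 \<xi>_def)
    then have "\<xi> \<mu> ** n \<mu> y = n \<mu> y ** A \<mu> y ** (b \<mu> y ** n \<mu> y)"
      by (metis matrix_mul_assoc)
    then show ?thesis by (simp add: bn)
  qed
  have f_deriv: "(f \<mu> has_vector_derivative f \<mu> y ** L \<mu> y) (at y)" if \<mu>: "\<mu> \<noteq> 0" for \<mu> y
  proof -
    define E where "E = mexp (y *\<^sub>R (\<i> *\<^sub>C \<xi> \<mu>))"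
    have "(f \<mu> has_vector_derivative E ** - (n \<mu> y ** (C0 y + \<mu> *\<^sub>C C1 y)) + E ** (\<i> *\<^sub>C \<xi> \<mu>) ** n \<mu> y) (at y)"
      unfolding f_def E_def by (intro has_vector_derivative_mult mexp_has_vector_derivative' n)
    moreover have "E ** (\<i> *\<^sub>C \<xi> \<mu>) ** n \<mu> y = E ** n \<mu> y ** (\<i> *\<^sub>C A \<mu> y)"
      using n_conj[OF \<mu>, of y] by (simp flip: matrix_mul_assoc)
    moreover have "f \<mu> y ** L \<mu> y = E ** n \<mu> y ** (\<i> *\<^sub>C A \<mu> y) - E ** n \<mu> y ** (C0 y + \<mu> *\<^sub>C C1 y)"
      unfolding A_minus_C[OF \<mu>, symmetric] f_def E_def by (rule mm.diff_right)
    ultimately show ?thesis by (simp add: matrix_mul_assoc)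
  qed
  have f0: "f \<mu> 0 = mat 1" for \<mu> by (simp add: f_def n0)
  have f_G: "f \<mu> y \<in> G" and f_twisted: "f (omega k * \<mu>) y = \<tau> (f \<mu> y)" if \<mu>: "\<mu> \<in> sphere 0 1" for \<mu> y
  proof -
    note \<omega>\<mu> = omega_sphere[OF \<mu>]
    have nz: "\<mu> \<noteq> 0" "omega k * \<mu> \<noteq> 0" using \<mu> by auto
    have "f \<mu> y \<in> G \<and> f (omega k * \<mu>) y = \<tau> (f \<mu> y)"
    proof (rule \<tau>_flow[OF f_deriv[OF nz(1)] f0 f_deriv[OF nz(2)] f0 L_cont L_cont])
      fix y
      have E': "((\<lambda>\<epsilon>. mexp (\<epsilon> *\<^sub>R X)) has_vector_derivative X) (at 0)" for X :: "'n cmat"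
        using mexp_has_vector_derivative[of X 0 UNIV] by simp
      have "\<tau> (mexp (\<epsilon> *\<^sub>R L \<mu> y)) = mexp (\<epsilon> *\<^sub>R L (omega k * \<mu>) y)" for \<epsilon>
        by (simp add: \<tau>_exp[OF AL_mem(2)[OF \<mu>]] AL_twisted(2)[OF \<mu>])
      then show "\<exists>\<gamma>. \<gamma> 0 = mat 1 \<and> (\<forall>\<epsilon>. \<gamma> \<epsilon> \<in> G) \<and> (\<gamma> has_vector_derivative L \<mu> y) (at 0) \<and>
          ((\<lambda>\<epsilon>. \<tau> (\<gamma> \<epsilon>)) has_vector_derivative L (omega k * \<mu>) y) (at 0)"
        using E' lie_algebraD[OF AL_mem(2)[OF \<mu>]]
        by (intro exI[of _ "\<lambda>\<epsilon>. mexp (\<epsilon> *\<^sub>R L \<mu> y)"]) simp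
    qed
    then show "f \<mu> y \<in> G" "f (omega k * \<mu>) y = \<tau> (f \<mu> y)" by auto
  qed
  have b_C: "b \<mu> y \<in> group_C G" for \<mu> y
    using C_mem_lie_algebra_C _ b b0 n n0
    by (rule group_C_flow) (intro continuous_intros cs.continuous_on C_cont)
  \<comment> \<open>At parameter 0 only \<open>C0\<close> is left, so the solution stays in the
    complexification of the identity component of the fixed point group.\<close>
  have "b 0 y \<in> group_C K\<^sub>0" for y
  proof (rule compact_matrix_group.group_C_flow[OF compact_matrix_group_K\<^sub>0])
    show "C0 y \<in> lie_algebra_C K\<^sub>0" for y
    proof -
      have eq: "C0 y = - \<eta> y + \<i> *\<^sub>C \<kappa> y" by (simp add: C0_def)
      have "- \<eta> y \<in> lie_algebra K\<^sub>0" "\<kappa> y \<in> lie_algebra K\<^sub>0"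
        using \<kappa>_mem \<eta>_mem subspace_neg[OF compact_matrix_group.subspace_lie_algebra[OF compact_matrix_group_K\<^sub>0]]
        by (simp_all add: lie_algebra_K\<^sub>0)
      then show ?thesis
        unfolding eq by (rule compact_matrix_group.lie_algebra_CI[OF compact_matrix_group_K\<^sub>0])
    qed
    show "(b 0 has_vector_derivative C0 y ** b 0 y) (at y)" for y using b[of 0 y] by simp
    show "(n 0 has_vector_derivative - (n 0 y ** C0 y)) (at y)" for y using n[of 0 y] by simp
  qed (rule C_cont b0 n0)+
  then have "b 0 y \<in> group_C K" for y using group_C_K\<^sub>0 by blast
  moreover have "group_C K = (\<lambda>(a, b). a ** b) ` (K \<times> B)"
    using B by (simp add: iwasawa_decomposition_def bij_betw_def)
  ultimately have "b 0 y \<in> (\<lambda>(a, b). a ** b) ` (K \<times> B)" for y by simp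
  then have "\<forall>y. \<exists>k1\<in>K. \<exists>\<beta>\<in>B. b 0 y = k1 ** \<beta>"
    by (simp add: image_iff)
  then obtain k1 \<beta> where k1: "\<And>y. k1 y \<in> K" and \<beta>: "\<And>y. \<beta> y \<in> B" and b_0: "\<And>y. b 0 y = k1 y ** \<beta> y"
    by metis
  have k1_G: "k1 y \<in> G" for y using k1 K_G by blast
  \<comment> \<open>The factor \<open>k1\<close>, constant in the parameter, is moved from the
    positive factor to the frame. Being fixed by \<open>\<tau>\<close> it preserves both twisting
    conditions, and it leaves exactly \<open>\<beta>\<close> in \<open>B\<close> at parameter
    0.\<close>
  define F where "F = (\<lambda>z \<mu>. mexp (Re z *\<^sub>R \<xi> \<mu>) ** f \<mu> (Im z) ** k1 (Im z))"
  define b' where "b' = (\<lambda>z \<mu>. matrix_inv (k1 (Im z)) ** b \<mu> (Im z))"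
  have \<xi>_G: "\<xi> \<mu> \<in> lie_algebra G" "d\<tau> (\<xi> \<mu>) = \<xi> (omega k * \<mu>)" if "\<mu> \<in> sphere 0 1" for \<mu>
    using AL_mem(1)[OF that] AL_twisted(1)[OF that] by (simp_all add: \<xi>_def)
  have fb: "f \<mu> y ** b \<mu> y = mexp (y *\<^sub>R (\<i> *\<^sub>C \<xi> \<mu>))" for \<mu> y
    by (simp add: f_def nb flip: matrix_mul_assoc)
  have F_loop: "F z \<in> loop_group G \<tau> k" for z
  proof -
    have const: "(\<lambda>\<mu>. M) matholomorphic_on S" for M :: "'n cmat" and S by simp
    have "open (- {0 :: complex})" by auto
    note mexp_hol = mat_holomorphic_mexp[OF this]
    have E: "(\<lambda>\<mu>. mexp (r *\<^sub>R \<xi> \<mu>)) matholomorphic_on - {0}"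
      "(\<lambda>\<mu>. mexp (r *\<^sub>R (\<i> *\<^sub>C \<xi> \<mu>))) matholomorphic_on - {0}" for r
      unfolding scaleR_conv_cscale
      by (rule mexp_hol, rule mat_holomorphic_cscale[OF holomorphic_on_const \<xi>_holomorphic],
          rule mexp_hol, rule mat_holomorphic_cscale[OF holomorphic_on_const
            mat_holomorphic_cscale[OF holomorphic_on_const \<xi>_holomorphic]])
    have nh': "(\<lambda>\<mu>. n \<mu> y) matholomorphic_on - {0}" for y
      using nh[of y] holomorphic_on_subset by blast
    have "F z matholomorphic_on - {0}"
      unfolding F_def f_def by (intro mat_holomorphic_mult E nh' const)
    then have "smooth_loop (F z)" by (rule smooth_loop_mat_holomorphic)
    moreover have "F z \<mu> \<in> G" "F z (omega k * \<mu>) = \<tau> (F z \<mu>)" if \<mu>: "\<mu> \<in> sphere 0 1" for \<mu>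
    proof -
      have E: "mexp (Re z *\<^sub>R \<xi> \<mu>) \<in> G" by (intro lie_algebraD \<xi>_G \<mu>)
      show "F z \<mu> \<in> G" unfolding F_def by (intro mult_mem E f_G \<mu> k1_G)
      show "F z (omega k * \<mu>) = \<tau> (F z \<mu>)"
        using E f_G[OF \<mu>] k1_G
        by (simp add: F_def \<tau>_mult mult_mem \<tau>_K[OF k1] f_twisted[OF \<mu>] \<tau>_exp[OF \<xi>_G(1)[OF \<mu>]] \<xi>_G(2)[OF \<mu>])
    qed
    ultimately show ?thesis by (simp add: loop_group_def)
  qed
  have b_loop: "b' z \<in> loop_group_plus G \<tau> k B" for z
  proof -
    have k1': "matrix_inv (k1 (Im z)) \<in> K" using k1 K_inv by blast
    have hol: "b' z matholomorphic_on S" for S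
      unfolding b'_def using bh[of "Im z"] holomorphic_on_subset[of _ UNIV S]
      by (intro mat_holomorphic_mult) auto
    have "b' z \<in> loop_group_C G \<tau> k"
      unfolding loop_group_C_def
    proof (intro CollectI conjI ballI)
      show "smooth_loop (b' z)" using hol by (rule smooth_loop_mat_holomorphic)
      fix \<mu> :: complex assume \<mu>: "\<mu> \<in> sphere 0 1"
      \<comment> \<open>On the circle the polar decomposition of the positive factor is explicit,
        from which the action of the extended automorphism can be read off.\<close>
      have eq: "b' z \<mu> = (matrix_inv (k1 (Im z)) ** matrix_inv (f \<mu> (Im z))) ** mexp (\<i> *\<^sub>C (Im z *\<^sub>R \<xi> \<mu>))"
        if \<mu>: "\<mu> \<in> sphere 0 1" for \<mu>
      proof -
        have "matrix_inv (f \<mu> (Im z)) ** (f \<mu> (Im z) ** b \<mu> (Im z)) = b \<mu> (Im z)"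
          using f_G[OF \<mu>] by (simp add: matrix_mul_assoc)
        then show ?thesis by (simp add: b'_def fb flip: matrix_mul_assoc)
      qed
      have g: "matrix_inv (k1 (Im z)) ** matrix_inv (f \<mu> (Im z)) \<in> G" "Im z *\<^sub>R \<xi> \<mu> \<in> lie_algebra G"
        using f_G[OF \<mu>] k1_G \<xi>_G[OF \<mu>] by (auto intro: mult_mem inv_mem lie_algebra_scaleR)
      then show "b' z \<mu> \<in> group_C G" unfolding eq[OF \<mu>] group_C_def by blast
      have "aut_C G \<tau> (b' z \<mu>) = \<tau> (matrix_inv (k1 (Im z)) ** matrix_inv (f \<mu> (Im z))) **
          mexp (\<i> *\<^sub>C d\<tau> (Im z *\<^sub>R \<xi> \<mu>))"
        unfolding eq[OF \<mu>] by (rule aut_C_eq[OF g])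
      also have "\<dots> = b' z (omega k * \<mu>)"
        unfolding eq[OF omega_sphere[OF \<mu>]]
        using f_G[OF \<mu>] k1_G
        by (simp add: \<tau>_mult inv_mem \<tau>_K[OF k1'] \<tau>_inv f_twisted[OF \<mu>] linear_cmul[OF linear_d\<tau>] \<xi>_G(2)[OF \<mu>])
      finally show "b' z (omega k * \<mu>) = aut_C G \<tau> (b' z \<mu>)" by simp
    qed
    moreover have "b' z \<mu> \<in> group_C G" for \<mu>
    proof -
      obtain h X where "h \<in> G" "X \<in> lie_algebra G" "b \<mu> (Im z) = h ** mexp (\<i> *\<^sub>C X)"
        using b_C[of \<mu> "Im z"] by (auto simp: group_C_def)
      then have "b' z \<mu> = (matrix_inv (k1 (Im z)) ** h) ** mexp (\<i> *\<^sub>C X)" "matrix_inv (k1 (Im z)) ** h \<in> G"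
        using k1_G by (auto simp: b'_def matrix_mul_assoc intro: mult_mem inv_mem)
      then show ?thesis using \<open>X \<in> lie_algebra G\<close> unfolding group_C_def by blast
    qed
    moreover have "continuous_on (cball 0 1) (b' z)" using hol by (rule mat_holomorphic_imp_continuous_on)
    moreover have "b' z 0 \<in> B" using \<beta> k1_G by (simp add: b'_def b_0 matrix_mul_assoc)
    ultimately show ?thesis
      unfolding loop_group_plus_def using hol[of "ball 0 1"] by blast
  qed
  have "mexp (z *\<^sub>C \<xi> \<mu>) = F z \<mu> ** b' z \<mu>" for z \<mu>
  proof -
    have "F z \<mu> ** b' z \<mu> = mexp (Re z *\<^sub>R \<xi> \<mu>) ** (f \<mu> (Im z) ** b \<mu> (Im z))"
      using k1_G by (simp add: F_def b'_def matrix_mul_assoc)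
    also have "\<dots> = mexp (Re z *\<^sub>R \<xi> \<mu> + Im z *\<^sub>R (\<i> *\<^sub>C \<xi> \<mu>))"
      unfolding fb by (rule mexp_add[symmetric]) simp
    also have "Re z *\<^sub>R \<xi> \<mu> + Im z *\<^sub>R (\<i> *\<^sub>C \<xi> \<mu>) = z *\<^sub>C \<xi> \<mu>"
      by (simp add: vec_eq_iff complex_eq_iff)
    finally show ?thesis by simp
  qed
  then have "iwasawa_factors G \<tau> k B \<xi> F b'"
    unfolding iwasawa_factors_def using F_loop b_loop by blast
  moreover have "L 1 y = \<eta> y + v y" for y using A_circle(2)[of 1] by simp
  then have "(f 1 has_vector_derivative f 1 y ** (\<eta> y + v y)) (at y)" for y
    using f_deriv[of 1 y] by simp
  moreover have "\<exists>k1\<in>K. F (Complex x y) 1 = mexp (x *\<^sub>R \<xi> 1) ** f 1 y ** k1" for x y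
    using k1 by (auto simp: F_def)
  ultimately show ?thesis using f0[of 1] by blast
qed

lemma \<xi>_1: "\<xi> 1 = \<kappa> 0 + u 0"
  using A_circle(1)[of 1] by (simp add: \<xi>_def)

end

section \<open>Equivariant frames\<close>

lemma has_vector_derivative_line:
  assumes "(F has_derivative D) (at (p + t *\<^sub>R v))"
  shows "((\<lambda>t. F (p + t *\<^sub>R v)) has_vector_derivative D v) (at t)"
proof -
  have "((\<lambda>t. p + t *\<^sub>R v) has_derivative (\<lambda>s. s *\<^sub>R v)) (at t)"
    by (auto intro!: derivative_eq_intros)
  from has_derivative_compose[OF this assms]
  have "((\<lambda>t. F (p + t *\<^sub>R v)) has_derivative (\<lambda>s. D (s *\<^sub>R v))) (at t)" .
  moreover have "D (s *\<^sub>R v) = s *\<^sub>R D v" for s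
    using has_derivative_linear[OF assms] by (rule linear_cmul)
  ultimately show ?thesis by (simp add: has_vector_derivative_def)
qed

lemma has_vector_derivative_Re_line:
  assumes "(F has_derivative D) (at (Complex x y))"
  shows "((\<lambda>x. F (Complex x y)) has_vector_derivative D 1) (at x)"
proof -
  have "Complex 0 y + x *\<^sub>R 1 = Complex x y" for x by (simp add: complex_eq_iff)
  then show ?thesis using has_vector_derivative_line[of F D "Complex 0 y" x 1] assms by (simp only:)
qed

lemma has_vector_derivative_Im_line:
  assumes "(F has_derivative D) (at (Complex x y))"
  shows "((\<lambda>y. F (Complex x y)) has_vector_derivative D \<i>) (at y)"
proof -
  have "Complex x 0 + y *\<^sub>R \<i> = Complex x y" for y by (simp add: complex_eq_iff)
  then show ?thesis using has_vector_derivative_line[of F D "Complex x 0" y \<i>] assms by (simp only:)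
qed

lemma matrix_inv_one [simp]: "matrix_inv (mat 1 :: 'n::finite cmat) = mat 1"
  by (rule matrix_inv_unique) simp

context compact_matrix_group
begin

text \<open>The linear map is the adjoint for an invariant hermitian form.\<close>

lemma ex_linear_inverse: "\<exists>\<Lambda>. linear \<Lambda> \<and> (\<forall>g\<in>G. matrix_inv g = \<Lambda> g)"
proof -
  obtain P where P: "P \<in> convex hull ((\<lambda>g. adj g ** g) ` G)" "\<And>h. h \<in> G \<Longrightarrow> adj h ** P ** h = P"
    using ex_invariant_hermitian by blast
  have pos: "inner Y (P ** Y) > 0" if "Y \<noteq> 0" for Y
  proof -
    have "inner Y (adj g ** g ** Y) > 0" if g: "g \<in> G" for g
    proof -
      have "inner Y (adj g ** g ** Y) = inner (g ** Y) (g ** Y)"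
        by (simp only: inner_mult_left[of g Y] matrix_mul_assoc)
      moreover have "matrix_inv g ** (g ** Y) = Y" using g by (simp add: matrix_mul_assoc)
      then have "g ** Y \<noteq> 0" using \<open>Y \<noteq> 0\<close> by auto
      ultimately show ?thesis by simp
    qed
    moreover have "convex {P. inner Y (P ** Y) > 0}"
    proof -
      have "linear (\<lambda>P. inner Y (P ** Y))"
        by (rule linearI) (simp_all add: mat_distribs inner_add_right)
      from convex_linear_vimage[OF this, of "{0<..}"] show ?thesis by (simp add: vimage_def)
    qed
    ultimately have "convex hull ((\<lambda>g. adj g ** g) ` G) \<subseteq> {P. inner Y (P ** Y) > 0}"
      by (intro hull_minimal) auto
    then show ?thesis using P(1) by auto
  qed
  have "x = 0" if "P *v x = 0" for x
  proof -
    \<comment> \<open>A matrix with all columns equal to \<open>x\<close> transfers the positivity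
      from matrices to vectors.\<close>
    define Y :: "'n cmat" where "Y = (\<chi> i j. x $ i)"
    have "P ** Y = 0"
      using that by (simp add: Y_def vec_eq_iff matrix_matrix_mult_def matrix_vector_mult_def)
    then have "Y = 0" using pos[of Y] by fastforce
    then show ?thesis by (simp add: Y_def vec_eq_iff)
  qed
  then obtain Q where Q: "Q ** P = mat 1"
    using matrix_left_invertible_ker[of P] by blast
  define \<Lambda> where "\<Lambda> = (\<lambda>A. Q ** adj A ** P)"
  have "linear \<Lambda>"
    by (rule linearI) (simp_all add: \<Lambda>_def linear_add[OF linear_adj] linear_cmul[OF linear_adj] mat_distribs)
  moreover have "matrix_inv g = \<Lambda> g" if "g \<in> G" for g
  proof (rule matrix_inv_unique)
    have "\<Lambda> g ** g = Q ** (adj g ** P ** g)" by (simp add: \<Lambda>_def matrix_mul_assoc)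
    then have "\<Lambda> g ** g = mat 1" by (simp add: P(2)[OF that] Q)
    then show "g ** \<Lambda> g = mat 1" by (simp add: matrix_left_right_inverse[of g])
  qed
  ultimately show ?thesis by blast
qed

text \<open>On \<open>G\<close> inversion agrees with a linear map, so differentiability is
  immediate; the formula then comes from differentiating
  \<open>matrix_inv (g t) ** g t\<close>.\<close>

lemma has_vector_derivative_matrix_inv:
  assumes g: "\<And>t. g t \<in> G" and g': "(g has_vector_derivative g') (at t)"
  shows "((\<lambda>t. matrix_inv (g t)) has_vector_derivative - (matrix_inv (g t) ** g' ** matrix_inv (g t))) (at t)"
proof -
  obtain \<Lambda> where \<Lambda>: "linear \<Lambda>" "\<And>h. h \<in> G \<Longrightarrow> matrix_inv h = \<Lambda> h"
    using ex_linear_inverse by blast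
  have d: "((\<lambda>t. matrix_inv (g t)) has_vector_derivative \<Lambda> g') (at t)"
    using bounded_linear.has_vector_derivative[OF linear_conv_bounded_linear[THEN iffD1, OF \<Lambda>(1)] g']
    by (simp add: \<Lambda>(2) g)
  have "((\<lambda>t. matrix_inv (g t) ** g t) has_vector_derivative matrix_inv (g t) ** g' + \<Lambda> g' ** g t) (at t)"
    using d g' by (rule has_vector_derivative_mult)
  then have "((\<lambda>t::real. mat 1 :: 'n cmat) has_vector_derivative matrix_inv (g t) ** g' + \<Lambda> g' ** g t) (at t)"
    by (simp add: g)
  then have "matrix_inv (g t) ** g' + \<Lambda> g' ** g t = 0"
    by (rule vector_derivative_unique_at) (rule has_vector_derivative_const)
  then have "\<Lambda> g' ** g t = - (matrix_inv (g t) ** g')" by (simp add: add_eq_0_iff)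
  then have "\<Lambda> g' ** g t ** matrix_inv (g t) = - (matrix_inv (g t) ** g') ** matrix_inv (g t)" by simp
  then have "\<Lambda> g' = - (matrix_inv (g t) ** g' ** matrix_inv (g t))" using g by simp
  with d show ?thesis by simp
qed

end

text \<open>A constant change of gauge in \<open>K\<close>. This freedom is what later allows the
  generated map to be \<open>\<phi>\<close> itself, and not just a translate, when
  \<open>\<phi>\<close> is based at \<open>K\<close>.\<close>

lemma lax_data_conj:
  assumes "lax_data G \<tau> k K \<kappa> \<eta> u v" and k0: "k0 \<in> K"
  defines "c \<equiv> \<lambda>X. k0 ** X ** matrix_inv k0"
  shows "lax_data G \<tau> k K (\<lambda>y. c (\<kappa> y)) (\<lambda>y. c (\<eta> y)) (\<lambda>y. c (u y)) (\<lambda>y. c (v y))"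
proof -
  interpret lax_data G \<tau> k K \<kappa> \<eta> u v by (rule assms)
  note k0_G = K_G[OF k0]
  have lin: "linear c" by (rule linearI) (simp_all add: c_def mat_distribs)
  have br: "c (bracket X Y) = bracket (c X) (c Y)" for X Y
    using k0_G by (simp add: c_def bracket_def mat_distribs matrix_mul_assoc)
  have mem: "c X \<in> lie_algebra G" if "X \<in> lie_algebra G" for X
    unfolding c_def using k0_G that by (rule lie_algebra_Ad)
  have d: "d\<tau> (c X) = c (d\<tau> X)" if "X \<in> lie_algebra G" for X
    unfolding c_def using k0 that by (rule avg_Ad)
  have memK: "c X \<in> lie_algebra K" if "X \<in> lie_algebra K" for X
    using that mem d by (simp add: lie_algebra_K)
  have deriv: "((\<lambda>y. c (f y)) has_vector_derivative c f') (at y)"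
    if "(f has_vector_derivative f') (at y)" for f f' y
    using bounded_linear.has_vector_derivative[OF linear_conv_bounded_linear[THEN iffD1, OF lin] that] .
  show ?thesis
  proof (intro lax_data.intro lax_data_axioms.intro symmetric_space_axioms)
    show "((\<lambda>y. c (\<kappa> y)) has_vector_derivative
        bracket (c (\<kappa> y)) (c (\<eta> y)) + bracket (c (u y)) (c (v y))) (at y)" for y
      using deriv[OF \<kappa>_deriv] by (simp add: linear_add[OF lin] br)
    show "((\<lambda>y. c (u y)) has_vector_derivative
        bracket (c (\<kappa> y)) (c (v y)) + bracket (c (u y)) (c (\<eta> y))) (at y)" for y
      using deriv[OF u_deriv] by (simp add: linear_add[OF lin] br)
    show "((\<lambda>y. c (v y)) has_vector_derivative
        bracket (c (v y)) (c (\<eta> y)) - bracket (c (\<kappa> y)) (c (u y))) (at y)" for y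
      using deriv[OF v_deriv] by (simp add: linear_diff[OF lin] br)
    show "continuous_on UNIV (\<lambda>y. c (\<eta> y))"
      unfolding c_def by (intro mm.continuous_on continuous_intros \<eta>_cont)
  qed (simp_all add: memK \<kappa>_mem \<eta>_mem mem u_mem v_mem d d\<tau>_u d\<tau>_v linear_add[OF lin]
      linear_diff[OF lin] linear_cmul[OF lin])
qed

context symmetric_space
begin

definition mproj :: "'n cmat \<Rightarrow> 'n cmat" where "mproj X = X - avg X"

lemma linear_mproj: "linear mproj"
  unfolding mproj_def[abs_def] by (intro linear_compose_sub linear_avg) (simp add: linear_iff)

lemma mproj_mem: "X \<in> lie_algebra G \<Longrightarrow> mproj X \<in> lie_algebra G"
  unfolding mproj_def by (intro subspace_diff[OF subspace_lie_algebra] avg_mem)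

lemma avg_mproj: "X \<in> lie_algebra G \<Longrightarrow> avg (mproj X) = 0"
  by (simp add: mproj_def linear_diff[OF linear_avg] avg_fixed d\<tau>_avg)

lemma mproj_K: "X \<in> lie_algebra K \<Longrightarrow> mproj X = 0"
  by (simp add: mproj_def lie_algebra_K avg_fixed)

lemma mproj_Ad: "h \<in> K \<Longrightarrow> X \<in> lie_algebra G \<Longrightarrow> mproj (h ** X ** matrix_inv h) = h ** mproj X ** matrix_inv h"
  by (simp add: mproj_def avg_Ad mat_distribs)

lemma avg_in_K: "X \<in> lie_algebra G \<Longrightarrow> avg X \<in> lie_algebra K"
  by (simp add: lie_algebra_K avg_mem d\<tau>_avg)

text \<open>Bracketing with an element fixed by \<open>d\<tau>\<close> commutes with
  \<open>d\<tau>\<close>; in particular [k, m] is contained in m.\<close>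

lemma avg_bracket:
  assumes X: "X \<in> lie_algebra K" and Y: "Y \<in> lie_algebra G"
  shows "avg (bracket X Y) = bracket X (avg Y)"
proof -
  have "(d\<tau> ^^ j) (bracket X Y) = bracket X ((d\<tau> ^^ j) Y)" for j
    using X by (induction j) (auto simp: d\<tau>_bracket lie_algebra_K d\<tau>_pow_mem Y)
  then show ?thesis by (simp add: avg_def br.sum_right br.scaleR_right)
qed

lemma compact_matrix_group_fixed_points: "compact_matrix_group (fixed_points G \<tau>)"
  by unfold_locales
     (auto simp: compact_fixed_points one_fixed, auto simp: fixed_points_def mult_mem \<tau>_mult invertible inv_mem \<tau>_inv)

text \<open>\<open>K\<close> is not assumed closed, so the tangent argument is run in the compact
  fixed point group, which has the same Lie algebra.\<close>

lemma tangent_in_K: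
  assumes "\<gamma> 0 = mat 1" "\<And>\<epsilon>. \<gamma> \<epsilon> \<in> K" "(\<gamma> has_vector_derivative X) (at 0)"
  shows "X \<in> lie_algebra K"
proof -
  have "X \<in> lie_algebra (fixed_points G \<tau>)"
    using compact_matrix_group.tangent_in_lie_algebra[OF compact_matrix_group_fixed_points, of \<gamma> X]
      assms K_fixed by blast
  then have *: "\<And>t. mexp (t *\<^sub>R X) \<in> fixed_points G \<tau>" by (simp add: lie_algebra_def)
  then have "X \<in> lie_algebra G" by (auto simp: lie_algebra_def fixed_points_def)
  with * show ?thesis using fixed_mexp_iff[of X] by (simp add: lie_algebra_K)
qed

text \<open>Two lifts of one curve in the quotient. Differentiability of \<open>h\<close> need not
  be assumed, because \<open>h\<close> is the inverse of one lift times the other.\<close>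

lemma gauge:
  assumes mem: "\<And>t. \<gamma> t \<in> G" "\<And>t. \<delta> t \<in> G" "\<And>t. h t \<in> K" and eq: "\<And>t. \<gamma> t = \<delta> t ** h t"
    and \<gamma>': "(\<gamma> has_vector_derivative \<gamma>') (at 0)" and \<delta>': "(\<delta> has_vector_derivative \<delta>') (at 0)"
  shows "\<exists>h'. (h has_vector_derivative h') (at 0) \<and> matrix_inv (h 0) ** h' \<in> lie_algebra K \<and>
    matrix_inv (\<gamma> 0) ** \<gamma>' =
      matrix_inv (h 0) ** (matrix_inv (\<delta> 0) ** \<delta>') ** h 0 + matrix_inv (h 0) ** h'"
proof -
  have h_G: "h t \<in> G" for t using mem(3) K_G by blast
  have h_eq: "h t = matrix_inv (\<delta> t) ** \<gamma> t" for t
    using mem(2) by (simp add: eq matrix_mul_assoc)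
  from has_vector_derivative_mult[OF has_vector_derivative_matrix_inv[OF mem(2) \<delta>'] \<gamma>']
  obtain h' where h': "(h has_vector_derivative h') (at 0)"
    unfolding h_eq[abs_def] by blast
  have "matrix_inv (h 0) ** h' \<in> lie_algebra K"
  proof (rule tangent_in_K[of "\<lambda>t. matrix_inv (h 0) ** h t"])
    show "((\<lambda>t. matrix_inv (h 0) ** h t) has_vector_derivative matrix_inv (h 0) ** h') (at 0)"
      by (rule has_vector_derivative_rhs[OF has_vector_derivative_mult[OF has_vector_derivative_const h']]) simp
  qed (use h_G mem(3) K_mult K_inv in auto)
  moreover have "(\<gamma> has_vector_derivative \<delta> 0 ** h' + \<delta>' ** h 0) (at 0)"
    unfolding eq[abs_def] using \<delta>' h' by (rule has_vector_derivative_mult)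
  then have "\<gamma>' = \<delta> 0 ** h' + \<delta>' ** h 0" by (rule vector_derivative_unique_at[OF \<gamma>'])
  moreover have "matrix_inv (\<gamma> 0) = matrix_inv (h 0) ** matrix_inv (\<delta> 0)"
    using h_G mem(2) by (intro matrix_inv_unique) (simp add: eq matrix_mul_assoc)
  ultimately show ?thesis
    using h' mem(2) by (intro exI[of _ h']) (simp add: mat_distribs matrix_mul_assoc)
qed

lemma omega_unit: "(Re (omega k))\<^sup>2 + (Im (omega k))\<^sup>2 = 1"
  by (simp add: omega_def)

end

text \<open>The last assumption is equivariance of the cosets, not of the frame. The second
  derivative of \<open>F\<close> is what the exterior derivative of the Maurer-Cartan form
  involves.\<close>

locale equivariant_frame = symmetric_space G \<tau> k K for G :: "'n::finite cmat set" and \<tau> k K +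
  fixes F :: "complex \<Rightarrow> 'n cmat" and F' :: "complex \<Rightarrow> complex \<Rightarrow> 'n cmat" and A0 :: "'n cmat"
  assumes F_G: "F p \<in> G" and F_deriv: "(F has_derivative F' p) (at p)"
    and F'_diff: "\<exists>D. ((\<lambda>p. F' p w) has_derivative D) (at p)"
    and A0_mem: "A0 \<in> lie_algebra G"
    and coset: "matrix_inv (mexp (x *\<^sub>R A0) ** F (Complex 0 y)) ** F (Complex x y) \<in> K"
begin

definition \<alpha> :: "complex \<Rightarrow> complex \<Rightarrow> 'n cmat" where "\<alpha> p w = matrix_inv (F p) ** F' p w"

lemma maurer_cartan_eq: "maurer_cartan F p w = \<alpha> p w"
  by (simp add: maurer_cartan_def \<alpha>_def frechet_derivative_at[OF F_deriv, symmetric])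

lemma \<alpha>_linear: "linear (\<alpha> p)"
  unfolding \<alpha>_def using has_derivative_linear[OF F_deriv, of p]
  by (auto simp: linear_iff mat_distribs)

lemma \<alpha>_mem: "\<alpha> p w \<in> lie_algebra G"
proof (rule tangent_in_lie_algebra[of "\<lambda>\<epsilon>. matrix_inv (F p) ** F (p + \<epsilon> *\<^sub>R w)"])
  have "((\<lambda>\<epsilon>. F (p + \<epsilon> *\<^sub>R w)) has_vector_derivative F' p w) (at 0)"
    by (rule has_vector_derivative_line) (simp add: F_deriv)
  then show "((\<lambda>\<epsilon>. matrix_inv (F p) ** F (p + \<epsilon> *\<^sub>R w)) has_vector_derivative \<alpha> p w) (at 0)"
    unfolding \<alpha>_def by (rule has_vector_derivative_rhs[OF has_vector_derivative_mult[OF has_vector_derivative_const]]) simp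
qed (auto intro: mult_mem inv_mem F_G simp: F_G)

lemma \<alpha>_diff: "\<exists>D. ((\<lambda>p. \<alpha> p w) has_derivative D) (at p)"
proof -
  obtain \<Lambda> where \<Lambda>: "linear \<Lambda>" "\<And>h. h \<in> G \<Longrightarrow> matrix_inv h = \<Lambda> h"
    using ex_linear_inverse by blast
  have "((\<lambda>p. \<Lambda> (F p)) has_derivative (\<lambda>v. \<Lambda> (F' p v))) (at p)"
    by (rule bounded_linear.has_derivative[OF linear_conv_bounded_linear[THEN iffD1, OF \<Lambda>(1)] F_deriv])
  moreover obtain D where "((\<lambda>p. F' p w) has_derivative D) (at p)" using F'_diff by blast
  ultimately have "((\<lambda>p. \<Lambda> (F p) ** F' p w) has_derivative
      (\<lambda>v. \<Lambda> (F p) ** D v + \<Lambda> (F' p v) ** F' p w)) (at p)"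
    by (rule mm.FDERIV)
  then show ?thesis by (auto simp: \<alpha>_def \<Lambda>(2)[OF F_G])
qed

definition f :: "real \<Rightarrow> 'n cmat" where "f y = F (Complex 0 y)"
text \<open>\<open>X\<close> and \<open>Y\<close> are the components of the Maurer-Cartan form of
  the translated frame \<open>mexp (x A0) ** f y\<close>, hence independent of \<open>x\<close>;
  \<open>h\<close> is the gauge from this frame to \<open>F\<close>.\<close>

definition X :: "real \<Rightarrow> 'n cmat" where "X y = matrix_inv (f y) ** A0 ** f y"
definition Y :: "real \<Rightarrow> 'n cmat" where "Y y = \<alpha> (Complex 0 y) \<i>"
definition h :: "real \<Rightarrow> real \<Rightarrow> 'n cmat"
  where "h x y = matrix_inv (mexp (x *\<^sub>R A0) ** F (Complex 0 y)) ** F (Complex x y)"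

lemma f_G: "f y \<in> G" by (simp add: f_def F_G)

lemma X_mem: "X y \<in> lie_algebra G"
  unfolding X_def using f_G A0_mem by (rule lie_algebra_Ad')

lemma Y_mem: "Y y \<in> lie_algebra G" by (simp add: Y_def \<alpha>_mem)

lemma f_deriv: "(f has_vector_derivative f y ** Y y) (at y)"
proof -
  have "(f has_vector_derivative F' (Complex 0 y) \<i>) (at y)"
    unfolding f_def[abs_def] by (rule has_vector_derivative_Im_line) (rule F_deriv)
  then show ?thesis using F_G by (simp add: Y_def \<alpha>_def f_def matrix_mul_assoc)
qed

lemma f_inv_deriv: "((\<lambda>y. matrix_inv (f y)) has_vector_derivative - (Y y ** matrix_inv (f y))) (at y)"
  by (rule has_vector_derivative_rhs[OF has_vector_derivative_matrix_inv[OF f_G f_deriv]])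
     (simp add: f_G matrix_mul_assoc)

lemma X_deriv: "(X has_vector_derivative bracket (X y) (Y y)) (at y)"
  unfolding X_def[abs_def]
  by (rule has_vector_derivative_rhs, rule has_vector_derivative_mult, rule has_vector_derivative_mult,
      rule f_inv_deriv, rule has_vector_derivative_const, rule f_deriv)
     (simp add: bracket_def matrix_mul_assoc)

lemma h_K: "h x y \<in> K" unfolding h_def by (rule coset)

lemma translated_G: "mexp (x *\<^sub>R A0) ** f y \<in> G"
  by (intro mult_mem lie_algebraD A0_mem f_G)

lemma F_eq: "F (Complex x y) = mexp (x *\<^sub>R A0) ** f y ** h x y"
  using translated_G by (simp add: h_def f_def matrix_mul_assoc)

lemma h_0 [simp]: "h 0 y = mat 1"
  using F_G by (simp add: h_def)

lemma h_x_deriv: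
  "\<exists>h'. ((\<lambda>t. h (x + t) y) has_vector_derivative h') (at 0) \<and> matrix_inv (h x y) ** h' \<in> lie_algebra K \<and>
    \<alpha> (Complex x y) 1 = matrix_inv (h x y) ** X y ** h x y + matrix_inv (h x y) ** h'"
proof -
  have \<gamma>': "((\<lambda>t. F (Complex (x + t) y)) has_vector_derivative F' (Complex x y) 1) (at 0)"
  proof -
    have "((\<lambda>t. F (Complex (t + x) y)) has_vector_derivative F' (Complex x y) 1) (at 0)"
      using has_vector_derivative_Re_line[OF F_deriv, of y x]
      by (intro has_vector_derivative_shift[of "\<lambda>x. F (Complex x y)"]) simp
    then show ?thesis by (simp add: add.commute)
  qed
  have \<delta>': "((\<lambda>t. mexp ((x + t) *\<^sub>R A0) ** f y) has_vector_derivative mexp (x *\<^sub>R A0) ** A0 ** f y) (at 0)"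
  proof -
    have "((\<lambda>t. mexp ((t + x) *\<^sub>R A0)) has_vector_derivative mexp ((0 + x) *\<^sub>R A0) ** A0) (at 0)"
      by (rule has_vector_derivative_shift) (rule mexp_has_vector_derivative')
    then have "((\<lambda>t. mexp ((x + t) *\<^sub>R A0)) has_vector_derivative mexp (x *\<^sub>R A0) ** A0) (at 0)"
      by (simp add: add.commute)
    from has_vector_derivative_mult[OF this has_vector_derivative_const[of "f y"]] show ?thesis by simp
  qed
  have "matrix_inv (mexp (x *\<^sub>R A0) ** f y) ** (mexp (x *\<^sub>R A0) ** A0 ** f y) = X y"
  proof -
    have "matrix_inv (mexp (x *\<^sub>R A0) ** f y) = matrix_inv (f y) ** mexp (- (x *\<^sub>R A0))"
      using f_G by (intro matrix_inv_unique) (simp add: matrix_mul_assoc)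
    then show ?thesis by (simp add: X_def matrix_mul_assoc)
  qed
  with gauge[of "\<lambda>t. F (Complex (x + t) y)" "\<lambda>t. mexp ((x + t) *\<^sub>R A0) ** f y" "\<lambda>t. h (x + t) y",
      OF F_G translated_G h_K F_eq \<gamma>' \<delta>']
  show ?thesis by (simp add: \<alpha>_def)
qed

lemma h_y_deriv:
  "\<exists>h'. matrix_inv (h x y) ** h' \<in> lie_algebra K \<and>
    \<alpha> (Complex x y) \<i> = matrix_inv (h x y) ** Y y ** h x y + matrix_inv (h x y) ** h'"
proof -
  have \<gamma>': "((\<lambda>t. F (Complex x (y + t))) has_vector_derivative F' (Complex x y) \<i>) (at 0)"
  proof -
    have "((\<lambda>t. F (Complex x (t + y))) has_vector_derivative F' (Complex x y) \<i>) (at 0)"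
      using has_vector_derivative_Im_line[OF F_deriv, of x y]
      by (intro has_vector_derivative_shift[of "\<lambda>y. F (Complex x y)"]) simp
    then show ?thesis by (simp add: add.commute)
  qed
  have \<delta>': "((\<lambda>t. mexp (x *\<^sub>R A0) ** f (y + t)) has_vector_derivative mexp (x *\<^sub>R A0) ** (f y ** Y y)) (at 0)"
  proof -
    have "((\<lambda>t. f (t + y)) has_vector_derivative f y ** Y y) (at 0)"
      by (rule has_vector_derivative_shift) (simp add: f_deriv)
    then have "((\<lambda>t. f (y + t)) has_vector_derivative f y ** Y y) (at 0)"
      by (simp add: add.commute)
    from has_vector_derivative_mult[OF has_vector_derivative_const this] show ?thesis by simp
  qed
  have "matrix_inv (mexp (x *\<^sub>R A0) ** f y) ** (mexp (x *\<^sub>R A0) ** (f y ** Y y)) = Y y"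
    using translated_G[of x y] by (simp add: matrix_mul_assoc)
      (metis inv_left matrix_mul_assoc matrix_mul_lid)
  with gauge[of "\<lambda>t. F (Complex x (y + t))" "\<lambda>t. mexp (x *\<^sub>R A0) ** f (y + t)" "\<lambda>t. h x (y + t)",
      OF F_G translated_G h_K F_eq \<gamma>' \<delta>']
  show ?thesis by (auto simp: \<alpha>_def)
qed

definition \<kappa> where "\<kappa> y = avg (X y)"
definition u where "u y = mproj (X y)"
definition \<eta> where "\<eta> y = avg (Y y)"
definition v where "v y = mproj (Y y)"

lemma X_decomp: "X y = \<kappa> y + u y" and Y_decomp: "Y y = \<eta> y + v y"
  by (simp_all add: \<kappa>_def u_def \<eta>_def v_def mproj_def)

lemma \<kappa>_K: "\<kappa> y \<in> lie_algebra K" and \<eta>_K: "\<eta> y \<in> lie_algebra K"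
  by (simp_all add: \<kappa>_def \<eta>_def avg_in_K X_mem Y_mem)

lemma uv_mem: "u y \<in> lie_algebra G" "v y \<in> lie_algebra G"
  by (simp_all add: u_def v_def mproj_mem X_mem Y_mem)

text \<open>The inhomogeneous gauge terms lie in the Lie algebra of \<open>K\<close> and vanish
  under \<open>mproj\<close>, so the m-part is merely conjugated.\<close>

lemma \<alpha>_m_eq:
  "mproj (\<alpha> (Complex x y) 1) = matrix_inv (h x y) ** u y ** h x y"
  "mproj (\<alpha> (Complex x y) \<i>) = matrix_inv (h x y) ** v y ** h x y"
proof -
  have inv: "matrix_inv (matrix_inv (h x y)) = h x y"
    using K_G[OF h_K, of x y] by (intro matrix_inv_unique) simp
  have Ad: "mproj (matrix_inv (h x y) ** Z ** h x y) = matrix_inv (h x y) ** mproj Z ** h x y"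
    if "Z \<in> lie_algebra G" for Z
    using mproj_Ad[OF K_inv[OF h_K, of x y] that] by (simp add: inv)
  obtain h' where "matrix_inv (h x y) ** h' \<in> lie_algebra K"
    "\<alpha> (Complex x y) 1 = matrix_inv (h x y) ** X y ** h x y + matrix_inv (h x y) ** h'"
    using h_x_deriv by blast
  then show "mproj (\<alpha> (Complex x y) 1) = matrix_inv (h x y) ** u y ** h x y"
    by (simp add: linear_add[OF linear_mproj] mproj_K Ad X_mem u_def)
  obtain h' where "matrix_inv (h x y) ** h' \<in> lie_algebra K"
    "\<alpha> (Complex x y) \<i> = matrix_inv (h x y) ** Y y ** h x y + matrix_inv (h x y) ** h'"
    using h_y_deriv by blast
  then show "mproj (\<alpha> (Complex x y) \<i>) = matrix_inv (h x y) ** v y ** h x y"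
    by (simp add: linear_add[OF linear_mproj] mproj_K Ad Y_mem v_def)
qed

lemma alpha_k_eq: "alpha_k G \<tau> k K F p w = avg (\<alpha> p w)"
  and alpha_m_eq: "alpha_m G \<tau> k K F p w = mproj (\<alpha> p w)"
  by (simp_all add: alpha_k_def alpha_m_def maurer_cartan_eq k_part_eq m_part_eq \<alpha>_mem mproj_def)

text \<open>The coefficient of dz in the (1,0)-part of the m-component.\<close>

definition a :: "complex \<Rightarrow> 'n cmat"
  where "a p = (1/2) *\<^sub>R (mproj (\<alpha> p 1) - \<i> *\<^sub>C mproj (\<alpha> p \<i>))"

lemma form_10_eq: "form_10 (alpha_m G \<tau> k K F) p 1 = a p" "form_10 (alpha_m G \<tau> k K F) p \<i> = \<i> *\<^sub>C a p"
proof -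
  have "\<alpha> p (- 1) = - \<alpha> p 1" using \<alpha>_linear by (rule linear_neg)
  then show "form_10 (alpha_m G \<tau> k K F) p 1 = a p" "form_10 (alpha_m G \<tau> k K F) p \<i> = \<i> *\<^sub>C a p"
    by (simp_all add: form_10_def alpha_m_eq a_def linear_neg[OF linear_mproj] mat_distribs algebra_simps)
qed

lemma a_0: "a (Complex 0 y) = (1/2) *\<^sub>R (u y - \<i> *\<^sub>C v y)"
  by (simp add: a_def \<alpha>_m_eq)

text \<open>On the imaginary axis the coefficient is (u - iv)/2, an eigenvector for the conjugate of
  \<open>omega k\<close>; the relations are its components in g and i g.\<close>

lemma primitive_relations:
  assumes "\<And>p w. form_10 (alpha_m G \<tau> k K F) p w \<in> eigenspace G \<tau> k (- 1)"
  shows "d\<tau> (u y) = Re (omega k) *\<^sub>R u y - Im (omega k) *\<^sub>R v y"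
    "d\<tau> (v y) = Im (omega k) *\<^sub>R u y + Re (omega k) *\<^sub>R v y"
proof -
  have "a (Complex 0 y) \<in> eigenspace G \<tau> k (- 1)" using assms[of "Complex 0 y" 1] by (simp add: form_10_eq)
  moreover have "a (Complex 0 y) = (1/2) *\<^sub>R u y + \<i> *\<^sub>C (- (1/2) *\<^sub>R v y)"
    by (simp add: a_0 mat_distribs)
  ultimately have "(1/2) *\<^sub>R u y + \<i> *\<^sub>C (- (1/2) *\<^sub>R v y) \<in> eigenspace G \<tau> k (- 1)" by simp
  moreover have "(1/2) *\<^sub>R u y \<in> lie_algebra G" "- (1/2) *\<^sub>R v y \<in> lie_algebra G"
    by (intro lie_algebra_scaleR uv_mem)+
  moreover have "omega k powi - 1 = cnj (omega k)"
    by (simp add: omega_def power_int_minus cis_inverse cis_cnj)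
  ultimately have "d\<tau> ((1/2) *\<^sub>R u y) = Re (omega k) *\<^sub>R (1/2) *\<^sub>R u y + Im (omega k) *\<^sub>R (- (1/2) *\<^sub>R v y)"
    "d\<tau> (- (1/2) *\<^sub>R v y) = - Im (omega k) *\<^sub>R (1/2) *\<^sub>R u y + Re (omega k) *\<^sub>R (- (1/2) *\<^sub>R v y)"
    by (simp_all only: eigenspace_iff complex_cnj) simp_all
  then have "(1/2) *\<^sub>R d\<tau> (u y) = (1/2) *\<^sub>R (Re (omega k) *\<^sub>R u y - Im (omega k) *\<^sub>R v y)"
    "(- (1/2)) *\<^sub>R d\<tau> (v y) = (- (1/2)) *\<^sub>R (Im (omega k) *\<^sub>R u y + Re (omega k) *\<^sub>R v y)"
    unfolding linear_cmul[OF linear_d\<tau>] by (simp_all add: algebra_simps)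
  then show "d\<tau> (u y) = Re (omega k) *\<^sub>R u y - Im (omega k) *\<^sub>R v y"
    "d\<tau> (v y) = Im (omega k) *\<^sub>R u y + Re (omega k) *\<^sub>R v y"
    unfolding scaleR_cancel_left by auto
qed

text \<open>For an involution m is the eigenspace of -1, so the relations hold for every
  map.\<close>

lemma symmetric_relations:
  assumes "k = 2"
  shows "d\<tau> (u y) = Re (omega k) *\<^sub>R u y - Im (omega k) *\<^sub>R v y"
    "d\<tau> (v y) = Im (omega k) *\<^sub>R u y + Re (omega k) *\<^sub>R v y"
proof -
  have \<omega>: "omega k = - 1" by (simp add: assms omega_def complex_eq_iff)
  have "d\<tau> Z = - Z" if "avg Z = 0" for Z
  proof -
    have "avg Z = (1/2) *\<^sub>R (Z + d\<tau> Z)"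
      unfolding avg_def unfolding assms by (simp add: numeral_2_eq_2)
    then have "Z + d\<tau> Z = 0" using that by simp
    then show ?thesis by (simp add: add_eq_0_iff)
  qed
  then show "d\<tau> (u y) = Re (omega k) *\<^sub>R u y - Im (omega k) *\<^sub>R v y"
    "d\<tau> (v y) = Im (omega k) *\<^sub>R u y + Re (omega k) *\<^sub>R v y"
    by (simp_all add: \<omega> u_def v_def avg_mproj X_mem Y_mem)
qed

section \<open>The Lax equations along the imaginary axis\<close>

context
  assumes d\<tau>_u: "\<And>y. d\<tau> (u y) = Re (omega k) *\<^sub>R u y - Im (omega k) *\<^sub>R v y"
    and d\<tau>_v: "\<And>y. d\<tau> (v y) = Im (omega k) *\<^sub>R u y + Re (omega k) *\<^sub>R v y"
begin

text \<open>\<open>d\<tau>\<close> acts on the pair \<open>(u, v)\<close> by a rotation, and the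
  bracket is multiplied by its determinant, which is 1.\<close>

lemma bracket_uv_fixed: "avg (bracket (u y) (v y)) = bracket (u y) (v y)"
proof (rule avg_fixed)
  have "d\<tau> (bracket (u y) (v y)) = ((Re (omega k))\<^sup>2 + (Im (omega k))\<^sup>2) *\<^sub>R bracket (u y) (v y)"
    unfolding d\<tau>_bracket[OF uv_mem] d\<tau>_u d\<tau>_v
    by (simp add: br.add_left br.add_right br.diff_left br.diff_right br.scaleR_left br.scaleR_right
        bracket_self bracket_swap[of "v y" "u y"] power2_eq_square scaleR_add_left algebra_simps)
  then show "d\<tau> (bracket (u y) (v y)) = bracket (u y) (v y)" by (simp add: omega_unit)
qed

lemma avg_bracket_XY: "avg (bracket (X y) (Y y)) = bracket (\<kappa> y) (\<eta> y) + bracket (u y) (v y)"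
proof -
  have avg_uv: "avg (u y) = 0" "avg (v y) = 0"
    by (simp_all add: u_def v_def avg_mproj X_mem Y_mem)
  have \<eta>G: "\<eta> y \<in> lie_algebra G" "avg (\<eta> y) = \<eta> y"
    using \<eta>_K[of y] by (auto simp: lie_algebra_K avg_fixed)
  have "avg (bracket (u y) (\<eta> y)) = - avg (bracket (\<eta> y) (u y))"
    by (subst bracket_swap) (rule linear_neg[OF linear_avg])
  then have "avg (bracket (u y) (\<eta> y)) = 0"
    by (simp add: avg_bracket \<eta>_K uv_mem avg_uv br.zero_right)
  then show ?thesis
    by (simp add: X_decomp Y_decomp br.add_left br.add_right linear_add[OF linear_avg]
        avg_bracket[OF \<kappa>_K] \<eta>G uv_mem avg_uv br.zero_right bracket_uv_fixed)
qed

lemma \<kappa>_deriv: "(\<kappa> has_vector_derivative bracket (\<kappa> y) (\<eta> y) + bracket (u y) (v y)) (at y)"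
  unfolding \<kappa>_def[abs_def] avg_bracket_XY[symmetric, unfolded \<kappa>_def]
  using bounded_linear.has_vector_derivative[OF linear_conv_bounded_linear[THEN iffD1, OF linear_avg] X_deriv]
    avg_bracket_XY by (simp add: \<kappa>_def)

lemma u_deriv: "(u has_vector_derivative bracket (\<kappa> y) (v y) + bracket (u y) (\<eta> y)) (at y)"
proof -
  have "(u has_vector_derivative mproj (bracket (X y) (Y y))) (at y)"
    unfolding u_def[abs_def]
    by (rule bounded_linear.has_vector_derivative[OF linear_conv_bounded_linear[THEN iffD1, OF linear_mproj] X_deriv])
  moreover have "mproj (bracket (X y) (Y y)) = bracket (\<kappa> y) (v y) + bracket (u y) (\<eta> y)"
    unfolding mproj_def avg_bracket_XY by (simp add: X_decomp Y_decomp br.add_left br.add_right)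
  ultimately show ?thesis by simp
qed

lemma Y_diff: "\<exists>Y'. (Y has_vector_derivative Y') (at y)"
  unfolding Y_def[abs_def] using \<alpha>_diff has_vector_derivative_Im_line by blast

lemma \<eta>_cont: "continuous_on UNIV \<eta>"
proof -
  obtain Y' where "\<And>y. (Y has_vector_derivative Y' y) (at y)" using Y_diff by metis
  then have "continuous_on UNIV Y" by (rule has_vector_derivative_imp_continuous_on)
  then show ?thesis
    unfolding \<eta>_def[abs_def]
    by (rule linear_continuous_on_compose[OF _ linear_avg])
qed

text \<open>For \<open>k > 2\<close> the imaginary part of \<open>omega k\<close> is nonzero, so
  \<open>v\<close> is a combination of \<open>u\<close> and \<open>d\<tau> (u y)\<close> and
  inherits its equation from that of \<open>u\<close>.\<close>

lemma v_deriv_primitive: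
  assumes "k > 2"
  shows "(v has_vector_derivative bracket (v y) (\<eta> y) - bracket (\<kappa> y) (u y)) (at y)"
proof -
  define c s where "c = Re (omega k)" and "s = Im (omega k)"
  have "0 < sin (2 * pi / real k)"
    using assms by (intro sin_gt_zero) (auto simp: field_simps)
  then have s: "s \<noteq> 0" by (simp add: s_def omega_def)
  have v_eq: "v y = (1 / s) *\<^sub>R (c *\<^sub>R u y - d\<tau> (u y))" for y
    using s by (simp add: d\<tau>_u flip: c_def s_def)
  define u' where "u' = bracket (\<kappa> y) (v y) + bracket (u y) (\<eta> y)"
  have u': "(u has_vector_derivative u') (at y)" unfolding u'_def by (rule u_deriv)
  have "((\<lambda>y. (1 / s) *\<^sub>R (c *\<^sub>R u y - d\<tau> (u y))) has_vector_derivative (1 / s) *\<^sub>R (c *\<^sub>R u' - d\<tau> u')) (at y)"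
    by (intro bounded_linear.has_vector_derivative[OF bounded_linear_scaleR_right] has_vector_derivative_diff
        bounded_linear.has_vector_derivative[OF linear_conv_bounded_linear[THEN iffD1, OF linear_d\<tau>]] u')
  then have "(v has_vector_derivative (1 / s) *\<^sub>R (c *\<^sub>R u' - d\<tau> u')) (at y)"
    using v_eq by presburger
  moreover have "d\<tau> u' = bracket (\<kappa> y) (s *\<^sub>R u y + c *\<^sub>R v y) + bracket (c *\<^sub>R u y - s *\<^sub>R v y) (\<eta> y)"
    using \<kappa>_K[of y] \<eta>_K[of y]
    by (simp add: u'_def linear_add[OF linear_d\<tau>] d\<tau>_bracket lie_algebra_K uv_mem d\<tau>_u d\<tau>_v c_def s_def)
  then have "c *\<^sub>R u' - d\<tau> u' = s *\<^sub>R (bracket (v y) (\<eta> y) - bracket (\<kappa> y) (u y))"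
    by (simp add: u'_def br.add_left br.add_right br.diff_left br.diff_right br.scaleR_left br.scaleR_right
        algebra_simps)
  ultimately show ?thesis using s by simp
qed

text \<open>The harmonic map equation is evaluated on the two coordinate directions at a point of
  the imaginary axis, where \<open>h\<close> is the identity.\<close>

lemma v_deriv_harmonic:
  assumes harmonic: "\<And>p w w'. ext_deriv (form_10 (alpha_m G \<tau> k K F)) p w w'
      + bracket_wedge (alpha_k G \<tau> k K F) (form_10 (alpha_m G \<tau> k K F)) p w w' = 0"
  shows "(v has_vector_derivative bracket (v y) (\<eta> y) - bracket (\<kappa> y) (u y)) (at y)"
proof -
  define p where "p = Complex 0 y"
  obtain Y' where Y': "(Y has_vector_derivative Y') (at y)" using Y_diff by blast
  define v' where "v' = mproj Y'"
  have v': "(v has_vector_derivative v') (at y)"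
    unfolding v_def[abs_def] v'_def
    by (rule bounded_linear.has_vector_derivative[OF linear_conv_bounded_linear[THEN iffD1, OF linear_mproj] Y'])
  have v'_mem: "v' \<in> lie_algebra G"
    by (rule derivative_in_subspace[OF subspace_lie_algebra uv_mem(2) v'])
  define u' where "u' = bracket (\<kappa> y) (v y) + bracket (u y) (\<eta> y)"
  have u': "(u has_vector_derivative u') (at y)" unfolding u'_def by (rule u_deriv)
  have "\<exists>D. (a has_derivative D) (at p)"
  proof -
    obtain D1 D2 where D: "((\<lambda>p. \<alpha> p 1) has_derivative D1) (at p)" "((\<lambda>p. \<alpha> p \<i>) has_derivative D2) (at p)"
      using \<alpha>_diff by metis
    have "((\<lambda>p. (1/2) *\<^sub>R (mproj (\<alpha> p 1) - \<i> *\<^sub>C mproj (\<alpha> p \<i>))) has_derivative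
        (\<lambda>v. (1/2) *\<^sub>R (mproj (D1 v) - \<i> *\<^sub>C mproj (D2 v)))) (at p)"
      by (intro has_derivative_scaleR_right has_derivative_diff
          bounded_linear.has_derivative[OF cs.bounded_linear_right]
          bounded_linear.has_derivative[OF linear_conv_bounded_linear[THEN iffD1, OF linear_mproj]] D)
    then show ?thesis unfolding a_def[abs_def] by blast
  qed
  then obtain D where D: "(a has_derivative D) (at p)" by blast
  have Di: "((\<lambda>q. \<i> *\<^sub>C a q) has_derivative (\<lambda>w. \<i> *\<^sub>C D w)) (at p)"
    by (rule bounded_linear.has_derivative[OF cs.bounded_linear_right D])
  have D_y: "D \<i> = (1/2) *\<^sub>R (u' - \<i> *\<^sub>C v')"
  proof -
    have "((\<lambda>y. a (Complex 0 y)) has_vector_derivative D \<i>) (at y)"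
      using D unfolding p_def by (rule has_vector_derivative_Im_line)
    moreover have "((\<lambda>y. a (Complex 0 y)) has_vector_derivative (1/2) *\<^sub>R (u' - \<i> *\<^sub>C v')) (at y)"
      unfolding a_0
      by (intro bounded_linear.has_vector_derivative[OF bounded_linear_scaleR_right]
          has_vector_derivative_diff has_vector_derivative_cscale u' v')
    ultimately show ?thesis by (rule vector_derivative_unique_at)
  qed
  obtain h' where h': "((\<lambda>t. h t y) has_vector_derivative h') (at 0)" "h' \<in> lie_algebra K"
    "\<alpha> p 1 = X y + h'"
    using h_x_deriv[of 0 y] unfolding p_def by auto
  \<comment> \<open>In the \<open>x\<close>-direction the coefficient \<open>a\<close> changes only
    by conjugation with the gauge.\<close>
  have D_x: "D 1 = bracket (a p) h'"
  proof -
    have "((\<lambda>x. a (Complex x y)) has_vector_derivative D 1) (at 0)"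
      using D unfolding p_def by (rule has_vector_derivative_Re_line)
    moreover have "a (Complex x y) = matrix_inv (h x y) ** a p ** h x y" for x
      unfolding p_def a_0 by (simp add: a_def \<alpha>_m_eq mat_distribs)
    moreover have "((\<lambda>x. matrix_inv (h x y) ** a p ** h x y) has_vector_derivative bracket (a p) h') (at 0)"
    proof -
      have "((\<lambda>x. matrix_inv (h x y)) has_vector_derivative - h') (at 0)"
        by (rule has_vector_derivative_rhs[OF has_vector_derivative_matrix_inv[OF K_G[OF h_K] h'(1)]])
           simp
      from has_vector_derivative_mult[OF has_vector_derivative_mult[OF this has_vector_derivative_const] h'(1)]
      show ?thesis
        by (rule has_vector_derivative_rhs)
           (simp add: bracket_def)
    qed
    ultimately show ?thesis
      using vector_derivative_unique_at by (simp only:) blast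
  qed
  \<comment> \<open>The gauge term \<open>h'\<close> also enters the k-part, where it will cancel
    the bracket coming from \<open>D 1\<close>.\<close>
  have "avg (\<alpha> p 1) = \<kappa> y + h'" "avg (\<alpha> p \<i>) = \<eta> y"
    using h'(2,3) by (auto simp: linear_add[OF linear_avg] \<kappa>_def \<eta>_def Y_def p_def lie_algebra_K avg_fixed)
  moreover have "ext_deriv (form_10 (alpha_m G \<tau> k K F)) p 1 \<i> = \<i> *\<^sub>C D 1 - D \<i>"
    by (simp add: ext_deriv_def form_10_eq frechet_derivative_at[OF D, symmetric]
        frechet_derivative_at[OF Di, symmetric])
  ultimately have "\<i> *\<^sub>C bracket (a p) h' - (1/2) *\<^sub>R (u' - \<i> *\<^sub>C v') +
      (bracket (\<kappa> y + h') (\<i> *\<^sub>C a p) - bracket (\<eta> y) (a p)) = 0"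
    using harmonic[of p 1 \<i>] by (simp add: bracket_wedge_def alpha_k_eq form_10_eq D_x D_y)
  then have "(1/2) *\<^sub>R (u' - \<i> *\<^sub>C v') = \<i> *\<^sub>C bracket (\<kappa> y) (a p) - bracket (\<eta> y) (a p)"
    by (simp add: br.add_left bracket_cscale bracket_swap[of h' "a p"] mat_distribs algebra_simps)
  then have "(1/2) *\<^sub>R (u' - \<i> *\<^sub>C v') = (1/2) *\<^sub>R (\<i> *\<^sub>C bracket (\<kappa> y) (u y - \<i> *\<^sub>C v y) - bracket (\<eta> y) (u y - \<i> *\<^sub>C v y))"
    unfolding p_def a_0 by (simp only: br.scaleR_right cscale_scaleR flip: scaleR_diff_right)
  then have "u' - \<i> *\<^sub>C v' = \<i> *\<^sub>C bracket (\<kappa> y) (u y - \<i> *\<^sub>C v y) - bracket (\<eta> y) (u y - \<i> *\<^sub>C v y)"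
    unfolding scaleR_cancel_left by simp
  \<comment> \<open>The component in g repeats the equation for \<open>u\<close>; the component in i
    g is the one sought.\<close>
  then have eq: "u' + \<i> *\<^sub>C (- v') = (bracket (\<kappa> y) (v y) + bracket (u y) (\<eta> y)) +
      \<i> *\<^sub>C (bracket (\<kappa> y) (u y) - bracket (v y) (\<eta> y))"
    by (simp add: br.diff_right bracket_cscale bracket_swap[of "\<eta> y"] mat_distribs algebra_simps)
  have "\<kappa> y \<in> lie_algebra G" "\<eta> y \<in> lie_algebra G"
    using \<kappa>_K[of y] \<eta>_K[of y] by (simp_all add: lie_algebra_K)
  then have "- v' = bracket (\<kappa> y) (u y) - bracket (v y) (\<eta> y)"
    using v'_mem u'_def
    by (intro lie_algebra_C_unique[THEN conjunct2, OF _ _ _ _ eq])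
       (auto intro!: lie_algebra_add lie_algebra_bracket uv_mem subspace_diff[OF subspace_lie_algebra]
         subspace_neg[OF subspace_lie_algebra])
  then have "v' = bracket (v y) (\<eta> y) - bracket (\<kappa> y) (u y)"
    by (metis add.inverse_inverse minus_diff_eq)
  with v' show ?thesis by simp
qed

lemma lax_dataI:
  assumes "\<And>y. (v has_vector_derivative bracket (v y) (\<eta> y) - bracket (\<kappa> y) (u y)) (at y)"
  shows "lax_data G \<tau> k K \<kappa> \<eta> u v"
  by (intro lax_data.intro lax_data_axioms.intro symmetric_space_axioms assms \<kappa>_K \<eta>_K uv_mem d\<tau>_u d\<tau>_v
      \<eta>_cont \<kappa>_deriv u_deriv)

end

end

section \<open>Equivariant maps are generated by degree one potentials\<close>

lemma frame_derivatives:
  assumes "frame G K \<phi> F"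
  obtains F' where "\<And>p. (F has_derivative F' p) (at p)" "\<And>p w. \<exists>D. ((\<lambda>p. F' p w) has_derivative D) (at p)"
proof -
  have "C_times (Suc (Suc 0)) UNIV F"
    using assms by (simp only: frame_def smooth_on_def)
  then obtain F' where F': "\<forall>p\<in>UNIV. (F has_derivative F' p) (at p)" "\<forall>w. C_times (Suc 0) UNIV (\<lambda>p. F' p w)"
    by (subst (asm) C_times.simps(2)) blast
  show thesis
  proof (rule that)
    show "(F has_derivative F' p) (at p)" for p using F'(1) by simp
    show "\<exists>D. ((\<lambda>p. F' p w) has_derivative D) (at p)" for p w
      using F'(2)[rule_format, of w] by (subst (asm) C_times.simps(2)) blast
  qed
qed

lemma equivariant_translate:
  assumes "equivariant G K \<phi>"
  obtains A0 where "A0 \<in> lie_algebra G" "\<And>x y. \<phi> (Complex x y) = mexp (x *\<^sub>R A0) <#\<^bsub>GLn\<^esub> \<phi> (Complex 0 y)"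
proof -
  obtain A0 \<psi> where A0: "A0 \<in> lie_algebra G" "\<And>x y. \<phi> (Complex x y) = mexp (x *\<^sub>R A0) <#\<^bsub>GLn\<^esub> \<psi> y"
    using assms unfolding equivariant_def by blast
  have "\<phi> (Complex 0 y) = \<psi> y" for y using A0(2)[of 0 y] by simp
  then show thesis using that A0 by simp
qed

context symmetric_space
begin

lemma l_coset_eqD:
  assumes "a \<in> G" "a <#\<^bsub>GLn\<^esub> K = b <#\<^bsub>GLn\<^esub> K"
  shows "matrix_inv a ** b \<in> K"
proof -
  have "b \<in> b <#\<^bsub>GLn\<^esub> K" unfolding mem_l_coset_GLn using K_one by (intro bexI[of _ "mat 1"]) simp
  then obtain h where "h \<in> K" "b = a ** h" unfolding assms(2)[symmetric] mem_l_coset_GLn by blast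
  then show ?thesis using assms(1) by (simp add: matrix_mul_assoc)
qed

text \<open>A generated map takes 0 to \<open>K\<close>, so \<open>\<phi>\<close> is first moved
  there by the inverse of \<open>f0\<close>. The remaining freedom \<open>k0\<close>, realised by
  conjugating the Lax data, lets one statement serve both forms of the theorem.\<close>

lemma equivariant_imp_generated:
  assumes B: "iwasawa_decomposition K B" and prim: "primitive_harmonic G \<tau> k K \<phi>"
    and equi: "equivariant G K \<phi>"
  shows "\<exists>f0\<in>G. \<phi> 0 = f0 <#\<^bsub>GLn\<^esub> K \<and> (\<forall>k0\<in>K. \<exists>\<xi>\<in>loop_algebra_1 G \<tau> k. \<exists>\<phi>0.
    generated_by G \<tau> k K B \<phi>0 \<xi> \<and> (\<forall>z. \<phi>0 z = (k0 ** matrix_inv f0) <#\<^bsub>GLn\<^esub> \<phi> z))"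
proof -
  obtain F where fr: "frame G K \<phi> F"
    and cond: "k = 2 \<and> (\<forall>p u v. ext_deriv (form_10 (alpha_m G \<tau> k K F)) p u v
             + bracket_wedge (alpha_k G \<tau> k K F) (form_10 (alpha_m G \<tau> k K F)) p u v = 0) \<or>
      k > 2 \<and> (\<forall>p v. form_10 (alpha_m G \<tau> k K F) p v \<in> eigenspace G \<tau> k (-1))"
    using prim unfolding primitive_harmonic_def harmonic_map_def primitive_map_def by blast
  obtain F' where F': "\<And>p. (F has_derivative F' p) (at p)" "\<And>p w. \<exists>D. ((\<lambda>p. F' p w) has_derivative D) (at p)"
    using frame_derivatives[OF fr] by blast
  have F_G: "F p \<in> G" and \<phi>: "\<phi> p = F p <#\<^bsub>GLn\<^esub> K" for p using fr by (auto simp: frame_def)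
  obtain A0 where A0: "A0 \<in> lie_algebra G"
    and translate: "\<And>x y. \<phi> (Complex x y) = mexp (x *\<^sub>R A0) <#\<^bsub>GLn\<^esub> \<phi> (Complex 0 y)"
    using equivariant_translate[OF equi] by blast
  interpret equivariant_frame G \<tau> k K F F' A0
  proof (intro equivariant_frame.intro equivariant_frame_axioms.intro symmetric_space_axioms F_G F' A0)
    fix x y
    show "matrix_inv (mexp (x *\<^sub>R A0) ** F (Complex 0 y)) ** F (Complex x y) \<in> K"
    proof (rule l_coset_eqD)
      show "mexp (x *\<^sub>R A0) ** F (Complex 0 y) \<in> G" by (intro mult_mem lie_algebraD A0 F_G)
      show "(mexp (x *\<^sub>R A0) ** F (Complex 0 y)) <#\<^bsub>GLn\<^esub> K = F (Complex x y) <#\<^bsub>GLn\<^esub> K"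
        using translate[of x y] by (simp only: \<phi> l_coset_GLn_assoc)
    qed
  qed
  have lax: "lax_data G \<tau> k K \<kappa> \<eta> u v"
  proof (cases "k = 2")
    case True
    then have "\<And>p w w'. ext_deriv (form_10 (alpha_m G \<tau> k K F)) p w w'
      + bracket_wedge (alpha_k G \<tau> k K F) (form_10 (alpha_m G \<tau> k K F)) p w w' = 0" using cond by auto
    then show ?thesis
      by (intro lax_dataI v_deriv_harmonic symmetric_relations[OF True])
  next
    case False
    then have k: "k > 2" and *: "\<And>p v. form_10 (alpha_m G \<tau> k K F) p v \<in> eigenspace G \<tau> k (-1)"
      using cond by auto
    show ?thesis
      by (intro lax_dataI v_deriv_primitive k primitive_relations *)
  qed
  have fn: "f y ** matrix_inv (f y) = mat 1" "matrix_inv (f y) ** f y = mat 1" for y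
    using f_G by auto
  have \<phi>_f: "\<phi> (Complex x y) = (mexp (x *\<^sub>R A0) ** f y) <#\<^bsub>GLn\<^esub> K" for x y
    using translate[of x y] by (simp only: \<phi> f_def l_coset_GLn_assoc)
  show ?thesis
  proof (intro bexI[of _ "f 0"] conjI ballI)
    show "f 0 \<in> G" by (rule f_G)
    show "\<phi> 0 = f 0 <#\<^bsub>GLn\<^esub> K" using \<phi>[of 0] by (simp add: f_def complex_eq_iff[of "Complex 0 0"] flip: zero_complex.code)
    fix k0 assume k0: "k0 \<in> K"
    define k1 where "k1 = matrix_inv k0"
    have k01: "k0 ** k1 = mat 1" "k1 ** k0 = mat 1" using K_G[OF k0] by (simp_all add: k1_def)
    have k1: "k1 \<in> K" unfolding k1_def using k0 by (rule K_inv)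
    define c where "c = (\<lambda>X. k0 ** X ** k1)"
    interpret conj: lax_data G \<tau> k K "\<lambda>y. c (\<kappa> y)" "\<lambda>y. c (\<eta> y)" "\<lambda>y. c (u y)" "\<lambda>y. c (v y)"
      unfolding c_def k1_def using lax k0 by (rule lax_data_conj)
    obtain E b e where E: "iwasawa_factors G \<tau> k B conj.\<xi> E b"
      and e': "\<And>y. (e has_vector_derivative e y ** (c (\<eta> y) + c (v y))) (at y)" and e0: "e 0 = mat 1"
      and E1: "\<And>x y. \<exists>k1\<in>K. E (Complex x y) 1 = mexp (x *\<^sub>R conj.\<xi> 1) ** e y ** k1"
      using conj.generates[OF B] by blast
    define n where "n = (\<lambda>y. matrix_inv (f y))"
    have n': "(n has_vector_derivative - (Y y ** n y)) (at y)" for y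
      unfolding n_def by (rule f_inv_deriv)
    have cY: "c (\<eta> y) + c (v y) = k0 ** Y y ** k1" for y
      by (simp add: c_def Y_decomp mat_distribs)
    \<comment> \<open>Both sides solve the same linear equation with the same initial value;
      multiplying \<open>e\<close> by \<open>k0 ** n y\<close> gives a constant curve.\<close>
    have e_eq: "e y = k0 ** n 0 ** f y ** k1" for y
    proof -
      have "((\<lambda>y. e y ** (k0 ** n y)) has_vector_derivative 0) (at y)" for y
      proof (rule has_vector_derivative_rhs, rule has_vector_derivative_mult, rule e',
          rule has_vector_derivative_mult, rule has_vector_derivative_const, rule n')
        have "k0 ** Y y ** k1 ** (k0 ** n y) = k0 ** Y y ** (k1 ** k0) ** n y"
          by (simp only: matrix_mul_assoc)
        then have step: "(c (\<eta> y) + c (v y)) ** (k0 ** n y) = k0 ** Y y ** n y"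
          by (simp only: cY k01 matrix_mul_rid)
        have "e y ** (c (\<eta> y) + c (v y)) ** (k0 ** n y) = e y ** ((c (\<eta> y) + c (v y)) ** (k0 ** n y))"
          by (rule matrix_mul_assoc[symmetric])
        also have "\<dots> = e y ** (k0 ** Y y ** n y)" by (simp only: step)
        finally show "e y ** (k0 ** - (Y y ** n y) + 0 ** n y) + e y ** (c (\<eta> y) + c (v y)) ** (k0 ** n y) = 0"
          by (simp add: matrix_mul_assoc)
      qed
      from zero_derivative_imp_const[OF this, of y 0] have "e y ** (k0 ** n y) = k0 ** n 0"
        by (simp add: e0)
      then have "e y ** (k0 ** n y) ** (f y ** k1) = k0 ** n 0 ** (f y ** k1)" by simp
      moreover have "e y ** (k0 ** n y) ** (f y ** k1) = e y ** (k0 ** (n y ** f y) ** k1)"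
        by (simp add: matrix_mul_assoc)
      ultimately show ?thesis by (simp add: n_def fn k01 matrix_mul_assoc)
    qed
    have \<xi>1: "conj.\<xi> 1 = (k0 ** n 0) ** A0 ** (f 0 ** k1)"
    proof -
      have "conj.\<xi> 1 = c (X 0)" unfolding conj.\<xi>_1 by (simp add: c_def X_decomp mat_distribs)
      then show ?thesis by (simp add: c_def X_def n_def matrix_mul_assoc)
    qed
    have "(f 0 ** k1) ** (k0 ** n 0) = f 0 ** (k1 ** k0) ** n 0" by (simp add: matrix_mul_assoc)
    then have inv: "(f 0 ** k1) ** (k0 ** n 0) = mat 1" by (simp add: k01 n_def fn)
    have mexp_\<xi>: "mexp (x *\<^sub>R conj.\<xi> 1) = (k0 ** n 0) ** mexp (x *\<^sub>R A0) ** (f 0 ** k1)" for x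
      using mexp_conj[OF inv, of "x *\<^sub>R A0"] by (simp add: \<xi>1)
    have coset: "E z 1 <#\<^bsub>GLn\<^esub> K = (k0 ** n 0) <#\<^bsub>GLn\<^esub> \<phi> z" for z
    proof -
      obtain x y where z: "z = Complex x y" by (cases z)
      obtain k2 where k2: "k2 \<in> K" "E z 1 = mexp (x *\<^sub>R conj.\<xi> 1) ** e y ** k2"
        using E1[of x y] z by blast
      have "E z 1 = (k0 ** n 0) ** mexp (x *\<^sub>R A0) ** ((f 0 ** k1) ** (k0 ** n 0)) ** f y ** (k1 ** k2)"
        unfolding k2(2) mexp_\<xi> e_eq by (simp only: matrix_mul_assoc)
      also have "\<dots> = (k0 ** n 0) ** ((mexp (x *\<^sub>R A0) ** f y) ** (k1 ** k2))"
        unfolding inv by (simp only: matrix_mul_rid matrix_mul_assoc)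
      finally have "E z 1 <#\<^bsub>GLn\<^esub> K =
          (k0 ** n 0) <#\<^bsub>GLn\<^esub> ((mexp (x *\<^sub>R A0) ** f y) <#\<^bsub>GLn\<^esub> ((k1 ** k2) <#\<^bsub>GLn\<^esub> K))"
        by (simp only: l_coset_GLn_assoc)
      then show ?thesis
        by (simp only: l_coset_K[OF K_mult[OF k1 k2(1)]] \<phi>_f z)
    qed
    show "\<exists>\<xi>\<in>loop_algebra_1 G \<tau> k. \<exists>\<phi>0. generated_by G \<tau> k K B \<phi>0 \<xi> \<and>
        (\<forall>z. \<phi>0 z = (k0 ** matrix_inv (f 0)) <#\<^bsub>GLn\<^esub> \<phi> z)"
    proof (intro bexI[of _ conj.\<xi>] exI[of _ "\<lambda>z. E z 1 <#\<^bsub>GLn\<^esub> K"] conjI allI)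
      show "generated_by G \<tau> k K B (\<lambda>z. E z 1 <#\<^bsub>GLn\<^esub> K) conj.\<xi>"
        unfolding generated_by_def using E by blast
      show "E z 1 <#\<^bsub>GLn\<^esub> K = (k0 ** matrix_inv (f 0)) <#\<^bsub>GLn\<^esub> \<phi> z" for z
        using coset by (simp add: n_def)
      show "conj.\<xi> \<in> loop_algebra_1 G \<tau> k" by (rule conj.\<xi>_loop_algebra_1)
    qed
  qed
qed

end

theorem theorem2p4:
  fixes G K B :: "(complex^'n^'n) set"
    and \<tau> :: "complex^'n^'n \<Rightarrow> complex^'n^'n"
    and k :: nat
    and \<phi> :: "complex \<Rightarrow> (complex^'n^'n) set"
  assumes "k_symmetric_space G \<tau> k K"
    and "iwasawa_decomposition K B"
    and "smooth_into_quotient G K \<phi>"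
    and "primitive_harmonic G \<tau> k K \<phi>"
  shows "(\<phi> 0 = K \<longrightarrow>
            (equivariant G K \<phi> \<longleftrightarrow> (\<exists>\<xi>\<in>loop_algebra_1 G \<tau> k. generated_by G \<tau> k K B \<phi> \<xi>))) \<and>
         (equivariant G K \<phi> \<longleftrightarrow>
            (\<exists>\<xi>\<in>loop_algebra_1 G \<tau> k. generated_up_to_translation G \<tau> k K B \<phi> \<xi>))"
proof -
  interpret symmetric_space G \<tau> k K using assms(1) by (rule k_symmetric_spaceD)
  have up_to: "generated_up_to_translation G \<tau> k K B \<phi> \<xi>" if "generated_by G \<tau> k K B \<phi> \<xi>" for \<xi>
    unfolding generated_up_to_translation_def
    using that one_mem by (intro bexI[of _ "mat 1"] exI[of _ \<phi>]) auto
  have forward: "(\<phi> 0 = K \<longrightarrow> (\<exists>\<xi>\<in>loop_algebra_1 G \<tau> k. generated_by G \<tau> k K B \<phi> \<xi>)) \<and>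
      (\<exists>\<xi>\<in>loop_algebra_1 G \<tau> k. generated_up_to_translation G \<tau> k K B \<phi> \<xi>)"
    if equi: "equivariant G K \<phi>"
  proof -
    obtain f0 where f0: "f0 \<in> G" "\<phi> 0 = f0 <#\<^bsub>GLn\<^esub> K"
      and gen: "\<forall>k0\<in>K. \<exists>\<xi>\<in>loop_algebra_1 G \<tau> k. \<exists>\<phi>0. generated_by G \<tau> k K B \<phi>0 \<xi> \<and>
        (\<forall>z. \<phi>0 z = (k0 ** matrix_inv f0) <#\<^bsub>GLn\<^esub> \<phi> z)"
      using equivariant_imp_generated[OF assms(2,4) equi] by (elim bexE conjE)
    have "\<exists>\<xi>\<in>loop_algebra_1 G \<tau> k. generated_by G \<tau> k K B \<phi> \<xi>" if base: "\<phi> 0 = K"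
    proof -
      \<comment> \<open>The choice of \<open>f0\<close> for \<open>k0\<close> is therefore
        admissible, and it makes the translation trivial.\<close>
      have "f0 \<in> K"
        using f0 base l_coset_eqD[of "mat 1" f0] by simp
      from bspec[OF gen this] obtain \<xi> \<phi>0 where \<xi>: "\<xi> \<in> loop_algebra_1 G \<tau> k" "generated_by G \<tau> k K B \<phi>0 \<xi>"
        and eq: "\<forall>z. \<phi>0 z = (f0 ** matrix_inv f0) <#\<^bsub>GLn\<^esub> \<phi> z" by (elim bexE exE conjE)
      have "\<phi>0 = \<phi>" by (rule ext) (simp add: eq f0)
      then show ?thesis using \<xi> by blast
    qed
    moreover obtain \<xi> \<phi>0 where \<xi>: "\<xi> \<in> loop_algebra_1 G \<tau> k" "generated_by G \<tau> k K B \<phi>0 \<xi>"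
      and eq: "\<forall>z. \<phi>0 z = (mat 1 ** matrix_inv f0) <#\<^bsub>GLn\<^esub> \<phi> z"
      using bspec[OF gen K_one] by (elim bexE exE conjE)
    have "\<phi> z = f0 <#\<^bsub>GLn\<^esub> \<phi>0 z" for z
    proof -
      have "f0 <#\<^bsub>GLn\<^esub> \<phi>0 z = (f0 ** (mat 1 ** matrix_inv f0)) <#\<^bsub>GLn\<^esub> \<phi> z"
        by (simp only: eq l_coset_GLn_assoc)
      then show ?thesis using f0(1) by simp
    qed
    then have "generated_up_to_translation G \<tau> k K B \<phi> \<xi>"
      unfolding generated_up_to_translation_def using f0(1) \<xi>(2) by blast
    ultimately show ?thesis using \<xi>(1) by blast
  qed
  have "equivariant G K \<phi>" if "\<exists>\<xi>\<in>loop_algebra_1 G \<tau> k. generated_up_to_translation G \<tau> k K B \<phi> \<xi>"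
    using that generated_imp_equivariant[OF assms(2,3)] by (elim bexE)
  moreover from this have "equivariant G K \<phi>" if "\<exists>\<xi>\<in>loop_algebra_1 G \<tau> k. generated_by G \<tau> k K B \<phi> \<xi>"
    using that up_to by blast
  ultimately show ?thesis
    using forward by (intro conjI impI iffI) simp_all
qed

end
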